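(* Let $M$ be a smooth connected manifold, $\bar x\in M$, $\Delta$ a smooth distribution on $M$, and $g$ a smooth Riemannian metric on $\Delta$ for which $M$ is complete (for the sub-Riemannian distance) and for which no nontrivial singular path is minimizing. If the distribution $\Delta$ is nonholonomic on $M$, then the value function $V_{g,\Delta}$ is continuous on $M$, and locally semiconcave on $M\setminus\{\bar x\}$.
   Context: $\Delta$ is a smooth subbundle of $TM$; it is nonholonomic if near every point it is spanned by linearly independent smooth vector fields whose iterated Lie brackets (including the fields themselves) span the tangent space at every point of that neighborhood. A smooth Riemannian metric $g$ on $\Delta$ is a smoothly varying inner product $g_x$ on $\Delta(x)$. A horizontal path is an absolutely continuous $\gamma:[0,1]\to M$ with $\dot\gamma(t)\in\Delta(\gamma(t))$ a.e.; $\Omega_\Delta(x_0)$ is the set of those with $\gamma(0)=x_0$ (a Banach manifold for the $W^{1,1}$-topology), and $\Omega_\Delta(x_0,x_1)$ the set of those with moreover $\gamma(1)=x_1$. The end-point mapping $E_{x_0}:\Omega_\Delta(x_0)\to M$, $\gamma\mapsto\gamma(1)$, is smooth; a horizontal path $\gamma$ is singular if it is a critical point of $E_{\gamma(0)}$; it is nontrivial if not constant. The length of $\gamma$ is $\int_0^1\sqrt{g_\gamma(\dot\gamma,\dot\gamma)}\,dt$; $d_{SR}(x_0,x_1)$ is the infimum of lengths of horizontal paths joining $x_0$ to $x_1$; a path is minimizing if its length equals $d_{SR}$ of its end-points. $V_{g,\Delta}(x):=\inf\{J_g(\gamma):\gamma\in\Omega_\Delta(\bar x,x)\}$ with $J_g(\gamma):=\int_0^1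 g_{\gamma(t)}(\dot\gamma(t),\dot\gamma(t))\,dt$; it equals $d_{SR}(\bar x,x)^2$. Semiconcavity: $u:U\to\mathbb{R}$ with $U\subset\mathbb{R}^n$ open is locally semiconcave on $U$ if for every $z\in U$ there are $C,\delta>0$ such that $\mu u(y)+(1-\mu)u(x)-u(\mu y+(1-\mu)x)\le\mu(1-\mu)C|x-y|^2$ for all $x,y$ in the open ball of center $z$ and radius $\delta$ and all $\mu\in[0,1]$. For $U\subset M$ open, $u:U\to\mathbb{R}$ is locally semiconcave if for every $x\in U$ there are a neighborhood $U_x$ of $x$ and a smooth diffeomorphism $\varphi_x:U_x\to\varphi_x(U_x)\subset\mathbb{R}^n$ onto an open set such that $u\circ\varphi_x^{-1}$ is locally semiconcave on $\varphi_x(U_x)$. *)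

theory Defs
  imports "HOL-Analysis.Analysis"
begin

section \<open>Smooth maps between Euclidean spaces\<close>

fun Ck_on :: "nat \<Rightarrow> 'a::euclidean_space set \<Rightarrow> ('a \<Rightarrow> 'b::real_normed_vector) \<Rightarrow> bool" where
  "Ck_on 0 S f \<longleftrightarrow> continuous_on S f"
| "Ck_on (Suc k) S f \<longleftrightarrow>
     (\<forall>x\<in>S. f differentiable (at x)) \<and> (\<forall>v. Ck_on k S (\<lambda>x. frechet_derivative f (at x) v))"

text \<open>Only used for open sets \<open>S\<close>.\<close>

definition smooth_on :: "'a::euclidean_space set \<Rightarrow> ('a \<Rightarrow> 'b::real_normed_vector) \<Rightarrow> bool" where
  "smooth_on S f \<longleftrightarrow> (\<forall>k. Ck_on k S f)"


section \<open>Smooth manifolds\<close>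

text \<open>
  The underlying space of the manifold is a whole (Hausdorff, second countable) type \<open>'m\<close>; a chart
  is a pair of its domain and its coordinate map. Coordinate maps are irrelevant outside the domain.
\<close>

type_synonym ('m, 'e) chart = "'m set \<times> ('m \<Rightarrow> 'e)"

abbreviation chart_dom :: "('m, 'e) chart \<Rightarrow> 'm set" where "chart_dom \<equiv> fst"
abbreviation chart_map :: "('m, 'e) chart \<Rightarrow> 'm \<Rightarrow> 'e" where "chart_map \<equiv> snd"

definition chart_inv :: "('m, 'e) chart \<Rightarrow> 'e \<Rightarrow> 'm" where
  "chart_inv c = inv_into (chart_dom c) (chart_map c)"

definition is_chart :: "('m::topological_space, 'e::euclidean_space) chart \<Rightarrow> bool" where
  "is_chart c \<longleftrightarrow> open (chart_dom c) \<and> open (chart_map c ` chart_dom c) \<and>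
     homeomorphism (chart_dom c) (chart_map c ` chart_dom c) (chart_map c) (chart_inv c)"

definition smooth_transition ::
    "('m::topological_space, 'e::euclidean_space) chart \<Rightarrow> ('m, 'e) chart \<Rightarrow> bool" where
  "smooth_transition c d \<longleftrightarrow>
     smooth_on (chart_map c ` (chart_dom c \<inter> chart_dom d)) (chart_map d \<circ> chart_inv c)"

definition smooth_atlas :: "('m::topological_space, 'e::euclidean_space) chart set \<Rightarrow> bool" where
  "smooth_atlas A \<longleftrightarrow> (\<forall>c\<in>A. is_chart c) \<and> (\<Union>c\<in>A. chart_dom c) = UNIV \<and>
     (\<forall>c\<in>A. \<forall>d\<in>A. smooth_transition c d)"

text \<open>
  Membership in the maximal atlas: these are exactly the smooth diffeomorphisms from an open subset
  of the manifold onto an open subset of the model space.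
\<close>

definition smooth_chart ::
    "('m::topological_space, 'e::euclidean_space) chart set \<Rightarrow> ('m, 'e) chart \<Rightarrow> bool" where
  "smooth_chart A c \<longleftrightarrow> is_chart c \<and> (\<forall>d\<in>A. smooth_transition c d \<and> smooth_transition d c)"

definition smooth_fun_on ::
    "('m::topological_space, 'e::euclidean_space) chart set \<Rightarrow> 'm set \<Rightarrow> ('m \<Rightarrow> real) \<Rightarrow> bool" where
  "smooth_fun_on A U f \<longleftrightarrow>
     (\<forall>c\<in>A. smooth_on (chart_map c ` (U \<inter> chart_dom c)) (f \<circ> chart_inv c))"


section \<open>Tangent vectors and vector fields\<close>

text \<open>
  A preferred chart \<open>chart_at A x\<close> is selected around each point, and the tangent space at \<open>x\<close> is
  the model space \<open>'e\<close>: the element \<open>v\<close> stands for the tangent vector whose coordinates in the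
  preferred chart at \<open>x\<close> are \<open>v\<close>. The preferred chart may vary discontinuously with \<open>x\<close>, so a
  vector field \<open>X :: 'm \<Rightarrow> 'e\<close> must be transported by \<open>tangent_coord\<close> into a fixed chart \<open>c\<close>
  before regularity is discussed.
\<close>

definition chart_at :: "('m, 'e) chart set \<Rightarrow> 'm \<Rightarrow> ('m, 'e) chart" where
  "chart_at A x = (SOME c. c \<in> A \<and> x \<in> chart_dom c)"

definition tangent_coord ::
    "('m, 'e::euclidean_space) chart set \<Rightarrow> ('m, 'e) chart \<Rightarrow> 'm \<Rightarrow> 'e \<Rightarrow> 'e" where
  "tangent_coord A c x v =
     frechet_derivative (chart_map c \<circ> chart_inv (chart_at A x)) (at (chart_map (chart_at A x) x)) v"

definition field_coord ::
    "('m, 'e::euclidean_space) chart set \<Rightarrow> ('m, 'e) chart \<Rightarrow> ('m \<Rightarrow> 'e) \<Rightarrow> 'e \<Rightarrow> 'e" where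
  "field_coord A c X p = tangent_coord A c (chart_inv c p) (X (chart_inv c p))"

definition smooth_field_on ::
    "('m::topological_space, 'e::euclidean_space) chart set \<Rightarrow> 'm set \<Rightarrow> ('m \<Rightarrow> 'e) \<Rightarrow> bool" where
  "smooth_field_on A U X \<longleftrightarrow>
     (\<forall>c\<in>A. smooth_on (chart_map c ` (U \<inter> chart_dom c)) (field_coord A c X))"

definition smooth_time_field_on ::
    "('m::topological_space, 'e::euclidean_space) chart set \<Rightarrow> (real \<times> 'm) set \<Rightarrow>
     (real \<times> 'm \<Rightarrow> 'e) \<Rightarrow> bool" where
  "smooth_time_field_on A W X \<longleftrightarrow>
     (\<forall>c\<in>A. smooth_on {(t, p). p \<in> chart_map c ` chart_dom c \<and> (t, chart_inv c p) \<in> W}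
                       (\<lambda>(t, p). field_coord A c (\<lambda>y. X (t, y)) p))"

definition lie_bracket ::
    "('m, 'e::euclidean_space) chart set \<Rightarrow> ('m \<Rightarrow> 'e) \<Rightarrow> ('m \<Rightarrow> 'e) \<Rightarrow> 'm \<Rightarrow> 'e" where
  "lie_bracket A X Y x =
     (let c = chart_at A x; p = chart_map c x; X' = field_coord A c X; Y' = field_coord A c Y
      in frechet_derivative Y' (at p) (X' p) - frechet_derivative X' (at p) (Y' p))"

inductive_set iterated_brackets ::
    "('m, 'e::euclidean_space) chart set \<Rightarrow> ('k \<Rightarrow> 'm \<Rightarrow> 'e) \<Rightarrow> ('m \<Rightarrow> 'e) set"
  for A X where
  gen: "X i \<in> iterated_brackets A X"
| bracket: "\<lbrakk>Y \<in> iterated_brackets A X; Z \<in> iterated_brackets A X\<rbrakk> \<Longrightarrow>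
     lie_bracket A Y Z \<in> iterated_brackets A X"


section \<open>Distributions and sub-Riemannian metrics\<close>

text \<open>
  A distribution assigns to \<open>x\<close> a subset of the tangent space at \<open>x\<close>. Its rank is \<open>CARD('k)\<close>, where
  the finite type \<open>'k\<close> indexes the local frames; this makes \<open>real ^ 'k\<close> the space of control values.
\<close>

definition frame_at :: "('m \<Rightarrow> 'e::euclidean_space set) \<Rightarrow> 'm \<Rightarrow> ('k::finite \<Rightarrow> 'e) \<Rightarrow> bool" where
  "frame_at \<Delta> x F \<longleftrightarrow> inj F \<and> independent (range F) \<and> span (range F) = \<Delta> x"

definition local_frame ::
    "('m::topological_space, 'e::euclidean_space) chart set \<Rightarrow> ('m \<Rightarrow> 'e set) \<Rightarrow> 'm set \<Rightarrow>
     ('k::finite \<Rightarrow> 'm \<Rightarrow> 'e) \<Rightarrow> bool" where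
  "local_frame A \<Delta> U X \<longleftrightarrow>
     (\<forall>i. smooth_field_on A U (X i)) \<and> (\<forall>y\<in>U. frame_at \<Delta> y (\<lambda>i. X i y))"

definition smooth_distribution ::
    "'k::finite itself \<Rightarrow> ('m::topological_space, 'e::euclidean_space) chart set \<Rightarrow>
     ('m \<Rightarrow> 'e set) \<Rightarrow> bool" where
  "smooth_distribution K A \<Delta> \<longleftrightarrow>
     (\<forall>x. \<exists>U (X :: 'k \<Rightarrow> 'm \<Rightarrow> 'e). open U \<and> x \<in> U \<and> local_frame A \<Delta> U X)"

definition nonholonomic ::
    "'k::finite itself \<Rightarrow> ('m::topological_space, 'e::euclidean_space) chart set \<Rightarrow>
     ('m \<Rightarrow> 'e set) \<Rightarrow> bool" where
  "nonholonomic K A \<Delta> \<longleftrightarrow>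
     (\<forall>x. \<exists>U (X :: 'k \<Rightarrow> 'm \<Rightarrow> 'e). open U \<and> x \<in> U \<and> local_frame A \<Delta> U X \<and>
        (\<forall>y\<in>U. span {Z y |Z. Z \<in> iterated_brackets A X} = UNIV))"

definition inner_product_on ::
    "'e::real_vector set \<Rightarrow> ('e \<Rightarrow> 'e \<Rightarrow> real) \<Rightarrow> bool" where
  "inner_product_on V b \<longleftrightarrow>
     (\<forall>v\<in>V. \<forall>w\<in>V. b v w = b w v) \<and>
     (\<forall>u\<in>V. \<forall>v\<in>V. \<forall>w\<in>V. b (u + v) w = b u w + b v w) \<and>
     (\<forall>r. \<forall>v\<in>V. \<forall>w\<in>V. b (r *\<^sub>R v) w = r * b v w) \<and>
     (\<forall>v\<in>V. v \<noteq> 0 \<longrightarrow> b v v > 0)"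

definition smooth_metric ::
    "('m::topological_space, 'e::euclidean_space) chart set \<Rightarrow> ('m \<Rightarrow> 'e set) \<Rightarrow>
     ('m \<Rightarrow> 'e \<Rightarrow> 'e \<Rightarrow> real) \<Rightarrow> bool" where
  "smooth_metric A \<Delta> g \<longleftrightarrow>
     (\<forall>x. inner_product_on (\<Delta> x) (g x)) \<and>
     (\<forall>U X Y. open U \<and> smooth_field_on A U X \<and> smooth_field_on A U Y \<and>
        (\<forall>x\<in>U. X x \<in> \<Delta> x \<and> Y x \<in> \<Delta> x) \<longrightarrow> smooth_fun_on A U (\<lambda>x. g x (X x) (Y x)))"


section \<open>Horizontal paths, length, energy\<close>

text \<open>Paths are functions on \<open>\<real>\<close> of which only the restriction to \<open>[0,1]\<close> matters.\<close>

definition absolutely_continuous_on_ivl ::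
    "real \<Rightarrow> real \<Rightarrow> (real \<Rightarrow> 'e::real_normed_vector) \<Rightarrow> bool" where
  "absolutely_continuous_on_ivl a b f \<longleftrightarrow>
     (\<forall>\<epsilon>>0. \<exists>\<delta>>0. \<forall>D. D division_of \<Union>D \<and> \<Union>D \<subseteq> {a..b} \<and> (\<Sum>I\<in>D. Sup I - Inf I) < \<delta> \<longrightarrow>
        (\<Sum>I\<in>D. norm (f (Sup I) - f (Inf I))) < \<epsilon>)"

definition ac_path ::
    "('m::topological_space, 'e::euclidean_space) chart set \<Rightarrow> (real \<Rightarrow> 'm) \<Rightarrow> bool" where
  "ac_path A \<gamma> \<longleftrightarrow> continuous_on {0..1} \<gamma> \<and>
     (\<forall>c\<in>A. \<forall>a b. 0 \<le> a \<and> a \<le> b \<and> b \<le> 1 \<and> \<gamma> ` {a..b} \<subseteq> chart_dom c \<longrightarrow>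
        absolutely_continuous_on_ivl a b (chart_map c \<circ> \<gamma>))"

definition has_velocity ::
    "('m, 'e::euclidean_space) chart set \<Rightarrow> (real \<Rightarrow> 'm) \<Rightarrow> real \<Rightarrow> 'e \<Rightarrow> bool" where
  "has_velocity A \<gamma> t v \<longleftrightarrow> ((chart_map (chart_at A (\<gamma> t)) \<circ> \<gamma>) has_vector_derivative v) (at t)"

definition velocity ::
    "('m, 'e::euclidean_space) chart set \<Rightarrow> (real \<Rightarrow> 'm) \<Rightarrow> real \<Rightarrow> 'e" where
  "velocity A \<gamma> t = vector_derivative (chart_map (chart_at A (\<gamma> t)) \<circ> \<gamma>) (at t)"

definition horizontal ::
    "('m::topological_space, 'e::euclidean_space) chart set \<Rightarrow> ('m \<Rightarrow> 'e set) \<Rightarrow>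
     (real \<Rightarrow> 'm) \<Rightarrow> bool" where
  "horizontal A \<Delta> \<gamma> \<longleftrightarrow> ac_path A \<gamma> \<and>
     (AE t in lebesgue_on {0..1}. \<exists>v\<in>\<Delta> (\<gamma> t). has_velocity A \<gamma> t v)"

definition horizontal_paths ::
    "('m::topological_space, 'e::euclidean_space) chart set \<Rightarrow> ('m \<Rightarrow> 'e set) \<Rightarrow>
     'm \<Rightarrow> 'm \<Rightarrow> (real \<Rightarrow> 'm) set" where
  "horizontal_paths A \<Delta> x y = {\<gamma>. horizontal A \<Delta> \<gamma> \<and> \<gamma> 0 = x \<and> \<gamma> 1 = y}"

text \<open>
  Length, energy and their infima take values in \<open>[0,\<infinity>]\<close>: a horizontal path, whose velocity is
  merely integrable, may have infinite energy, and the infimum over an empty set is \<open>\<infinity>\<close>.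
\<close>

definition sr_length ::
    "('m, 'e::euclidean_space) chart set \<Rightarrow> ('m \<Rightarrow> 'e \<Rightarrow> 'e \<Rightarrow> real) \<Rightarrow> (real \<Rightarrow> 'm) \<Rightarrow> ennreal" where
  "sr_length A g \<gamma> =
     (\<integral>\<^sup>+t. ennreal (sqrt (g (\<gamma> t) (velocity A \<gamma> t) (velocity A \<gamma> t))) \<partial>lebesgue_on {0..1})"

definition sr_energy ::
    "('m, 'e::euclidean_space) chart set \<Rightarrow> ('m \<Rightarrow> 'e \<Rightarrow> 'e \<Rightarrow> real) \<Rightarrow> (real \<Rightarrow> 'm) \<Rightarrow> ennreal" where
  "sr_energy A g \<gamma> =
     (\<integral>\<^sup>+t. ennreal (g (\<gamma> t) (velocity A \<gamma> t) (velocity A \<gamma> t)) \<partial>lebesgue_on {0..1})"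

definition sr_dist ::
    "('m::topological_space, 'e::euclidean_space) chart set \<Rightarrow> ('m \<Rightarrow> 'e set) \<Rightarrow>
     ('m \<Rightarrow> 'e \<Rightarrow> 'e \<Rightarrow> real) \<Rightarrow> 'm \<Rightarrow> 'm \<Rightarrow> ennreal" where
  "sr_dist A \<Delta> g x y = (INF \<gamma>\<in>horizontal_paths A \<Delta> x y. sr_length A g \<gamma>)"

definition value_fun ::
    "('m::topological_space, 'e::euclidean_space) chart set \<Rightarrow> ('m \<Rightarrow> 'e set) \<Rightarrow>
     ('m \<Rightarrow> 'e \<Rightarrow> 'e \<Rightarrow> real) \<Rightarrow> 'm \<Rightarrow> 'm \<Rightarrow> ennreal" where
  "value_fun A \<Delta> g xbar x = (INF \<gamma>\<in>horizontal_paths A \<Delta> xbar x. sr_energy A g \<gamma>)"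

definition sr_complete ::
    "('m::topological_space, 'e::euclidean_space) chart set \<Rightarrow> ('m \<Rightarrow> 'e set) \<Rightarrow>
     ('m \<Rightarrow> 'e \<Rightarrow> 'e \<Rightarrow> real) \<Rightarrow> bool" where
  "sr_complete A \<Delta> g \<longleftrightarrow>
     (\<forall>s :: nat \<Rightarrow> 'm. (\<forall>\<epsilon>>0. \<exists>N. \<forall>i\<ge>N. \<forall>j\<ge>N. sr_dist A \<Delta> g (s i) (s j) < \<epsilon>) \<longrightarrow>
        (\<exists>x. (\<lambda>i. sr_dist A \<Delta> g (s i) x) \<longlonglongrightarrow> 0))"

definition minimizing ::
    "('m::topological_space, 'e::euclidean_space) chart set \<Rightarrow> ('m \<Rightarrow> 'e set) \<Rightarrow>
     ('m \<Rightarrow> 'e \<Rightarrow> 'e \<Rightarrow> real) \<Rightarrow> (real \<Rightarrow> 'm) \<Rightarrow> bool" where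
  "minimizing A \<Delta> g \<gamma> \<longleftrightarrow>
     horizontal A \<Delta> \<gamma> \<and> sr_length A g \<gamma> = sr_dist A \<Delta> g (\<gamma> 0) (\<gamma> 1)"

definition nontrivial_path :: "(real \<Rightarrow> 'm) \<Rightarrow> bool" where
  "nontrivial_path \<gamma> \<longleftrightarrow> \<not> (\<gamma> constant_on {0..1})"


section \<open>The space of integrable functions on the unit interval\<close>

definition L1_rel :: "(real \<Rightarrow> 'a::euclidean_space) \<Rightarrow> (real \<Rightarrow> 'a) \<Rightarrow> bool" where
  "L1_rel f h \<longleftrightarrow> integrable (lebesgue_on {0..1}) f \<and> integrable (lebesgue_on {0..1}) h \<and>
     (AE t in lebesgue_on {0..1}. f t = h t)"

lemma part_equivp_L1_rel: "part_equivp (L1_rel :: (real \<Rightarrow> 'a::euclidean_space) \<Rightarrow> _)"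
proof (rule part_equivpI)
  show "\<exists>f :: real \<Rightarrow> 'a. L1_rel f f"
    by (rule exI[of _ "\<lambda>_. 0"]) (simp add: L1_rel_def)
  show "symp (L1_rel :: (real \<Rightarrow> 'a) \<Rightarrow> _)"
    by (rule sympI) (auto simp: L1_rel_def elim: eventually_mono)
  show "transp (L1_rel :: (real \<Rightarrow> 'a) \<Rightarrow> _)"
    by (rule transpI) (auto simp: L1_rel_def elim: eventually_elim2)
qed

quotient_type (overloaded) 'a L1 = "real \<Rightarrow> 'a::euclidean_space" / partial: L1_rel
  by (rule part_equivp_L1_rel)

instantiation L1 :: (euclidean_space) real_normed_vector
begin

lift_definition zero_L1 :: "'a L1" is "\<lambda>_. 0"
  by (simp add: L1_rel_def)

lift_definition plus_L1 :: "'a L1 \<Rightarrow> 'a L1 \<Rightarrow> 'a L1" is "\<lambda>f h t. f t + h t"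
  by (auto simp: L1_rel_def)

lift_definition minus_L1 :: "'a L1 \<Rightarrow> 'a L1 \<Rightarrow> 'a L1" is "\<lambda>f h t. f t - h t"
  by (auto simp: L1_rel_def)

lift_definition uminus_L1 :: "'a L1 \<Rightarrow> 'a L1" is "\<lambda>f t. - f t"
  by (auto simp: L1_rel_def)

lift_definition scaleR_L1 :: "real \<Rightarrow> 'a L1 \<Rightarrow> 'a L1" is "\<lambda>r f t. r *\<^sub>R f t"
  by (auto simp: L1_rel_def)

lift_definition norm_L1 :: "'a L1 \<Rightarrow> real" is "\<lambda>f. \<integral>t. norm (f t) \<partial>lebesgue_on {0..1}"
  unfolding L1_rel_def by (intro integral_cong_AE) auto

definition dist_L1 :: "'a L1 \<Rightarrow> 'a L1 \<Rightarrow> real" where "dist_L1 u w = norm (u - w)"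

definition sgn_L1 :: "'a L1 \<Rightarrow> 'a L1" where "sgn_L1 u = inverse (norm u) *\<^sub>R u"

definition uniformity_L1 :: "('a L1 \<times> 'a L1) filter" where
  "uniformity_L1 = (INF e\<in>{0<..}. principal {(u, w). dist u w < e})"

definition open_L1 :: "'a L1 set \<Rightarrow> bool" where
  "open_L1 U \<longleftrightarrow> (\<forall>u\<in>U. \<forall>\<^sub>F (u', w) in uniformity. u' = u \<longrightarrow> w \<in> U)"

instance
proof
  fix u v w :: "'a L1" and a b :: real and U :: "'a L1 set"
  show "u + v + w = u + (v + w)" "u + v = v + u" "0 + u = u" "- u + u = 0" "u - v = u + - v"
    "a *\<^sub>R (u + v) = a *\<^sub>R u + a *\<^sub>R v" "(a + b) *\<^sub>R u = a *\<^sub>R u + b *\<^sub>R u"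
    "a *\<^sub>R b *\<^sub>R u = (a * b) *\<^sub>R u" "1 *\<^sub>R u = u"
    by (transfer; auto simp: L1_rel_def algebra_simps)+
  show "dist u v = norm (u - v)" "sgn u = inverse (norm u) *\<^sub>R u"
    "uniformity = (INF e\<in>{0<..}. principal {(u, w :: 'a L1). dist u w < e})"
    "open U \<longleftrightarrow> (\<forall>u\<in>U. \<forall>\<^sub>F (u', w) in uniformity. u' = u \<longrightarrow> w \<in> U)"
    by (simp_all add: dist_L1_def sgn_L1_def uniformity_L1_def open_L1_def)
  show "norm u = 0 \<longleftrightarrow> u = 0"
    by transfer (auto simp: L1_rel_def integral_nonneg_eq_0_iff_AE)
  show "norm (u + v) \<le> norm u + norm v"
  proof transfer
    fix f h :: "real \<Rightarrow> 'a"
    assume "L1_rel f f" "L1_rel h h"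
    then have f: "integrable (lebesgue_on {0..1}) f" and h: "integrable (lebesgue_on {0..1}) h"
      by (auto simp: L1_rel_def)
    have "(\<integral>t. norm (f t + h t) \<partial>lebesgue_on {0..1})
        \<le> (\<integral>t. norm (f t) + norm (h t) \<partial>lebesgue_on {0..1})"
      using f h by (intro integral_mono) (auto intro: norm_triangle_ineq)
    also have "\<dots> = (\<integral>t. norm (f t) \<partial>lebesgue_on {0..1}) + (\<integral>t. norm (h t) \<partial>lebesgue_on {0..1})"
      using f h by simp
    finally show "(\<integral>t. norm (f t + h t) \<partial>lebesgue_on {0..1})
        \<le> (\<integral>t. norm (f t) \<partial>lebesgue_on {0..1}) + (\<integral>t. norm (h t) \<partial>lebesgue_on {0..1})" .
  qed
  show "norm (a *\<^sub>R u) = \<bar>a\<bar> * norm u"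
    by transfer (auto simp: L1_rel_def)
qed

end


section \<open>Singular paths\<close>

text \<open>
  The Banach manifold of horizontal paths starting at \<open>x\<^sub>0\<close> (with the \<open>W\<^sup>1\<^sup>,\<^sup>1\<close> topology) is modelled on
  \<open>L\<^sup>1([0,1], \<real>\<^sup>k)\<close>, \<open>k\<close> being the rank. A parametrization of it near \<open>\<gamma>\<close> is obtained from a smooth
  time-dependent frame \<open>X\<close> of the distribution on a neighbourhood \<open>W\<close> of the graph of \<open>\<gamma>\<close>: to the
  control \<open>u\<close> it associates the solution of \<open>\<gamma>\<^sub>u' = \<Sum>\<^sub>i u\<^sub>i(t) X\<^sub>i(t, \<gamma>\<^sub>u)\<close>, \<open>\<gamma>\<^sub>u(0) = x\<^sub>0\<close>. (Frames
  depending on time are needed since the distribution need not be trivial near the image of a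
  self-intersecting path; along a graph a frame always exists.)
\<close>

definition frame_along ::
    "('m::topological_space, 'e::euclidean_space) chart set \<Rightarrow> ('m \<Rightarrow> 'e set) \<Rightarrow> (real \<Rightarrow> 'm) \<Rightarrow>
     (real \<times> 'm) set \<Rightarrow> ('k::finite \<Rightarrow> real \<times> 'm \<Rightarrow> 'e) \<Rightarrow> bool" where
  "frame_along A \<Delta> \<gamma> W X \<longleftrightarrow> open W \<and> (\<forall>t\<in>{0..1}. (t, \<gamma> t) \<in> W) \<and>
     (\<forall>i. smooth_time_field_on A W (X i)) \<and> (\<forall>(t, y)\<in>W. frame_at \<Delta> y (\<lambda>i. X i (t, y)))"

definition control_path ::
    "('m::topological_space, 'e::euclidean_space) chart set \<Rightarrow> (real \<times> 'm) set \<Rightarrow>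
     ('k::finite \<Rightarrow> real \<times> 'm \<Rightarrow> 'e) \<Rightarrow> 'm \<Rightarrow> (real ^ 'k) L1 \<Rightarrow> (real \<Rightarrow> 'm) \<Rightarrow> bool" where
  "control_path A W X x0 u \<gamma> \<longleftrightarrow> ac_path A \<gamma> \<and> \<gamma> 0 = x0 \<and> (\<forall>t\<in>{0..1}. (t, \<gamma> t) \<in> W) \<and>
     (AE t in lebesgue_on {0..1}. has_velocity A \<gamma> t (\<Sum>i\<in>UNIV. (rep_L1 u t $ i) *\<^sub>R X i (t, \<gamma> t)))"

text \<open>
  The end-point mapping in such a parametrization. By uniqueness of solutions it is well defined on
  an open set of controls, which contains the control of \<open>\<gamma>\<close>; its value elsewhere is irrelevant.
\<close>

definition control_endpoint ::
    "('m::topological_space, 'e::euclidean_space) chart set \<Rightarrow> (real \<times> 'm) set \<Rightarrow>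
     ('k::finite \<Rightarrow> real \<times> 'm \<Rightarrow> 'e) \<Rightarrow> 'm \<Rightarrow> (real ^ 'k) L1 \<Rightarrow> 'm" where
  "control_endpoint A W X x0 u = (THE y. \<exists>\<gamma>. control_path A W X x0 u \<gamma> \<and> \<gamma> 1 = y)"

text \<open>
  A critical point of the end-point mapping: its (Frechet) differential at \<open>\<gamma>\<close> is not onto the
  tangent space at \<open>\<gamma>(1)\<close>. As always, the property does not depend on the chosen chart.
\<close>

definition singular_path ::
    "'k::finite itself \<Rightarrow> ('m::topological_space, 'e::euclidean_space) chart set \<Rightarrow>
     ('m \<Rightarrow> 'e set) \<Rightarrow> (real \<Rightarrow> 'm) \<Rightarrow> bool" where
  "singular_path K A \<Delta> \<gamma> \<longleftrightarrow> horizontal A \<Delta> \<gamma> \<and>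
     (\<exists>W (X :: 'k \<Rightarrow> real \<times> 'm \<Rightarrow> 'e) u L.
        frame_along A \<Delta> \<gamma> W X \<and> control_path A W X (\<gamma> 0) u \<gamma> \<and>
        ((\<lambda>w. chart_map (chart_at A (\<gamma> 1)) (control_endpoint A W X (\<gamma> 0) w)) has_derivative L) (at u) \<and>
        \<not> surj L)"


section \<open>Semiconcavity\<close>

definition semiconcave_euclidean :: "'e::euclidean_space set \<Rightarrow> ('e \<Rightarrow> real) \<Rightarrow> bool" where
  "semiconcave_euclidean U u \<longleftrightarrow>
     (\<forall>z\<in>U. \<exists>C>0. \<exists>\<delta>>0. ball z \<delta> \<subseteq> U \<and>
        (\<forall>x\<in>ball z \<delta>. \<forall>y\<in>ball z \<delta>. \<forall>\<mu>\<in>{0..1}.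
           \<mu> * u y + (1 - \<mu>) * u x - u (\<mu> *\<^sub>R y + (1 - \<mu>) *\<^sub>R x)
             \<le> \<mu> * (1 - \<mu>) * C * (norm (x - y))\<^sup>2))"

definition locally_semiconcave ::
    "('m::topological_space, 'e::euclidean_space) chart set \<Rightarrow> 'm set \<Rightarrow> ('m \<Rightarrow> real) \<Rightarrow> bool" where
  "locally_semiconcave A U u \<longleftrightarrow>
     (\<forall>x\<in>U. \<exists>c. smooth_chart A c \<and> x \<in> chart_dom c \<and> chart_dom c \<subseteq> U \<and>
        semiconcave_euclidean (chart_map c ` chart_dom c) (u \<circ> chart_inv c))"

end

theory Submission
  imports Defs "HOL-Complex_Analysis.Great_Picard"
begin

text \<open>
  A minimizing path of speed \<open>r\<close> inside one chart is the trajectory of a bounded control \<open>u\<close>. If \<open>q\<close> solves the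
  adjoint equation, the end point of the trajectory of \<open>w\<close> satisfies
  \<open>q(1) \<bullet> (y\<^sub>w(1) - y\<^sub>u(1)) = \<integral> F(y\<^sub>u)\<^sup>T q \<bullet> (w - u) + O(\<bar>w - u\<bar>\<^sup>2)\<close>, so the path is singular as soon as \<open>F(y\<^sub>u)\<^sup>T q\<close> vanishes
  for some \<open>q \<noteq> 0\<close>. As this is excluded, the controls \<open>u + F(y\<^sub>u)\<^sup>T q\<close> reach every point \<open>z\<close> near the end point, with
  energy at most \<open>r\<^sup>2 + P \<bullet> (z - y\<^sub>u(1)) + C \<bar>z - y\<^sub>u(1)\<bar>\<^sup>2\<close>. Applied to one short minimizing path this gives the
  accessibility of a neighbourhood, hence the finiteness and the continuity of the distance. Applied, with constants
  uniform by compactness, to the last piece of length \<open>r\<close> of a shortest path from \<open>xbar\<close> to \<open>y\<close>, it gives a quadratic upper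
  bound of the value function at every \<open>y\<close>, which is semiconcavity.
\<close>

section \<open>Absolutely continuous functions on an interval\<close>

text \<open>The obstacle is uniformity: near a given point the constants of the quadratic bound must
  not depend on the minimizing piece, and the piece enters them only through the lower bound
  \<open>\<kappa>\<close> of the Gram form. Therefore all last pieces get the same length
  \<open>r\<close> and lie in one chart, where they form a family closed under pointwise limits.
  Closedness says that limits of pairs at distance at least \<open>r\<close> are again such pairs,
  which is continuity of the distance; so accessibility must be settled before semiconcavity. No
  shortest path from \<open>xbar\<close> is ever constructed, only a point \<open>p\<close> on the
  way at distance \<open>r\<close> from \<open>y\<close>. The relation \<open>reach T x y\<close>
  (speed at most \<open>T\<close> on unit time) links absolutely continuous horizontal paths with
  bounded controls; for it, bounds on length and on the square root of the energy are
  interchangeable. As \<open>singular_path\<close> differentiates the end point on L1 controls, the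
  remainder of the expansion is estimated by the square of the L1 norm. If the energy of the last
  piece grows by \<open>a\<close>, the distance grows by at most \<open>a / (2 * r)\<close>;
  squaring this gives the bound for the value function.\<close>

lemma lebesgue_differentiation_ivl:
  fixes f :: "real \<Rightarrow> 'a::euclidean_space"
  assumes f: "f integrable_on {a..b}"
  obtains N where "negligible N"
    "\<And>t. t \<in> {a<..<b} - N \<Longrightarrow> ((\<lambda>s. integral {a..s} f) has_vector_derivative f t) (at t)"
proof -
  define F where "F = (\<lambda>s. integral {a..s} f)"
  define err where "err t h = norm (F (t + h) - F t - h *\<^sub>R f t)" for t h
  \<comment> \<open>\<open>E n\<close> collects the points where the difference quotient misses
    \<open>f t\<close> by at least 1/(n+1) at arbitrarily small scale. Off the union of these sets
    the derivative is \<open>f t\<close>, so each of them has to be null.\<close>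
  define E where "E n = {t \<in> {a<..<b}. \<forall>d>0. \<exists>h. h \<noteq> 0 \<and> \<bar>h\<bar> < d \<and> t + h \<in> {a..b} \<and> err t h \<ge> \<bar>h\<bar> / real (Suc n)}" for n
  have F_diff: "integral {s..t} f = F t - F s" if "a \<le> s" "s \<le> t" "t \<le> b" for s t
  proof -
    have "f integrable_on {a..t}"
      using f by (rule integrable_subinterval_real) (use that in auto)
    from Henstock_Kurzweil_Integration.integral_combine[OF that(1,2) this] show ?thesis
      by (simp add: F_def algebra_simps)
  qed
  have "negligible (E n)" for n
  proof -
    have "\<exists>T. E n \<subseteq> T \<and> T \<in> lmeasurable \<and> measure lebesgue T \<le> e" if "e > 0" for e
    proof -
      have "e / real (Suc n) > 0" using that by simp
      with f[unfolded cbox_interval[symmetric]] obtain \<gamma> where "gauge \<gamma>"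
        and \<gamma>: "\<And>p. \<lbrakk>p tagged_partial_division_of (cbox a b); \<gamma> fine p\<rbrakk> \<Longrightarrow>
             sum (\<lambda>(x,k). norm(measure lborel k *\<^sub>R f x - integral k f)) p < e / real (Suc n)"
        by (rule Henstock_lemma) blast
      \<comment> \<open>\<open>I (t, h)\<close> is the interval between \<open>t\<close> and
        \<open>t + h\<close>, with its tag \<open>t\<close> at one end; it is written as a ball of
        centre t + h/2 for the Vitali covering theorem.\<close>
      define I where "I = (\<lambda>(t::real, h::real). cball (t + h/2) (\<bar>h\<bar>/2))"
      define K where "K = {(t, h). t \<in> E n \<and> h \<noteq> 0 \<and> t + h \<in> {a..b} \<and> I (t, h) \<subseteq> \<gamma> t \<and> err t h \<ge> \<bar>h\<bar> / real (Suc n)}"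
      have I_eq: "I (t, h) = {min t (t + h)..max t (t + h)}" for t h
        by (auto simp: I_def cball_def dist_real_def abs_if min_def max_def field_simps)
      obtain C where C: "countable C" "C \<subseteq> K"
        "pairwise (\<lambda>i j. disjnt (I i) (I j)) C" "negligible (E n - (\<Union>i\<in>C. I i))"
      proof (rule Vitali_covering_theorem_cballs[of K "\<lambda>(t,h). \<bar>h\<bar>/2" "E n" "\<lambda>(t,h). t + h/2"])
        show "0 < (case i of (t, h) \<Rightarrow> \<bar>h\<bar> / 2)" if "i \<in> K" for i
          using that by (auto simp: K_def)
      next
        fix t d :: real assume t: "t \<in> E n" "0 < d"
        obtain d' where d': "d' > 0" "ball t d' \<subseteq> \<gamma> t"
          using \<open>gauge \<gamma>\<close> by (meson gauge_def openE)
        obtain h where h: "h \<noteq> 0" "\<bar>h\<bar> < min d d'" "t + h \<in> {a..b}" "err t h \<ge> \<bar>h\<bar> / real (Suc n)"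
          using t(1) d'(1) t(2) unfolding E_def mem_Collect_eq
          by (elim conjE allE[of _ "min d d'"]) auto
        have "I (t, h) \<subseteq> ball t d'"
          using h by (auto simp: I_eq dist_real_def)
        then have "(t, h) \<in> K" using h t d' by (auto simp: K_def)
        moreover have "t \<in> I (t, h)" by (auto simp: I_eq)
        ultimately show "\<exists>i. i \<in> K \<and> t \<in> cball (case i of (t, h) \<Rightarrow> t + h / 2) (case i of (t, h) \<Rightarrow> \<bar>h\<bar> / 2) \<and> (case i of (t, h) \<Rightarrow> \<bar>h\<bar> / 2) < d"
          using h by (intro exI[of _ "(t, h)"]) (auto simp: I_def)
      qed (auto simp: I_def split_def)
      \<comment> \<open>A finite disjoint subfamily is a tagged partial division that is fine for
        the Henstock gauge. Its error terms \<open>err t h\<close> add up to less than e/(n+1),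
        while each is at least |h|/(n+1), so the total length is at most \<open>e\<close>.\<close>
      have bound: "measure lebesgue (\<Union>(I ` C')) \<le> e" if C': "C' \<subseteq> C" "finite C'" for C'
      proof -
        define p where "p = (\<lambda>(t, h). (t, I (t, h))) ` C'"
        have inj: "inj_on (\<lambda>(t, h). (t, I (t, h))) C'"
        proof (rule inj_onI, clarsimp)
          fix t h h' assume *: "(t, h) \<in> C'" "(t, h') \<in> C'" "I (t, h) = I (t, h')"
          then have "\<not> disjnt (I (t, h)) (I (t, h'))" by (auto simp: I_eq disjnt_def)
          then show "h = h'" using C(3) * C' unfolding pairwise_def by blast
        qed
        have E_in: "t \<in> {a<..<b}" if "(t, h) \<in> C'" for t h
          using that C(2) C' by (auto simp: K_def E_def)
        have th_in: "t + h \<in> {a..b}" if "(t, h) \<in> C'" for t h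
          using that C(2) C' by (auto simp: K_def)
        have part: "p tagged_partial_division_of (cbox a b)"
          unfolding tagged_partial_division_of_def
        proof (intro conjI allI impI)
          show "finite p" using C' by (simp add: p_def)
          fix x k assume xk: "(x, k) \<in> p"
          then obtain h where h: "(x, h) \<in> C'" "k = I (x, h)" by (auto simp: p_def)
          show "x \<in> k" using h by (auto simp: I_eq)
          show "k \<subseteq> cbox a b" using h E_in[OF h(1)] th_in[OF h(1)] by (auto simp: I_eq)
          show "\<exists>a b. k = cbox a b" using h I_eq by (metis cbox_interval)
        next
          fix x1 k1 x2 k2 assume *: "(x1, k1) \<in> p \<and> (x2, k2) \<in> p \<and> (x1, k1) \<noteq> (x2, k2)"
          then obtain h1 h2 where h: "(x1, h1) \<in> C'" "k1 = I (x1, h1)" "(x2, h2) \<in> C'" "k2 = I (x2, h2)"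
            by (auto simp: p_def)
          then have "(x1,h1) \<noteq> (x2,h2)" using * by auto
          then have "disjnt k1 k2" using C(3) C' h unfolding pairwise_def by blast
          then show "interior k1 \<inter> interior k2 = {}"
            using interior_subset by (fastforce simp: disjnt_def)
        qed
        have fine: "\<gamma> fine p"
          unfolding fine_def using C(2) C' by (auto simp: p_def K_def)
        have "measure lebesgue (\<Union>(I ` C')) \<le> (\<Sum>i\<in>C'. measure lebesgue (I i))"
          by (rule measure_UNION_le) (use C' in \<open>auto simp: I_def\<close>)
        also have "\<dots> \<le> (\<Sum>(t, h)\<in>C'. real (Suc n) * norm (measure lborel (I (t,h)) *\<^sub>R f t - integral (I (t,h)) f))"
        proof (rule sum_mono, clarsimp simp only: prod.case)
          fix t h assume th: "(t, h) \<in> C'"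
          have eh: "err t h \<ge> \<bar>h\<bar> / real (Suc n)" using th C(2) C' by (auto simp: K_def)
          have c: "measure lebesgue (I (t, h)) = \<bar>h\<bar>" unfolding I_eq by (cases "h \<ge> 0") (auto simp: min_def max_def)
          have "norm (measure lborel (I (t,h)) *\<^sub>R f t - integral (I (t,h)) f) = err t h"
          proof (cases "h \<ge> 0")
            case True
            then have "integral (I (t, h)) f = F (t + h) - F t"
              unfolding I_eq using F_diff[of t "t+h"] E_in[OF th] th_in[OF th] by simp
            then show ?thesis using True
              by (simp add: err_def I_eq norm_minus_commute[of "h *\<^sub>R f t"])
          next
            case False
            then have "integral (I (t, h)) f = F t - F (t + h)"
              unfolding I_eq using F_diff[of "t+h" t] E_in[OF th] th_in[OF th] by simp
            then show ?thesis using False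
              unfolding \<open>integral (I (t, h)) f = _\<close> err_def I_eq
              by (intro arg_cong[where f=norm]) (simp add: algebra_simps)
          qed
          then show "measure lebesgue (I (t, h)) \<le> real (Suc n) * norm (measure lborel (I (t,h)) *\<^sub>R f t - integral (I (t,h)) f)"
            using eh c by (simp add: field_simps)
        qed
        also have "\<dots> = real (Suc n) * (\<Sum>(t, h)\<in>C'. norm (measure lborel (I (t,h)) *\<^sub>R f t - integral (I (t,h)) f))"
          by (simp add: sum_distrib_left split_def)
        also have "(\<Sum>(t, h)\<in>C'. norm (measure lborel (I (t,h)) *\<^sub>R f t - integral (I (t,h)) f)) =
            sum (\<lambda>(x,k). norm(measure lborel k *\<^sub>R f x - integral k f)) p"
          unfolding p_def by (subst sum.reindex[OF inj]) (auto simp: split_def intro!: sum.cong)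
        also have "real (Suc n) * \<dots> \<le> e"
          using \<gamma>[OF part fine] by (simp add: field_simps)
        finally show ?thesis .
      qed
      have fin_bound: "measure lebesgue (\<Union>D) \<le> e" if "D \<subseteq> I ` C" "finite D" for D
        using that bound by (metis finite_subset_image)
      have I_meas: "D \<in> lmeasurable" if "D \<in> I ` C" for D
        using that by (auto simp: I_def)
      have "countable (I ` C)" using C(1) by simp
      from fmeasurable_Union_bound[OF this I_meas fin_bound] measure_Union_bound[OF this I_meas fin_bound]
      have UC: "\<Union>(I ` C) \<in> lmeasurable" "measure lebesgue (\<Union>(I ` C)) \<le> e" by blast+
      define T where "T = \<Union>(I ` C) \<union> (E n - (\<Union>i\<in>C. I i))"
      have neg: "E n - (\<Union>i\<in>C. I i) \<in> null_sets lebesgue"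
        using C(4) by (simp add: negligible_iff_null_sets)
      have "E n \<subseteq> T" by (auto simp: T_def)
      moreover have "measure lebesgue T = measure lebesgue (\<Union>(I ` C))"
        unfolding T_def by (rule measure_Un_null_set[OF fmeasurableD[OF UC(1)] neg])
      moreover have "T \<in> lmeasurable"
        unfolding T_def by (rule fmeasurable.Un[OF UC(1) negligible_imp_measurable[OF C(4)]])
      ultimately show ?thesis using UC by auto
    qed
    then show ?thesis by (simp add: negligible_outer_le)
  qed
  then have neg: "negligible (\<Union>n. E n)" by (intro negligible_countable_Union) auto
  show ?thesis
  proof (rule that[OF neg])
    fix t assume t: "t \<in> {a<..<b} - (\<Union>n. E n)"
    show "((\<lambda>s. integral {a..s} f) has_vector_derivative f t) (at t)"
      unfolding has_vector_derivative_def has_derivative_at_alt F_def[symmetric]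
    proof (intro conjI allI impI)
      show "bounded_linear (\<lambda>x. x *\<^sub>R f t)" by (rule bounded_linear_scaleR_left)
      fix r :: real assume r: "0 < r"
      then obtain n where n: "1 / real (Suc n) < r" using nat_approx_posE by blast
      have "t \<notin> E n" using t by blast
      moreover have "t \<in> {a<..<b}" using t by blast
      ultimately obtain d where d: "d > 0" "\<And>h. \<lbrakk>h \<noteq> 0; \<bar>h\<bar> < d; t + h \<in> {a..b}\<rbrakk> \<Longrightarrow> err t h < \<bar>h\<bar> / real (Suc n)"
        unfolding E_def mem_Collect_eq by (meson not_le)
      show "\<exists>d>0. \<forall>y. norm (y - t) < d \<longrightarrow> norm (F y - F t - (y - t) *\<^sub>R f t) \<le> r * norm (y - t)"
      proof (intro exI[of _ "min d (min (t - a) (b - t))"] conjI allI impI)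
        show "0 < min d (min (t - a) (b - t))" using d t by auto
        fix y assume y: "norm (y - t) < min d (min (t - a) (b - t))"
        show "norm (F y - F t - (y - t) *\<^sub>R f t) \<le> r * norm (y - t)"
        proof (cases "y = t")
          case False
          have "err t (y - t) < \<bar>y - t\<bar> / real (Suc n)"
            using y False by (intro d) auto
          also have "\<dots> \<le> r * \<bar>y - t\<bar>"
            using mult_right_mono[of "1 / real (Suc n)" r "\<bar>y - t\<bar>"] n by simp
          finally show ?thesis by (simp add: err_def)
        qed simp
      qed
    qed
  qed
qed

text \<open>Two kinds of tags: the intervals with tag in \<open>N\<close> lie in an open set of
  small measure, where absolute continuity makes the increments of \<open>f\<close> small in total;
  at the other tags differentiability compares the increment with \<open>h\<close>. The integral is
  the gauge integral, so integrability of \<open>h\<close> is part of the conclusion.\<close>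

lemma absolutely_continuous_FTC:
  fixes f :: "real \<Rightarrow> 'a::euclidean_space"
  assumes ac: "absolutely_continuous_on_ivl a b f" and N: "negligible N" and "a \<le> b"
    and deriv: "\<And>t. t \<in> {a..b} - N \<Longrightarrow> (f has_vector_derivative h t) (at t within {a..b})"
  shows "(h has_integral f b - f a) {a..b}"
proof -
  define h' where "h' t = (if t \<in> N then 0 else h t)" for t
  have "(h' has_integral f b - f a) (cbox a b)"
    unfolding has_integral
  proof (intro allI impI)
    fix e :: real assume e: "e > 0"
    obtain \<delta> where \<delta>: "\<delta> > 0" and ac': "\<And>D. \<lbrakk>D division_of \<Union>D; \<Union>D \<subseteq> {a..b}; (\<Sum>I\<in>D. Sup I - Inf I) < \<delta>\<rbrakk>
         \<Longrightarrow> (\<Sum>I\<in>D. norm (f (Sup I) - f (Inf I))) < e / 2"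
      using ac e unfolding absolutely_continuous_on_ivl_def by (meson half_gt_zero)
    obtain U where U: "open U" "N \<subseteq> U" "U \<in> lmeasurable" "measure lebesgue U < \<delta>"
    proof -
      have N': "N \<in> lmeasurable" "N \<in> null_sets lebesgue"
        using N by (auto simp: negligible_imp_measurable negligible_iff_null_sets)
      obtain T where T: "open T" "N \<subseteq> T" "(T - N) \<in> lmeasurable" "emeasure lebesgue (T - N) < ennreal \<delta>"
        using sets_lebesgue_outer_open[of N \<delta>] N' \<delta> by auto
      have eq: "T = (T - N) \<union> N" using T by auto
      have "T \<in> lmeasurable" using T(3) N'(1) by (subst eq) (rule fmeasurable.Un)
      moreover have "measure lebesgue T = measure lebesgue (T - N)"
        by (subst eq, rule measure_Un_null_set) (use T N' in auto)
      then have "measure lebesgue T < \<delta>"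
        using T \<delta> by (simp add: emeasure_eq_measure2 ennreal_less_iff)
      ultimately show ?thesis using T that by blast
    qed
    \<comment> \<open>Half of the tolerance is for the tags outside \<open>N\<close>: at rate
      \<open>\<eta>\<close> the total length b - a contributes at most e/2. The summand 1 covers the
      case a = b.\<close>
    define \<eta> where "\<eta> = e / (2 * (b - a + 1))"
    have \<eta>: "\<eta> > 0" using e \<open>a \<le> b\<close> by (simp add: \<eta>_def)
    have "\<exists>d>0. \<forall>y\<in>{a..b}. \<bar>y - t\<bar> < d \<longrightarrow> norm (f y - f t - (y - t) *\<^sub>R h t) \<le> \<eta> * \<bar>y - t\<bar>"
      if "t \<in> {a..b} - N" for t
      using deriv[OF that] \<eta> unfolding has_vector_derivative_def has_derivative_within_alt by auto
    then obtain d where d: "\<And>t. t \<in> {a..b} - N \<Longrightarrow> d t > 0"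
      "\<And>t y. \<lbrakk>t \<in> {a..b} - N; y \<in> {a..b}; \<bar>y - t\<bar> < d t\<rbrakk> \<Longrightarrow> norm (f y - f t - (y - t) *\<^sub>R h t) \<le> \<eta> * \<bar>y - t\<bar>"
      by metis
    \<comment> \<open>Tags in \<open>N\<close> are confined to the small open set \<open>U\<close>;
      the last branch only makes the gauge total.\<close>
    define \<gamma> where "\<gamma> t = (if t \<in> N then U else if t \<in> {a..b} then ball t (d t) else ball t 1)" for t
    have "gauge \<gamma>"
      unfolding gauge_def \<gamma>_def using U d(1) by auto
    show "\<exists>\<gamma>. gauge \<gamma> \<and> (\<forall>D. D tagged_division_of cbox a b \<and> \<gamma> fine D \<longrightarrow>
         norm ((\<Sum>(x, K)\<in>D. measure lborel K *\<^sub>R h' x) - (f b - f a)) < e)"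
    proof (intro exI[of _ \<gamma>] conjI allI impI \<open>gauge \<gamma>\<close>)
      fix D assume D: "D tagged_division_of cbox a b \<and> \<gamma> fine D"
      then have fin: "finite D" by auto
      define inc where "inc K = f (Sup K) - f (Inf K)" for K
      have K_ivl: "\<exists>u v. K = {u..v} \<and> a \<le> u \<and> u \<le> t \<and> t \<le> v \<and> v \<le> b" if "(t, K) \<in> D" for t K
      proof -
        have "t \<in> K" "K \<subseteq> cbox a b" "\<exists>u v. K = cbox u v"
          using D that unfolding tagged_division_of_def tagged_partial_division_of_def by blast+
        then show ?thesis by (metis atLeastAtMost_iff atLeastatMost_subset_iff cbox_interval order_trans)
      qed
      have "(\<Sum>(x, K)\<in>D. f (Sup K) - f (Inf K)) = f b - f a"
        using additive_tagged_division_1[OF \<open>a \<le> b\<close>, of D f] D by auto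
      then have "norm ((\<Sum>(x, K)\<in>D. measure lborel K *\<^sub>R h' x) - (f b - f a)) =
          norm (\<Sum>(x, K)\<in>D. measure lborel K *\<^sub>R h' x - inc K)"
        by (simp add: inc_def split_def sum_subtractf)
      also have "\<dots> \<le> (\<Sum>(x, K)\<in>D. norm (measure lborel K *\<^sub>R h' x - inc K))"
        by (rule order_trans[OF norm_sum]) (simp add: split_def)
      also have "\<dots> = (\<Sum>(x, K)\<in>{p\<in>D. fst p \<in> N}. norm (measure lborel K *\<^sub>R h' x - inc K))
            + (\<Sum>(x, K)\<in>{p\<in>D. fst p \<notin> N}. norm (measure lborel K *\<^sub>R h' x - inc K))"
        by (subst sum.union_disjoint[symmetric]) (use fin in \<open>auto intro!: sum.cong\<close>)
      also have "(\<Sum>(x, K)\<in>{p\<in>D. fst p \<in> N}. norm (measure lborel K *\<^sub>R h' x - inc K)) < e / 2"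
      proof -
        define DN where "DN = {p\<in>D. fst p \<in> N}"
        have part: "DN tagged_partial_division_of cbox a b"
          using D unfolding DN_def tagged_division_of_def
          by (auto intro: tagged_partial_division_subset)
        have dv: "snd ` DN division_of \<Union>(snd ` DN)"
          using partial_division_of_tagged_division[OF part] by blast
        have inN: "\<Union>(snd ` DN) \<subseteq> U"
          using D unfolding DN_def fine_def \<gamma>_def by fastforce
        have sub: "\<Union>(snd ` DN) \<subseteq> {a..b}"
          using part unfolding tagged_partial_division_of_def by fastforce
        have SI: "Sup K - Inf K = measure lebesgue K \<and> K \<in> lmeasurable" if "K \<in> snd ` DN" for K
          using that K_ivl unfolding DN_def by force
        have fDN: "finite DN" using fin by (simp add: DN_def)
        have "(\<Sum>K\<in>snd ` DN. Sup K - Inf K) = (\<Sum>K\<in>snd ` DN. measure lebesgue K)"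
          using SI by (intro sum.cong) auto
        also have "\<dots> = measure lebesgue (\<Union>(snd ` DN))"
          using content_division[OF dv] by simp
        also have "\<dots> \<le> measure lebesgue U"
          using SI fDN U by (intro measure_mono_fmeasurable inN) (auto intro!: sets.finite_Union fmeasurableD)
        finally have "(\<Sum>K\<in>snd ` DN. norm (inc K)) < e / 2"
          unfolding inc_def using U(4) by (intro ac' dv sub) auto
        moreover have "(\<Sum>(x, K)\<in>DN. norm (measure lborel K *\<^sub>R h' x - inc K)) = (\<Sum>(x, K)\<in>DN. norm (inc K))"
          by (intro sum.cong) (auto simp: h'_def DN_def)
        moreover have "(\<Sum>(x, K)\<in>DN. norm (inc K)) = (\<Sum>K\<in>snd ` DN. norm (inc K))"
        proof -
          \<comment> \<open>Different tags may share a degenerate interval, so passing from tagged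
            pairs to intervals asks for a function that vanishes on those. The value at the empty
            set is forced to 0 since \<open>Sup\<close> and \<open>Inf\<close> carry no information
            there.\<close>
          define inc' where "inc' K = (if K = {} then 0 else norm (inc K))" for K
          have "(\<Sum>(x, K)\<in>DN. inc' K) = (\<Sum>K\<in>snd ` DN. inc' K)"
          proof (rule sum.over_tagged_division_lemma[OF tagged_partial_division_of_Union_self[OF part]])
            fix u v :: real assume "box u v = {}"
            then show "inc' (cbox u v) = 0"
              by (cases "u = v") (auto simp: inc'_def inc_def)
          qed
          moreover have "K \<noteq> {}" if "(t, K) \<in> DN" for t K
            using that K_ivl[of t K] unfolding DN_def by auto
          then have "(\<Sum>(x, K)\<in>DN. inc' K) = (\<Sum>(x, K)\<in>DN. norm (inc K))"
             "(\<Sum>K\<in>snd ` DN. inc' K) = (\<Sum>K\<in>snd ` DN. norm (inc K))"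
            by (auto simp: inc'_def intro!: sum.cong)
          ultimately show ?thesis by simp
        qed
        ultimately show ?thesis unfolding DN_def by simp
      qed
      also have "(\<Sum>(x, K)\<in>{p\<in>D. fst p \<notin> N}. norm (measure lborel K *\<^sub>R h' x - inc K)) \<le> e / 2"
      proof -
        have "(\<Sum>(x, K)\<in>{p\<in>D. fst p \<notin> N}. norm (measure lborel K *\<^sub>R h' x - inc K)) \<le>
            (\<Sum>(x, K)\<in>{p\<in>D. fst p \<notin> N}. \<eta> * measure lborel K)"
        proof (rule sum_mono, clarsimp)
          fix t K assume tK: "(t, K) \<in> D" "t \<notin> N"
          then obtain u v where uv: "K = {u..v}" "a \<le> u" "u \<le> t" "t \<le> v" "v \<le> b" using K_ivl by blast
          have "{u..v} \<subseteq> ball t (d t)"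
            using D tK uv unfolding fine_def \<gamma>_def by fastforce
          moreover have "u \<in> {u..v}" "v \<in> {u..v}" using uv by auto
          ultimately have *: "\<bar>u - t\<bar> < d t" "\<bar>v - t\<bar> < d t"
            unfolding ball_def by (auto simp: dist_real_def abs_minus_commute)
          have 1: "norm (f u - f t - (u - t) *\<^sub>R h t) \<le> \<eta> * (t - u)"
            using d(2)[of t u] * uv tK by auto
          have 2: "norm (f v - f t - (v - t) *\<^sub>R h t) \<le> \<eta> * (v - t)"
            using d(2)[of t v] * uv tK by auto
          have "measure lborel K *\<^sub>R h' t - inc K = (f u - f t - (u - t) *\<^sub>R h t) - (f v - f t - (v - t) *\<^sub>R h t)"
            using uv tK by (simp add: inc_def h'_def algebra_simps)
          then have "norm (measure lborel K *\<^sub>R h' t - inc K) \<le> \<eta> * (t - u) + \<eta> * (v - t)"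
            using 1 2 norm_triangle_ineq4 by (smt (verit, best))
          then show "norm (measure lborel K *\<^sub>R h' t - inc K) \<le> \<eta> * measure lborel K"
            using uv by (simp add: algebra_simps)
        qed
        also have "\<dots> \<le> (\<Sum>(x, K)\<in>D. \<eta> * measure lborel K)"
          using fin \<eta> by (intro sum_mono2) auto
        also have "\<dots> = \<eta> * (b - a)"
          using additive_content_tagged_division[of D a b] D \<open>a \<le> b\<close>
          by (simp add: sum_distrib_left[symmetric] split_def)
        also have "\<dots> \<le> e / 2"
          using e \<open>a \<le> b\<close> by (simp add: \<eta>_def field_simps)
        finally show ?thesis .
      qed
      finally show "norm ((\<Sum>(x, K)\<in>D. measure lborel K *\<^sub>R h' x) - (f b - f a)) < e" by simp
    qed
  qed
  then show ?thesis
    unfolding cbox_interval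
    by (rule has_integral_spike[OF N, rotated]) (auto simp: h'_def)
qed

lemma absolutely_continuous_on_ivl_subset:
  assumes "absolutely_continuous_on_ivl a b f" "a \<le> c" "d \<le> b"
  shows "absolutely_continuous_on_ivl c d f"
  unfolding absolutely_continuous_on_ivl_def
proof (intro allI impI)
  fix e :: real assume "e > 0"
  then obtain \<delta> where "\<delta> > 0" and \<delta>: "\<And>D. D division_of \<Union>D \<and> \<Union>D \<subseteq> {a..b} \<and> (\<Sum>I\<in>D. Sup I - Inf I) < \<delta> \<Longrightarrow>
        (\<Sum>I\<in>D. norm (f (Sup I) - f (Inf I))) < e"
    using assms(1) unfolding absolutely_continuous_on_ivl_def by meson
  moreover have "{c..d} \<subseteq> {a..b}" using assms by auto
  ultimately show "\<exists>\<delta>>0. \<forall>D. D division_of \<Union>D \<and> \<Union>D \<subseteq> {c..d} \<and> (\<Sum>I\<in>D. Sup I - Inf I) < \<delta> \<longrightarrow>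
        (\<Sum>I\<in>D. norm (f (Sup I) - f (Inf I))) < e"
    by (meson order_trans)
qed

lemma division_Sup_Inf:
  fixes D :: "real set set"
  assumes "D division_of S" "I \<in> D"
  shows "I = {Inf I..Sup I}" "Inf I \<le> Sup I" "Inf I \<in> I" "Sup I \<in> I"
proof -
  obtain u v where "I = cbox u v" "I \<noteq> {}"
    using assms by (metis division_ofD(3,4))
  then show "I = {Inf I..Sup I}" "Inf I \<le> Sup I" "Inf I \<in> I" "Sup I \<in> I" by auto
qed

text \<open>Absolute continuity with tolerance 1 bounds the variation of \<open>f\<close> over any
  interval shorter than \<delta>, and a gauge integrable function whose indefinite integral has
  bounded variation is absolutely integrable. Short intervals are enough for the local use along a
  path.\<close>

lemma absolutely_continuous_abs_integrable:
  fixes f :: "real \<Rightarrow> 'a::euclidean_space"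
  assumes ac: "absolutely_continuous_on_ivl a b f" and N: "negligible N"
    and deriv: "\<And>t. t \<in> {a..b} - N \<Longrightarrow> (f has_vector_derivative h t) (at t within {a..b})"
  shows "\<exists>\<delta>>0. \<forall>c d. a \<le> c \<and> c \<le> d \<and> d \<le> b \<and> d - c < \<delta> \<longrightarrow> h absolutely_integrable_on {c..d}"
proof -
  obtain \<delta> where "\<delta> > 0" and \<delta>: "\<And>D. \<lbrakk>D division_of \<Union>D; \<Union>D \<subseteq> {a..b}; (\<Sum>I\<in>D. Sup I - Inf I) < \<delta>\<rbrakk> \<Longrightarrow>
        (\<Sum>I\<in>D. norm (f (Sup I) - f (Inf I))) < 1"
    using ac unfolding absolutely_continuous_on_ivl_def by (meson zero_less_one)
  have ftc: "(h has_integral f v - f u) {u..v}" if "a \<le> u" "u \<le> v" "v \<le> b" for u v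
  proof (rule absolutely_continuous_FTC[OF _ N \<open>u \<le> v\<close>])
    show "absolutely_continuous_on_ivl u v f"
      using absolutely_continuous_on_ivl_subset[OF ac] that by blast
    show "(f has_vector_derivative h t) (at t within {u..v})" if "t \<in> {u..v} - N" for t
      by (rule has_vector_derivative_within_subset[OF deriv]) (use that \<open>a \<le> u\<close> \<open>v \<le> b\<close> in auto)
  qed
  have "h absolutely_integrable_on {c..d}" if cd: "a \<le> c" "c \<le> d" "d \<le> b" "d - c < \<delta>" for c d
  proof -
    have "h absolutely_integrable_on cbox c d"
    proof (rule bounded_variation_absolutely_integrable_interval)
      show "h integrable_on cbox c d" using ftc[OF cd(1-3)] by auto
      fix D assume D: "D division_of cbox c d"
      then have D': "D division_of \<Union>D" by auto
      have sub: "\<Union>D \<subseteq> {a..b}" using division_ofD(6)[OF D] cd by auto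
      have ivl: "I = {Inf I..Sup I}" "Inf I \<le> Sup I" "a \<le> Inf I" "Sup I \<le> b" if "I \<in> D" for I
        using division_Sup_Inf[OF D' that] sub that by (auto 0 3)
      have "(\<Sum>I\<in>D. norm (integral I h)) = (\<Sum>I\<in>D. norm (f (Sup I) - f (Inf I)))"
      proof (rule sum.cong[OF refl])
        fix I assume "I \<in> D"
        note i = ivl[OF this]
        have "integral I h = f (Sup I) - f (Inf I)"
          by (subst i(1), rule integral_unique) (rule ftc[OF i(3,2,4)])
        then show "norm (integral I h) = norm (f (Sup I) - f (Inf I))" by simp
      qed
      also have "\<dots> < 1"
      proof (rule \<delta>[OF D' sub])
        have "(\<Sum>I\<in>D. Sup I - Inf I) = (\<Sum>I\<in>D. measure lebesgue I)"
        proof (rule sum.cong[OF refl])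
          fix I assume "I \<in> D"
          note i = ivl[OF this]
          have "measure lebesgue {Inf I..Sup I} = Sup I - Inf I" using i(2) by simp
          then show "Sup I - Inf I = measure lebesgue I" using i(1) by simp
        qed
        also have "\<dots> = d - c"
          using content_division[OF D] cd by simp
        finally show "(\<Sum>I\<in>D. Sup I - Inf I) < \<delta>" using cd by simp
      qed
      finally show "(\<Sum>I\<in>D. norm (integral I h)) \<le> 1" by simp
    qed
    then show ?thesis by simp
  qed
  with \<open>\<delta> > 0\<close> show ?thesis by blast
qed

text \<open>Uniform integrability of \<open>k\<close>: truncation at a high level \<open>n\<close>
  discards a function of integral below half of the tolerance on the whole interval, and the
  truncated part contributes at most \<open>n\<close> times the total length of the
  division.\<close>

lemma absolutely_continuous_modulus:
  fixes f :: "real \<Rightarrow> 'a::real_normed_vector" and k :: "real \<Rightarrow> real"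
  assumes k: "k absolutely_integrable_on {a..b}" "\<And>t. t \<in> {a..b} \<Longrightarrow> 0 \<le> k t"
    and f: "\<And>s t. \<lbrakk>a \<le> s; s \<le> t; t \<le> b\<rbrakk> \<Longrightarrow> norm (f t - f s) \<le> C * integral {s..t} k"
    and C: "C > 0"
  shows "absolutely_continuous_on_ivl a b f"
  unfolding absolutely_continuous_on_ivl_def
proof (intro allI impI)
  fix e :: real assume e: "e > 0"
  define e' where "e' = e / C"
  have e': "e' > 0" using e C by (simp add: e'_def)
  have k_int: "k integrable_on {a..b}" by (rule set_lebesgue_integral_eq_integral(1)[OF k(1)])
  define kn where "kn n t = min (k t) (real n)" for n t
  have kn_abs: "kn n absolutely_integrable_on {a..b}" for n
    unfolding kn_def by (rule absolutely_integrable_min_1[OF k(1)]) auto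
  then have kn_int: "kn n integrable_on {a..b}" for n by (rule set_lebesgue_integral_eq_integral(1))
  have "(\<lambda>n. integral {a..b} (kn n)) \<longlonglongrightarrow> integral {a..b} k"
  proof (rule dominated_convergence(2)[OF kn_int k_int])
    show "norm (kn n t) \<le> k t" if "t \<in> {a..b}" for n t using k(2)[OF that] by (simp add: kn_def)
    show "(\<lambda>n. kn n t) \<longlonglongrightarrow> k t" if "t \<in> {a..b}" for t
    proof (rule tendsto_eventually)
      obtain n0 where "k t \<le> real n0" using real_arch_simple by blast
      then show "\<forall>\<^sub>F n in sequentially. kn n t = k t"
        by (intro eventually_sequentiallyI[of n0]) (auto simp: kn_def min_def)
    qed
  qed
  then have "\<forall>\<^sub>F n in sequentially. dist (integral {a..b} (kn n)) (integral {a..b} k) < e' / 2"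
    using e' by (intro tendstoD) auto
  then obtain n where "dist (integral {a..b} (kn n)) (integral {a..b} k) < e' / 2"
    by (metis eventually_sequentially order_refl)
  then have n: "integral {a..b} k - integral {a..b} (kn n) < e' / 2"
    unfolding dist_real_def by linarith
  define \<phi> where "\<phi> t = k t - kn n t" for t
  have \<phi>_int: "\<phi> integrable_on {a..b}" unfolding \<phi>_def by (intro integrable_diff k_int kn_int)
  have \<phi>_nn: "\<phi> t \<ge> 0" for t by (simp add: \<phi>_def kn_def)
  have \<phi>_small: "integral {a..b} \<phi> < e' / 2"
    unfolding \<phi>_def using n by (subst integral_diff) (auto simp: k_int kn_int)
  show "\<exists>\<delta>>0. \<forall>D. D division_of \<Union>D \<and> \<Union>D \<subseteq> {a..b} \<and> (\<Sum>I\<in>D. Sup I - Inf I) < \<delta> \<longrightarrow>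
       (\<Sum>I\<in>D. norm (f (Sup I) - f (Inf I))) < e"
  proof (intro exI[of _ "e' / (2 * (real n + 1))"] conjI allI impI)
    show "e' / (2 * (real n + 1)) > 0" using e' by simp
    fix D :: "real set set" assume D: "D division_of \<Union>D \<and> \<Union>D \<subseteq> {a..b} \<and> (\<Sum>I\<in>D. Sup I - Inf I) < e' / (2 * (real n + 1))"
    then have dv: "D division_of \<Union>D" and sub: "\<Union>D \<subseteq> {a..b}" by auto
    have ivl: "I = {Inf I..Sup I}" "Inf I \<le> Sup I" "a \<le> Inf I" "Sup I \<le> b" if "I \<in> D" for I
      using division_Sup_Inf[OF dv that] sub that by (auto 0 3)
    have sub_ivl: "{Inf I..Sup I} \<subseteq> {a..b}" if "I \<in> D" for I
      using ivl(2-4)[OF that] by auto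
    have "(\<Sum>I\<in>D. norm (f (Sup I) - f (Inf I))) \<le> (\<Sum>I\<in>D. C * (integral I \<phi> + real n * (Sup I - Inf I)))"
    proof (rule sum_mono)
      fix I assume I: "I \<in> D"
      note i = ivl[OF I]
      have "integral {Inf I..Sup I} k = integral {Inf I..Sup I} (\<lambda>t. \<phi> t + kn n t)"
        by (simp add: \<phi>_def)
      also have "\<dots> = integral {Inf I..Sup I} \<phi> + integral {Inf I..Sup I} (kn n)"
        by (intro integral_add integrable_subinterval_real[OF \<phi>_int] integrable_subinterval_real[OF kn_int] sub_ivl I)
      also have "integral {Inf I..Sup I} (kn n) \<le> integral {Inf I..Sup I} (\<lambda>t. real n)"
        by (intro integral_le integrable_subinterval_real[OF kn_int] sub_ivl I) (auto simp: kn_def)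
      also have "integral {Inf I..Sup I} (\<lambda>t. real n) = real n * (Sup I - Inf I)"
        using i(2) by simp
      finally have "integral {Inf I..Sup I} k \<le> integral I \<phi> + real n * (Sup I - Inf I)"
        using i(1) by simp
      then show "norm (f (Sup I) - f (Inf I)) \<le> C * (integral I \<phi> + real n * (Sup I - Inf I))"
        using f[OF i(3,2,4)] C by (smt (verit) mult_left_mono)
    qed
    also have "\<dots> = C * ((\<Sum>I\<in>D. integral I \<phi>) + real n * (\<Sum>I\<in>D. Sup I - Inf I))"
      by (simp add: sum_distrib_left sum.distrib distrib_left)
    also have "(\<Sum>I\<in>D. integral I \<phi>) = integral (\<Union>D) \<phi>"
    proof (rule integral_combine_division_topdown[symmetric, OF _ dv])
      show "\<phi> integrable_on \<Union>D"
        by (rule integrable_on_subdivision[OF dv \<phi>_int sub])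
    qed
    also have "integral (\<Union>D) \<phi> \<le> integral {a..b} \<phi>"
      by (rule integral_subset_le[OF sub integrable_on_subdivision[OF dv \<phi>_int sub] \<phi>_int]) (use \<phi>_nn in auto)
    finally have "(\<Sum>I\<in>D. norm (f (Sup I) - f (Inf I))) \<le> C * (integral {a..b} \<phi> + real n * (\<Sum>I\<in>D. Sup I - Inf I))"
      using C by simp
    also have "real n * (\<Sum>I\<in>D. Sup I - Inf I) \<le> real n * (e' / (2 * (real n + 1)))"
      using D by (intro mult_left_mono) auto
    also have "\<dots> \<le> e' / 2" using e' by (simp add: field_simps)
    finally have "(\<Sum>I\<in>D. norm (f (Sup I) - f (Inf I))) \<le> C * (integral {a..b} \<phi> + e' / 2)" using C by simp
    also have "\<dots> < C * e'" using \<phi>_small C by simp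
    also have "\<dots> = e" using C by (simp add: e'_def)
    finally show "(\<Sum>I\<in>D. norm (f (Sup I) - f (Inf I))) < e" .
  qed
qed

text \<open>Absolute continuity on [0,1] in integrated form, with the density carried along. State
  equation, adjoint equation and Gronwall estimates are all stated in this form.\<close>

definition primitive :: "(real \<Rightarrow> 'a::euclidean_space) \<Rightarrow> (real \<Rightarrow> 'a) \<Rightarrow> bool" where
  "primitive f h \<longleftrightarrow> h absolutely_integrable_on {0..1} \<and> (\<forall>t\<in>{0..1}. f t = f 0 + integral {0..t} h)"

lemma abs_integrable_ivl:
  fixes h :: "real \<Rightarrow> 'a::euclidean_space"
  assumes "h absolutely_integrable_on {a..b}" "a \<le> c" "d \<le> (b::real)"
  shows "h absolutely_integrable_on {c..d}"
  by (rule set_integrable_subset[OF assms(1)]) (use assms in auto)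

lemma abs_integrable_imp_integrable: "h absolutely_integrable_on S \<Longrightarrow> h integrable_on S"
  for h :: "real \<Rightarrow> 'a::euclidean_space"
  by (rule set_lebesgue_integral_eq_integral(1))

lemma integral_diff_ivl:
  assumes "h integrable_on {a..b}" "a \<le> s" "s \<le> t" "t \<le> (b::real)"
  shows "integral {a..t} h - integral {a..s} h = integral {s..t} (h :: real \<Rightarrow> 'a::banach)"
  using Henstock_Kurzweil_Integration.integral_combine[OF assms(2,3) integrable_subinterval_real[OF assms(1)]] assms
  by (simp add: algebra_simps)

lemma primitive_eq:
  assumes "primitive f h" "t \<in> {0..1}" shows "f 0 + integral {0..t} h = f t"
  using assms unfolding primitive_def by metis

lemma primitive_diff:
  assumes "primitive f h" "0 \<le> s" "s \<le> t" "t \<le> 1"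
  shows "f t - f s = integral {s..t} h"
proof -
  have "h integrable_on {0..1}"
    using assms(1) abs_integrable_imp_integrable by (auto simp: primitive_def)
  moreover have "f 0 + integral {0..t} h = f t" "f 0 + integral {0..s} h = f s"
    by (rule primitive_eq[OF assms(1)]; use assms in simp)+
  ultimately show ?thesis using integral_diff_ivl[of h 0 1 s t] assms(2-4)
    by (metis add_diff_cancel_left)
qed

lemma primitive_has_integral:
  assumes "primitive f h" "0 \<le> s" "s \<le> t" "t \<le> 1"
  shows "(h has_integral f t - f s) {s..t}"
proof -
  have "h absolutely_integrable_on {0..1}" using assms(1) by (simp add: primitive_def)
  then have "h integrable_on {s..t}"
    using assms by (intro abs_integrable_imp_integrable[OF abs_integrable_ivl])
  then show ?thesis by (simp add: primitive_diff[OF assms] has_integral_integral)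
qed

lemma primitive_norm_le:
  assumes "primitive f h" "0 \<le> s" "s \<le> t" "t \<le> 1"
    and k: "k integrable_on {s..t}" "\<And>\<tau>. \<tau> \<in> {s..t} \<Longrightarrow> norm (h \<tau>) \<le> k \<tau>"
  shows "norm (f t - f s) \<le> integral {s..t} k"
  unfolding primitive_diff[OF assms(1-4)]
  by (rule integral_norm_bound_integral[OF has_integral_integrable[OF primitive_has_integral[OF assms(1-4)]] k])

lemma abs_integrable_norm:
  "h absolutely_integrable_on S \<Longrightarrow> (\<lambda>t. norm (h t)) absolutely_integrable_on S"
  for h :: "real \<Rightarrow> 'a::euclidean_space"
  by (rule absolutely_integrable_norm[unfolded o_def])

lemma primitive_continuous:
  assumes "primitive f h" shows "continuous_on {0..1} f"
proof -
  have "continuous_on {0..1} (\<lambda>t. f 0 + integral {0..t} h)"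
    using assms unfolding primitive_def
    by (intro continuous_on_add continuous_on_const indefinite_integral_continuous_1)
      (blast dest: abs_integrable_imp_integrable)
  then show ?thesis by (rule continuous_on_eq) (rule primitive_eq[OF assms])
qed

lemma primitive_deriv:
  assumes "primitive f h"
  obtains N where "negligible N" "\<And>t. t \<in> {0<..<1} - N \<Longrightarrow> (f has_vector_derivative h t) (at t)"
proof -
  have "h integrable_on {0..1}" using assms by (auto simp: primitive_def intro: abs_integrable_imp_integrable)
  then obtain N where N: "negligible N"
    "\<And>t. t \<in> {0<..<1} - N \<Longrightarrow> ((\<lambda>s. integral {0..s} h) has_vector_derivative h t) (at t)"
    by (rule lebesgue_differentiation_ivl) blast
  show ?thesis
  proof (rule that[OF N(1)])
    fix t assume t: "t \<in> {0<..<1} - N"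
    have "((\<lambda>s. f 0 + integral {0..s} h) has_vector_derivative h t) (at t)"
      using N(2)[OF t] by (auto intro!: derivative_eq_intros)
    then show "(f has_vector_derivative h t) (at t)"
      by (rule has_vector_derivative_transform_within_open[where S = "{0<..<1}"])
        (use t in \<open>auto intro: primitive_eq[OF assms]\<close>)
  qed
qed

lemma primitive_intro:
  fixes f :: "real \<Rightarrow> 'a::euclidean_space"
  assumes ac: "absolutely_continuous_on_ivl 0 1 f" and N: "negligible N"
    and deriv: "\<And>t. t \<in> {0<..<1} - N \<Longrightarrow> (f has_vector_derivative h t) (at t)"
    and h: "h absolutely_integrable_on {0..1}"
  shows "primitive f h"
  unfolding primitive_def
proof (intro conjI ballI h)
  fix t :: real assume t: "t \<in> {0..1}"
  have "(h has_integral f t - f 0) {0..t}"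
  proof (rule absolutely_continuous_FTC)
    show "absolutely_continuous_on_ivl 0 t f"
      by (rule absolutely_continuous_on_ivl_subset[OF ac]) (use t in auto)
    show "negligible (N \<union> {0, 1})" using N by auto
    show "(f has_vector_derivative h s) (at s within {0..t})" if "s \<in> {0..t} - (N \<union> {0, 1})" for s
      by (rule has_vector_derivative_at_within[OF deriv]) (use that t in auto)
  qed (use t in auto)
  then show "f t = f 0 + integral {0..t} h" by (simp add: integral_unique)
qed

lemma abs_integrable_continuous_mult:
  fixes B :: "'a::euclidean_space \<Rightarrow> 'b::euclidean_space \<Rightarrow> 'c::euclidean_space"
  assumes "bounded_bilinear B" "continuous_on {a..b::real} g" "h absolutely_integrable_on {a..b}"
  shows "(\<lambda>t. B (g t) (h t)) absolutely_integrable_on {a..b}"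
proof (rule absolutely_integrable_bounded_measurable_product[where h = B and f = g and g = h])
  show "bilinear B" using assms(1) bilinear_conv_bounded_bilinear by blast
  show "g \<in> borel_measurable (lebesgue_on {a..b})"
    using assms(2) by (intro continuous_imp_measurable_on_sets_lebesgue) auto
  show "bounded (g ` {a..b})" using assms(2) compact_continuous_image compact_imp_bounded by blast
qed (use assms in auto)

text \<open>The product has modulus of continuity governed by |f'| + |g'|, with the suprema of |f|
  and |g| as constants; hence it is absolutely continuous, and its derivative is known almost
  everywhere.\<close>

lemma primitive_inner:
  assumes f: "primitive f f'" and g: "primitive g g'"
  shows "primitive (\<lambda>t. f t \<bullet> g t) (\<lambda>t. f' t \<bullet> g t + f t \<bullet> g' t)"
proof -
  note cf = primitive_continuous[OF f] and cg = primitive_continuous[OF g]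
  have f': "f' absolutely_integrable_on {0..1}" and g': "g' absolutely_integrable_on {0..1}"
    using f g by (auto simp: primitive_def)
  obtain Bf where Bf: "\<And>t. t \<in> {0..1} \<Longrightarrow> norm (f t) \<le> Bf" "Bf > 0"
    using compact_imp_bounded[OF compact_continuous_image[OF cf compact_Icc]] unfolding bounded_pos by (metis imageI)
  obtain Bg where Bg: "\<And>t. t \<in> {0..1} \<Longrightarrow> norm (g t) \<le> Bg" "Bg > 0"
    using compact_imp_bounded[OF compact_continuous_image[OF cg compact_Icc]] unfolding bounded_pos by (metis imageI)
  define k where "k t = norm (f' t) + norm (g' t)" for t
  have k: "k absolutely_integrable_on {0..1}"
    unfolding k_def by (intro set_integral_add(1) abs_integrable_norm f' g')
  obtain Nf where Nf: "negligible Nf" "\<And>t. t \<in> {0<..<1} - Nf \<Longrightarrow> (f has_vector_derivative f' t) (at t)"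
    using primitive_deriv[OF f] by blast
  obtain Ng where Ng: "negligible Ng" "\<And>t. t \<in> {0<..<1} - Ng \<Longrightarrow> (g has_vector_derivative g' t) (at t)"
    using primitive_deriv[OF g] by blast
  show ?thesis
  proof (rule primitive_intro)
    show "absolutely_continuous_on_ivl 0 1 (\<lambda>t. f t \<bullet> g t)"
    proof (rule absolutely_continuous_modulus[OF k, where C = "Bf + Bg"])
      fix s t :: real assume st: "0 \<le> s" "s \<le> t" "t \<le> 1"
      have ki: "k integrable_on {s..t}"
        using abs_integrable_imp_integrable[OF abs_integrable_ivl[OF k]] st by auto
      have 1: "norm (f t - f s) \<le> integral {s..t} k" "norm (g t - g s) \<le> integral {s..t} k"
        by (rule primitive_norm_le[OF f st ki] primitive_norm_le[OF g st ki]; simp add: k_def)+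
      have "f t \<bullet> g t - f s \<bullet> g s = (f t - f s) \<bullet> g t + f s \<bullet> (g t - g s)"
        by (simp add: inner_diff_left inner_diff_right)
      then have "norm (f t \<bullet> g t - f s \<bullet> g s) \<le> norm (f t - f s) * norm (g t) + norm (f s) * norm (g t - g s)"
        using Cauchy_Schwarz_ineq2 by (smt (verit) real_norm_def)
      also have "\<dots> \<le> integral {s..t} k * Bg + Bf * integral {s..t} k"
        using 1 Bf Bg st order_trans[OF norm_ge_zero 1(1)] by (intro add_mono mult_mono) auto
      finally show "norm (f t \<bullet> g t - f s \<bullet> g s) \<le> (Bf + Bg) * integral {s..t} k" by (simp add: algebra_simps)
    qed (use Bf Bg in \<open>auto simp: k_def\<close>)
    show "negligible (Nf \<union> Ng)" using Nf Ng by auto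
    show "((\<lambda>t. f t \<bullet> g t) has_vector_derivative f' t \<bullet> g t + f t \<bullet> g' t) (at t)"
      if "t \<in> {0<..<1} - (Nf \<union> Ng)" for t
    proof -
      have "(f has_vector_derivative f' t) (at t)" "(g has_vector_derivative g' t) (at t)"
        using that Nf Ng by auto
      then have "((\<lambda>t. f t \<bullet> g t) has_vector_derivative f t \<bullet> g' t + f' t \<bullet> g t) (at t)"
        by (rule bounded_bilinear.has_vector_derivative[OF bounded_bilinear_inner])
      then show ?thesis by (simp add: add.commute)
    qed
    have "(\<lambda>t. g t \<bullet> f' t) absolutely_integrable_on {0..1}" "(\<lambda>t. f t \<bullet> g' t) absolutely_integrable_on {0..1}"
      by (intro abs_integrable_continuous_mult[OF bounded_bilinear_inner] cf cg f' g')+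
    from set_integral_add(1)[OF this]
    show "(\<lambda>t. f' t \<bullet> g t + f t \<bullet> g' t) absolutely_integrable_on {0..1}"
      by (simp add: inner_commute)
  qed
qed

section \<open>Gronwall inequality and Caratheodory differential equations\<close>

text \<open>The integrating factor for a merely integrable rate \<open>k\<close>. For c = 2 it says
  that the integral of k exp(2K) over [0,t] is at most half of exp(2K(t)), where K is the integral
  of k: the source of the factor 1/2 in the Gronwall and Picard arguments.\<close>

lemma primitive_exp:
  fixes k :: "real \<Rightarrow> real"
  assumes k: "k absolutely_integrable_on {0..1}" "\<And>t. t \<in> {0..1} \<Longrightarrow> 0 \<le> k t" and "c \<ge> 0"
  shows "primitive (\<lambda>t. exp (c * integral {0..t} k)) (\<lambda>t. c * k t * exp (c * integral {0..t} k))"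
proof -
  define K where "K t = integral {0..t} k" for t
  have K: "primitive K k" unfolding primitive_def K_def using k by simp
  note cK = primitive_continuous[OF K]
  have mono: "K s \<le> K t" if "0 \<le> s" "s \<le> t" "t \<le> 1" for s t
  proof -
    have "0 \<le> K t - K s" unfolding primitive_diff[OF K that]
      by (rule Henstock_Kurzweil_Integration.integral_nonneg) (use that k primitive_has_integral[OF K that] in auto)
    then show ?thesis by simp
  qed
  obtain N where N: "negligible N" "\<And>t. t \<in> {0<..<1} - N \<Longrightarrow> (K has_vector_derivative k t) (at t)"
    using primitive_deriv[OF K] by blast
  have "primitive (\<lambda>t. exp (c * K t)) (\<lambda>t. c * k t * exp (c * K t))"
  proof (rule primitive_intro[OF _ N(1)])
    show "absolutely_continuous_on_ivl 0 1 (\<lambda>t. exp (c * K t))"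
    proof (rule absolutely_continuous_modulus[OF k, where C = "(c + 1) * exp (c * K 1)"])
      fix s t :: real assume st: "0 \<le> s" "s \<le> t" "t \<le> 1"
      have "exp (c * K s) \<ge> exp (c * K t) * (1 - (c * K t - c * K s))"
        using exp_ge_add_one_self[of "c * K s - c * K t"]
        by (simp add: exp_diff field_simps)
      then have "exp (c * K t) - exp (c * K s) \<le> exp (c * K t) * (c * (K t - K s))" by (simp add: algebra_simps)
      also have "\<dots> \<le> exp (c * K 1) * ((c + 1) * (K t - K s))"
        using mono[OF st] mono[of t 1] st \<open>c \<ge> 0\<close> by (intro mult_mono) (auto intro: mult_left_mono)
      finally have "exp (c * K t) - exp (c * K s) \<le> (c + 1) * exp (c * K 1) * (K t - K s)" by (simp add: algebra_simps)
      moreover have "exp (c * K s) \<le> exp (c * K t)" using mono[OF st] \<open>c \<ge> 0\<close> by (simp add: mult_left_mono)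
      ultimately show "norm (exp (c * K t) - exp (c * K s)) \<le> (c + 1) * exp (c * K 1) * integral {s..t} k"
        unfolding primitive_diff[OF K st, symmetric] by simp
    qed (use \<open>c \<ge> 0\<close> in \<open>auto intro: mult_pos_pos\<close>)
    show "((\<lambda>t. exp (c * K t)) has_vector_derivative c * k t * exp (c * K t)) (at t)" if "t \<in> {0<..<1} - N" for t
      using N(2)[OF that] unfolding has_real_derivative_iff_has_vector_derivative[symmetric]
      by (auto intro!: derivative_eq_intros)
    have "(\<lambda>t. (c * exp (c * K t)) * k t) absolutely_integrable_on {0..1}"
      by (intro abs_integrable_continuous_mult[OF bounded_bilinear_mult] continuous_intros cK k)
    then show "(\<lambda>t. c * k t * exp (c * K t)) absolutely_integrable_on {0..1}" by (simp add: mult_ac)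
  qed
  then show ?thesis by (simp add: K_def)
qed

text \<open>The maximum \<open>M\<close> of y exp(-2K) satisfies M <= a + M/2 by the integrating
  factor, hence M <= 2a. The two factors 2 of the bound come from this argument and reappear in
  \<open>deviation_const\<close> and \<open>adj_bound\<close>.\<close>

lemma gronwall_integral:
  fixes y k :: "real \<Rightarrow> real"
  assumes k: "k absolutely_integrable_on {0..1}" "\<And>t. t \<in> {0..1} \<Longrightarrow> 0 \<le> k t"
    and y: "continuous_on {0..1} y" "\<And>t. t \<in> {0..1} \<Longrightarrow> 0 \<le> y t"
    and le: "\<And>t. t \<in> {0..1} \<Longrightarrow> y t \<le> a + integral {0..t} (\<lambda>s. k s * y s)"
    and t: "t \<in> {0..1}"
  shows "y t \<le> 2 * a * exp (2 * integral {0..1} k)"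
proof -
  define K where "K t = integral {0..t} k" for t
  have K: "primitive K k" unfolding primitive_def K_def using k by simp
  note cK = primitive_continuous[OF K]
  have E: "primitive (\<lambda>t. exp (2 * K t)) (\<lambda>t. 2 * k t * exp (2 * K t))"
    unfolding K_def using primitive_exp[OF k, of 2] by simp
  have K0: "K 0 = 0" by (simp add: K_def)
  have mono: "K s \<le> K t" if "0 \<le> s" "s \<le> t" "t \<le> 1" for s t
  proof -
    have "0 \<le> K t - K s" unfolding primitive_diff[OF K that]
      by (rule Henstock_Kurzweil_Integration.integral_nonneg) (use that k primitive_has_integral[OF K that] in auto)
    then show ?thesis by simp
  qed
  have "continuous_on {0..1} (\<lambda>t. y t * exp (- 2 * K t))" by (intro continuous_intros y cK)
  then obtain s where s: "s \<in> {0..1}" "\<And>t. t \<in> {0..1} \<Longrightarrow> y t * exp (- 2 * K t) \<le> y s * exp (- 2 * K s)"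
    using continuous_attains_sup[of "{0..1::real}"] by force
  define M where "M = y s * exp (- 2 * K s)"
  have M0: "M \<ge> 0" unfolding M_def using y s by auto
  have a0: "a \<ge> 0" using le[of 0] y(2)[of 0] by simp
  have yM: "y t \<le> M * exp (2 * K t)" if "t \<in> {0..1}" for t
    using s(2)[OF that] unfolding M_def[symmetric] by (simp add: exp_minus field_simps)
  have "y s \<le> a + integral {0..s} (\<lambda>s. k s * y s)" by (rule le[OF s(1)])
  also have "integral {0..s} (\<lambda>s. k s * y s) \<le> integral {0..s} (\<lambda>\<tau>. M / 2 * (2 * k \<tau> * exp (2 * K \<tau>)))"
  proof (rule integral_le)
    have "(\<lambda>t. y t * k t) absolutely_integrable_on {0..1}"
      by (intro abs_integrable_continuous_mult[OF bounded_bilinear_mult] y k)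
    then show "(\<lambda>s. k s * y s) integrable_on {0..s}"
      using s by (auto simp: mult.commute intro: abs_integrable_imp_integrable[OF abs_integrable_ivl])
    show "(\<lambda>\<tau>. M / 2 * (2 * k \<tau> * exp (2 * K \<tau>))) integrable_on {0..s}"
      using has_integral_mult_right[OF primitive_has_integral[OF E, of 0 s], of "M / 2"] s by auto
    show "k \<tau> * y \<tau> \<le> M / 2 * (2 * k \<tau> * exp (2 * K \<tau>))" if "\<tau> \<in> {0..s}" for \<tau>
    proof -
      have "\<tau> \<in> {0..1}" using that s by auto
      from mult_left_mono[OF yM[OF this] k(2)[OF this]] show ?thesis by (simp add: mult_ac)
    qed
  qed
  also have "\<dots> = M / 2 * (exp (2 * K s) - 1)"
  proof -
    have "integral {0..s} (\<lambda>\<tau>. 2 * k \<tau> * exp (2 * K \<tau>)) = exp (2 * K s) - 1"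
      using primitive_diff[OF E, of 0 s] s K0 by auto
    then show ?thesis
      by (subst integral_mult_right) presburger
  qed
  finally have "y s * exp (- 2 * K s) \<le> (a + M / 2 * (exp (2 * K s) - 1)) * exp (- 2 * K s)"
    by (simp add: mult_right_mono)
  also have "\<dots> = a * exp (- 2 * K s) + M / 2 * (exp (2 * K s) * exp (- 2 * K s)) - M / 2 * exp (- 2 * K s)"
    by (simp only: ring_distribs mult.assoc)
  also have "exp (2 * K s) * exp (- 2 * K s) = 1" by (simp flip: exp_add)
  also have "a * exp (- 2 * K s) + M / 2 * 1 - M / 2 * exp (- 2 * K s) \<le> a * 1 + M / 2"
  proof -
    have "exp (- 2 * K s) \<le> 1" using mono[of 0 s] s K0 by simp
    then have "a * exp (- 2 * K s) \<le> a * 1" using a0 by (rule mult_left_mono)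
    moreover have "M / 2 * exp (- 2 * K s) \<ge> 0" using M0 by simp
    ultimately show ?thesis by linarith
  qed
  finally have "M \<le> 2 * a" unfolding M_def by simp
  have "y t \<le> M * exp (2 * K t)" by (rule yM[OF t])
  also have "\<dots> \<le> 2 * a * exp (2 * K 1)"
    using \<open>M \<le> 2 * a\<close> a0 mono[of t 1] t by (intro mult_mono) auto
  finally show ?thesis by (simp add: K_def)
qed

text \<open>Picard iteration in the sup norm weighted by exp(-2K), in which the integral operator
  contracts by 1/2 on all of [0,1] at once, although the Lipschitz constant \<open>k\<close> is only
  integrable in time.\<close>

theorem caratheodory_existence:
  fixes F :: "real \<Rightarrow> 'a::euclidean_space \<Rightarrow> 'a" and k :: "real \<Rightarrow> real"
  assumes k: "k absolutely_integrable_on {0..1}" "\<And>t. t \<in> {0..1} \<Longrightarrow> 0 \<le> k t"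
    and lip: "\<And>t x y. t \<in> {0..1} \<Longrightarrow> norm (F t x - F t y) \<le> k t * norm (x - y)"
    and int: "\<And>z. continuous_on {0..1} z \<Longrightarrow> (\<lambda>t. F t (z t)) absolutely_integrable_on {0..1}"
  obtains z where "primitive z (\<lambda>t. F t (z t))" "z 0 = x0"
proof -
  define K where "K t = integral {0..t} k" for t
  have K: "primitive K k" unfolding primitive_def K_def using k by simp
  note cK = primitive_continuous[OF K]
  have E: "primitive (\<lambda>t. exp (2 * K t)) (\<lambda>t. 2 * k t * exp (2 * K t))"
    unfolding K_def using primitive_exp[OF k, of 2] by simp
  have K0: "K 0 = 0" by (simp add: K_def)
  \<comment> \<open>The complete space is that of bounded continuous functions on the whole line;
    the clamp \<open>c\<close> extends functions from [0,1] to it.\<close>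
  define c where "c t = max 0 (min 1 t)" for t :: real
  have c: "c t \<in> {0..1}" "continuous_on UNIV c" for t
    unfolding c_def by (auto intro!: continuous_intros)
  have c_id: "c t = t" if "t \<in> {0..1}" for t using that by (simp add: c_def)
  \<comment> \<open>The unknown of the fixed point problem is \<zeta> = exp(-2K) w, so that the
    weighted norm of \<open>w\<close> becomes the ordinary norm of \<zeta>.\<close>
  define w where "w \<zeta> t = exp (2 * K t) *\<^sub>R apply_bcontfun \<zeta> t" for \<zeta> :: "real \<Rightarrow>\<^sub>C 'a" and t
  define G where "G \<zeta> t = exp (- 2 * K t) *\<^sub>R (x0 + integral {0..t} (\<lambda>s. F s (w \<zeta> s)))" for \<zeta> :: "real \<Rightarrow>\<^sub>C 'a" and t
  have w_cont: "continuous_on {0..1} (w \<zeta>)" for \<zeta> :: "real \<Rightarrow>\<^sub>C 'a"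
    unfolding w_def by (intro continuous_intros cK continuous_on_apply_bcontfun)
  have F_int: "(\<lambda>s. F s (w \<zeta> s)) integrable_on {0..t}" if "t \<in> {0..1}" for \<zeta> :: "real \<Rightarrow>\<^sub>C 'a" and t
    by (rule abs_integrable_imp_integrable[OF abs_integrable_ivl[OF int[OF w_cont]]]) (use that in auto)
  have G_cont: "continuous_on {0..1} (G \<zeta>)" for \<zeta> :: "real \<Rightarrow>\<^sub>C 'a"
    unfolding G_def by (intro continuous_intros cK indefinite_integral_continuous_1 F_int) auto
  have GB: "(\<lambda>t. G \<zeta> (c t)) \<in> bcontfun" for \<zeta> :: "real \<Rightarrow>\<^sub>C 'a"
    unfolding bcontfun_def mem_Collect_eq
  proof
    show "continuous_on UNIV (\<lambda>t. G \<zeta> (c t))"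
      by (rule continuous_on_compose2[OF G_cont c(2)]) (use c in auto)
    have "bounded (G \<zeta> ` {0..1})"
      by (intro compact_imp_bounded compact_continuous_image G_cont) auto
    then show "bounded (range (\<lambda>t. G \<zeta> (c t)))"
      by (rule bounded_subset) (use c in auto)
  qed
  define T where "T \<zeta> = Bcontfun (\<lambda>t. G \<zeta> (c t))" for \<zeta> :: "real \<Rightarrow>\<^sub>C 'a"
  have T_app: "apply_bcontfun (T \<zeta>) t = G \<zeta> (c t)" for \<zeta> :: "real \<Rightarrow>\<^sub>C 'a" and t
    unfolding T_def using GB by (simp add: Bcontfun_inverse)
  have "\<exists>!\<zeta>. T \<zeta> = \<zeta>"
  proof (rule banach_fix_type[of "1/2"])
    show "\<forall>\<zeta> \<xi>. dist (T \<zeta>) (T \<xi>) \<le> 1 / 2 * dist \<zeta> \<xi>"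
    proof (intro allI dist_bound)
      fix \<zeta> \<xi> :: "real \<Rightarrow>\<^sub>C 'a" and t
      define \<tau> where "\<tau> = c t"
      have \<tau>: "\<tau> \<in> {0..1}" using c by (simp add: \<tau>_def)
      define D where "D = dist \<zeta> \<xi>"
      have "norm (integral {0..\<tau>} (\<lambda>s. F s (w \<zeta> s)) - integral {0..\<tau>} (\<lambda>s. F s (w \<xi> s))) =
          norm (integral {0..\<tau>} (\<lambda>s. F s (w \<zeta> s) - F s (w \<xi> s)))"
        using \<tau> by (simp add: integral_diff F_int)
      also have "\<dots> \<le> integral {0..\<tau>} (\<lambda>s. D / 2 * (2 * k s * exp (2 * K s)))"
      proof (rule integral_norm_bound_integral)
        show "(\<lambda>s. F s (w \<zeta> s) - F s (w \<xi> s)) integrable_on {0..\<tau>}"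
          using \<tau> by (intro integrable_diff F_int)
        show "(\<lambda>s. D / 2 * (2 * k s * exp (2 * K s))) integrable_on {0..\<tau>}"
          using has_integral_mult_right[OF primitive_has_integral[OF E, of 0 \<tau>], of "D / 2"] \<tau> by auto
        fix s assume s: "s \<in> {0..\<tau>}"
        then have s': "s \<in> {0..1}" using \<tau> by auto
        have "norm (F s (w \<zeta> s) - F s (w \<xi> s)) \<le> k s * norm (w \<zeta> s - w \<xi> s)" by (rule lip[OF s'])
        also have "norm (w \<zeta> s - w \<xi> s) = exp (2 * K s) * dist (apply_bcontfun \<zeta> s) (apply_bcontfun \<xi> s)"
          by (simp add: w_def dist_norm flip: scaleR_diff_right)
        also have "k s * \<dots> \<le> k s * (exp (2 * K s) * D)"
          unfolding D_def by (intro mult_left_mono dist_bounded k s') auto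
        finally show "norm (F s (w \<zeta> s) - F s (w \<xi> s)) \<le> D / 2 * (2 * k s * exp (2 * K s))"
          by (simp add: mult_ac)
      qed
      also have "\<dots> = D / 2 * integral {0..\<tau>} (\<lambda>s. 2 * k s * exp (2 * K s))"
        by (rule integral_mult_right)
      also have "integral {0..\<tau>} (\<lambda>s. 2 * k s * exp (2 * K s)) = exp (2 * K \<tau>) - 1"
        using primitive_diff[OF E, of 0 \<tau>] \<tau> K0 by auto
      also have "D / 2 * (exp (2 * K \<tau>) - 1) \<le> D / 2 * exp (2 * K \<tau>)"
        by (intro mult_left_mono) (auto simp: D_def)
      finally have *: "norm (integral {0..\<tau>} (\<lambda>s. F s (w \<zeta> s)) - integral {0..\<tau>} (\<lambda>s. F s (w \<xi> s))) \<le> D / 2 * exp (2 * K \<tau>)" .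
      have "dist (apply_bcontfun (T \<zeta>) t) (apply_bcontfun (T \<xi>) t) =
         exp (- 2 * K \<tau>) * norm (integral {0..\<tau>} (\<lambda>s. F s (w \<zeta> s)) - integral {0..\<tau>} (\<lambda>s. F s (w \<xi> s)))"
        unfolding T_app \<tau>_def[symmetric] G_def dist_norm by (simp flip: scaleR_diff_right)
      also have "\<dots> \<le> exp (- 2 * K \<tau>) * (D / 2 * exp (2 * K \<tau>))"
        by (intro mult_left_mono *) auto
      also have "\<dots> = (exp (- 2 * K \<tau>) * exp (2 * K \<tau>)) * (D / 2)" by (simp only: mult_ac)
      also have "exp (- 2 * K \<tau>) * exp (2 * K \<tau>) = 1" by (simp flip: exp_add)
      finally show "dist (apply_bcontfun (T \<zeta>) t) (apply_bcontfun (T \<xi>) t) \<le> 1 / 2 * dist \<zeta> \<xi>"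
        by (simp add: D_def)
    qed
  qed auto
  then obtain \<zeta> where \<zeta>: "T \<zeta> = \<zeta>" by blast
  have w_eq: "w \<zeta> t = x0 + integral {0..t} (\<lambda>s. F s (w \<zeta> s))" if "t \<in> {0..1}" for t
  proof -
    have "apply_bcontfun \<zeta> t = G \<zeta> t" using T_app[of \<zeta> t] c_id[OF that] \<zeta> by simp
    then have "w \<zeta> t = (exp (2 * K t) * exp (- 2 * K t)) *\<^sub>R (x0 + integral {0..t} (\<lambda>s. F s (w \<zeta> s)))"
      by (simp add: w_def[of \<zeta> t] G_def)
    also have "exp (2 * K t) * exp (- 2 * K t) = 1" by (simp flip: exp_add)
    finally show ?thesis by simp
  qed
  show ?thesis
  proof (rule that)
    show w0: "w \<zeta> 0 = x0" using w_eq[of 0] by simp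
    show "primitive (w \<zeta>) (\<lambda>t. F t (w \<zeta> t))"
      unfolding primitive_def w0 by (intro conjI ballI int w_cont w_eq)
  qed
qed

lemma abs_integrable_reflect:
  fixes h :: "real \<Rightarrow> 'a::euclidean_space"
  assumes "h absolutely_integrable_on {0..1}"
  shows "(\<lambda>t. h (1 - t)) absolutely_integrable_on {0..1}"
    and "t \<in> {0..1} \<Longrightarrow> integral {0..t} (\<lambda>s. h (1 - s)) = integral {1 - t..1} h"
proof -
  have refl: "((\<lambda>t. f (1 - t)) has_integral i) {1 - b..1 - a}"
    if "(f has_integral i) {a..b}" "a \<le> b" for f :: "real \<Rightarrow> 'b::euclidean_space" and i a b
  proof -
    have "(\<lambda>x. 1 - x) ` {a..b} = {1 - b..1 - a}"
      by (auto simp: image_iff intro!: bexI[of _ "1 - _"])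
    then show ?thesis
      using has_integral_affinity[of f i a b "-1" 1] that by (simp add: algebra_simps)
  qed
  have "(\<lambda>t. h (1 - t)) integrable_on {0..1}"
    using refl[of h _ 0 1] abs_integrable_imp_integrable[OF assms] by (auto simp: integrable_on_def)
  moreover have "(\<lambda>t. norm (h (1 - t))) integrable_on {0..1}"
    using refl[of "\<lambda>t. norm (h t)" _ 0 1] abs_integrable_imp_integrable[OF abs_integrable_norm[OF assms]]
    by (auto simp: integrable_on_def)
  ultimately show "(\<lambda>t. h (1 - t)) absolutely_integrable_on {0..1}" by (rule absolutely_integrable_onI)
  assume t: "t \<in> {0..1}"
  then have "(h has_integral integral {1 - t..1} h) {1 - t..1}"
    using abs_integrable_imp_integrable[OF abs_integrable_ivl[OF assms, of "1 - t" 1]] by auto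
  from refl[OF this] t show "integral {0..t} (\<lambda>s. h (1 - s)) = integral {1 - t..1} h"
    by (auto intro: integral_unique)
qed

lemma abs_integrable_minus:
  "h absolutely_integrable_on S \<Longrightarrow> (\<lambda>t. - h t) absolutely_integrable_on S"
  for h :: "real \<Rightarrow> 'a::euclidean_space"
  by (rule absolutely_integrable_linear[OF _ bounded_linear_minus[OF bounded_linear_ident], unfolded o_def])

lemma primitive_reflect:
  assumes "primitive f h"
  shows "primitive (\<lambda>t. f (1 - t)) (\<lambda>t. - h (1 - t))"
proof -
  have h: "h absolutely_integrable_on {0..1}" using assms by (simp add: primitive_def)
  show ?thesis unfolding primitive_def
  proof (intro conjI ballI)
    show "(\<lambda>t. - h (1 - t)) absolutely_integrable_on {0..1}"
      by (rule abs_integrable_minus[OF abs_integrable_reflect(1)[OF h]])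
    fix t :: real assume t: "t \<in> {0..1}"
    have "f 1 - f (1 - t) = integral {1 - t..1} h" by (rule primitive_diff[OF assms]) (use t in auto)
    then show "f (1 - t) = f (1 - 0) + integral {0..t} (\<lambda>t. - h (1 - t))"
      using abs_integrable_reflect(2)[OF h t] by (simp add: integral_neg algebra_simps)
  qed
qed

text \<open>Time reversal of the forward theorem. It serves the adjoint equation, whose value is
  prescribed at time 1.\<close>

corollary caratheodory_existence_backward:
  fixes F :: "real \<Rightarrow> 'a::euclidean_space \<Rightarrow> 'a" and k :: "real \<Rightarrow> real"
  assumes k: "k absolutely_integrable_on {0..1}" "\<And>t. t \<in> {0..1} \<Longrightarrow> 0 \<le> k t"
    and lip: "\<And>t x y. t \<in> {0..1} \<Longrightarrow> norm (F t x - F t y) \<le> k t * norm (x - y)"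
    and int: "\<And>z. continuous_on {0..1} z \<Longrightarrow> (\<lambda>t. F t (z t)) absolutely_integrable_on {0..1}"
  obtains z where "primitive z (\<lambda>t. F t (z t))" "z 1 = x1"
proof -
  obtain z where z: "primitive z (\<lambda>t. - F (1 - t) (z t))" "z 0 = x1"
  proof (rule caratheodory_existence[where F = "\<lambda>t x. - F (1 - t) x" and k = "\<lambda>t. k (1 - t)"])
    show "(\<lambda>t. k (1 - t)) absolutely_integrable_on {0..1}" by (rule abs_integrable_reflect(1)[OF k(1)])
    show "0 \<le> k (1 - t)" if "t \<in> {0..1}" for t using k(2)[of "1 - t"] that by simp
    show "norm (- F (1 - t) x - - F (1 - t) y) \<le> k (1 - t) * norm (x - y)" if "t \<in> {0..1}" for t x y
      using lip[of "1 - t" y x] that by (simp add: norm_minus_commute)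
    fix z :: "real \<Rightarrow> 'a" assume z: "continuous_on {0..1} z"
    have "continuous_on {0..1} (\<lambda>t. z (1 - t))"
      by (intro continuous_on_compose2[OF z] continuous_intros) auto
    from abs_integrable_minus[OF abs_integrable_reflect(1)[OF int[OF this]]]
    show "(\<lambda>t. - F (1 - t) (z t)) absolutely_integrable_on {0..1}" by simp
  qed
  from primitive_reflect[OF z(1)] z(2) show ?thesis
    by (intro that[of "\<lambda>t. z (1 - t)"]) auto
qed

section \<open>Lipschitz curves as integrals of their derivatives\<close>

text \<open>With Lipschitz constant 1/2 both G = f + t/2 and H = t/2 - f are nondecreasing, and G +
  H = t, so their Stieltjes measures add up to Lebesgue measure. The measure of G is therefore
  absolutely continuous, and its Radon-Nikodym density minus 1/2 is the derivative of f.\<close>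

lemma lipschitz_half_primitive:
  fixes f :: "real \<Rightarrow> real"
  assumes lip: "\<And>s t. \<lbrakk>s \<in> {0..1}; t \<in> {0..1}\<rbrakk> \<Longrightarrow> \<bar>f t - f s\<bar> \<le> 1 / 2 * \<bar>t - s\<bar>"
  obtains h where "primitive f h"
proof -
  define c where "c t = max 0 (min 1 t)" for t :: real
  have c: "c t \<in> {0..1}" "\<bar>c t - c s\<bar> \<le> \<bar>t - s\<bar>" for t s
    unfolding c_def by auto
  have flip: "\<bar>f (c t) - f (c s)\<bar> \<le> 1 / 2 * \<bar>t - s\<bar>" for s t
    using lip[OF c(1)[of s] c(1)[of t]] c(2)[of t s] by simp
  have fc_cont: "continuous_on UNIV (\<lambda>t. f (c t))"
  proof (rule lipschitz_on_continuous_on[where L = "1/2"], rule lipschitz_onI)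
    show "dist (f (c x)) (f (c y)) \<le> 1 / 2 * dist x y" for x y
      using flip[of y x] flip[of x y] unfolding dist_real_def by simp
  qed simp
  define G H where "G t = f (c t) + t / 2" and "H t = t / 2 - f (c t)" for t
  have mono: "G s \<le> G t" "H s \<le> H t" if "s \<le> t" for s t
    using flip[of s t] flip[of t s] that by (auto simp: G_def H_def abs_if split: if_splits)
  have cont: "continuous_on UNIV G" "continuous_on UNIV H"
    unfolding G_def H_def by (auto intro!: continuous_intros fc_cont)
  have Ioo: "emeasure (interval_measure \<phi>) {l<..<u} = ennreal (\<phi> u - \<phi> l)"
    if "l \<le> u" "\<And>s t. s \<le> t \<Longrightarrow> \<phi> s \<le> \<phi> t" "continuous_on UNIV \<phi>" for \<phi> :: "real \<Rightarrow> real" and l u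
  proof -
    have sing: "{x} \<in> null_sets (interval_measure \<phi>)" for x
      using emeasure_interval_measure_Icc[of x x \<phi>] that by (auto intro!: null_setsI)
    have "{l<..<u} = {l..u} - ({l} \<union> {u})" by auto
    also have "emeasure (interval_measure \<phi>) \<dots> = emeasure (interval_measure \<phi>) {l..u}"
      by (rule emeasure_Diff_null_set[OF null_sets.Un[OF sing sing]]) auto
    finally show ?thesis using emeasure_interval_measure_Icc[of l u \<phi>] that by simp
  qed
  define \<mu> where "\<mu> A = emeasure (interval_measure G) A + emeasure (interval_measure H) A" for A
  define M where "M = measure_of UNIV (sets borel) \<mu>"
  have sets_M: "sets M = sets borel" unfolding M_def by (simp add: sets.sigma_sets_eq[of borel, simplified])
  have em: "emeasure M A = \<mu> A" if "A \<in> sets borel" for A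
  proof (rule emeasure_measure_of[OF M_def])
    show "positive (sets M) \<mu>" by (simp add: positive_def \<mu>_def)
    show "countably_additive (sets M) \<mu>"
    proof (rule countably_additiveI)
      fix B :: "nat \<Rightarrow> real set"
      assume B: "range B \<subseteq> sets M" "disjoint_family B" "\<Union>(range B) \<in> sets M"
      have "(\<Sum>i. \<mu> (B i)) = (\<Sum>i. emeasure (interval_measure G) (B i)) + (\<Sum>i. emeasure (interval_measure H) (B i))"
        unfolding \<mu>_def by (rule suminf_add[symmetric]) auto
      also have "\<dots> = \<mu> (\<Union>(range B))"
        unfolding \<mu>_def using B sets_M by (simp add: suminf_emeasure)
      finally show "(\<Sum>i. \<mu> (B i)) = \<mu> (\<Union>(range B))" .
    qed
  qed (use that sets_M in auto)
  have "lborel = M"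
  proof (rule lborel_eqI[OF _ sets_M])
    fix l u :: real assume "\<And>b. b \<in> Basis \<Longrightarrow> l \<bullet> b \<le> u \<bullet> b"
    then have lu: "l \<le> u" by simp
    have "emeasure M {l<..<u} = ennreal (G u - G l) + ennreal (H u - H l)"
      using Ioo[OF lu mono(1) cont(1)] Ioo[OF lu mono(2) cont(2)] by (simp add: em \<mu>_def)
    also have "\<dots> = ennreal (u - l)"
      using mono[OF lu] by (subst ennreal_plus[symmetric]) (auto simp: G_def H_def)
    finally show "emeasure M (box l u) = ennreal (\<Prod>b\<in>Basis. (u - l) \<bullet> b)" by simp
  qed
  have "absolutely_continuous lborel (interval_measure G)"
    unfolding absolutely_continuous_def
  proof
    fix N assume N: "N \<in> null_sets (lborel :: real measure)"
    then have "emeasure M N = 0" "N \<in> sets borel" using \<open>lborel = M\<close> by auto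
    then show "N \<in> null_sets (interval_measure G)" by (auto intro!: null_setsI simp: em \<mu>_def)
  qed
  then obtain \<phi> where \<phi>: "\<phi> \<in> borel_measurable lborel" "density lborel \<phi> = interval_measure G"
    using sigma_finite_measure.Radon_Nikodym[OF sigma_finite_lborel, of "interval_measure G"] by auto
  define h where "h x = enn2real (\<phi> x)" for x
  have \<phi>_int: "(\<integral>\<^sup>+x. \<phi> x * indicator {s..t} x \<partial>lborel) = ennreal (G t - G s)" if "s \<le> t" for s t
  proof -
    have "emeasure (density lborel \<phi>) {s..t} = (\<integral>\<^sup>+x. \<phi> x * indicator {s..t} x \<partial>lborel)"
      by (rule emeasure_density) (use \<phi> in auto)
    then show ?thesis
      using emeasure_interval_measure_Icc[of s t G] that mono(1) cont(1) \<phi>(2) by simp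
  qed
  have h_int: "(h has_integral G t - G s) {s..t}" if "s \<le> t" for s t
  proof -
    have "AE x in lborel. \<phi> x * indicator {s..t} x \<noteq> \<infinity>"
      by (rule nn_integral_PInf_AE) (use \<phi> \<phi>_int[OF that] in auto)
    then have "(\<integral>\<^sup>+x. ennreal (h x * indicator {s..t} x) \<partial>lborel) = (\<integral>\<^sup>+x. \<phi> x * indicator {s..t} x \<partial>lborel)"
      by (intro nn_integral_cong_AE) (auto elim!: eventually_mono simp: h_def indicator_def top.not_eq_extremum)
    then have "((\<lambda>x. h x * indicator {s..t} x) has_integral G t - G s) UNIV"
      using \<phi>_int[OF that] mono(1)[OF that] \<phi>(1)
      by (intro nn_integral_has_integral) (auto simp: h_def indicator_def)
    moreover have "(\<lambda>x. h x * indicator {s..t} x) = (\<lambda>x. if x \<in> {s..t} then h x else 0)" by auto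
    ultimately show ?thesis by (simp only: has_integral_restrict_UNIV)
  qed
  show ?thesis
  proof (rule that)
    have "h absolutely_integrable_on {0..1}"
      using h_int[of 0 1] by (intro nonnegative_absolutely_integrable_1) (auto simp: h_def)
    then have *: "(\<lambda>t. h t - 1 / 2) absolutely_integrable_on {0..1}"
      by (intro set_integral_diff(1)) auto
    show "primitive f (\<lambda>t. h t - 1 / 2)"
      unfolding primitive_def
    proof (intro conjI ballI *)
      fix t :: real assume t: "t \<in> {0..1}"
      have "((\<lambda>t. h t - 1 / 2) has_integral (G t - G 0) - (1/2) * t) {0..t}"
        using has_integral_diff[OF h_int[of 0 t] has_integral_const_real[of "1/2" 0 t]] t by (simp add: mult.commute)
      moreover have "c t = t" "c 0 = 0" using t by (auto simp: c_def)
      ultimately show "f t = f 0 + integral {0..t} (\<lambda>t. h t - 1 / 2)"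
        by (simp add: integral_unique G_def)
    qed
  qed
qed

text \<open>Division by M = 2(|L| + 1) makes each coordinate 1/2-Lipschitz, which is the
  normalization of the scalar case.\<close>

theorem lipschitz_primitive:
  fixes f :: "real \<Rightarrow> 'a::euclidean_space"
  assumes lip: "\<And>s t. \<lbrakk>s \<in> {0..1}; t \<in> {0..1}\<rbrakk> \<Longrightarrow> norm (f t - f s) \<le> L * \<bar>t - s\<bar>"
  obtains h where "primitive f h"
proof -
  define M where "M = 2 * (\<bar>L\<bar> + 1)"
  have M: "M > 0" by (simp add: M_def)
  have "\<exists>h. primitive (\<lambda>t. (f t \<bullet> b) / M) h" if b: "b \<in> Basis" for b
  proof -
    have "\<bar>(f t \<bullet> b) / M - (f s \<bullet> b) / M\<bar> \<le> 1 / 2 * \<bar>t - s\<bar>" if "s \<in> {0..1}" "t \<in> {0..1}" for s t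
    proof -
      have "\<bar>f t \<bullet> b - f s \<bullet> b\<bar> \<le> norm (f t - f s)"
        using Basis_le_norm[OF b, of "f t - f s"] by (simp add: inner_diff_left)
      also have "\<dots> \<le> L * \<bar>t - s\<bar>" by (rule lip[OF that])
      also have "\<dots> \<le> M / 2 * \<bar>t - s\<bar>" by (intro mult_right_mono) (auto simp: M_def)
      finally show ?thesis using M by (simp add: field_simps flip: diff_divide_distrib)
    qed
    from lipschitz_half_primitive[OF this] show ?thesis by blast
  qed
  then obtain h where h: "\<And>b. b \<in> Basis \<Longrightarrow> primitive (\<lambda>t. (f t \<bullet> b) / M) (h b)" by metis
  define g where "g t = (\<Sum>b\<in>Basis. (M * h b t) *\<^sub>R b)" for t
  have hi: "h b absolutely_integrable_on {0..1}" if "b \<in> Basis" for b using h[OF that] by (simp add: primitive_def)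
  have abs: "g absolutely_integrable_on {0..1}"
    unfolding g_def
  proof (intro absolutely_integrable_sum finite_Basis)
    fix b :: 'a assume b: "b \<in> Basis"
    have "(\<lambda>t. h b t *\<^sub>R (M *\<^sub>R b)) absolutely_integrable_on {0..1}"
      by (rule absolutely_integrable_linear[OF hi[OF b] bounded_linear_scaleR_left, unfolded o_def])
    then show "(\<lambda>t. (M * h b t) *\<^sub>R b) absolutely_integrable_on {0..1}" by (simp add: mult.commute)
  qed
  show ?thesis
  proof (rule that[of g], unfold primitive_def, intro conjI ballI abs)
    fix t :: real assume t: "t \<in> {0..1}"
    have gi: "g integrable_on {0..t}"
      by (rule abs_integrable_imp_integrable[OF abs_integrable_ivl[OF abs]]) (use t in auto)
    show "f t = f 0 + integral {0..t} g"
    proof (rule euclidean_eqI)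
      fix b :: 'a assume b: "b \<in> Basis"
      have "integral {0..t} g \<bullet> b = integral {0..t} (\<lambda>s. g s \<bullet> b)"
        using integral_linear[OF gi bounded_linear_inner_left, of b] by (simp add: o_def)
      also have "(\<lambda>s. g s \<bullet> b) = (\<lambda>s. M * h b s)"
        using b by (auto simp: g_def inner_sum_left inner_Basis if_distrib sum.delta cong: if_cong)
      also have "integral {0..t} (\<lambda>s. M * h b s) = M * integral {0..t} (h b)" by (rule integral_mult_right)
      also have "integral {0..t} (h b) = (f t \<bullet> b) / M - (f 0 \<bullet> b) / M"
        using primitive_diff[OF h[OF b], of 0 t] t by simp
      also have "M * (f t \<bullet> b / M - f 0 \<bullet> b / M) = f t \<bullet> b - f 0 \<bullet> b"
        using M by (simp add: right_diff_distrib)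
      finally show "f t \<bullet> b = (f 0 + integral {0..t} g) \<bullet> b"
        by (simp add: inner_add_left)
    qed
  qed
qed

section \<open>Control systems\<close>

text \<open>Unlike \<open>is_traj\<close>, which asks for an integrable control, \<open>ctraj\<close> is preserved by pointwise limits.\<close>

definition ctraj ::
  "('z::euclidean_space \<Rightarrow> 'u::euclidean_space \<Rightarrow> 'z) \<Rightarrow> real \<Rightarrow> real \<Rightarrow> (real \<Rightarrow> 'z) \<Rightarrow> bool" where
  "ctraj Y r C z \<longleftrightarrow> (\<forall>s t. 0 \<le> s \<and> s \<le> t \<and> t \<le> 1 \<longrightarrow>
     (\<exists>u. norm u \<le> r \<and> norm (z t - z s - (t - s) *\<^sub>R Y (z s) u) \<le> C * (t - s)\<^sup>2))"

definition is_traj ::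
  "('z::euclidean_space \<Rightarrow> 'u::euclidean_space \<Rightarrow> 'z) \<Rightarrow> 'z set \<Rightarrow> (real \<Rightarrow> 'u) \<Rightarrow> (real \<Rightarrow> 'z) \<Rightarrow> bool" where
  "is_traj Y S u z \<longleftrightarrow> u absolutely_integrable_on {0..1} \<and> (\<forall>t\<in>{0..1}. z t \<in> S) \<and>
     primitive z (\<lambda>t. Y (z t) (u t))"

lemma linear_basis_sum:
  fixes u :: "'a::euclidean_space"
  assumes "linear f" shows "f u = (\<Sum>c\<in>Basis. (u \<bullet> c) *\<^sub>R f c)"
proof -
  have "f u = f (\<Sum>c\<in>Basis. (u \<bullet> c) *\<^sub>R c)" by (simp add: euclidean_representation)
  also have "\<dots> = (\<Sum>c\<in>Basis. (u \<bullet> c) *\<^sub>R f c)" using assms by (simp add: linear_sum linear_cmul o_def)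
  finally show ?thesis .
qed

lemma tendsto_linear_family:
  fixes Y :: "'z::metric_space \<Rightarrow> 'u::euclidean_space \<Rightarrow> 'w::real_normed_vector"
  assumes lin: "\<And>x. linear (Y x)" and cont: "\<And>c. continuous_on S (\<lambda>x. Y x c)"
    and x: "x \<longlonglongrightarrow> l" "\<And>n. x n \<in> S" "l \<in> S" and u: "u \<longlonglongrightarrow> v"
  shows "(\<lambda>n. Y (x n) (u n)) \<longlonglongrightarrow> Y l v"
proof -
  have "(\<lambda>n. Y (x n) c) \<longlonglongrightarrow> Y l c" for c
    using cont[of c] x unfolding continuous_on_sequentially by (auto simp: o_def)
  then have "(\<lambda>n. \<Sum>c\<in>Basis. (u n \<bullet> c) *\<^sub>R Y (x n) c) \<longlonglongrightarrow> (\<Sum>c\<in>Basis. (v \<bullet> c) *\<^sub>R Y l c)"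
    by (intro tendsto_intros u)
  then show ?thesis by (simp flip: linear_basis_sum[OF lin])
qed

lemma abs_integrable_linear_family:
  fixes Y :: "'z::topological_space \<Rightarrow> 'u::euclidean_space \<Rightarrow> 'w::euclidean_space"
  assumes lin: "\<And>x. linear (Y x)" and cont: "\<And>c. continuous_on S (\<lambda>x. Y x c)"
    and x: "continuous_on {a..b::real} x" "\<And>t. t \<in> {a..b} \<Longrightarrow> x t \<in> S" and u: "u absolutely_integrable_on {a..b}"
  shows "(\<lambda>t. Y (x t) (u t)) absolutely_integrable_on {a..b}"
proof -
  have "(\<lambda>t. \<Sum>c\<in>Basis. (u t \<bullet> c) *\<^sub>R Y (x t) c) absolutely_integrable_on {a..b}"
  proof (intro absolutely_integrable_sum finite_Basis)
    fix c :: 'u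
    have uc: "(\<lambda>t. u t \<bullet> c) absolutely_integrable_on {a..b}"
      by (rule absolutely_integrable_linear[OF u bounded_linear_inner_left, unfolded o_def])
    have "continuous_on {a..b} (\<lambda>t. Y (x t) c)"
      by (rule continuous_on_compose2[OF cont x(1)]) (use x in auto)
    from abs_integrable_continuous_mult[OF bounded_bilinear.flip[OF bounded_bilinear_scaleR] this uc]
    show "(\<lambda>t. (u t \<bullet> c) *\<^sub>R Y (x t) c) absolutely_integrable_on {a..b}" .
  qed
  then show ?thesis by (simp flip: linear_basis_sum[OF lin])
qed

text \<open>For fixed \<open>s\<close> and \<open>t\<close> the witnessing controls are single
  vectors in a compact ball, and a limit point of them is a witness for the limit curve. No
  convergence of controls as functions of time is involved.\<close>

lemma ctraj_limit:
  assumes lin: "\<And>x. linear (Y x)" and cont: "\<And>c. continuous_on S (\<lambda>x. Y x c)"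
    and z: "\<And>n. ctraj Y r C (zn n)" "\<And>n t. t \<in> {0..1} \<Longrightarrow> zn n t \<in> S" "\<And>t. t \<in> {0..1} \<Longrightarrow> (\<lambda>n. zn n t) \<longlonglongrightarrow> z t"
    and S: "closed S"
  shows "ctraj Y r C z"
  unfolding ctraj_def
proof (intro allI impI)
  fix s t :: real assume st: "0 \<le> s \<and> s \<le> t \<and> t \<le> 1"
  then have st': "s \<in> {0..1}" "t \<in> {0..1}" by auto
  have "\<exists>u. norm u \<le> r \<and> norm (zn n t - zn n s - (t - s) *\<^sub>R Y (zn n s) u) \<le> C * (t - s)\<^sup>2" for n
    using z(1)[of n] st unfolding ctraj_def by blast
  then obtain u where u: "\<And>n. norm (u n) \<le> r" "\<And>n. norm (zn n t - zn n s - (t - s) *\<^sub>R Y (zn n s) (u n)) \<le> C * (t - s)\<^sup>2"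
    by metis
  have "seq_compact (cball 0 r :: 'b set)" by (simp add: compact_imp_seq_compact)
  then obtain l k where l: "norm l \<le> r" "strict_mono (k :: nat \<Rightarrow> nat)" "(u \<circ> k) \<longlonglongrightarrow> l"
    using u(1) unfolding seq_compact_def by (metis mem_cball_0)
  have lim: "(\<lambda>n. zn (k n) \<tau>) \<longlonglongrightarrow> z \<tau>" if "\<tau> \<in> {0..1}" for \<tau>
    using LIMSEQ_subseq_LIMSEQ[OF z(3)[OF that] l(2)] by (simp add: o_def)
  have "z s \<in> S" using closed_sequentially[OF S _ z(3)[OF st'(1)]] z(2)[OF st'(1)] by blast
  then have "(\<lambda>n. Y (zn (k n) s) (u (k n))) \<longlonglongrightarrow> Y (z s) l"
    using l(3) by (intro tendsto_linear_family[OF lin cont lim] z(2) st') (auto simp: o_def)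
  then have "(\<lambda>n. norm (zn (k n) t - zn (k n) s - (t - s) *\<^sub>R Y (zn (k n) s) (u (k n)))) \<longlonglongrightarrow>
      norm (z t - z s - (t - s) *\<^sub>R Y (z s) l)"
    by (intro tendsto_intros lim st')
  then have "norm (z t - z s - (t - s) *\<^sub>R Y (z s) l) \<le> C * (t - s)\<^sup>2"
    by (rule LIMSEQ_le_const2) (use u(2) in blast)
  with l(1) show "\<exists>u. norm u \<le> r \<and> norm (z t - z s - (t - s) *\<^sub>R Y (z s) u) \<le> C * (t - s)\<^sup>2" by blast
qed

lemma ctraj_lipschitz:
  assumes z: "ctraj Y r C z" and bnd: "\<And>t u. t \<in> {0..1} \<Longrightarrow> norm (Y (z t) u) \<le> M * norm u" and "0 \<le> M" "0 \<le> C" "0 \<le> r"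
    and st: "s \<in> {0..1}" "t \<in> {0..1}"
  shows "norm (z t - z s) \<le> (M * r + C) * \<bar>t - s\<bar>"
proof -
  have *: "norm (z t - z s) \<le> (M * r + C) * (t - s)" if st: "0 \<le> s" "s \<le> t" "t \<le> 1" for s t
  proof -
    obtain u where u: "norm u \<le> r" "norm (z t - z s - (t - s) *\<^sub>R Y (z s) u) \<le> C * (t - s)\<^sup>2"
      using z st unfolding ctraj_def by blast
    have "norm (z t - z s) \<le> norm (z t - z s - (t - s) *\<^sub>R Y (z s) u) + norm ((t - s) *\<^sub>R Y (z s) u)"
      by (metis diff_add_cancel norm_triangle_ineq)
    also have "norm ((t - s) *\<^sub>R Y (z s) u) \<le> (t - s) * (M * r)"
    proof -
      have "norm (Y (z s) u) \<le> M * norm u" by (rule bnd) (use st in auto)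
      also have "\<dots> \<le> M * r" using u assms by (intro mult_left_mono) auto
      finally show ?thesis using st by (simp add: mult_left_mono)
    qed
    finally have "norm (z t - z s) \<le> norm (z t - z s - (t - s) *\<^sub>R Y (z s) u) + (t - s) * (M * r)" by simp
    moreover have "C * (t - s)\<^sup>2 \<le> C * (t - s)"
      using st \<open>0 \<le> C\<close> mult_left_le[of "t - s" "t - s"] by (intro mult_left_mono) (auto simp: power2_eq_square)
    ultimately show ?thesis using u(2) by (simp add: algebra_simps)
  qed
  show ?thesis
  proof (cases "s \<le> t")
    case True then show ?thesis using *[of s t] st by auto
  next
    case False then show ?thesis using *[of t s] st by (auto simp: norm_minus_commute)
  qed
qed

text \<open>The difference quotients over [t, t + h n] differ from \<open>Y (z t) (u n)\<close> by
  O(h n), and the image of the control ball under a linear map is compact, so the limit is again the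
  velocity of an admissible control.\<close>

lemma ctraj_deriv:
  assumes lin: "\<And>x. linear (Y x)" and z: "ctraj Y r C z"
    and t: "t \<in> {0<..<1}" "(z has_vector_derivative d) (at t)"
  shows "\<exists>u. norm u \<le> r \<and> d = Y (z t) u"
proof -
  define h where "h n = (1 - t) / real (n + 1)" for n
  have h: "h n > 0" "t + h n \<le> 1" "h n \<noteq> 0" for n
    using t(1) mult_left_mono[of 1 "real (n + 1)" "1 - t"] by (auto simp: h_def field_simps)
  have h0: "h \<longlonglongrightarrow> 0" unfolding h_def
    using tendsto_mult_right_zero[OF LIMSEQ_inverse_real_of_nat, of "1 - t"] by (simp add: divide_inverse add.commute)
  have "\<exists>u. norm u \<le> r \<and> norm (z (t + h n) - z t - h n *\<^sub>R Y (z t) u) \<le> C * (h n)\<^sup>2" for n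
    using z t(1) h[of n] unfolding ctraj_def by (elim allE[of _ t] allE[of _ "t + h n"]) auto
  then obtain u where u: "\<And>n. norm (u n) \<le> r" "\<And>n. norm (z (t + h n) - z t - h n *\<^sub>R Y (z t) (u n)) \<le> C * (h n)\<^sup>2"
    by metis
  have "(\<lambda>n. (z (t + h n) - z t) /\<^sub>R h n) \<longlonglongrightarrow> d"
  proof -
    have "((\<lambda>\<eta>. norm (z (t + \<eta>) - z t - \<eta> *\<^sub>R d) / norm \<eta>) \<longlongrightarrow> 0) (at 0)"
      using t(2) unfolding has_vector_derivative_def has_derivative_at by blast
    then have "(\<lambda>n. norm (z (t + h n) - z t - h n *\<^sub>R d) / norm (h n)) \<longlonglongrightarrow> 0"
      unfolding tendsto_at_iff_sequentially using h h0 by (auto simp: o_def)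
    moreover have "norm (z (t + h n) - z t - h n *\<^sub>R d) / norm (h n) = norm ((z (t + h n) - z t) /\<^sub>R h n - d)" for n
    proof -
      have "(z (t + h n) - z t) /\<^sub>R h n - d = (z (t + h n) - z t - h n *\<^sub>R d) /\<^sub>R h n"
        using h[of n] by (simp add: scaleR_diff_right)
      then show ?thesis by (simp add: divide_inverse mult.commute)
    qed
    ultimately have "(\<lambda>n. (z (t + h n) - z t) /\<^sub>R h n - d) \<longlonglongrightarrow> 0" by (simp add: tendsto_norm_zero_iff)
    then show ?thesis by (simp add: LIM_zero_iff)
  qed
  moreover have "(\<lambda>n. (z (t + h n) - z t) /\<^sub>R h n - Y (z t) (u n)) \<longlonglongrightarrow> 0"
  proof (rule Lim_null_comparison)
    show "(\<lambda>n. C * h n) \<longlonglongrightarrow> 0" using tendsto_mult_right_zero[OF h0] .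
    have "norm ((z (t + h n) - z t) /\<^sub>R h n - Y (z t) (u n)) \<le> C * h n" for n
    proof -
      have "(z (t + h n) - z t) /\<^sub>R h n - Y (z t) (u n) = (z (t + h n) - z t - h n *\<^sub>R Y (z t) (u n)) /\<^sub>R h n"
        using h[of n] by (simp add: scaleR_diff_right)
      then have "norm ((z (t + h n) - z t) /\<^sub>R h n - Y (z t) (u n)) =
          norm (z (t + h n) - z t - h n *\<^sub>R Y (z t) (u n)) / h n"
        using h[of n] by (simp add: divide_inverse mult.commute)
      also have "\<dots> \<le> C * (h n)\<^sup>2 / h n" using u(2)[of n] h[of n] by (intro divide_right_mono) auto
      also have "\<dots> = C * h n" using h[of n] by (simp add: power2_eq_square)
      finally show ?thesis .
    qed
    then show "\<forall>\<^sub>F n in sequentially. norm ((z (t + h n) - z t) /\<^sub>R h n - Y (z t) (u n)) \<le> C * h n" by simp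
  qed
  ultimately have lim: "(\<lambda>n. Y (z t) (u n)) \<longlonglongrightarrow> d"
    using tendsto_diff by fastforce
  have cl: "closed (Y (z t) ` cball 0 r)"
    by (intro compact_imp_closed compact_continuous_image linear_continuous_on) (use lin linear_conv_bounded_linear in auto)
  have mem: "Y (z t) (u n) \<in> Y (z t) ` cball 0 r" for n using u(1)[of n] by auto
  have "d \<in> Y (z t) ` cball 0 r" by (rule closed_sequentially[OF cl mem lim])
  then show ?thesis by auto
qed

lemma norm_average_le:
  fixes u :: "real \<Rightarrow> 'u::euclidean_space"
  assumes "u integrable_on {s..t}" "s < t" "\<And>\<tau>. \<tau> \<in> {s..t} \<Longrightarrow> norm (u \<tau>) \<le> r"
  shows "norm (integral {s..t} u /\<^sub>R (t - s)) \<le> r"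
proof -
  have "norm (integral {s..t} u) \<le> integral {s..t} (\<lambda>_. r)"
    by (rule integral_norm_bound_integral) (use assms in auto)
  then show ?thesis using assms(2) by (simp add: field_simps)
qed

text \<open>The witness is the mean of the control over [s,t], of norm at most \<open>r\<close> by
  convexity of the ball. Freezing the state at time \<open>s\<close> costs at most L r times the
  displacement M r (t - s), integrated over a time t - s.\<close>

lemma is_traj_ctraj:
  assumes lin: "\<And>x. linear (Y x)" and z: "is_traj Y S u z" and u: "\<And>t. t \<in> {0..1} \<Longrightarrow> norm (u t) \<le> r"
    and bnd: "\<And>x u. x \<in> S \<Longrightarrow> norm (Y x u) \<le> M * norm u"
    and lip: "\<And>x y u. \<lbrakk>x \<in> S; y \<in> S\<rbrakk> \<Longrightarrow> norm (Y x u - Y y u) \<le> L * norm u * norm (x - y)"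
    and pos: "0 \<le> M" "0 \<le> L" "0 \<le> r"
  shows "ctraj Y r (L * M * r\<^sup>2) z"
  unfolding ctraj_def
proof (intro allI impI)
  fix s t :: real assume st: "0 \<le> s \<and> s \<le> t \<and> t \<le> 1"
  have prim: "primitive z (\<lambda>t. Y (z t) (u t))" and ui: "u absolutely_integrable_on {0..1}"
    and zS: "\<And>t. t \<in> {0..1} \<Longrightarrow> z t \<in> S" using z by (auto simp: is_traj_def)
  have speed: "norm (Y (z \<tau>) (u \<tau>)) \<le> M * r" if "\<tau> \<in> {0..1}" for \<tau>
    using bnd[OF zS[OF that], of "u \<tau>"] mult_left_mono[OF u[OF that] pos(1)] by simp
  have inc: "norm (z \<tau> - z s) \<le> M * r * (\<tau> - s)" if "\<tau> \<in> {s..t}" for \<tau>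
  proof -
    have "norm (z \<tau> - z s) \<le> integral {s..\<tau>} (\<lambda>_. M * r)"
      by (rule primitive_norm_le[OF prim]) (use that st speed in auto)
    then show ?thesis using that by (simp add: mult_ac)
  qed
  show "\<exists>u. norm u \<le> r \<and> norm (z t - z s - (t - s) *\<^sub>R Y (z s) u) \<le> L * M * r\<^sup>2 * (t - s)\<^sup>2"
  proof (cases "s = t")
    case True then show ?thesis using pos by (intro exI[of _ 0]) auto
  next
    case False
    then have st': "s < t" using st by auto
    have ui': "u integrable_on {s..t}" using abs_integrable_imp_integrable[OF abs_integrable_ivl[OF ui]] st by auto
    define a where "a = integral {s..t} u /\<^sub>R (t - s)"
    have bl: "bounded_linear (Y (z s))" using lin linear_conv_bounded_linear by blast
    have "(t - s) *\<^sub>R Y (z s) a = Y (z s) (integral {s..t} u)"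
      using st' lin by (simp add: a_def linear_cmul)
    also have "\<dots> = integral {s..t} (\<lambda>\<tau>. Y (z s) (u \<tau>))"
      using integral_linear[OF ui' bl] by (simp add: o_def)
    finally have "z t - z s - (t - s) *\<^sub>R Y (z s) a =
        integral {s..t} (\<lambda>\<tau>. Y (z \<tau>) (u \<tau>)) - integral {s..t} (\<lambda>\<tau>. Y (z s) (u \<tau>))"
      using primitive_diff[OF prim] st by simp
    also have "\<dots> = integral {s..t} (\<lambda>\<tau>. Y (z \<tau>) (u \<tau>) - Y (z s) (u \<tau>))"
      by (rule integral_diff[symmetric])
        (use primitive_has_integral[OF prim] st integrable_linear[OF ui' bl] in \<open>auto simp: o_def\<close>)
    also have "norm \<dots> \<le> integral {s..t} (\<lambda>_. L * r * (M * r * (t - s)))"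
    proof (rule integral_norm_bound_integral)
      show "(\<lambda>\<tau>. Y (z \<tau>) (u \<tau>) - Y (z s) (u \<tau>)) integrable_on {s..t}"
        by (rule integrable_diff)
         (use primitive_has_integral[OF prim] st integrable_linear[OF ui' bl] in \<open>auto simp: o_def\<close>)
      fix \<tau> assume \<tau>: "\<tau> \<in> {s..t}"
      then have \<tau>': "\<tau> \<in> {0..1}" using st by auto
      have "norm (Y (z \<tau>) (u \<tau>) - Y (z s) (u \<tau>)) \<le> L * norm (u \<tau>) * norm (z \<tau> - z s)"
        by (rule lip) (use zS \<tau>' st in auto)
      also have "\<dots> \<le> L * r * (M * r * (t - s))"
      proof (intro mult_mono)
        show "norm (z \<tau> - z s) \<le> M * r * (t - s)"
          using inc[OF \<tau>] mult_left_mono[of "\<tau> - s" "t - s" "M * r"] \<tau> pos by simp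
      qed (use u[OF \<tau>'] pos in auto)
      finally show "norm (Y (z \<tau>) (u \<tau>) - Y (z s) (u \<tau>)) \<le> L * r * (M * r * (t - s))" .
    qed auto
    also have "\<dots> = L * M * r\<^sup>2 * (t - s)\<^sup>2" using st by (simp add: power2_eq_square)
    finally have "norm (z t - z s - (t - s) *\<^sub>R Y (z s) a) \<le> L * M * r\<^sup>2 * (t - s)\<^sup>2" .
    moreover have "norm a \<le> r" unfolding a_def by (rule norm_average_le[OF ui' st']) (use u st in auto)
    ultimately show ?thesis by blast
  qed
qed

lemma ctraj_compactness:
  assumes lin: "\<And>x. linear (Y x)" and cont: "\<And>c. continuous_on S (\<lambda>x. Y x c)"
    and z: "\<And>n. ctraj Y r C (zn n)" "\<And>n t. t \<in> {0..1} \<Longrightarrow> zn n t \<in> S"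
    and bnd: "\<And>x u. x \<in> S \<Longrightarrow> norm (Y x u) \<le> M * norm u"
    and pos: "0 \<le> M" "0 \<le> C" "0 \<le> r" and S: "compact S"
  obtains k :: "nat \<Rightarrow> nat" and z where "strict_mono k" "ctraj Y r C z"
    "\<And>t. t \<in> {0..1} \<Longrightarrow> (\<lambda>n. zn (k n) t) \<longlonglongrightarrow> z t" "\<And>t. t \<in> {0..1} \<Longrightarrow> z t \<in> S"
proof -
  obtain b where b: "\<And>x. x \<in> S \<Longrightarrow> norm x \<le> b" using compact_imp_bounded[OF S] by (auto simp: bounded_iff)
  define D where "D = M * r + C + 1"
  have D: "D > 0" using pos by (simp add: D_def add_nonneg_pos)
  have lip: "norm (zn n t - zn n s) \<le> D * \<bar>t - s\<bar>" if "s \<in> {0..1}" "t \<in> {0..1}" for n s t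
  proof -
    have "norm (zn n t - zn n s) \<le> (M * r + C) * \<bar>t - s\<bar>"
      by (rule ctraj_lipschitz[OF z(1) bnd[OF z(2)] pos that])
    also have "\<dots> \<le> D * \<bar>t - s\<bar>" by (intro mult_right_mono) (auto simp: D_def)
    finally show ?thesis .
  qed
  obtain z and k :: "nat \<Rightarrow> nat" where k: "strict_mono k"
    and conv: "\<And>e. 0 < e \<Longrightarrow> \<exists>N. \<forall>n x. n \<ge> N \<and> x \<in> {0..1} \<longrightarrow> norm (zn (k n) x - z x) < e"
  proof (rule Arzela_Ascoli[of "{0..1::real}" zn b])
    fix s e :: real assume s: "s \<in> {0..1}" "0 < e"
    show "\<exists>d>0. \<forall>n t. t \<in> {0..1} \<and> norm (s - t) < d \<longrightarrow> norm (zn n s - zn n t) < e"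
    proof (intro exI[of _ "e / D"] conjI allI impI)
      fix n t assume t: "t \<in> {0..1} \<and> norm (s - t) < e / D"
      then have "norm (zn n s - zn n t) \<le> D * \<bar>s - t\<bar>" using lip s by blast
      also have "\<dots> < e" using t D by (simp add: field_simps)
      finally show "norm (zn n s - zn n t) < e" .
    qed (use s D in auto)
  next
    show "compact {0..1::real}" by simp
    show "norm (zn n t) \<le> b" if "t \<in> {0..1}" for n t by (rule b[OF z(2)[OF that]])
    fix z and k :: "nat \<Rightarrow> nat"
    assume k: "strict_mono k" and c: "\<And>e. 0 < e \<Longrightarrow> \<exists>N. \<forall>n x. n \<ge> N \<and> x \<in> {0..1} \<longrightarrow> norm (zn (k n) x - z x) < e"
    show thesis by (rule that[OF k c])
  qed
  have lim: "(\<lambda>n. zn (k n) t) \<longlonglongrightarrow> z t" if "t \<in> {0..1}" for t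
  proof (rule LIMSEQ_I)
    fix e :: real assume "0 < e"
    from conv[OF this] obtain N where "\<forall>n x. n \<ge> N \<and> x \<in> {0..1} \<longrightarrow> norm (zn (k n) x - z x) < e" ..
    with that show "\<exists>no. \<forall>n\<ge>no. norm (zn (k n) t - z t) < e" by (intro exI[of _ N]) simp
  qed
  have "ctraj Y r C z"
  proof (rule ctraj_limit[OF lin cont _ _ lim compact_imp_closed[OF S]])
    show "ctraj Y r C (zn (k n))" for n by (rule z(1))
    show "zn (k n) t \<in> S" if "t \<in> {0..1}" for n t by (rule z(2)[OF that])
  qed simp
  moreover have "z t \<in> S" if "t \<in> {0..1}" for t
    by (rule closed_sequentially[OF compact_imp_closed[OF S] _ lim[OF that]]) (rule z(2)[OF that])
  ultimately show ?thesis using that[OF k _ lim] by blast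
qed

section \<open>Measurable recovery of controls from velocities\<close>

lemma continuous_on_linear_family:
  fixes Y :: "'z::topological_space \<Rightarrow> 'u::euclidean_space \<Rightarrow> 'w::real_normed_vector"
  assumes lin: "\<And>x. linear (Y x)" and cont: "\<And>c. continuous_on S (\<lambda>x. Y x c)"
    and f: "continuous_on T f" "\<And>t. t \<in> T \<Longrightarrow> f t \<in> S" and g: "continuous_on T g"
  shows "continuous_on T (\<lambda>t. Y (f t) (g t))"
proof -
  have "continuous_on T (\<lambda>t. \<Sum>c\<in>Basis. (g t \<bullet> c) *\<^sub>R Y (f t) c)"
    by (intro continuous_intros g continuous_on_compose2[OF cont f(1)]) (use f in auto)
  then show ?thesis by (simp flip: linear_basis_sum[OF lin])
qed

text \<open>On the compact product of \<open>B\<close> and the unit ball the map (x, u) -> (x, F x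
  u) is continuous and injective, hence has a continuous inverse; homogeneity in \<open>u\<close>
  extends it to controls of any size. The coercivity constant \<open>m\<close>, a minimum over the
  unit sphere, makes the control integrable whenever the velocity is.\<close>

lemma measurable_left_inverse:
  fixes F :: "'z::euclidean_space \<Rightarrow> 'u::euclidean_space \<Rightarrow> 'w::euclidean_space"
  assumes lin: "\<And>x. linear (F x)" and cont: "\<And>c. continuous_on B (\<lambda>x. F x c)"
    and B: "compact B" and inj: "\<And>x u. \<lbrakk>x \<in> B; F x u = 0\<rbrakk> \<Longrightarrow> u = 0"
  obtains U m where "U \<in> borel_measurable borel" "\<And>x u. x \<in> B \<Longrightarrow> U (x, F x u) = u"
    "m > 0" "\<And>x u. x \<in> B \<Longrightarrow> m * norm u \<le> norm (F x u)"
proof -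
  define K where "K = B \<times> cball (0::'u) 1"
  define G where "G p = (fst p, F (fst p) (snd p))" for p
  have Fc: "continuous_on (B \<times> T) (\<lambda>p. F (fst p) (snd p))" for T
    by (rule continuous_on_linear_family[OF lin cont]) (auto intro: continuous_intros)
  have Gc: "continuous_on K G"
    unfolding G_def K_def by (intro continuous_intros Fc)
  have K: "compact K" unfolding K_def by (intro compact_Times B) auto
  have diff: "u = v" if "x \<in> B" "F x u = F x v" for x u v
    using inj[OF that(1), of "u - v"] that(2) lin[of x] by (simp add: linear_diff)
  have Ginj: "inj_on G K"
    by (rule inj_onI) (auto simp: G_def K_def prod_eq_iff intro: diff)
  define g where "g = inv_into K G"
  have gc: "continuous_on (G ` K) g"
    by (rule continuous_on_inv[OF Gc K]) (auto simp: g_def inv_into_f_f[OF Ginj])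
  obtain m where m: "m > 0" "\<And>x u. x \<in> B \<Longrightarrow> m * norm u \<le> norm (F x u)"
  proof (cases "B = {}")
    case False
    have "compact (B \<times> sphere (0::'u) 1)" by (intro compact_Times B) auto
    moreover have "B \<times> sphere (0::'u) 1 \<noteq> {}" using False by simp
    moreover have "continuous_on (B \<times> sphere (0::'u) 1) (\<lambda>p. norm (F (fst p) (snd p)))"
      by (intro continuous_intros Fc)
    ultimately obtain p where p: "p \<in> B \<times> sphere (0::'u) 1"
      "\<And>q. q \<in> B \<times> sphere (0::'u) 1 \<Longrightarrow> norm (F (fst p) (snd p)) \<le> norm (F (fst q) (snd q))"
      using continuous_attains_inf by (metis (no_types, lifting))
    define m where "m = norm (F (fst p) (snd p))"
    have "m > 0" using p(1) inj[of "fst p" "snd p"] unfolding m_def by (cases p) auto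
    moreover have "m * norm u \<le> norm (F x u)" if x: "x \<in> B" for x u
    proof (cases "u = 0")
      case False
      have "m \<le> norm (F x (u /\<^sub>R norm u))" using p(2)[of "(x, u /\<^sub>R norm u)"] x False by (simp add: m_def)
      also have "\<dots> = norm (F x u) / norm u" using lin[of x] by (simp add: linear_cmul divide_inverse mult.commute)
      finally show ?thesis using False by (simp add: field_simps)
    qed simp
    ultimately show ?thesis using that by blast
  qed (use that[of 1] in auto)
  define gK where "gK q = indicator (G ` K) q *\<^sub>R g q" for q
  have gK: "gK \<in> borel_measurable borel"
    unfolding gK_def
    by (rule borel_measurable_continuous_on_indicator[OF _ gc])
      (intro borel_compact compact_continuous_image Gc K)
  \<comment> \<open>The velocity is scaled to norm \<open>m\<close>, which forces its control into
    the unit ball, and the scaling is undone outside. At velocity 0 the outer factor yields the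
    right value 0.\<close>
  define U where "U q = (norm (snd q) / m) *\<^sub>R snd (gK (fst q, (m / norm (snd q)) *\<^sub>R snd q))" for q
  show ?thesis
  proof (rule that[OF _ _ m])
    have [measurable]: "gK \<in> borel_measurable borel" by (rule gK)
    have [measurable]: "(fst :: 'z \<times> 'w \<Rightarrow> 'z) \<in> borel_measurable borel" "(snd :: 'z \<times> 'w \<Rightarrow> 'w) \<in> borel_measurable borel"
      "(snd :: 'z \<times> 'u \<Rightarrow> 'u) \<in> borel_measurable borel"
      by (intro borel_measurable_continuous_onI continuous_intros)+
    have "(\<lambda>q::'z \<times> 'w. (m / norm (snd q)) *\<^sub>R snd q) \<in> borel_measurable borel"
      by measurable
    then have "(\<lambda>q::'z \<times> 'w. (fst q, (m / norm (snd q)) *\<^sub>R snd q)) \<in> borel_measurable borel"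
      by (intro borel_measurable_Pair) simp
    then have "(\<lambda>q. gK (fst q, (m / norm (snd q)) *\<^sub>R snd q)) \<in> borel_measurable borel"
      by (rule measurable_compose[OF _ gK])
    then show "U \<in> borel_measurable borel"
      unfolding U_def by (intro borel_measurable_scaleR) measurable
    fix x u assume x: "x \<in> B"
    show "U (x, F x u) = u"
    proof (cases "u = 0")
      case True then show ?thesis using lin[of x] by (simp add: U_def linear_0)
    next
      case False
      then have n0: "norm (F x u) > 0" using m(2)[OF x, of u] m(1)
        by (metis mult_pos_pos order_less_le_trans zero_less_norm_iff)
      define \<kappa> where "\<kappa> = m / norm (F x u)"
      have "\<kappa> > 0" using m n0 by (simp add: \<kappa>_def)
      have "norm (\<kappa> *\<^sub>R u) \<le> 1" using m(2)[OF x, of u] n0 m(1) by (simp add: \<kappa>_def field_simps)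
      then have K1: "(x, \<kappa> *\<^sub>R u) \<in> K" using x by (simp add: K_def)
      have G1: "(x, \<kappa> *\<^sub>R F x u) = G (x, \<kappa> *\<^sub>R u)" using lin[of x] by (simp add: G_def linear_cmul)
      have "gK (x, \<kappa> *\<^sub>R F x u) = (x, \<kappa> *\<^sub>R u)"
        unfolding G1 gK_def g_def using K1 by (simp add: inv_into_f_f[OF Ginj])
      then have "U (x, F x u) = (1 / \<kappa>) *\<^sub>R (\<kappa> *\<^sub>R u)"
        using m by (simp add: U_def \<kappa>_def)
      then show ?thesis using \<open>\<kappa> > 0\<close> by simp
    qed
  qed
qed

lemma AE_lebesgue_on_ivl:
  assumes "negligible N" "\<And>t. t \<in> {0<..<1} - N \<Longrightarrow> P t"
  shows "AE t in lebesgue_on {0..1::real}. P t"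
proof -
  have "negligible (N \<union> {0,1})" using assms(1) by auto
  then have "AE t in lebesgue. t \<notin> N \<union> {0, 1}" by (intro AE_not_in) (simp only: negligible_iff_null_sets)
  then have "AE t in lebesgue. t \<in> {0..1} \<longrightarrow> P t"
    by (rule AE_mp) (rule AE_I2, use assms(2) in auto)
  then show ?thesis by (subst AE_restrict_space_iff) auto
qed

lemma primitive_cong_ae:
  assumes f: "primitive f h" and N: "negligible N" "\<And>t. t \<in> {0<..<1} - N \<Longrightarrow> h t = h' t"
  shows "primitive f h'"
proof -
  have N': "negligible (N \<union> {0, 1})" using N by auto
  have h: "h absolutely_integrable_on {0..1}" using f by (simp add: primitive_def)
  have h': "h' absolutely_integrable_on {0..1}"
    by (rule absolutely_integrable_spike[OF h N']) (use N(2) in auto)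
  have "integral {0..t} h = integral {0..t} h'" if "t \<in> {0..1}" for t
    by (rule integral_spike[OF N']) (use N(2) that in auto)
  then have "f 0 + integral {0..t} h' = f t" if "t \<in> {0..1}" for t
    using primitive_eq[OF f that] that by simp
  then show ?thesis unfolding primitive_def using h' by metis
qed

lemma bounded_measurable_abs_integrable:
  fixes u :: "real \<Rightarrow> 'u::euclidean_space"
  assumes "u \<in> borel_measurable (lebesgue_on {a..b})" "\<And>t. t \<in> {a..b} \<Longrightarrow> norm (u t) \<le> r"
  shows "u absolutely_integrable_on {a..b}"
  by (rule measurable_bounded_by_integrable_imp_absolutely_integrable[OF assms(1)])
    (use assms(2) in \<open>auto intro: integrable_const_ivl\<close>)

text \<open>\<open>Q\<close> is extra knowledge about some control with the given velocity; by
  injectivity the measurably selected control is that very one and inherits \<open>Q\<close>. Both a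
  bound on the norm and its exact value are transported in this way.\<close>

lemma velocity_control:
  fixes F :: "'z::euclidean_space \<Rightarrow> 'u::euclidean_space \<Rightarrow> 'z"
  assumes lin: "\<And>x. linear (F x)" and cont: "\<And>c. continuous_on B (\<lambda>x. F x c)"
    and B: "compact B" and inj: "\<And>x u. \<lbrakk>x \<in> B; F x u = 0\<rbrakk> \<Longrightarrow> u = 0"
    and x: "continuous_on {a..b::real} x" "\<And>t. t \<in> {a..b} \<Longrightarrow> x t \<in> B"
    and h: "h absolutely_integrable_on {a..b}" and N: "negligible N"
    and inc: "\<And>t. t \<in> {a<..<b} - N \<Longrightarrow> \<exists>u. h t = F (x t) u \<and> Q t u"
  obtains w where "w absolutely_integrable_on {a..b}" "\<And>t. t \<in> {a<..<b} - N \<Longrightarrow> h t = F (x t) (w t) \<and> Q t (w t)"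
    "\<And>t. t \<notin> {a<..<b} - N \<Longrightarrow> w t = 0"
proof -
  obtain U m where U: "U \<in> borel_measurable borel" "\<And>x u. x \<in> B \<Longrightarrow> U (x, F x u) = u"
    and m: "m > 0" "\<And>x u. x \<in> B \<Longrightarrow> m * norm u \<le> norm (F x u)"
  proof (rule measurable_left_inverse[OF lin cont B])
    show "u = 0" if "x \<in> B" "F x u = 0" for x u by (rule inj[OF that])
  qed (rule that)
  define w where "w t = (if t \<in> {a<..<b} - N then U (x t, h t) else 0)" for t
  have w: "h t = F (x t) (w t) \<and> Q t (w t)" if t: "t \<in> {a<..<b} - N" for t
  proof -
    obtain v where v: "h t = F (x t) v" "Q t v" using inc[OF t] by blast
    have "U (x t, h t) = v" unfolding v(1) using t by (intro U(2) x(2)) auto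
    then show ?thesis using v t by (simp add: w_def)
  qed
  have "(\<lambda>t. U (x t, h t)) \<in> borel_measurable (lebesgue_on {a..b})"
    by (intro measurable_compose[OF borel_measurable_Pair U(1)] continuous_imp_measurable_on_sets_lebesgue x
      integrable_imp_measurable abs_integrable_imp_integrable h) auto
  moreover have "{a<..<b} - N \<in> sets lebesgue" by (intro sets.Diff negligible_imp_sets[OF N]) simp
  then have "indicat_real ({a<..<b} - N) \<in> borel_measurable (lebesgue_on {a..b})"
    by (intro measurable_restrict_space1 borel_measurable_indicator)
  ultimately have "(\<lambda>t. indicat_real ({a<..<b} - N) t *\<^sub>R U (x t, h t)) \<in> borel_measurable (lebesgue_on {a..b})"
    by (intro borel_measurable_scaleR)
  moreover have "(\<lambda>t. indicat_real ({a<..<b} - N) t *\<^sub>R U (x t, h t)) = w" by (auto simp: w_def indicator_def)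
  ultimately have wm: "w \<in> borel_measurable (lebesgue_on {a..b})" by simp
  have "w absolutely_integrable_on {a..b}"
  proof (rule measurable_bounded_by_integrable_imp_absolutely_integrable[OF wm])
    show "(\<lambda>t. norm (h t) / m) integrable_on {a..b}"
      by (intro integrable_on_divide abs_integrable_imp_integrable abs_integrable_norm h)
    show "norm (w t) \<le> norm (h t) / m" if "t \<in> {a..b}" for t
    proof (cases "t \<in> {a<..<b} - N")
      case True then show ?thesis using w[OF True] m(2)[OF x(2)[OF that], of "w t"] m(1) by (simp add: field_simps)
    next
      case False then show ?thesis using m(1) by (simp only: w_def if_False norm_zero) simp
    qed
  qed auto
  then show ?thesis by (rule that) (erule w, unfold w_def, erule if_not_P)
qed

lemma traj_of_inclusion:
  fixes F :: "'z::euclidean_space \<Rightarrow> 'u::euclidean_space \<Rightarrow> 'z"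
  assumes lin: "\<And>x. linear (F x)" and cont: "\<And>c. continuous_on B (\<lambda>x. F x c)"
    and B: "compact B" and inj: "\<And>x u. \<lbrakk>x \<in> B; F x u = 0\<rbrakk> \<Longrightarrow> u = 0"
    and h: "primitive x h" "\<And>t. t \<in> {0..1} \<Longrightarrow> x t \<in> B" and N: "negligible N"
    and r: "0 \<le> r" "\<And>t. t \<in> {0<..<1} - N \<Longrightarrow> \<exists>u. h t = F (x t) u \<and> norm u \<le> r"
  obtains u where "is_traj F B u x" "\<And>t. norm (u t) \<le> r"
proof -
  have hi: "h absolutely_integrable_on {0..1}" using h(1) unfolding primitive_def by blast
  obtain u where u: "u absolutely_integrable_on {0..1}" "\<And>t. t \<in> {0<..<1} - N \<Longrightarrow> h t = F (x t) (u t) \<and> norm (u t) \<le> r"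
    "\<And>t. t \<notin> {0<..<1} - N \<Longrightarrow> u t = 0"
    by (rule velocity_control[where F = F and B = B and Q = "\<lambda>t u. norm u \<le> r" and a = 0 and b = 1 and x = x and h = h and N = N, OF lin cont B])
      (erule (1) inj | rule primitive_continuous[OF h(1)] hi N | erule h(2) r(2) | blast)+
  show ?thesis
  proof (rule that)
    have "h t = F (x t) (u t)" if "t \<in> {0<..<1} - N" for t using u(2)[OF that] by simp
    from primitive_cong_ae[OF h(1) N this] show "is_traj F B u x" unfolding is_traj_def using u(1) h(2) by blast
    show "norm (u t) \<le> r" for t using u(2,3)[of t] r(1) by (cases "t \<in> {0<..<1} - N") auto
  qed
qed

text \<open>Converse of \<open>is_traj_ctraj\<close>: the curve is Lipschitz, hence a primitive; at
  almost every time its derivative is the velocity of a control of norm at most \<open>r\<close>,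
  and these controls can be selected measurably.\<close>

lemma ctraj_is_traj:
  fixes F :: "'z::euclidean_space \<Rightarrow> 'u::euclidean_space \<Rightarrow> 'z"
  assumes lin: "\<And>x. linear (F x)" and cont: "\<And>c. continuous_on B (\<lambda>x. F x c)"
    and B: "compact B" and inj: "\<And>x u. \<lbrakk>x \<in> B; F x u = 0\<rbrakk> \<Longrightarrow> u = 0"
    and bnd: "\<And>x u. x \<in> B \<Longrightarrow> norm (F x u) \<le> M * norm u"
    and x: "ctraj F r C x" "\<And>t. t \<in> {0..1} \<Longrightarrow> x t \<in> B" and pos: "0 \<le> M" "0 \<le> C" "0 \<le> r"
  obtains u where "is_traj F B u x" "\<And>t. norm (u t) \<le> r"
proof -
  obtain h where h: "primitive x h"
    using lipschitz_primitive[OF ctraj_lipschitz[OF x(1) bnd[OF x(2)] pos]] by blast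
  obtain N where N: "negligible N" "\<And>t. t \<in> {0<..<1} - N \<Longrightarrow> (x has_vector_derivative h t) (at t)"
    using primitive_deriv[OF h] by blast
  have inc: "\<exists>u. h t = F (x t) u \<and> norm u \<le> r" if t: "t \<in> {0<..<1} - N" for t
    using ctraj_deriv[OF lin x(1) _ N(2)[OF t]] t by blast
  show ?thesis
    by (rule traj_of_inclusion[where F = F and B = B and r = r and x = x and h = h and N = N, OF lin cont B])
      (fact inj h x(2) N(1) pos(3) inc that)+
qed

section \<open>Control systems on a ball\<close>

text \<open>The transpose of a linear \<open>f\<close> applied to \<open>z\<close>. The coordinate
  formula is linear in \<open>z\<close> for every \<open>f\<close> and makes continuity in
  parameters immediate.\<close>

definition tr :: "('a::euclidean_space \<Rightarrow> 'b::real_inner) \<Rightarrow> 'b \<Rightarrow> 'a" where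
  "tr f z = (\<Sum>b\<in>Basis. (z \<bullet> f b) *\<^sub>R b)"

lemma tr_inner: "linear f \<Longrightarrow> tr f z \<bullet> v = z \<bullet> f v"
proof -
  assume f: "linear f"
  have "tr f z \<bullet> v = (\<Sum>b\<in>Basis. (z \<bullet> f b) * (b \<bullet> v))" by (simp add: tr_def inner_sum_left)
  also have "\<dots> = z \<bullet> (\<Sum>b\<in>Basis. (v \<bullet> b) *\<^sub>R f b)" by (simp add: inner_sum_right inner_commute mult.commute)
  also have "(\<Sum>b\<in>Basis. (v \<bullet> b) *\<^sub>R f b) = f v" by (rule linear_basis_sum[OF f, symmetric])
  finally show ?thesis .
qed

lemma tr_norm:
  assumes "linear f" "\<And>v. norm (f v) \<le> K * norm v"
  shows "norm (tr f z) \<le> K * norm z"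
proof (cases "tr f z = 0")
  case True
  have "0 \<le> K" using assms(2)[of "SOME b. b \<in> Basis"] norm_Basis[of "SOME b. b \<in> Basis"] some_in_eq[of Basis]
    by (metis nonempty_Basis mult.right_neutral norm_ge_zero order_trans)
  then show ?thesis using True by simp
next
  case False
  have "norm (tr f z) * norm (tr f z) = z \<bullet> f (tr f z)"
    using tr_inner[OF assms(1), of z "tr f z"] by (simp add: dot_square_norm power2_eq_square)
  also have "\<dots> \<le> norm z * norm (f (tr f z))" by (rule norm_cauchy_schwarz)
  also have "\<dots> \<le> norm z * (K * norm (tr f z))" by (intro mult_left_mono assms) auto
  finally have "norm (tr f z) * norm (tr f z) \<le> (K * norm z) * norm (tr f z)" by (simp add: mult_ac)
  then show ?thesis using False by simp
qed

lemma tr_linear: "linear (tr f)"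
  by (rule linearI) (simp_all add: tr_def inner_add_left scaleR_add_left sum.distrib scaleR_sum_right)

lemma tr_linear_left:
  assumes "\<And>v. linear (\<lambda>u. G u v)" shows "linear (\<lambda>u. tr (G u) z)"
  by (rule linearI)
    (simp_all add: tr_def linear_add[OF assms] linear_cmul[OF assms] inner_add_right scaleR_add_left sum.distrib scaleR_sum_right)

lemma continuous_on_tr:
  assumes "\<And>v. continuous_on S (\<lambda>x. G x v)" "continuous_on S z"
  shows "continuous_on S (\<lambda>x. tr (G x) (z x))"
  unfolding tr_def by (intro continuous_intros assms)

text \<open>A driftless system, linear in the control: \<open>F x u\<close> is the velocity,
  \<open>DF x u v\<close> its derivative in the state along \<open>v\<close>. The one constant
  \<open>L\<close> bounds \<open>DF\<close> and is a Lipschitz constant of it, so it governs both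
  the Lipschitz estimate and the Taylor remainder of \<open>F\<close>; \<open>M\<close> bounds the
  speed and hence how far a control of given L1 norm can move the state. \<open>F_inj\<close> stands
  for linear independence of the frame.\<close>

locale control_system =
  fixes F :: "'e::euclidean_space \<Rightarrow> 'u::euclidean_space \<Rightarrow> 'e" and DF :: "'e \<Rightarrow> 'u \<Rightarrow> 'e \<Rightarrow> 'e"
    and p0 :: 'e and R M L :: real
  assumes R: "0 < R" and M: "0 < M" and L: "0 < L"
    and F_lin: "linear (F x)" and DF_lin: "linear (\<lambda>u. DF x u v)"
    and F_deriv: "x \<in> cball p0 R \<Longrightarrow> ((\<lambda>x. F x u) has_derivative DF x u) (at x)"
    and F_bnd: "x \<in> cball p0 R \<Longrightarrow> norm (F x u) \<le> M * norm u"
    and DF_bnd: "x \<in> cball p0 R \<Longrightarrow> norm (DF x u v) \<le> L * norm u * norm v"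
    and DF_lip: "\<lbrakk>x \<in> cball p0 R; y \<in> cball p0 R\<rbrakk> \<Longrightarrow>
        norm (DF x u v - DF y u v) \<le> L * norm u * norm (x - y) * norm v"
    and F_inj: "\<lbrakk>x \<in> cball p0 R; F x u = 0\<rbrakk> \<Longrightarrow> u = 0"
begin

abbreviation B where "B \<equiv> cball p0 R"

lemma DF_lin2: "x \<in> B \<Longrightarrow> linear (DF x u)"
  using F_deriv has_derivative_linear by blast

lemma F_cont: "continuous_on B (\<lambda>x. F x c)"
  using F_deriv has_derivative_continuous continuous_at_imp_continuous_on by blast

lemma DF_cont: "continuous_on B (\<lambda>x. DF x u v)"
proof (rule lipschitz_on_continuous_on[where L = "L * norm u * norm v"], rule lipschitz_onI)
  show "dist (DF x u v) (DF y u v) \<le> L * norm u * norm v * dist x y" if "x \<in> B" "y \<in> B" for x y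
    using DF_lip[OF that] by (simp add: dist_norm mult_ac)
qed (use L in simp)

lemma F_lip:
  assumes "x \<in> B" "y \<in> B" shows "norm (F x u - F y u) \<le> L * norm u * norm (x - y)"
proof (rule differentiable_bound[where S = B and f' = "\<lambda>x. DF x u"])
  show "((\<lambda>x. F x u) has_derivative DF x u) (at x within B)" if "x \<in> B" for x
    using F_deriv[OF that] has_derivative_at_withinI by blast
  show "onorm (DF x u) \<le> L * norm u" if "x \<in> B" for x
    by (rule onorm_bound) (use L DF_bnd[OF that] in auto)
qed (use assms in auto)

lemma F_taylor:
  assumes "x \<in> B" "y \<in> B" shows "norm (F y u - F x u - DF x u (y - x)) \<le> L * norm u * (norm (y - x))\<^sup>2"
proof -
  have "norm (F y u - F x u - DF x u (y - x)) \<le> norm (y - x) * (L * norm u * norm (y - x))"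
  proof (rule differentiable_bound_linearization[where S = "closed_segment x y" and f' = "\<lambda>x. DF x u"])
    have sub: "closed_segment x y \<subseteq> B" using assms by (simp add: closed_segment_subset)
    show "x + t *\<^sub>R (y - x) \<in> closed_segment x y" if "t \<in> {0..1}" for t
      using that unfolding closed_segment_def by (auto intro!: exI[of _ t] simp: algebra_simps)
    show "((\<lambda>x. F x u) has_derivative DF z u) (at z within closed_segment x y)" if "z \<in> closed_segment x y" for z
      by (rule has_derivative_at_withinI[OF F_deriv]) (use sub that in blast)
    fix z assume z: "z \<in> closed_segment x y"
    have "onorm (\<lambda>v. DF z u v - DF x u v) \<le> L * norm u * norm (y - x)"
    proof (rule onorm_bound)
      fix v
      have "norm (DF z u v - DF x u v) \<le> L * norm u * norm (z - x) * norm v"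
        using DF_lip[OF _ assms(1), of z u v] z sub by blast
      also have "\<dots> \<le> L * norm u * norm (y - x) * norm v"
        using segment_bound1[OF z] L by (intro mult_right_mono mult_left_mono) (auto simp: norm_minus_commute)
      finally show "norm (DF z u v - DF x u v) \<le> L * norm u * norm (y - x) * norm v" .
    qed (use L in auto)
    then show "onorm (DF z u - DF x u) \<le> L * norm u * norm (y - x)" by (simp add: fun_diff_def)
  qed auto
  then show ?thesis by (simp add: power2_eq_square mult_ac)
qed

lemma F_traj_integrable:
  assumes "continuous_on {0..1} x" "\<And>t. t \<in> {0..1} \<Longrightarrow> x t \<in> B" "u absolutely_integrable_on {0..1::real}"
  shows "(\<lambda>t. F (x t) (u t)) absolutely_integrable_on {0..1}"
  by (rule abs_integrable_linear_family[where Y = F and S = B, OF F_lin F_cont assms])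

definition deviation_const where "deviation_const V = 2 * M * exp (2 * L * V)"

text \<open>The difference of velocities splits into F(y)(w - u), bounded by M|w - u|, and F(y)u -
  F(x)u, which carries the Gronwall rate L|u|. So only the L1 norm of the reference control
  \<open>u\<close> enters the constant. For w = u this is uniqueness of trajectories.\<close>

lemma traj_gronwall:
  assumes x: "is_traj F B u x" and y: "is_traj F B w y" and "x 0 = y 0"
    and U: "integral {0..1} (\<lambda>t. norm (u t)) \<le> U" and t: "t \<in> {0..1}"
  shows "norm (y t - x t) \<le> deviation_const U * integral {0..1} (\<lambda>t. norm (w t - u t))"
proof -
  define V where "V = integral {0..1} (\<lambda>t. norm (w t - u t))"
  have px: "primitive x (\<lambda>t. F (x t) (u t))" and py: "primitive y (\<lambda>t. F (y t) (w t))"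
    and u: "u absolutely_integrable_on {0..1}" and w: "w absolutely_integrable_on {0..1}"
    and xB: "\<And>t. t \<in> {0..1} \<Longrightarrow> x t \<in> B" and yB: "\<And>t. t \<in> {0..1} \<Longrightarrow> y t \<in> B"
    using x y by (auto simp: is_traj_def)
  note cx = primitive_continuous[OF px] and cy = primitive_continuous[OF py]
  have v: "(\<lambda>t. norm (w t - u t)) absolutely_integrable_on {0..1}"
    by (intro abs_integrable_norm set_integral_diff(1) u w)
  have V0: "V \<ge> 0" unfolding V_def
    by (rule Henstock_Kurzweil_Integration.integral_nonneg[OF abs_integrable_imp_integrable[OF v]]) simp
  have "norm (y t - x t) \<le> 2 * (M * V) * exp (2 * integral {0..1} (\<lambda>t. L * norm (u t)))"
  proof (rule gronwall_integral[OF _ _ _ _ _ t])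
    show ku: "(\<lambda>t. L * norm (u t)) absolutely_integrable_on {0..1}"
      by (rule absolutely_integrable_linear[OF abs_integrable_norm[OF u] bounded_linear_mult_right, unfolded o_def])
    show cn: "continuous_on {0..1} (\<lambda>t. norm (y t - x t))" by (intro continuous_intros cx cy)
    show "0 \<le> L * norm (u t)" for t using L by simp
    fix t :: real assume t: "t \<in> {0..1}"
    then have sub: "{0..t} \<subseteq> {0..1}" by auto
    have i1: "(\<lambda>s. L * norm (u s) * norm (y s - x s)) integrable_on {0..t}"
      using abs_integrable_continuous_mult[OF bounded_bilinear_mult cn ku] t
      by (intro abs_integrable_imp_integrable[OF abs_integrable_ivl[where a = 0 and b = 1]]) (auto simp: mult_ac)
    have i2: "(\<lambda>s. norm (w s - u s)) integrable_on {0..t}"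
      using abs_integrable_imp_integrable[OF abs_integrable_ivl[OF v]] t by auto
    have "y t - x t = integral {0..t} (\<lambda>s. F (y s) (w s)) - integral {0..t} (\<lambda>s. F (x s) (u s))"
      using primitive_diff[OF px, of 0 t] primitive_diff[OF py, of 0 t] t assms(3) by (simp add: algebra_simps)
    also have "\<dots> = integral {0..t} (\<lambda>s. F (y s) (w s) - F (x s) (u s))"
      by (rule integral_diff[symmetric])
        (use primitive_has_integral[OF px, of 0 t] primitive_has_integral[OF py, of 0 t] t in auto)
    also have "norm \<dots> \<le> integral {0..t} (\<lambda>s. M * norm (w s - u s) + L * norm (u s) * norm (y s - x s))"
    proof (rule integral_norm_bound_integral)
      show "(\<lambda>s. F (y s) (w s) - F (x s) (u s)) integrable_on {0..t}"
        by (rule integrable_diff)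
        (use primitive_has_integral[OF px, of 0 t] primitive_has_integral[OF py, of 0 t] t in auto)
      show "(\<lambda>s. M * norm (w s - u s) + L * norm (u s) * norm (y s - x s)) integrable_on {0..t}"
        by (intro integrable_add i1 integrable_on_mult_right i2)
      fix s assume "s \<in> {0..t}"
      then have s: "s \<in> {0..1}" using t by auto
      have "F (y s) (w s) - F (x s) (u s) = F (y s) (w s - u s) + (F (y s) (u s) - F (x s) (u s))"
        using linear_diff[OF F_lin] by simp
      then have "norm (F (y s) (w s) - F (x s) (u s)) \<le> norm (F (y s) (w s - u s)) + norm (F (y s) (u s) - F (x s) (u s))"
        by (metis norm_triangle_ineq)
      also have "\<dots> \<le> M * norm (w s - u s) + L * norm (u s) * norm (y s - x s)"
        by (intro add_mono F_bnd F_lip xB yB s)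
      finally show "norm (F (y s) (w s) - F (x s) (u s)) \<le> M * norm (w s - u s) + L * norm (u s) * norm (y s - x s)" .
    qed
    also have "\<dots> = M * integral {0..t} (\<lambda>s. norm (w s - u s)) + integral {0..t} (\<lambda>s. L * norm (u s) * norm (y s - x s))"
      by (subst integral_add) (use i1 i2 in \<open>auto intro: integrable_on_mult_right\<close>)
    also have "integral {0..t} (\<lambda>s. norm (w s - u s)) \<le> V"
      unfolding V_def by (rule integral_subset_le[OF sub i2 abs_integrable_imp_integrable[OF v]]) simp
    finally show "norm (y t - x t) \<le> M * V + integral {0..t} (\<lambda>s. L * norm (u s) * norm (y s - x s))"
      using M by (simp add: mult_left_mono)
  qed simp
  also have "\<dots> \<le> 2 * (M * V) * exp (2 * L * U)"
    using M V0 L U by (intro mult_left_mono) (auto simp: mult_left_mono)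
  finally show ?thesis by (simp add: deviation_const_def V_def mult_ac)
qed

text \<open>Composition with the closest-point projection onto \<open>B\<close> makes the system
  globally Lipschitz; the bound on the L1 norm of \<open>w\<close> then keeps the solution in
  \<open>B\<close>, where the projection is the identity.\<close>

lemma traj_exists:
  assumes w: "w absolutely_integrable_on {0..1}" and x0: "norm (x0 - p0) + M * integral {0..1} (\<lambda>t. norm (w t)) \<le> R"
  obtains y where "is_traj F B w y" "y 0 = x0"
proof -
  define P where "P = closest_point B"
  have Bne: "closed B" "convex B" "B \<noteq> {}" using R by auto
  have P: "P z \<in> B" "norm (P z - P z') \<le> norm (z - z')" for z z'
    unfolding P_def using closest_point_in_set[OF Bne(1,3)] closest_point_lipschitz[OF Bne(2,1,3)] by (auto simp: dist_norm)
  have P_id: "P z = z" if "z \<in> B" for z unfolding P_def by (rule closest_point_self[OF that])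
  have P_cont: "continuous_on S P" for S unfolding P_def by (rule continuous_on_closest_point[OF Bne(2,1,3)])
  have wn: "(\<lambda>t. norm (w t)) absolutely_integrable_on {0..1}" by (rule abs_integrable_norm[OF w])
  obtain y where y: "primitive y (\<lambda>t. F (P (y t)) (w t))" "y 0 = x0"
  proof (rule caratheodory_existence[where F = "\<lambda>t z. F (P z) (w t)" and k = "\<lambda>t. L * norm (w t)"])
    show "(\<lambda>t. L * norm (w t)) absolutely_integrable_on {0..1}"
      by (rule absolutely_integrable_linear[OF wn bounded_linear_mult_right, unfolded o_def])
    show "0 \<le> L * norm (w t)" for t using L by simp
    show "norm (F (P x) (w t) - F (P y) (w t)) \<le> L * norm (w t) * norm (x - y)" for t x y
      by (rule order_trans[OF F_lip[OF P(1) P(1)]]) (use L P(2) in \<open>simp add: mult_left_mono\<close>)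
    show "(\<lambda>t. F (P (z t)) (w t)) absolutely_integrable_on {0..1}" if z: "continuous_on {0..1} z" for z
      by (rule F_traj_integrable[OF _ _ w]) (use P continuous_on_compose2[OF P_cont z] in auto)
  qed
  have yB: "y t \<in> B" if t: "t \<in> {0..1}" for t
  proof -
    have i: "(\<lambda>t. M * norm (w t)) integrable_on {0..s}" if "s \<in> {0..1}" for s
      using abs_integrable_imp_integrable[OF abs_integrable_ivl[OF wn]] that by (intro integrable_on_mult_right) auto
    have "norm (y t - y 0) \<le> integral {0..t} (\<lambda>t. M * norm (w t))"
      by (rule primitive_norm_le[OF y(1)]) (use t i F_bnd[OF P(1)] in auto)
    also have "\<dots> \<le> integral {0..1} (\<lambda>t. M * norm (w t))"
      by (rule integral_subset_le) (use t i[of t] i[of 1] M in auto)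
    also have "\<dots> = M * integral {0..1} (\<lambda>t. norm (w t))" by (rule integral_mult_right)
    finally have "norm (y t - p0) \<le> R"
      using x0 y(2) norm_triangle_ineq[of "y t - y 0" "x0 - p0"] by simp
    then show ?thesis by (simp add: dist_norm norm_minus_commute)
  qed
  show ?thesis
  proof (rule that[of y, OF _ y(2)])
    have "primitive y (\<lambda>t. F (y t) (w t))"
      by (rule primitive_cong_ae[OF y(1) negligible_empty]) (use yB P_id in auto)
    then show "is_traj F B w y" using w yB by (simp add: is_traj_def)
  qed
qed

end

section \<open>Algebra of primitives\<close>

lemma primitive_linear:
  assumes "bounded_linear T" "primitive f h"
  shows "primitive (\<lambda>t. T (f t)) (\<lambda>t. T (h t))"
proof -
  have h: "h absolutely_integrable_on {0..1}" using assms(2) by (simp add: primitive_def)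
  have Th: "(\<lambda>t. T (h t)) absolutely_integrable_on {0..1}"
    by (rule absolutely_integrable_linear[OF h assms(1), unfolded o_def])
  have "T (f t) = T (f 0) + integral {0..t} (\<lambda>t. T (h t))" if t: "t \<in> {0..1}" for t
  proof -
    have "h integrable_on {0..t}" using abs_integrable_imp_integrable[OF abs_integrable_ivl[OF h]] t by auto
    from integral_linear[OF this assms(1)] have "integral {0..t} (\<lambda>t. T (h t)) = T (integral {0..t} h)"
      by (simp add: o_def)
    moreover have "T (f t) = T (f 0 + integral {0..t} h)" using primitive_eq[OF assms(2) t] by simp
    ultimately show ?thesis using assms(1) by (simp add: linear_simps)
  qed
  then show ?thesis unfolding primitive_def using Th by blast
qed

lemma primitive_add:
  assumes f: "primitive f f'" and g: "primitive g g'"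
  shows "primitive (\<lambda>t. f t + g t) (\<lambda>t. f' t + g' t)"
proof -
  have a: "(\<lambda>t. f' t + g' t) absolutely_integrable_on {0..1}"
    using f g by (intro set_integral_add(1)) (auto simp: primitive_def)
  have "f t + g t = (f 0 + g 0) + integral {0..t} (\<lambda>t. f' t + g' t)" if t: "t \<in> {0..1}" for t
  proof -
    have "integral {0..t} (\<lambda>t. f' t + g' t) = integral {0..t} f' + integral {0..t} g'"
      by (rule integral_add) (use primitive_has_integral[OF f, of 0 t] primitive_has_integral[OF g, of 0 t] t in auto)
    then show ?thesis using primitive_eq[OF f t] primitive_eq[OF g t] by (metis (no_types) add.assoc add.left_commute)
  qed
  then show ?thesis unfolding primitive_def using a by blast
qed

lemma primitive_minus:
  assumes f: "primitive f f'" and g: "primitive g g'"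
  shows "primitive (\<lambda>t. f t - g t) (\<lambda>t. f' t - g' t)"
  using primitive_add[OF f primitive_linear[OF bounded_linear_minus[OF bounded_linear_ident] g]] by simp

lemma primitive_zero: "primitive (\<lambda>t. 0) (\<lambda>t. 0)"
  by (simp add: primitive_def)

lemma primitive_lincomb:
  assumes "finite I" "\<And>i. i \<in> I \<Longrightarrow> primitive (f i) (h i)"
  shows "primitive (\<lambda>t. \<Sum>i\<in>I. c i *\<^sub>R f i t) (\<lambda>t. \<Sum>i\<in>I. c i *\<^sub>R h i t)"
  using assms
proof (induction I rule: finite_induct)
  case (insert i I)
  then show ?case
    using primitive_add[OF primitive_linear[OF bounded_linear_scaleR_right, of "f i" "h i" "c i"]] by simp
qed (simp add: primitive_zero)

lemma primitive_Pair:
  assumes f: "primitive f f'" and g: "primitive g g'"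
  shows "primitive (\<lambda>t. (f t, g t)) (\<lambda>t. (f' t, g' t))"
proof -
  have "bounded_linear (\<lambda>x. (x, 0))" "bounded_linear (\<lambda>y. (0, y))"
    by (auto intro!: bounded_linear_Pair bounded_linear_ident bounded_linear_zero)
  from primitive_add[OF primitive_linear[OF this(1) f] primitive_linear[OF this(2) g]] show ?thesis by simp
qed

lemma primitive_abs_int: "primitive f h \<Longrightarrow> h absolutely_integrable_on {0..1}"
  by (simp add: primitive_def)

section \<open>The adjoint equation and the first variation of the end point\<close>

context control_system
begin

text \<open>The equation q' = -DF(x,u)^T q, dual to the linearization along the trajectory; the
  covector q is identified with a vector by the inner product.\<close>

definition adj_sol :: "(real \<Rightarrow> 'u) \<Rightarrow> (real \<Rightarrow> 'e) \<Rightarrow> (real \<Rightarrow> 'e) \<Rightarrow> bool" where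
  "adj_sol u x q \<longleftrightarrow> primitive q (\<lambda>t. - tr (DF (x t) (u t)) (q t))"

lemma adj_family:
  shows "linear (\<lambda>u. tr (DF (fst p) u) (snd p))"
    and "continuous_on (B \<times> T) (\<lambda>p. tr (DF (fst p) c) (snd p))"
proof -
  show "linear (\<lambda>u. tr (DF (fst p) u) (snd p))" by (rule tr_linear_left[OF DF_lin])
  show "continuous_on (B \<times> T) (\<lambda>p. tr (DF (fst p) c) (snd p))"
    by (intro continuous_on_tr continuous_on_compose2[OF DF_cont] continuous_intros) auto
qed

lemma adj_norm:
  assumes "x \<in> B" shows "norm (tr (DF x u) z) \<le> L * norm u * norm z"
  by (rule tr_norm[OF DF_lin2[OF assms] DF_bnd[OF assms]])

lemma traj_parts:
  assumes "is_traj F B u x"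
  shows "primitive x (\<lambda>t. F (x t) (u t))" "u absolutely_integrable_on {0..1}" "\<And>t. t \<in> {0..1} \<Longrightarrow> x t \<in> B"
    "continuous_on {0..1} x"
  using assms primitive_continuous by (auto simp: is_traj_def)

lemma adj_exists:
  assumes x: "is_traj F B u x" obtains q where "adj_sol u x q" "q 1 = a"
proof -
  note xp = traj_parts[OF x]
  obtain q where q: "primitive q (\<lambda>t. - tr (DF (x t) (u t)) (q t))" "q 1 = a"
  proof (rule caratheodory_existence_backward[where F = "\<lambda>t q. - tr (DF (x t) (u t)) q" and k = "\<lambda>t. L * norm (u t)"])
    show "(\<lambda>t. L * norm (u t)) absolutely_integrable_on {0..1}"
      by (rule absolutely_integrable_linear[OF abs_integrable_norm[OF xp(2)] bounded_linear_mult_right, unfolded o_def])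
    show "0 \<le> L * norm (u t)" for t using L by simp
    show "norm (- tr (DF (x t) (u t)) y - - tr (DF (x t) (u t)) z) \<le> L * norm (u t) * norm (y - z)"
      if "t \<in> {0..1}" for t y z
      using adj_norm[OF xp(3)[OF that], of "u t" "y - z"] linear_diff[OF tr_linear, of "DF (x t) (u t)" y z]
      by (simp add: norm_minus_commute)
    show "(\<lambda>t. - tr (DF (x t) (u t)) (z t)) absolutely_integrable_on {0..1}" if z: "continuous_on {0..1} z" for z
    proof -
      have "(\<lambda>t. tr (DF (fst (x t, z t)) (u t)) (snd (x t, z t))) absolutely_integrable_on {0..1}"
        by (rule abs_integrable_linear_family[where Y = "\<lambda>p u. tr (DF (fst p) u) (snd p)" and S = "B \<times> UNIV",
            OF adj_family _ _ xp(2)])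
          (use xp z in \<open>auto intro: continuous_on_Pair\<close>)
      then show ?thesis by (intro abs_integrable_minus) simp
    qed
  qed
  then show ?thesis using that by (simp add: adj_sol_def)
qed

lemma adj_lincomb:
  assumes "\<And>b. b \<in> Basis \<Longrightarrow> adj_sol u x (Q b)"
  shows "adj_sol u x (\<lambda>t. \<Sum>b\<in>(Basis :: 'e set). c b *\<^sub>R Q b t)"
proof -
  have "primitive (\<lambda>t. \<Sum>b\<in>(Basis :: 'e set). c b *\<^sub>R Q b t) (\<lambda>t. \<Sum>b\<in>(Basis :: 'e set). c b *\<^sub>R - tr (DF (x t) (u t)) (Q b t))"
    using assms by (intro primitive_lincomb) (auto simp: adj_sol_def)
  moreover have "(\<Sum>b\<in>(Basis :: 'e set). c b *\<^sub>R - tr (DF (x t) (u t)) (Q b t)) = - tr (DF (x t) (u t)) (\<Sum>b\<in>Basis. c b *\<^sub>R Q b t)" for t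
    by (simp add: linear_sum[OF tr_linear] linear_cmul[OF tr_linear] sum_negf)
  ultimately show ?thesis by (simp add: adj_sol_def)
qed

lemma adj_scale:
  assumes "adj_sol u x q" shows "adj_sol u x (\<lambda>t. c *\<^sub>R q t)"
  using primitive_linear[OF bounded_linear_scaleR_right assms[unfolded adj_sol_def], of c]
  by (simp add: adj_sol_def linear_cmul[OF tr_linear])

text \<open>Gronwall after reversing time, because the bound is in terms of the value at time
  1.\<close>

lemma adj_bound:
  assumes x: "is_traj F B u x" and q: "adj_sol u x q" and U: "integral {0..1} (\<lambda>t. norm (u t)) \<le> U" and t: "t \<in> {0..1}"
  shows "norm (q t) \<le> 2 * exp (2 * L * U) * norm (q 1)"
proof -
  note xp = traj_parts[OF x]
  have pq: "primitive q (\<lambda>t. - tr (DF (x t) (u t)) (q t))" using q by (simp add: adj_sol_def)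
  define p where "p t = q (1 - t)" for t
  have pp: "primitive p (\<lambda>t. - (- tr (DF (x (1 - t)) (u (1 - t))) (p t)))"
    unfolding p_def using primitive_reflect[OF pq] .
  have k: "(\<lambda>t. L * norm (u t)) absolutely_integrable_on {0..1}"
    by (rule absolutely_integrable_linear[OF abs_integrable_norm[OF xp(2)] bounded_linear_mult_right, unfolded o_def])
  note kr = abs_integrable_reflect[OF k]
  have "norm (p (1 - t)) \<le> 2 * norm (q 1) * exp (2 * integral {0..1} (\<lambda>t. L * norm (u (1 - t))))"
  proof (rule gronwall_integral[OF kr(1), where y = "\<lambda>t. norm (p t)" and t = "1 - t"])
    show cn: "continuous_on {0..1} (\<lambda>t. norm (p t))" by (intro continuous_intros primitive_continuous[OF pp])
    show "0 \<le> L * norm (u (1 - t))" for t using L by simp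
    fix s :: real assume s: "s \<in> {0..1}"
    have i: "(\<lambda>\<tau>. L * norm (u (1 - \<tau>)) * norm (p \<tau>)) integrable_on {0..s}"
      using abs_integrable_continuous_mult[OF bounded_bilinear_mult cn kr(1)] s
      by (intro abs_integrable_imp_integrable[OF abs_integrable_ivl[where a = 0 and b = 1]]) (auto simp: mult_ac)
    have "norm (p s - p 0) \<le> integral {0..s} (\<lambda>\<tau>. L * norm (u (1 - \<tau>)) * norm (p \<tau>))"
    proof (rule primitive_norm_le[OF pp _ _ _ i])
      fix \<tau> assume "\<tau> \<in> {0..s}"
      then have "1 - \<tau> \<in> {0..1}" using s by auto
      from adj_norm[OF xp(3)[OF this]]
      show "norm (- (- tr (DF (x (1 - \<tau>)) (u (1 - \<tau>))) (p \<tau>))) \<le> L * norm (u (1 - \<tau>)) * norm (p \<tau>)" by simp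
    qed (use s in auto)
    moreover have "norm (p s) \<le> norm (p 0) + norm (p s - p 0)" by (metis norm_triangle_sub)
    ultimately show "norm (p s) \<le> norm (q 1) + integral {0..s} (\<lambda>\<tau>. L * norm (u (1 - \<tau>)) * norm (p \<tau>))"
      by (simp add: p_def)
  qed (use t in auto)
  also have "integral {0..1} (\<lambda>t. L * norm (u (1 - t))) = L * integral {0..1} (\<lambda>t. norm (u t))"
    using kr(2)[of 1] by (simp add: integral_mult_right)
  also have "2 * norm (q 1) * exp (2 * (L * integral {0..1} (\<lambda>t. norm (u t)))) \<le> 2 * norm (q 1) * exp (2 * L * U)"
    using U L by (intro mult_left_mono) (auto simp: mult_left_mono)
  finally show ?thesis by (simp add: p_def mult_ac)
qed

lemma tr_F_cont:
  assumes x: "is_traj F B u x" and q: "continuous_on {0..1} q"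
  shows "continuous_on {0..1} (\<lambda>t. tr (F (x t)) (q t))"
  using traj_parts[OF x] by (intro continuous_on_tr continuous_on_compose2[OF F_cont] q) auto

lemma tr_F_norm: "x \<in> B \<Longrightarrow> norm (tr (F x) z) \<le> M * norm z"
  by (rule tr_norm[OF F_lin F_bnd])

text \<open>The first term comes from the Taylor remainder L|u||y - x|^2, the second one from the
  mixed term L|w - u||y - x|; in both, |y - x| is at most \<open>deviation_const U\<close> times the
  L1 distance of the controls.\<close>

definition expansion_const where "expansion_const U = L * U * (deviation_const U)\<^sup>2 + L * deviation_const U"

text \<open>First variation of the end point: the adjoint solution \<open>q\<close> cancels the linear part of the
  perturbation \<open>y - x\<close>, so that only the direct effect of the control survives, up to a quadratic error.\<close>

lemma endpoint_expansion:
  assumes x: "is_traj F B u x" and y: "is_traj F B w y" and "x 0 = y 0" and q: "adj_sol u x q"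
    and U: "integral {0..1} (\<lambda>t. norm (u t)) \<le> U" and Q: "\<And>t. t \<in> {0..1} \<Longrightarrow> norm (q t) \<le> Q"
  shows "\<bar>q 1 \<bullet> (y 1 - x 1) - integral {0..1} (\<lambda>t. tr (F (x t)) (q t) \<bullet> (w t - u t))\<bar>
     \<le> Q * expansion_const U * (integral {0..1} (\<lambda>t. norm (w t - u t)))\<^sup>2"
proof -
  note xp = traj_parts[OF x] and yp = traj_parts[OF y]
  define V where "V = integral {0..1} (\<lambda>t. norm (w t - u t))"
  define v where "v t = w t - u t" for t
  have v: "v absolutely_integrable_on {0..1}" unfolding v_def by (rule set_integral_diff(1)[OF yp(2) xp(2)])
  have nv: "(\<lambda>t. norm (v t)) integrable_on {0..1}" and nu: "(\<lambda>t. norm (u t)) integrable_on {0..1}"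
    using abs_integrable_norm[OF v] abs_integrable_norm[OF xp(2)] by (auto intro: abs_integrable_imp_integrable)
  have V0: "V \<ge> 0" unfolding V_def using nv unfolding v_def
    by (intro Henstock_Kurzweil_Integration.integral_nonneg) auto
  have U0: "U \<ge> 0" using U nu Henstock_Kurzweil_Integration.integral_nonneg[OF nu] by simp
  have Q0: "Q \<ge> 0" using order_trans[OF norm_ge_zero Q[of 0]] by simp
  have G0: "deviation_const U \<ge> 0" using M by (simp add: deviation_const_def)
  define \<xi> where "\<xi> t = y t - x t" for t
  have \<xi>: "norm (\<xi> t) \<le> deviation_const U * V" if "t \<in> {0..1}" for t
    unfolding \<xi>_def V_def by (rule traj_gronwall[OF x y assms(3) U that])
  have p\<xi>: "primitive \<xi> (\<lambda>t. F (y t) (w t) - F (x t) (u t))"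
    unfolding \<xi>_def by (rule primitive_minus[OF yp(1) xp(1)])
  have pq: "primitive q (\<lambda>t. - tr (DF (x t) (u t)) (q t))" using q by (simp add: adj_sol_def)
  define g where "g t = - tr (DF (x t) (u t)) (q t) \<bullet> \<xi> t + q t \<bullet> (F (y t) (w t) - F (x t) (u t))" for t
  have pg: "primitive (\<lambda>t. q t \<bullet> \<xi> t) g"
    unfolding g_def by (rule primitive_inner[OF pq p\<xi>])
  define f where "f t = tr (F (x t)) (q t) \<bullet> v t" for t
  have fi: "f integrable_on {0..1}"
    unfolding f_def
    by (intro abs_integrable_imp_integrable abs_integrable_continuous_mult[OF bounded_bilinear_inner _ v] tr_F_cont[OF x] primitive_continuous[OF pq])
  have gi: "g integrable_on {0..1}" by (rule abs_integrable_imp_integrable[OF primitive_abs_int[OF pg]])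
  have "q 1 \<bullet> (y 1 - x 1) - integral {0..1} f = integral {0..1} g - integral {0..1} f"
    using primitive_diff[OF pg, of 0 1] assms(3) by (simp add: \<xi>_def)
  also have "\<dots> = integral {0..1} (\<lambda>t. g t - f t)" by (rule integral_diff[OF gi fi, symmetric])
  finally have eq: "q 1 \<bullet> (y 1 - x 1) - integral {0..1} f = integral {0..1} (\<lambda>t. g t - f t)" .
  have "norm (integral {0..1} (\<lambda>t. g t - f t)) \<le>
      integral {0..1} (\<lambda>t. Q * L * (deviation_const U * V)\<^sup>2 * norm (u t) + Q * L * (deviation_const U * V) * norm (v t))"
  proof (rule integral_norm_bound_integral)
    show "(\<lambda>t. g t - f t) integrable_on {0..1}" by (rule integrable_diff[OF gi fi])
    show "(\<lambda>t. Q * L * (deviation_const U * V)\<^sup>2 * norm (u t) + Q * L * (deviation_const U * V) * norm (v t)) integrable_on {0..1}"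
      by (intro integrable_add integrable_on_mult_right nu nv)
    fix t :: real assume t: "t \<in> {0..1}"
    note xB = xp(3)[OF t] and yB = yp(3)[OF t]
    have 1: "tr (DF (x t) (u t)) (q t) \<bullet> \<xi> t = q t \<bullet> DF (x t) (u t) (\<xi> t)"
      by (rule tr_inner[OF DF_lin2[OF xB]])
    have 2: "f t = q t \<bullet> F (x t) (v t)" unfolding f_def by (rule tr_inner[OF F_lin])
    have 3: "F (y t) (w t) = F (y t) (u t) + F (y t) (v t)"
      using linear_add[OF F_lin, of "y t" "u t" "v t"] by (simp add: v_def)
    \<comment> \<open>The term with \<open>DF\<close> is supplied by the derivative of
      \<open>q\<close> through the transpose. After removal of \<open>f\<close>, only a Taylor
      remainder and a product of two perturbations are left.\<close>
    have "g t - f t = q t \<bullet> ((F (y t) (u t) - F (x t) (u t) - DF (x t) (u t) (\<xi> t)) + (F (y t) (v t) - F (x t) (v t)))"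
      unfolding g_def 2 3 using 1 by (simp add: inner_add_right inner_diff_right)
    then have "norm (g t - f t) \<le> norm (q t) * norm ((F (y t) (u t) - F (x t) (u t) - DF (x t) (u t) (\<xi> t)) + (F (y t) (v t) - F (x t) (v t)))"
      by (simp add: Cauchy_Schwarz_ineq2)
    also have "\<dots> \<le> Q * (L * norm (u t) * (deviation_const U * V)\<^sup>2 + L * norm (v t) * (deviation_const U * V))"
    proof (intro mult_mono Q t order_trans[OF norm_triangle_ineq] add_mono)
      have "norm (F (y t) (u t) - F (x t) (u t) - DF (x t) (u t) (\<xi> t)) \<le> L * norm (u t) * (norm (\<xi> t))\<^sup>2"
        unfolding \<xi>_def by (rule F_taylor[OF xB yB])
      also have "\<dots> \<le> L * norm (u t) * (deviation_const U * V)\<^sup>2"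
        using \<xi>[OF t] L by (intro mult_left_mono power_mono) auto
      finally show "norm (F (y t) (u t) - F (x t) (u t) - DF (x t) (u t) (\<xi> t)) \<le> L * norm (u t) * (deviation_const U * V)\<^sup>2" .
      have "norm (F (y t) (v t) - F (x t) (v t)) \<le> L * norm (v t) * norm (\<xi> t)"
        unfolding \<xi>_def by (rule F_lip[OF yB xB])
      also have "\<dots> \<le> L * norm (v t) * (deviation_const U * V)"
        using \<xi>[OF t] L by (intro mult_left_mono) auto
      finally show "norm (F (y t) (v t) - F (x t) (v t)) \<le> L * norm (v t) * (deviation_const U * V)" .
    qed (use Q0 in auto)
    also have "\<dots> = Q * L * (deviation_const U * V)\<^sup>2 * norm (u t) + Q * L * (deviation_const U * V) * norm (v t)"
      by (simp add: algebra_simps)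
    finally show "norm (g t - f t) \<le> Q * L * (deviation_const U * V)\<^sup>2 * norm (u t) + Q * L * (deviation_const U * V) * norm (v t)" .
  qed
  also have "\<dots> = Q * L * (deviation_const U * V)\<^sup>2 * integral {0..1} (\<lambda>t. norm (u t)) + Q * L * (deviation_const U * V) * integral {0..1} (\<lambda>t. norm (v t))"
    by (subst integral_add) (use nu nv in \<open>auto intro: integrable_on_mult_right\<close>)
  also have "\<dots> \<le> Q * L * (deviation_const U * V)\<^sup>2 * U + Q * L * (deviation_const U * V) * V"
  proof -
    have "integral {0..1} (\<lambda>t. norm (v t)) = V" by (simp add: V_def v_def)
    then show ?thesis using U Q0 L G0 V0 by (simp add: mult_left_mono)
  qed
  also have "\<dots> = Q * expansion_const U * V\<^sup>2"
    by (simp add: expansion_const_def power2_eq_square algebra_simps)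
  finally have "\<bar>q 1 \<bullet> (y 1 - x 1) - integral {0..1} f\<bar> \<le> Q * expansion_const U * V\<^sup>2" using eq by simp
  then show ?thesis unfolding f_def v_def V_def .
qed

end

section \<open>Perturbation of the end point with an energy estimate\<close>

lemma integral_le_const:
  fixes f :: "real \<Rightarrow> real"
  assumes "f integrable_on {0..1}" "\<And>t. t \<in> {0..1} \<Longrightarrow> f t \<le> c"
  shows "integral {0..1} f \<le> c"
proof -
  have "integral {0..1} f \<le> integral {0..1::real} (\<lambda>t. c)" by (rule Henstock_Kurzweil_Integration.integral_le) (use assms in auto)
  then show ?thesis by simp
qed

context control_system
begin

text \<open>Reached by the controls \<open>u + F(x)\<^sup>T q\<close>, \<open>q\<close> in the space of adjoint solutions; the end-point equation is solved
  by Brouwer's theorem after inverting the Gram matrix \<open>W\<close>, whose lower bound is \<open>\<kappa>\<close>.\<close>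

theorem endpoint_perturbation:
  assumes r: "r > 0" and s: "s > 0" and \<kappa>: "\<kappa> > 0"
  obtains C \<delta> where "C > 0" "\<delta> > 0"
    "\<And>x u. \<lbrakk>is_traj F B u x; \<And>t. t \<in> {0..1} \<Longrightarrow> norm (u t) \<le> r; norm (x 0 - p0) + M * (r + s) \<le> R;
       \<And>q. adj_sol u x q \<Longrightarrow> \<kappa> * (norm (q 1))\<^sup>2 \<le> integral {0..1} (\<lambda>t. (norm (tr (F (x t)) (q t)))\<^sup>2)\<rbrakk> \<Longrightarrow>
     \<exists>P. norm P \<le> C \<and> (\<forall>z. norm (z - x 1) < \<delta> \<longrightarrow> (\<exists>w y. is_traj F B w y \<and> y 0 = x 0 \<and> y 1 = z \<and>
        (\<lambda>t. (norm (w t))\<^sup>2) integrable_on {0..1} \<and>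
        integral {0..1} (\<lambda>t. (norm (w t))\<^sup>2) \<le> r\<^sup>2 + P \<bullet> (z - x 1) + C * (norm (z - x 1))\<^sup>2))"
proof -
  \<comment> \<open>\<open>Q\<close> bounds adjoint solutions and \<open>K\<close> the controls made
    from them, both per unit of |q(1)|; \<open>C4\<close> bounds the second-order error of the end
    point, the dimension counting its coordinates. The terms of \<open>C\<close> dominate, in order,
    the norm of \<open>P\<close>, the energy shift caused by the second-order error, and the energy
    of the added control. The two parts of \<open>\<delta>\<close> keep the parameter
    \<open>a\<close> below \<open>s / K\<close>, where the trajectory stays in \<open>B\<close>, and
    make the fixed-point map preserve its ball.\<close>
  define Q where "Q = 2 * exp (2 * L * r)"
  define K where "K = M * Q"
  define C4 where "C4 = real DIM('e) * (Q * expansion_const r * K\<^sup>2) + 1"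
  define C where "C = 2 * r * K / \<kappa> + 8 * r * K * C4 / \<kappa> ^ 3 + 4 * K\<^sup>2 / \<kappa>\<^sup>2 + 1"
  define \<delta> where "\<delta> = min (\<kappa> * s / (2 * K)) (\<kappa>\<^sup>2 / (4 * C4))"
  have Q: "Q > 0" and K: "K > 0" using M by (auto simp: Q_def K_def)
  have dev_pos: "deviation_const U > 0" for U using M by (simp add: deviation_const_def)
  have err_pos: "expansion_const r > 0" using dev_pos[of r] L r by (simp add: expansion_const_def add_pos_pos)
  have C4: "C4 > 0" using Q err_pos by (simp add: C4_def add_nonneg_pos)
  have C: "C > 0" unfolding C_def using r K C4 \<kappa> by (intro add_nonneg_pos add_nonneg_nonneg) auto
  have \<delta>: "\<delta> > 0" unfolding \<delta>_def using \<kappa> K C4 s by simp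
  show ?thesis
  proof (rule that[OF C \<delta>])
    fix x u
    assume x: "is_traj F B u x" and u: "\<And>t. t \<in> {0..1} \<Longrightarrow> norm (u t) \<le> r"
      and x0: "norm (x 0 - p0) + M * (r + s) \<le> R"
      and nondeg: "\<And>q. adj_sol u x q \<Longrightarrow> \<kappa> * (norm (q 1))\<^sup>2 \<le> integral {0..1} (\<lambda>t. (norm (tr (F (x t)) (q t)))\<^sup>2)"
    note xp = traj_parts[OF x]
    have nu: "(\<lambda>t. norm (u t)) integrable_on {0..1}"
      using abs_integrable_norm[OF xp(2)] by (rule abs_integrable_imp_integrable)
    have U: "integral {0..1} (\<lambda>t. norm (u t)) \<le> r"
      using integral_le_const[OF nu, where c = r] u by simp
    have "\<exists>q. adj_sol u x q \<and> q 1 = b" for b using adj_exists[OF x] by blast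
    then obtain qb where qb: "\<And>b. adj_sol u x (qb b)" "\<And>b. qb b 1 = b" by metis
    define q where "q a t = (\<Sum>b\<in>Basis. (a \<bullet> b) *\<^sub>R qb b t)" for a t
    have q_adj: "adj_sol u x (q a)" for a unfolding q_def by (rule adj_lincomb) (rule qb)
    have q_1: "q a 1 = a" for a by (simp add: q_def qb(2) euclidean_representation)
    have q_norm: "norm (q a t) \<le> Q * norm a" if "t \<in> {0..1}" for a t
      using adj_bound[OF x q_adj U that, of a] by (simp add: Q_def q_1)
    have q_cont: "continuous_on {0..1} (q a)" for a
      using q_adj primitive_continuous unfolding adj_sol_def by blast
    have q_lin: "linear (\<lambda>a. q a t)" for t
      by (rule linearI) (simp_all add: q_def inner_add_left scaleR_add_left sum.distrib scaleR_sum_right)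
    define v where "v a t = tr (F (x t)) (q a t)" for a t
    have v_cont: "continuous_on {0..1} (v a)" for a unfolding v_def by (rule tr_F_cont[OF x q_cont])
    have v_abs: "v a absolutely_integrable_on {0..1}" for a
      by (rule absolutely_integrable_continuous_real[OF v_cont])
    have v_norm: "norm (v a t) \<le> K * norm a" if t: "t \<in> {0..1}" for a t
    proof -
      have "norm (v a t) \<le> M * norm (q a t)" unfolding v_def by (rule tr_F_norm[OF xp(3)[OF t]])
      also have "\<dots> \<le> M * (Q * norm a)" using q_norm[OF t] M by (intro mult_left_mono) auto
      finally show ?thesis by (simp add: K_def)
    qed
    have v_lin: "linear (\<lambda>a. v a t)" for t
      unfolding v_def using linear_compose[OF q_lin tr_linear] by (simp add: o_def)
    have v_int: "integral {0..1} (\<lambda>t. norm (v a t)) \<le> K * norm a" for a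
      using integral_le_const[OF abs_integrable_imp_integrable[OF abs_integrable_norm[OF v_abs]], where c = "K * norm a"]
        v_norm by simp
    have vv_int: "(\<lambda>t. v a t \<bullet> v b t) integrable_on {0..1}" for a b
      by (intro integrable_continuous_real continuous_intros v_cont)
    have uv_int: "(\<lambda>t. u t \<bullet> v a t) integrable_on {0..1}" for a
      using abs_integrable_imp_integrable[OF abs_integrable_continuous_mult[OF bounded_bilinear_inner v_cont xp(2)]]
      by (simp add: inner_commute)
    \<comment> \<open>\<open>W\<close> is the Gram matrix of the controls \<open>v b\<close>; it is
      also the linear part of the end point as a function of the parameter \<open>a\<close>.\<close>
    define W where "W a = (\<Sum>b\<in>Basis. integral {0..1} (\<lambda>t. v b t \<bullet> v a t) *\<^sub>R b)" for a
    have int_lin: "linear (\<lambda>a. integral {0..1} (\<lambda>t. g t \<bullet> v a t))"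
      if "\<And>a. (\<lambda>t. g t \<bullet> v a t) integrable_on {0..1}" for g
      by (rule linearI)
        (simp_all add: linear_add[OF v_lin] linear_cmul[OF v_lin] inner_add_right integral_add that integral_mult_right)
    have W_lin: "linear W"
      unfolding W_def
      by (intro linear_compose_sum ballI linearI)
        (simp_all add: linear_add[OF int_lin[OF vv_int]] linear_cmul[OF int_lin[OF vv_int]] scaleR_add_left)
    have W_inner: "b \<bullet> W a = integral {0..1} (\<lambda>t. v b t \<bullet> v a t)" if "b \<in> Basis" for a b
      using that by (simp add: W_def inner_sum_right inner_Basis if_distrib sum.delta cong: if_cong)
    have W_pos: "\<kappa> * (norm a)\<^sup>2 \<le> a \<bullet> W a" for a
    proof -
      have "a \<bullet> W a = (\<Sum>b\<in>Basis. (a \<bullet> b) * integral {0..1} (\<lambda>t. v a t \<bullet> v b t))"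
        unfolding W_def by (simp add: inner_sum_right mult.commute inner_commute)
      also have "\<dots> = integral {0..1} (\<lambda>t. v a t \<bullet> v (\<Sum>b\<in>Basis. (a \<bullet> b) *\<^sub>R b) t)"
        by (subst linear_sum[OF int_lin[OF vv_int], unfolded o_def])
          (simp add: linear_cmul[OF int_lin[OF vv_int]])
      also have "\<dots> = integral {0..1} (\<lambda>t. (norm (v a t))\<^sup>2)"
        by (simp add: euclidean_representation power2_norm_eq_inner)
      finally show ?thesis using nondeg[OF q_adj, of a] by (simp add: q_1 v_def)
    qed
    have W_norm: "\<kappa> * norm a \<le> norm (W a)" for a
    proof (cases "a = 0")
      case False
      have "\<kappa> * (norm a)\<^sup>2 \<le> norm a * norm (W a)" using W_pos[of a] norm_cauchy_schwarz[of a "W a"] by simp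
      then have "norm a * (\<kappa> * norm a) \<le> norm a * norm (W a)" by (simp add: power2_eq_square mult_ac)
      then show ?thesis using False by simp
    qed simp
    have "inj W"
      unfolding linear_injective_0[OF W_lin]
    proof (intro allI impI)
      fix a assume "W a = 0"
      then have "norm a \<le> 0" using W_norm[of a] \<kappa> by (simp add: mult_le_0_iff)
      then show "a = 0" by simp
    qed
    then obtain Wi where Wi: "linear Wi" "\<And>a. Wi (W a) = a" "\<And>h. W (Wi h) = h"
      using linear_injective_isomorphism[OF W_lin] by blast
    have Wi_norm: "norm (Wi h) \<le> norm h / \<kappa>" for h
      using W_norm[of "Wi h"] \<kappa> Wi(3)[of h] by (simp add: field_simps)
    have "\<exists>y. is_traj F B (\<lambda>t. u t + v a t) y \<and> y 0 = x 0" if a: "norm a \<le> s / K" for a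
    proof -
      have w: "(\<lambda>t. u t + v a t) absolutely_integrable_on {0..1}" by (rule set_integral_add(1)[OF xp(2) v_abs])
      have "K * norm a \<le> s" using a K by (simp add: field_simps)
      then have "norm (u t + v a t) \<le> r + s" if "t \<in> {0..1}" for t
        using u[OF that] v_norm[OF that, of a] norm_triangle_ineq[of "u t" "v a t"] by simp
      then have "integral {0..1} (\<lambda>t. norm (u t + v a t)) \<le> r + s"
        using integral_le_const[OF abs_integrable_imp_integrable[OF abs_integrable_norm[OF w]], where c = "r + s"] by simp
      then have "norm (x 0 - p0) + M * integral {0..1} (\<lambda>t. norm (u t + v a t)) \<le> R"
        using x0 M by (smt (verit) mult_left_mono)
      from traj_exists[OF w this] show ?thesis by blast
    qed
    then obtain Y where Y: "\<And>a. norm a \<le> s / K \<Longrightarrow> is_traj F B (\<lambda>t. u t + v a t) (Y a)"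
      "\<And>a. norm a \<le> s / K \<Longrightarrow> Y a 0 = x 0" by metis
    have E_est: "norm (Y a 1 - x 1 - W a) \<le> C4 * (norm a)\<^sup>2" if a: "norm a \<le> s / K" for a
    proof -
      have b: "\<bar>(Y a 1 - x 1 - W a) \<bullet> b\<bar> \<le> Q * expansion_const r * (K * norm a)\<^sup>2" if b: "b \<in> Basis" for b
      proof -
        have "\<bar>q b 1 \<bullet> (Y a 1 - x 1) - integral {0..1} (\<lambda>t. tr (F (x t)) (q b t) \<bullet> (u t + v a t - u t))\<bar>
            \<le> Q * expansion_const r * (integral {0..1} (\<lambda>t. norm (u t + v a t - u t)))\<^sup>2"
          by (rule endpoint_expansion[OF x Y(1)[OF a] _ q_adj U]) (use q_norm[of _ b] b Y(2)[OF a] in auto)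
        also have "\<dots> \<le> Q * expansion_const r * (K * norm a)\<^sup>2"
          using v_int[of a] Q err_pos Henstock_Kurzweil_Integration.integral_nonneg[OF abs_integrable_imp_integrable[OF abs_integrable_norm[OF v_abs[of a]]]]
          by (intro mult_left_mono power_mono) auto
        finally show ?thesis using W_inner[OF b, of a]
          by (simp add: q_1 v_def inner_diff_left inner_diff_right inner_commute)
      qed
      have "norm (Y a 1 - x 1 - W a) \<le> (\<Sum>b\<in>Basis. \<bar>(Y a 1 - x 1 - W a) \<bullet> b\<bar>)" by (rule norm_le_l1)
      also have "\<dots> \<le> real DIM('e) * (Q * expansion_const r * (K * norm a)\<^sup>2)"
        using b by (intro sum_bounded_above) auto
      also have "\<dots> \<le> C4 * (norm a)\<^sup>2"
        by (simp add: C4_def power_mult_distrib algebra_simps)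
      finally show ?thesis .
    qed
    have E_lip: "norm (Y a 1 - Y a' 1) \<le> deviation_const (r + s) * K * norm (a - a')" if a: "norm a \<le> s / K" "norm a' \<le> s / K" for a a'
    proof -
      have "K * norm a' \<le> s" using a(2) K by (simp add: field_simps)
      then have "norm (u t + v a' t) \<le> r + s" if "t \<in> {0..1}" for t
        using u[OF that] v_norm[OF that, of a'] norm_triangle_ineq[of "u t" "v a' t"] by simp
      then have "integral {0..1} (\<lambda>t. norm (u t + v a' t)) \<le> r + s"
        using integral_le_const[OF abs_integrable_imp_integrable[OF abs_integrable_norm[OF traj_parts(2)[OF Y(1)[OF a(2)]]]], where c = "r + s"] by simp
      from traj_gronwall[OF Y(1)[OF a(2)] Y(1)[OF a(1)] _ this, of 1] Y(2) a
      have "norm (Y a 1 - Y a' 1) \<le> deviation_const (r + s) * integral {0..1} (\<lambda>t. norm (u t + v a t - (u t + v a' t)))" by simp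
      also have "(\<lambda>t. norm (u t + v a t - (u t + v a' t))) = (\<lambda>t. norm (v (a - a') t))"
        by (simp add: linear_diff[OF v_lin])
      also have "deviation_const (r + s) * integral {0..1} (\<lambda>t. norm (v (a - a') t)) \<le> deviation_const (r + s) * (K * norm (a - a'))"
        using dev_pos[of "r + s"] by (intro mult_left_mono v_int) auto
      finally show ?thesis by (simp add: mult_ac)
    qed
    \<comment> \<open>The cross term in the energy of \<open>u + v a\<close>. Composed with the
      inverse of \<open>W\<close> it is a linear functional of the displacement of the end point,
      and \<open>P\<close> represents it.\<close>
    define lf where "lf a = 2 * integral {0..1} (\<lambda>t. u t \<bullet> v a t)" for a
    have lf_lin: "linear lf"
      unfolding lf_def using linear_compose_scale_right[OF int_lin[OF uv_int], of 2] by simp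
    have lf_norm: "\<bar>lf a\<bar> \<le> 2 * r * K * norm a" for a
    proof -
      have "norm (integral {0..1} (\<lambda>t. u t \<bullet> v a t)) \<le> integral {0..1::real} (\<lambda>t. r * (K * norm a))"
      proof (rule integral_norm_bound_integral[OF uv_int])
        fix t :: real assume t: "t \<in> {0..1}"
        have "norm (u t \<bullet> v a t) \<le> norm (u t) * norm (v a t)" by (simp add: Cauchy_Schwarz_ineq2)
        also have "\<dots> \<le> r * (K * norm a)" using u[OF t] v_norm[OF t, of a] r by (intro mult_mono) auto
        finally show "norm (u t \<bullet> v a t) \<le> r * (K * norm a)" .
      qed auto
      then show ?thesis by (simp add: lf_def)
    qed
    define P where "P = tr (\<lambda>h. lf (Wi h)) (1::real)"
    have lfWi_lin: "linear (\<lambda>h. lf (Wi h))" using linear_compose[OF Wi(1) lf_lin] by (simp add: o_def)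
    have P_inner: "P \<bullet> h = lf (Wi h)" for h unfolding P_def using tr_inner[OF lfWi_lin, of 1 h] by simp
    have P_norm: "norm P \<le> 2 * r * K / \<kappa>"
    proof -
      have "norm P \<le> 2 * r * K / \<kappa> * norm (1::real)" unfolding P_def
      proof (rule tr_norm[OF lfWi_lin])
        fix h
        have "norm (lf (Wi h)) \<le> 2 * r * K * norm (Wi h)" using lf_norm by simp
        also have "\<dots> \<le> 2 * r * K * (norm h / \<kappa>)" using Wi_norm r K by (intro mult_left_mono) auto
        finally show "norm (lf (Wi h)) \<le> 2 * r * K / \<kappa> * norm h" by simp
      qed
      then show ?thesis by simp
    qed
    show "\<exists>P. norm P \<le> C \<and> (\<forall>z. norm (z - x 1) < \<delta> \<longrightarrow> (\<exists>w y. is_traj F B w y \<and> y 0 = x 0 \<and> y 1 = z \<and>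
        (\<lambda>t. (norm (w t))\<^sup>2) integrable_on {0..1} \<and>
        integral {0..1} (\<lambda>t. (norm (w t))\<^sup>2) \<le> r\<^sup>2 + P \<bullet> (z - x 1) + C * (norm (z - x 1))\<^sup>2))"
    proof (intro exI[of _ P] conjI allI impI)
      have nn: "0 \<le> 8 * r * K * C4 / \<kappa> ^ 3" "0 \<le> 4 * K\<^sup>2 / \<kappa>\<^sup>2" using r K C4 \<kappa> by auto
      show "norm P \<le> C" using P_norm nn unfolding C_def by linarith
      fix z assume z: "norm (z - x 1) < \<delta>"
      define h where "h = z - x 1"
      define \<rho> where "\<rho> = 2 * norm h / \<kappa>"
      have h1: "norm h \<le> \<kappa> * s / (2 * K)" "norm h \<le> \<kappa>\<^sup>2 / (4 * C4)" using z by (auto simp: h_def \<delta>_def)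
      have \<rho>0: "\<rho> \<ge> 0" using \<kappa> by (simp add: \<rho>_def)
      have \<rho>K: "\<rho> \<le> s / K" using h1(1) \<kappa> K by (simp add: \<rho>_def field_simps)
      have \<rho>C: "C4 * \<rho>\<^sup>2 \<le> norm h"
      proof -
        have "C4 * \<rho>\<^sup>2 = (norm h * (4 * C4) / \<kappa>\<^sup>2) * norm h" using \<kappa> by (simp add: \<rho>_def power2_eq_square field_simps)
        also have "\<dots> \<le> 1 * norm h" using h1(2) \<kappa> C4 by (intro mult_right_mono) (auto simp: field_simps)
        finally show ?thesis by simp
      qed
      have inK: "norm a \<le> s / K" if "a \<in> cball 0 \<rho>" for a using that \<rho>K by simp
      \<comment> \<open>Reaching \<open>z\<close> means that \<open>W a\<close> equals the
        displacement \<open>h\<close> minus the second-order error, which is the fixed-point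
        equation of \<open>T\<close>. The radius 2|h|/\<kappa> leaves room for an error as large as
        |h|.\<close>
      define T where "T a = Wi (h - (Y a 1 - x 1 - W a))" for a
      obtain a where a: "a \<in> cball 0 \<rho>" "T a = a"
      proof (rule brouwer[of "cball 0 \<rho>" T])
        show "cball 0 \<rho> \<noteq> ({} :: 'e set)" using \<rho>0 by simp
        have "continuous_on (cball 0 \<rho>) (\<lambda>a. Y a 1)"
        proof (rule lipschitz_on_continuous_on[where L = "deviation_const (r + s) * K"], rule lipschitz_onI)
          show "dist (Y a 1) (Y a' 1) \<le> deviation_const (r + s) * K * dist a a'" if "a \<in> cball 0 \<rho>" "a' \<in> cball 0 \<rho>" for a a'
            using E_lip[OF inK[OF that(1)] inK[OF that(2)]] by (simp add: dist_norm)
        qed (use dev_pos[of "r + s"] K in simp)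
        then show "continuous_on (cball 0 \<rho>) T"
          unfolding T_def
          by (intro continuous_on_compose2[OF linear_continuous_on[of Wi UNIV]] continuous_intros linear_continuous_on[of W])
            (use Wi(1) W_lin linear_conv_bounded_linear in auto)
        show "T \<in> cball 0 \<rho> \<rightarrow> cball 0 \<rho>"
        proof
          fix a assume a: "a \<in> cball (0::'e) \<rho>"
          have "norm (h - (Y a 1 - x 1 - W a)) \<le> norm h + norm (Y a 1 - x 1 - W a)" by (rule norm_triangle_ineq4)
          also have "\<dots> \<le> norm h + C4 * \<rho>\<^sup>2"
            using E_est[OF inK[OF a]] a C4 by (smt (verit) mem_cball_0 mult_left_mono norm_ge_zero power_mono)
          also have "\<dots> \<le> 2 * norm h" using \<rho>C by simp
          finally have "norm (h - (Y a 1 - x 1 - W a)) / \<kappa> \<le> \<rho>"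
            using \<kappa> by (simp add: \<rho>_def divide_right_mono)
          then show "T a \<in> cball 0 \<rho>" using Wi_norm[of "h - (Y a 1 - x 1 - W a)"] by (simp add: T_def)
        qed
      qed auto
      note aK = inK[OF a(1)]
      have "W a = h - (Y a 1 - x 1 - W a)" using a(2) Wi(3) unfolding T_def by metis
      then have Yz: "Y a 1 = z" by (simp add: h_def algebra_simps)
      have an: "norm a \<le> \<rho>" using a by simp
      \<comment> \<open>The parameter found is the linear solution \<open>Wi h\<close> up to second
        order, so replacing \<open>lf a\<close> by P \<bullet> h costs only a multiple of
        |h|^2.\<close>
      have a_diff: "norm (a - Wi h) \<le> C4 * \<rho>\<^sup>2 / \<kappa>"
      proof -
        have "a = Wi h - Wi (Y a 1 - x 1 - W a)"
          using a(2) unfolding T_def by (simp add: linear_diff[OF Wi(1)])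
        then have "norm (a - Wi h) = norm (Wi (Y a 1 - x 1 - W a))"
          by (metis norm_minus_cancel add_diff_cancel_left' diff_add_cancel minus_diff_eq)
        also have "\<dots> \<le> norm (Y a 1 - x 1 - W a) / \<kappa>" by (rule Wi_norm)
        also have "\<dots> \<le> C4 * \<rho>\<^sup>2 / \<kappa>"
          using E_est[OF aK] an C4 \<kappa> by (intro divide_right_mono) (smt (verit) mult_left_mono norm_ge_zero power_mono, simp)
        finally show ?thesis .
      qed
      have uu_int: "(\<lambda>t. (norm (u t))\<^sup>2) integrable_on {0..1}"
      proof -
        have "u \<in> borel_measurable (lebesgue_on {0..1})"
          by (intro integrable_imp_measurable abs_integrable_imp_integrable xp(2))
        then have "(\<lambda>t. (norm (u t))\<^sup>2) absolutely_integrable_on {0..1}"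
          by (intro bounded_measurable_abs_integrable[where r = "r\<^sup>2"]) (use u r in \<open>auto intro!: power_mono\<close>)
        then show ?thesis by (rule abs_integrable_imp_integrable)
      qed
      have eq: "(norm (u t + v a t))\<^sup>2 = (norm (u t))\<^sup>2 + 2 * (u t \<bullet> v a t) + v a t \<bullet> v a t" for t
        by (simp add: power2_norm_eq_inner inner_add_left inner_add_right inner_commute)
      have ww_int: "(\<lambda>t. (norm (u t + v a t))\<^sup>2) integrable_on {0..1}"
        unfolding eq by (intro integrable_add uu_int integrable_on_mult_right uv_int vv_int)
      have "integral {0..1} (\<lambda>t. (norm (u t + v a t))\<^sup>2) =
          integral {0..1} (\<lambda>t. (norm (u t))\<^sup>2) + lf a + integral {0..1} (\<lambda>t. v a t \<bullet> v a t)"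
        unfolding eq lf_def
        by (simp add: integral_add integrable_add uu_int integrable_on_mult_right uv_int vv_int integral_mult_right)
      also have "integral {0..1} (\<lambda>t. (norm (u t))\<^sup>2) \<le> r\<^sup>2"
        using integral_le_const[OF uu_int, where c = "r\<^sup>2"] u by (simp add: power_mono)
      also have "integral {0..1} (\<lambda>t. v a t \<bullet> v a t) \<le> (K * \<rho>)\<^sup>2"
      proof -
        have "v a t \<bullet> v a t \<le> (K * \<rho>)\<^sup>2" if "t \<in> {0..1}" for t
        proof -
          have "norm (v a t) \<le> K * \<rho>"
            using order_trans[OF v_norm[OF that] mult_left_mono[OF an]] K by simp
          then show ?thesis unfolding power2_norm_eq_inner[symmetric] by (intro power_mono) auto
        qed
        then show ?thesis using integral_le_const[OF vv_int[of a a], where c = "(K * \<rho>)\<^sup>2"] by simp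
      qed
      also have "lf a = P \<bullet> h + lf (a - Wi h)"
        unfolding P_inner by (simp add: linear_diff[OF lf_lin])
      also have "lf (a - Wi h) \<le> 2 * r * K * (C4 * \<rho>\<^sup>2 / \<kappa>)"
      proof -
        have "0 \<le> 2 * r * K" using r K by simp
        from mult_left_mono[OF a_diff this] lf_norm[of "a - Wi h"] show ?thesis by linarith
      qed
      finally have "integral {0..1} (\<lambda>t. (norm (u t + v a t))\<^sup>2) \<le> r\<^sup>2 + (P \<bullet> h + 2 * r * K * (C4 * \<rho>\<^sup>2 / \<kappa>)) + (K * \<rho>)\<^sup>2"
        by simp
      also have "\<dots> = r\<^sup>2 + P \<bullet> h + (8 * r * K * C4 / \<kappa> ^ 3 + 4 * K\<^sup>2 / \<kappa>\<^sup>2) * (norm h)\<^sup>2"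
        using \<kappa> by (simp add: \<rho>_def power2_eq_square power3_eq_cube field_simps)
      also have "\<dots> \<le> r\<^sup>2 + P \<bullet> h + C * (norm h)\<^sup>2"
      proof -
        have "0 \<le> 2 * r * K / \<kappa>" using r K \<kappa> by simp
        then have "8 * r * K * C4 / \<kappa> ^ 3 + 4 * K\<^sup>2 / \<kappa>\<^sup>2 \<le> C" unfolding C_def by linarith
        then show ?thesis by (intro add_left_mono mult_right_mono) auto
      qed
      finally show "\<exists>w y. is_traj F B w y \<and> y 0 = x 0 \<and> y 1 = z \<and>
          (\<lambda>t. (norm (w t))\<^sup>2) integrable_on {0..1} \<and>
          integral {0..1} (\<lambda>t. (norm (w t))\<^sup>2) \<le> r\<^sup>2 + P \<bullet> (z - x 1) + C * (norm (z - x 1))\<^sup>2"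
        using Y(1)[OF aK] Y(2)[OF aK] Yz ww_int unfolding h_def by blast
    qed
  qed
qed

end

section \<open>Uniform nondegeneracy by compactness\<close>

lemma norm_fst_snd_le: "norm (fst z) \<le> norm z" "norm (snd z) \<le> norm z"
  by (cases z; simp add: norm_fst_le norm_snd_le)+

context control_system
begin

text \<open>The adjoint equation is adjoined to the state equation, so that compactness applies to both at once.\<close>

definition adjoined_F :: "'e \<times> 'e \<Rightarrow> 'u \<Rightarrow> 'e \<times> 'e" where
  "adjoined_F z u = (F (fst z) u, - tr (DF (fst z) u) (snd z))"

lemma adjoined_F_lin: "linear (adjoined_F z)"
  by (rule linearI)
    (simp_all add: adjoined_F_def linear_add[OF F_lin] linear_cmul[OF F_lin] linear_add[OF adj_family(1)[of z]] linear_cmul[OF adj_family(1)[of z]])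

lemma adjoined_F_cont: "continuous_on (B \<times> T) (\<lambda>z. adjoined_F z c)"
  unfolding adjoined_F_def
  by (intro continuous_intros continuous_on_compose2[OF F_cont] adj_family(2)) auto

lemma norm_Pair_le: "norm (x, y) \<le> norm x + norm y"
  by (simp add: norm_Pair sqrt_sum_squares_le_sum)

lemma adjoined_F_bnd:
  assumes "z \<in> B \<times> cball 0 Q" "0 \<le> Q" shows "norm (adjoined_F z u) \<le> (M + L * Q) * norm u"
proof -
  have z: "fst z \<in> B" "norm (snd z) \<le> Q" using assms by auto
  have "norm (adjoined_F z u) \<le> norm (F (fst z) u) + norm (tr (DF (fst z) u) (snd z))"
    unfolding adjoined_F_def using norm_Pair_le[of "F (fst z) u" "- tr (DF (fst z) u) (snd z)"] by simp
  also have "\<dots> \<le> M * norm u + L * norm u * Q"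
    using z L by (intro add_mono F_bnd order_trans[OF adj_norm] mult_left_mono) auto
  finally show ?thesis by (simp add: algebra_simps)
qed

lemma tr_diff: "tr (\<lambda>v. f v - g v) z = tr f z - tr g z"
  by (simp add: tr_def inner_diff_right scaleR_diff_left sum_subtractf)

lemma adjoined_F_lip:
  assumes "z \<in> B \<times> cball 0 Q" "z' \<in> B \<times> cball 0 Q" "0 \<le> Q"
  shows "norm (adjoined_F z u - adjoined_F z' u) \<le> (2 * L + L * Q) * norm u * norm (z - z')"
proof -
  have z: "fst z \<in> B" "fst z' \<in> B" "norm (snd z) \<le> Q" "norm (snd z') \<le> Q" using assms by auto
  have le: "norm (fst z - fst z') \<le> norm (z - z')" "norm (snd z - snd z') \<le> norm (z - z')"
    using norm_fst_snd_le[of "z - z'"] by simp_all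
  define T where "T = tr (DF (fst z) u) (snd z) - tr (DF (fst z') u) (snd z')"
  have Teq: "T = tr (\<lambda>v. DF (fst z) u v - DF (fst z') u v) (snd z) + tr (DF (fst z') u) (snd z - snd z')"
    unfolding T_def tr_diff by (simp add: linear_diff[OF tr_linear])
  have n1: "norm (tr (\<lambda>v. DF (fst z) u v - DF (fst z') u v) (snd z)) \<le> (L * norm u * norm (z - z')) * norm (snd z)"
  proof (rule tr_norm)
    show "linear (\<lambda>v. DF (fst z) u v - DF (fst z') u v)" by (intro linear_compose_sub DF_lin2 z)
    fix v
    have "norm (DF (fst z) u v - DF (fst z') u v) \<le> L * norm u * norm (fst z - fst z') * norm v" by (rule DF_lip[OF z(1,2)])
    also have "\<dots> \<le> L * norm u * norm (z - z') * norm v"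
      using le L by (intro mult_right_mono mult_left_mono) auto
    finally show "norm (DF (fst z) u v - DF (fst z') u v) \<le> L * norm u * norm (z - z') * norm v" .
  qed
  have n2: "norm (tr (DF (fst z') u) (snd z - snd z')) \<le> L * norm u * norm (snd z - snd z')" by (rule adj_norm[OF z(2)])
  have "norm T \<le> norm (tr (\<lambda>v. DF (fst z) u v - DF (fst z') u v) (snd z)) + norm (tr (DF (fst z') u) (snd z - snd z'))"
    unfolding Teq by (rule norm_triangle_ineq)
  also have "\<dots> \<le> L * norm u * norm (z - z') * norm (snd z) + L * norm u * norm (snd z - snd z')"
    by (rule add_mono[OF n1 n2])
  also have "\<dots> \<le> L * norm u * norm (z - z') * Q + L * norm u * norm (z - z')"
    using le z L by (intro add_mono mult_left_mono) auto
  finally have T: "norm T \<le> L * norm u * norm (z - z') * Q + L * norm u * norm (z - z')" .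
  have F: "norm (F (fst z) u - F (fst z') u) \<le> L * norm u * norm (z - z')"
    using F_lip[OF z(1,2), of u] le L by (smt (verit) mult_left_mono mult_nonneg_nonneg norm_ge_zero)
  have "adjoined_F z u - adjoined_F z' u = (F (fst z) u - F (fst z') u, - T)" by (simp add: adjoined_F_def T_def)
  then have "norm (adjoined_F z u - adjoined_F z' u) \<le> norm (F (fst z) u - F (fst z') u) + norm T"
    using norm_Pair_le[of "F (fst z) u - F (fst z') u" "- T"] by simp
  then show ?thesis using T F by (simp add: algebra_simps)
qed

text \<open>This takes the place of weak compactness of bounded controls: convexity of the control
  ball enters through the means in \<open>is_traj_ctraj\<close>, its compactness through
  \<open>ctraj_deriv\<close>.\<close>

theorem traj_compactness:
  assumes x: "\<And>n. is_traj F B (u n) (x n)" "\<And>n t. t \<in> {0..1} \<Longrightarrow> norm (u n t) \<le> r" and r: "0 \<le> r"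
  obtains k :: "nat \<Rightarrow> nat" and y w where "strict_mono k" "is_traj F B w y" "\<And>t. norm (w t) \<le> r"
    "\<And>t. t \<in> {0..1} \<Longrightarrow> (\<lambda>n. x (k n) t) \<longlonglongrightarrow> y t"
proof -
  have c: "ctraj F r (L * M * r\<^sup>2) (x n)" for n
    by (rule is_traj_ctraj[OF F_lin x(1) x(2) F_bnd F_lip]) (use M L r in auto)
  obtain k :: "nat \<Rightarrow> nat" and y where k: "strict_mono k" "ctraj F r (L * M * r\<^sup>2) y"
    "\<And>t. t \<in> {0..1} \<Longrightarrow> (\<lambda>n. x (k n) t) \<longlonglongrightarrow> y t" "\<And>t. t \<in> {0..1} \<Longrightarrow> y t \<in> B"
  proof (rule ctraj_compactness[where zn = x and Y = F and S = B and M = M and C = "L * M * r\<^sup>2", OF F_lin F_cont c])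
    show "x n t \<in> B" if "t \<in> {0..1}" for n t by (rule traj_parts(3)[OF x(1) that])
    show "norm (F x u) \<le> M * norm u" if "x \<in> B" for x u by (rule F_bnd[OF that])
  qed (use M L r in auto)
  obtain w where w: "is_traj F B w y" "\<And>t. norm (w t) \<le> r"
  proof (rule ctraj_is_traj[where F = F and B = B and M = M, OF F_lin F_cont _ _ _ k(2) k(4)])
    show "u = 0" if "x \<in> B" "F x u = 0" for x u by (rule F_inj[OF that])
    show "norm (F x u) \<le> M * norm u" if "x \<in> B" for x u by (rule F_bnd[OF that])
  qed (use M L r in auto)
  show ?thesis by (rule that[OF k(1) w k(3)])
qed

text \<open>If no \<kappa> works, there are adjoint solutions with |q(1)| = 1 along members of the
  family whose integrals tend to 0. The pairs (trajectory, adjoint solution) have a limit over a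
  member of the family; there the continuous function tr (F x) q vanishes identically while |q(1)| =
  1, against \<open>nonsing\<close>.\<close>

theorem uniform_nondegeneracy:
  assumes r: "0 < r"
    and traj: "\<And>x. x \<in> \<M> \<Longrightarrow> \<exists>u. is_traj F B u x \<and> (\<forall>t. norm (u t) \<le> r)"
    and closed: "\<And>xn x u. \<lbrakk>\<And>n. xn n \<in> \<M>; \<And>t. t \<in> {0..1} \<Longrightarrow> (\<lambda>n. xn n t) \<longlonglongrightarrow> x t;
        is_traj F B u x; \<And>t. norm (u t) \<le> r\<rbrakk> \<Longrightarrow> x \<in> \<M>"
    and nonsing: "\<And>x u q. \<lbrakk>x \<in> \<M>; is_traj F B u x; \<And>t. norm (u t) \<le> r; adj_sol u x q;
        \<And>t. t \<in> {0..1} \<Longrightarrow> tr (F (x t)) (q t) = 0\<rbrakk> \<Longrightarrow> q 1 = 0"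
  obtains \<kappa> where "\<kappa> > 0" "\<And>x u q. \<lbrakk>x \<in> \<M>; is_traj F B u x; \<And>t. t \<in> {0..1} \<Longrightarrow> norm (u t) \<le> r; adj_sol u x q\<rbrakk> \<Longrightarrow>
      \<kappa> * (norm (q 1))\<^sup>2 \<le> integral {0..1} (\<lambda>t. (norm (tr (F (x t)) (q t)))\<^sup>2)"
proof (rule ccontr)
  note have_thesis = that
  assume not_thesis: "\<not> thesis"
  have neg: "\<exists>x u q. x \<in> \<M> \<and> is_traj F B u x \<and> (\<forall>t\<in>{0..1}. norm (u t) \<le> r) \<and> adj_sol u x q \<and>
      integral {0..1} (\<lambda>t. (norm (tr (F (x t)) (q t)))\<^sup>2) < \<kappa> * (norm (q 1))\<^sup>2" if "\<kappa> > 0" for \<kappa>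
    using have_thesis[OF that] not_thesis by (meson not_le)
  define \<phi> where "\<phi> p = (norm (tr (F (fst p)) (snd p)))\<^sup>2" for p
  define Q where "Q = 2 * exp (2 * L * r)"
  have Q: "Q > 0" by (simp add: Q_def)
  define S where "S = B \<times> cball (0::'e) Q"
  have S: "compact S" unfolding S_def by (intro compact_Times) auto
  have \<phi>_cont: "continuous_on S \<phi>"
    unfolding \<phi>_def S_def by (intro continuous_intros continuous_on_tr continuous_on_compose2[OF F_cont]) auto
  have "\<exists>x u q. x \<in> \<M> \<and> is_traj F B u x \<and> (\<forall>t\<in>{0..1}. norm (u t) \<le> r) \<and> adj_sol u x q \<and> norm (q 1) = 1 \<and>
      integral {0..1} (\<lambda>t. \<phi> (x t, q t)) < 1 / real (Suc n)" for n
  proof -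
    obtain x u q where *: "x \<in> \<M>" "is_traj F B u x" "\<forall>t\<in>{0..1}. norm (u t) \<le> r" "adj_sol u x q"
      "integral {0..1} (\<lambda>t. (norm (tr (F (x t)) (q t)))\<^sup>2) < 1 / real (Suc n) * (norm (q 1))\<^sup>2"
      using neg[of "1 / real (Suc n)"] by auto
    have "0 \<le> integral {0..1} (\<lambda>t. (norm (tr (F (x t)) (q t)))\<^sup>2)"
      by (cases "(\<lambda>t. (norm (tr (F (x t)) (q t)))\<^sup>2) integrable_on {0..1}")
        (auto intro: Henstock_Kurzweil_Integration.integral_nonneg simp: not_integrable_integral)
    then have q1: "norm (q 1) > 0" using *(5) by (cases "q 1 = 0") auto
    define c where "c = 1 / norm (q 1)"
    have eq: "(\<lambda>t. \<phi> (x t, c *\<^sub>R q t)) = (\<lambda>t. c\<^sup>2 * (norm (tr (F (x t)) (q t)))\<^sup>2)"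
      by (simp add: \<phi>_def linear_cmul[OF tr_linear] power_mult_distrib)
    have "integral {0..1} (\<lambda>t. \<phi> (x t, c *\<^sub>R q t)) = c\<^sup>2 * integral {0..1} (\<lambda>t. (norm (tr (F (x t)) (q t)))\<^sup>2)"
      unfolding eq by (rule integral_mult_right)
    also have "\<dots> < c\<^sup>2 * (1 / real (Suc n) * (norm (q 1))\<^sup>2)"
      using *(5) q1 by (intro mult_strict_left_mono) (auto simp: c_def)
    also have "\<dots> = 1 / real (Suc n)" using q1 by (simp add: c_def power2_eq_square field_simps)
    finally have "integral {0..1} (\<lambda>t. \<phi> (x t, c *\<^sub>R q t)) < 1 / real (Suc n)" .
    moreover have "norm (c *\<^sub>R q 1) = 1" using q1 by (simp add: c_def)
    ultimately show ?thesis using * adj_scale[OF *(4), of c] by (intro exI[of _ x] exI[of _ u] exI[of _ "\<lambda>t. c *\<^sub>R q t"]) auto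
  qed
  then have "\<forall>n. \<exists>d. fst d \<in> \<M> \<and> is_traj F B (fst (snd d)) (fst d) \<and> (\<forall>t\<in>{0..1}. norm (fst (snd d) t) \<le> r) \<and>
      adj_sol (fst (snd d)) (fst d) (snd (snd d)) \<and> norm (snd (snd d) 1) = 1 \<and>
      integral {0..1} (\<lambda>t. \<phi> (fst d t, snd (snd d) t)) < 1 / real (Suc n)"
    by simp
  then obtain d where d: "\<forall>n. fst (d n) \<in> \<M> \<and> is_traj F B (fst (snd (d n))) (fst (d n)) \<and>
      (\<forall>t\<in>{0..1}. norm (fst (snd (d n)) t) \<le> r) \<and>
      adj_sol (fst (snd (d n))) (fst (d n)) (snd (snd (d n))) \<and> norm (snd (snd (d n)) 1) = 1 \<and>
      integral {0..1} (\<lambda>t. \<phi> (fst (d n) t, snd (snd (d n)) t)) < 1 / real (Suc n)"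
    by (rule choice[THEN exE])
  define x u q where "x n = fst (d n)" and "u n = fst (snd (d n))" and "q n = snd (snd (d n))" for n
  have xn: "\<And>n. x n \<in> \<M>" "\<And>n. is_traj F B (u n) (x n)" "\<And>n t. t \<in> {0..1} \<Longrightarrow> norm (u n t) \<le> r"
    "\<And>n. adj_sol (u n) (x n) (q n)" "\<And>n. norm (q n 1) = 1" "\<And>n. integral {0..1} (\<lambda>t. \<phi> (x n t, q n t)) < 1 / real (Suc n)"
    using d by (auto simp: x_def u_def q_def)
  have qQ: "norm (q n t) \<le> Q" if "t \<in> {0..1}" for n t
  proof -
    have "integral {0..1} (\<lambda>t. norm (u n t)) \<le> r"
      by (rule integral_le_const[OF abs_integrable_imp_integrable[OF abs_integrable_norm[OF traj_parts(2)[OF xn(2)]]] xn(3)])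
    from adj_bound[OF xn(2,4) this that] show ?thesis by (simp add: Q_def xn(5))
  qed
  define z where "z n t = (x n t, q n t)" for n t
  have zS: "z n t \<in> S" if "t \<in> {0..1}" for n t
    using traj_parts(3)[OF xn(2) that] qQ[OF that] by (simp add: z_def S_def)
  have z_traj: "is_traj adjoined_F S (u n) (z n)" for n
    unfolding is_traj_def
  proof (intro conjI ballI)
    show "u n absolutely_integrable_on {0..1}" by (rule traj_parts(2)[OF xn(2)])
    show "primitive (z n) (\<lambda>t. adjoined_F (z n t) (u n t))"
      unfolding z_def adjoined_F_def using primitive_Pair[OF traj_parts(1)[OF xn(2)] xn(4)[unfolded adj_sol_def]] by simp
  qed (rule zS)
  define C where "C = (2 * L + L * Q) * (M + L * Q) * r\<^sup>2"
  have z_ctraj: "ctraj adjoined_F r C (z n)" for n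
    unfolding C_def
    by (rule is_traj_ctraj[OF adjoined_F_lin z_traj xn(3)]) (use L M Q r in \<open>auto simp: S_def intro!: adjoined_F_bnd adjoined_F_lip\<close>)
  obtain k :: "nat \<Rightarrow> nat" and \<zeta> where k: "strict_mono k" and \<zeta>: "ctraj adjoined_F r C \<zeta>"
    "\<And>t. t \<in> {0..1} \<Longrightarrow> (\<lambda>n. z (k n) t) \<longlonglongrightarrow> \<zeta> t" "\<And>t. t \<in> {0..1} \<Longrightarrow> \<zeta> t \<in> S"
  proof (rule ctraj_compactness[where zn = z and Y = adjoined_F and S = S and M = "M + L * Q" and C = C, OF adjoined_F_lin _ z_ctraj zS])
    show "continuous_on S (\<lambda>z. adjoined_F z c)" for c unfolding S_def by (rule adjoined_F_cont)
    show "norm (adjoined_F x u) \<le> (M + L * Q) * norm u" if "x \<in> S" for x u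
      using that Q unfolding S_def by (intro adjoined_F_bnd) auto
  qed (use L M Q r S in \<open>auto simp: C_def\<close>)
  define y p where "y t = fst (\<zeta> t)" and "p t = snd (\<zeta> t)" for t
  have yB: "y t \<in> B" and pQ: "norm (p t) \<le> Q" if "t \<in> {0..1}" for t
    using \<zeta>(3)[OF that] by (auto simp: y_def p_def S_def)
  have y_lim: "(\<lambda>n. x (k n) t) \<longlonglongrightarrow> y t" and p_lim: "(\<lambda>n. q (k n) t) \<longlonglongrightarrow> p t" if "t \<in> {0..1}" for t
    using tendsto_fst[OF \<zeta>(2)[OF that]] tendsto_snd[OF \<zeta>(2)[OF that]] by (simp_all add: z_def y_def p_def)
  have y_ctraj: "ctraj F r C y"
    unfolding ctraj_def
  proof (intro allI impI)
    fix s t :: real assume st: "0 \<le> s \<and> s \<le> t \<and> t \<le> 1"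
    then obtain v where v: "norm v \<le> r" "norm (\<zeta> t - \<zeta> s - (t - s) *\<^sub>R adjoined_F (\<zeta> s) v) \<le> C * (t - s)\<^sup>2"
      using \<zeta>(1) unfolding ctraj_def by blast
    have "norm (y t - y s - (t - s) *\<^sub>R F (y s) v) \<le> norm (\<zeta> t - \<zeta> s - (t - s) *\<^sub>R adjoined_F (\<zeta> s) v)"
      using norm_fst_snd_le(1)[of "\<zeta> t - \<zeta> s - (t - s) *\<^sub>R adjoined_F (\<zeta> s) v"]
      by (simp add: y_def adjoined_F_def)
    then show "\<exists>u. norm u \<le> r \<and> norm (y t - y s - (t - s) *\<^sub>R F (y s) u) \<le> C * (t - s)\<^sup>2"
      using v by (intro exI[of _ v]) auto
  qed
  have C0: "0 \<le> C" using L M Q by (simp add: C_def)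
  obtain w where w: "is_traj F B w y" "\<And>t. norm (w t) \<le> r"
  proof (rule ctraj_is_traj[where F = F and B = B and M = M, OF F_lin F_cont _ _ _ y_ctraj yB])
    show "u = 0" if "x \<in> B" "F x u = 0" for x u by (rule F_inj[OF that])
    show "norm (F x u) \<le> M * norm u" if "x \<in> B" for x u by (rule F_bnd[OF that])
  qed (use M L r C0 in auto)
  have yM: "y \<in> \<M>" by (rule closed[OF xn(1) y_lim w])
  have bnd2: "norm (adjoined_F (\<zeta> t) v) \<le> (M + L * Q) * norm v" if "t \<in> {0..1}" for t v
    using \<zeta>(3)[OF that] Q unfolding S_def by (intro adjoined_F_bnd) auto
  have MLQ: "0 \<le> M + L * Q" "0 \<le> r" using L M Q r by auto
  obtain h where h: "primitive \<zeta> h"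
    using lipschitz_primitive[OF ctraj_lipschitz[OF \<zeta>(1) bnd2 MLQ(1) C0 MLQ(2)]] by blast
  obtain N1 where N1: "negligible N1" "\<And>t. t \<in> {0<..<1} - N1 \<Longrightarrow> (\<zeta> has_vector_derivative h t) (at t)"
    using primitive_deriv[OF h] by blast
  obtain N2 where N2: "negligible N2" "\<And>t. t \<in> {0<..<1} - N2 \<Longrightarrow> (y has_vector_derivative F (y t) (w t)) (at t)"
    using primitive_deriv[OF traj_parts(1)[OF w(1)]] by blast
  \<comment> \<open>At almost every time the limit pair moves with some control \<open>v\<close>
    common to both components. The state component already has the control \<open>w\<close>, so
    injectivity of \<open>F\<close> gives v = w, and the second component solves the adjoint
    equation for that same control.\<close>
  have heq: "h t = adjoined_F (\<zeta> t) (w t)" if t: "t \<in> {0<..<1} - (N1 \<union> N2)" for t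
  proof -
    obtain v where v: "h t = adjoined_F (\<zeta> t) v" using ctraj_deriv[OF adjoined_F_lin \<zeta>(1) _ N1(2)] t by blast
    have "(y has_vector_derivative fst (h t)) (at t)"
      unfolding y_def using bounded_linear.has_vector_derivative[OF bounded_linear_fst N1(2)] t by auto
    then have "fst (h t) = F (y t) (w t)" using N2(2)[of t] t vector_derivative_unique_at by blast
    then have "F (y t) (v - w t) = 0" using v linear_diff[OF F_lin] by (simp add: adjoined_F_def y_def)
    then have "v = w t" using F_inj[OF yB, of t "v - w t"] t by auto
    then show ?thesis using v by simp
  qed
  have "negligible (N1 \<union> N2)" using N1 N2 by auto
  from primitive_cong_ae[OF h this heq] have "primitive \<zeta> (\<lambda>t. adjoined_F (\<zeta> t) (w t))" by blast
  from primitive_linear[OF bounded_linear_snd this] have p_adj: "adj_sol w y p"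
    unfolding adj_sol_def adjoined_F_def y_def[abs_def] p_def[abs_def] snd_conv .
  have "continuous_on {0..1} \<zeta>" by (rule primitive_continuous[OF h])
  then have \<phi>\<zeta>_cont: "continuous_on {0..1} (\<lambda>t. \<phi> (\<zeta> t))"
    by (rule continuous_on_compose2[OF \<phi>_cont]) (use \<zeta>(3) in auto)
  have l1: "(\<lambda>n. integral {0..1} (\<lambda>t. \<phi> (z (k n) t))) \<longlonglongrightarrow> integral {0..1} (\<lambda>t. \<phi> (\<zeta> t))"
  proof (rule dominated_convergence(2)[where h = "\<lambda>_. (M * Q)\<^sup>2"])
    fix n
    have "continuous_on {0..1} (z n)" for n using z_traj[of n] primitive_continuous by (auto simp: is_traj_def)
    then show "(\<lambda>t. \<phi> (z (k n) t)) integrable_on {0..1}"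
      by (intro integrable_continuous_real continuous_on_compose2[OF \<phi>_cont]) (use zS in auto)
    fix t :: real assume t: "t \<in> {0..1}"
    have "norm (tr (F (x (k n) t)) (q (k n) t)) \<le> M * norm (q (k n) t)"
      by (rule tr_F_norm[OF traj_parts(3)[OF xn(2) t]])
    also have "\<dots> \<le> M * Q" using qQ[OF t] M by (intro mult_left_mono) auto
    finally show "norm (\<phi> (z (k n) t)) \<le> (M * Q)\<^sup>2"
      by (simp add: \<phi>_def z_def power_mono)
  next
    fix t :: real assume t: "t \<in> {0..1}"
    show "(\<lambda>n. \<phi> (z (k n) t)) \<longlonglongrightarrow> \<phi> (\<zeta> t)"
      using \<phi>_cont \<zeta>(2)[OF t] zS[OF t] \<zeta>(3)[OF t] unfolding continuous_on_sequentially by (auto simp: o_def)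
  qed auto
  have l2: "(\<lambda>n. 1 / real (Suc (k n))) \<longlonglongrightarrow> 0"
    using LIMSEQ_subseq_LIMSEQ[OF LIMSEQ_inverse_real_of_nat k] by (simp add: o_def inverse_eq_divide)
  have l3: "integral {0..1} (\<lambda>t. \<phi> (z (k n) t)) \<le> 1 / real (Suc (k n))" for n
    using xn(6)[of "k n"] by (simp add: z_def)
  have "integral {0..1} (\<lambda>t. \<phi> (\<zeta> t)) \<le> 0"
    by (rule LIMSEQ_le[OF l1 l2]) (use l3 in auto)
  moreover have "0 \<le> integral {0..1} (\<lambda>t. \<phi> (\<zeta> t))"
    by (rule Henstock_Kurzweil_Integration.integral_nonneg[OF integrable_continuous_real[OF \<phi>\<zeta>_cont]]) (simp add: \<phi>_def)
  ultimately have "integral {0..1} (\<lambda>t. \<phi> (\<zeta> t)) = 0" by simp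
  then have "\<phi> (\<zeta> t) = 0" if "t \<in> {0..1}" for t
    using integral_eq_0_iff[OF \<phi>\<zeta>_cont] that by (simp add: \<phi>_def)
  then have "tr (F (y t)) (p t) = 0" if "t \<in> {0..1}" for t
    using that by (simp add: \<phi>_def y_def p_def)
  then have "p 1 = 0" by (rule nonsing[OF yM w p_adj])
  moreover have "(\<lambda>n. norm (q (k n) 1)) \<longlonglongrightarrow> norm (p 1)" by (intro tendsto_norm p_lim) simp
  then have "norm (p 1) = 1" by (simp add: xn(5) LIMSEQ_const_iff)
  ultimately show False by simp
qed

end

lemma frechet_derivative_cong_open:
  assumes "open S" "x \<in> S" "\<And>y. y \<in> S \<Longrightarrow> f y = g y"
  shows "frechet_derivative f (at x) = frechet_derivative g (at x)"
proof -
  have "(f has_derivative D) (at x) \<longleftrightarrow> (g has_derivative D) (at x)" for D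
    using has_derivative_transform_within_open[OF _ assms(1,2), of f D UNIV g]
      has_derivative_transform_within_open[OF _ assms(1,2), of g D UNIV f] assms(3) by auto
  then show ?thesis by (simp add: frechet_derivative_def)
qed

lemma differentiable_cong_open:
  assumes "open S" "x \<in> S" "\<And>y. y \<in> S \<Longrightarrow> f y = g y" "f differentiable (at x)"
  shows "g differentiable (at x)"
  using assms has_derivative_transform_within_open[OF _ assms(1,2), of f _ UNIV g]
  unfolding differentiable_def by blast

section \<open>Smooth functions\<close>

lemma Ck_on_cong:
  assumes "open S" "\<And>x. x \<in> S \<Longrightarrow> f x = g x" "Ck_on k S f"
  shows "Ck_on k S g"
  using assms(2,3)
proof (induction k arbitrary: f g)
  case 0 then show ?case using continuous_on_cong[of S S f g] by simp
next
  case (Suc k)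
  show ?case
    unfolding Ck_on.simps
  proof (intro conjI ballI allI)
    show "g differentiable (at x)" if "x \<in> S" for x
      using differentiable_cong_open[OF assms(1) that Suc.prems(1)] Suc.prems(2) that by auto
    fix v
    have "Ck_on k S (\<lambda>x. frechet_derivative f (at x) v)" using Suc.prems(2) by auto
    then show "Ck_on k S (\<lambda>x. frechet_derivative g (at x) v)"
      by (rule Suc.IH[rotated]) (use frechet_derivative_cong_open[OF assms(1) _ Suc.prems(1)] in auto)
  qed
qed

lemma Ck_on_subset: "Ck_on k S f \<Longrightarrow> T \<subseteq> S \<Longrightarrow> Ck_on k T f"
  by (induction k arbitrary: f) (auto intro: continuous_on_subset)

lemma Ck_on_Suc: "Ck_on (Suc k) S f \<Longrightarrow> Ck_on k S f"
proof (induction k arbitrary: f)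
  case 0
  then show ?case
    by (auto intro!: continuous_at_imp_continuous_on differentiable_imp_continuous_within)
next
  case (Suc k)
  have "Ck_on k S (\<lambda>x. frechet_derivative f (at x) v)" for v
    by (rule Suc.IH) (use Suc.prems in auto)
  then show ?case using Suc.prems by auto
qed

lemma Ck_on_SucI:
  assumes "open S" "\<And>x. x \<in> S \<Longrightarrow> (f has_derivative f' x) (at x)" "\<And>v. Ck_on k S (\<lambda>x. f' x v)"
  shows "Ck_on (Suc k) S f"
  unfolding Ck_on.simps
proof (intro conjI ballI allI)
  show "f differentiable (at x)" if "x \<in> S" for x using assms(2)[OF that] by (rule differentiableI)
  show "Ck_on k S (\<lambda>x. frechet_derivative f (at x) v)" for v
    by (rule Ck_on_cong[OF assms(1) _ assms(3)[of v]]) (use frechet_derivative_at[OF assms(2)] in auto)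
qed

lemma Ck_on_has_derivative:
  "Ck_on (Suc k) S f \<Longrightarrow> x \<in> S \<Longrightarrow> (f has_derivative frechet_derivative f (at x)) (at x)"
  by (simp add: frechet_derivative_works[symmetric])

lemma Ck_on_const: "open S \<Longrightarrow> Ck_on k S (\<lambda>x. c)"
proof (induction k arbitrary: c)
  case (Suc k) show ?case by (rule Ck_on_SucI[where f' = "\<lambda>x v. 0"]) (use Suc in auto)
qed simp

lemma Ck_on_bounded_linear:
  assumes T: "bounded_linear T" and S: "open S" shows "Ck_on k S f \<Longrightarrow> Ck_on k S (\<lambda>x. T (f x))"
proof (induction k arbitrary: f)
  case 0 then show ?case using bounded_linear.continuous_on[OF T] by auto
next
  case (Suc k)
  then have d: "(f has_derivative frechet_derivative f (at x)) (at x)" if "x \<in> S" for x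
    using that Ck_on_has_derivative by blast+
  show ?case
    by (rule Ck_on_SucI[OF S bounded_linear.has_derivative[OF T d]]) (use Suc in auto)
qed

lemma Ck_on_add:
  assumes S: "open S" shows "Ck_on k S f \<Longrightarrow> Ck_on k S g \<Longrightarrow> Ck_on k S (\<lambda>x. f x + g x)"
proof (induction k arbitrary: f g)
  case 0 then show ?case by (auto intro: continuous_intros)
next
  case (Suc k)
  then have d: "(f has_derivative frechet_derivative f (at x)) (at x)" "(g has_derivative frechet_derivative g (at x)) (at x)" if "x \<in> S" for x
    using that Ck_on_has_derivative by blast+
  show ?case
    by (rule Ck_on_SucI[OF S has_derivative_add[OF d]]) (use Suc in auto)
qed

lemma Ck_on_bilinear:
  assumes B: "bounded_bilinear B" and S: "open S"
  shows "Ck_on k S f \<Longrightarrow> Ck_on k S g \<Longrightarrow> Ck_on k S (\<lambda>x. B (f x) (g x))"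
proof (induction k arbitrary: f g)
  case 0 then show ?case using bounded_bilinear.continuous_on[OF B] by auto
next
  case (Suc k)
  then have d: "(f has_derivative frechet_derivative f (at x)) (at x)" "(g has_derivative frechet_derivative g (at x)) (at x)" if "x \<in> S" for x
    using that Ck_on_has_derivative by blast+
  have fg: "Ck_on k S f" "Ck_on k S g" using Suc.prems Ck_on_Suc by blast+
  show ?case
    by (rule Ck_on_SucI[OF S bounded_bilinear.FDERIV[OF B d]])
      (use Suc fg in \<open>auto intro!: Ck_on_add[OF S]\<close>)
qed

text \<open>The induction runs over all exponents at once, since differentiation lowers the exponent
  by one. The exponent -1/2 will normalize vector fields.\<close>

lemma Ck_on_powr:
  fixes f :: "'a::euclidean_space \<Rightarrow> real"
  assumes S: "open S" and pos: "\<And>x. x \<in> S \<Longrightarrow> f x > 0"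
  shows "Ck_on k S f \<Longrightarrow> Ck_on k S (\<lambda>x. f x powr a)"
proof (induction k arbitrary: a)
  case 0 then show ?case using pos by (auto intro!: continuous_intros) (use pos in fastforce)
next
  case (Suc k)
  then have d: "(f has_derivative frechet_derivative f (at x)) (at x)" if "x \<in> S" for x
    using that Ck_on_has_derivative by blast+
  have fk: "Ck_on k S f" using Suc.prems Ck_on_Suc by blast
  have "((\<lambda>x. f x powr a) has_derivative (\<lambda>v. (a * f x powr (a - 1)) * frechet_derivative f (at x) v)) (at x)" if x: "x \<in> S" for x
  proof -
    have "((\<lambda>y. y powr a) has_real_derivative a * f x powr (a - 1)) (at (f x))"
      using pos[OF x] by (rule has_real_derivative_powr)
    then show ?thesis
      using has_derivative_compose[OF d[OF x], of "\<lambda>y. y powr a"] unfolding has_field_derivative_def by simp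
  qed
  moreover have "Ck_on k S (\<lambda>x. (a * f x powr (a - 1)) * frechet_derivative f (at x) v)" for v
    by (intro Ck_on_bilinear[OF bounded_bilinear_mult S] Ck_on_bounded_linear[OF bounded_linear_mult_right S] Suc.IH fk)
      (use Suc.prems in auto)
  ultimately show ?case by (rule Ck_on_SucI[OF S])
qed

text \<open>Lets a frame that does not depend on time be regarded as a smooth time-dependent frame,
  which is the form asked for by \<open>frame_along\<close>.\<close>

lemma Ck_on_snd:
  assumes S: "open S"
  shows "Ck_on k S f \<Longrightarrow> Ck_on k ((UNIV :: real set) \<times> S) (\<lambda>p. f (snd p))"
proof (induction k arbitrary: f)
  case 0 then show ?case
    by (auto intro!: continuous_on_compose2[of S f] continuous_intros)
next
  case (Suc k)
  then have d: "(f has_derivative frechet_derivative f (at x)) (at x)" if "x \<in> S" for x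
    using that Ck_on_has_derivative by blast+
  have o: "open ((UNIV :: real set) \<times> S)" using S by (intro open_Times) auto
  have "((\<lambda>p::real \<times> 'a. f (snd p)) has_derivative (\<lambda>v. frechet_derivative f (at (snd p)) (snd v))) (at p)"
    if "p \<in> UNIV \<times> S" for p
    using has_derivative_compose[OF bounded_linear.has_derivative[OF bounded_linear_snd has_derivative_ident] d[of "snd p"]] that by auto
  then show ?case
    by (rule Ck_on_SucI[OF o]) (use Suc in auto)
qed

lemma smooth_on_cong: "smooth_on S f \<Longrightarrow> open S \<Longrightarrow> (\<And>x. x \<in> S \<Longrightarrow> f x = g x) \<Longrightarrow> smooth_on S g"
  unfolding smooth_on_def using Ck_on_cong by blast

lemma smooth_on_subset: "smooth_on S f \<Longrightarrow> T \<subseteq> S \<Longrightarrow> smooth_on T f"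
  unfolding smooth_on_def using Ck_on_subset by blast

lemma smooth_on_bilinear:
  "bounded_bilinear B \<Longrightarrow> open S \<Longrightarrow> smooth_on S f \<Longrightarrow> smooth_on S g \<Longrightarrow> smooth_on S (\<lambda>x. B (f x) (g x))"
  unfolding smooth_on_def using Ck_on_bilinear by blast

lemma smooth_on_add: "open S \<Longrightarrow> smooth_on S f \<Longrightarrow> smooth_on S g \<Longrightarrow> smooth_on S (\<lambda>x. f x + g x)"
  unfolding smooth_on_def using Ck_on_add by blast

lemma smooth_on_powr:
  "open S \<Longrightarrow> (\<And>x. x \<in> S \<Longrightarrow> f x > 0) \<Longrightarrow> smooth_on S f \<Longrightarrow> smooth_on S (\<lambda>x. f x powr a)"
  for f :: "'a::euclidean_space \<Rightarrow> real"
  unfolding smooth_on_def using Ck_on_powr by blast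

lemma smooth_on_continuous: "smooth_on S f \<Longrightarrow> continuous_on S f"
  unfolding smooth_on_def by (metis Ck_on.simps(1))

lemma smooth_on_has_derivative: "smooth_on S f \<Longrightarrow> x \<in> S \<Longrightarrow> (f has_derivative frechet_derivative f (at x)) (at x)"
  unfolding smooth_on_def using frechet_derivative_works by (metis Ck_on.simps(2))

lemma smooth_on_deriv: "smooth_on S f \<Longrightarrow> smooth_on S (\<lambda>x. frechet_derivative f (at x) v)"
  unfolding smooth_on_def by (metis Ck_on.simps(2))

lemma bounded_derivative_cball:
  fixes f :: "'a::euclidean_space \<Rightarrow> 'b::real_normed_vector"
  assumes f: "smooth_on S f" and B: "cball p R \<subseteq> S"
  obtains L where "L \<ge> 0" "\<And>x v. x \<in> cball p R \<Longrightarrow> norm (frechet_derivative f (at x) v) \<le> L * norm v"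
    "\<And>x y. \<lbrakk>x \<in> cball p R; y \<in> cball p R\<rbrakk> \<Longrightarrow> norm (f x - f y) \<le> L * norm (x - y)"
proof -
  have "\<exists>L. \<forall>x\<in>cball p R. norm (frechet_derivative f (at x) b) \<le> L" for b
  proof -
    have "continuous_on (cball p R) (\<lambda>x. frechet_derivative f (at x) b)"
      by (rule continuous_on_subset[OF smooth_on_continuous[OF smooth_on_deriv[OF f]] B])
    then have "bounded ((\<lambda>x. frechet_derivative f (at x) b) ` cball p R)"
      by (intro compact_imp_bounded compact_continuous_image) auto
    then show ?thesis by (auto simp: bounded_iff)
  qed
  then obtain K where K: "\<And>b x. x \<in> cball p R \<Longrightarrow> norm (frechet_derivative f (at x) b) \<le> K b" by metis
  define L where "L = (\<Sum>b\<in>(Basis :: 'a set). \<bar>K b\<bar>)"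
  have L0: "L \<ge> 0" by (simp add: L_def sum_nonneg)
  have bnd: "norm (frechet_derivative f (at x) v) \<le> L * norm v" if x: "x \<in> cball p R" for x v
  proof -
    have "linear (frechet_derivative f (at x))"
      using smooth_on_has_derivative[OF f] B x has_derivative_linear by blast
    then have "frechet_derivative f (at x) v = (\<Sum>b\<in>Basis. (v \<bullet> b) *\<^sub>R frechet_derivative f (at x) b)"
      by (rule linear_basis_sum)
    also have "norm \<dots> \<le> (\<Sum>b\<in>Basis. norm v * \<bar>K b\<bar>)"
    proof (rule sum_norm_le)
      fix b :: 'a assume b: "b \<in> Basis"
      have "norm (frechet_derivative f (at x) b) \<le> \<bar>K b\<bar>" using K[OF x, of b] by simp
      then show "norm ((v \<bullet> b) *\<^sub>R frechet_derivative f (at x) b) \<le> norm v * \<bar>K b\<bar>"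
        using Basis_le_norm[OF b, of v] by (simp add: mult_mono)
    qed
    finally show ?thesis by (simp add: L_def sum_distrib_left mult.commute)
  qed
  show ?thesis
  proof (rule that[OF L0 bnd])
    fix x y assume xy: "x \<in> cball p R" "y \<in> cball p R"
    show "norm (f x - f y) \<le> L * norm (x - y)"
    proof (rule differentiable_bound[where S = "cball p R" and f' = "\<lambda>x. frechet_derivative f (at x)"])
      show "(f has_derivative frechet_derivative f (at z)) (at z within cball p R)" if "z \<in> cball p R" for z
        by (rule has_derivative_at_withinI[OF smooth_on_has_derivative[OF f]]) (use that B in auto)
      show "onorm (frechet_derivative f (at z)) \<le> L" if "z \<in> cball p R" for z
        by (rule onorm_bound[OF L0 bnd[OF that]])
    qed (use xy in auto)
  qed auto
qed

section \<open>Paths on a manifold\<close>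

locale manifold =
  fixes A :: "('m::{t2_space, second_countable_topology}, 'e::euclidean_space) chart set"
  assumes atlas: "smooth_atlas A"
begin

abbreviation cimg :: "('m, 'e) chart \<Rightarrow> 'e set" where "cimg c \<equiv> chart_map c ` chart_dom c"

lemma chart_open: "c \<in> A \<Longrightarrow> open (chart_dom c)" "c \<in> A \<Longrightarrow> open (cimg c)"
  and chart_cont: "c \<in> A \<Longrightarrow> continuous_on (chart_dom c) (chart_map c)"
  and chart_inv_cont: "c \<in> A \<Longrightarrow> continuous_on (cimg c) (chart_inv c)"
  and chart_inv_map: "c \<in> A \<Longrightarrow> x \<in> chart_dom c \<Longrightarrow> chart_inv c (chart_map c x) = x"
  and chart_map_inv: "c \<in> A \<Longrightarrow> p \<in> cimg c \<Longrightarrow> chart_map c (chart_inv c p) = p"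
  and chart_inv_dom: "c \<in> A \<Longrightarrow> p \<in> cimg c \<Longrightarrow> chart_inv c p \<in> chart_dom c"
proof -
  assume "c \<in> A"
  then have c: "is_chart c" using atlas by (simp add: smooth_atlas_def)
  then show "open (chart_dom c)" "open (cimg c)" "continuous_on (chart_dom c) (chart_map c)"
    "continuous_on (cimg c) (chart_inv c)"
    by (auto simp: is_chart_def homeomorphism_def)
  show "x \<in> chart_dom c \<Longrightarrow> chart_inv c (chart_map c x) = x"
    using c unfolding is_chart_def homeomorphism_def by blast
  show "p \<in> cimg c \<Longrightarrow> chart_map c (chart_inv c p) = p" "p \<in> cimg c \<Longrightarrow> chart_inv c p \<in> chart_dom c"
    using c unfolding is_chart_def homeomorphism_def by auto
qed

lemma chart_at: "chart_at A x \<in> A" "x \<in> chart_dom (chart_at A x)"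
proof -
  have "x \<in> (\<Union>c\<in>A. chart_dom c)" using atlas by (simp add: smooth_atlas_def)
  then have "\<exists>c. c \<in> A \<and> x \<in> chart_dom c" by blast
  then show "chart_at A x \<in> A" "x \<in> chart_dom (chart_at A x)"
    unfolding chart_at_def by (metis (mono_tags, lifting) someI_ex)+
qed

lemma open_chart_image: "c \<in> A \<Longrightarrow> open U \<Longrightarrow> open (chart_map c ` (U \<inter> chart_dom c))"
proof -
  assume c: "c \<in> A" and U: "open U"
  have "chart_map c ` (U \<inter> chart_dom c) = cimg c \<inter> chart_inv c -` U"
    using chart_inv_map[OF c] by (auto simp: image_iff)
  also have "open \<dots>"
    by (rule continuous_open_preimage[OF chart_inv_cont[OF c] chart_open(2)[OF c] U])
  finally show ?thesis .
qed

lemma open_chart_preimage: "c \<in> A \<Longrightarrow> open V \<Longrightarrow> open (chart_dom c \<inter> chart_map c -` V)"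
  by (rule continuous_open_preimage[OF chart_cont chart_open(1)])

definition trans :: "('m, 'e) chart \<Rightarrow> ('m, 'e) chart \<Rightarrow> 'e \<Rightarrow> 'e" where
  "trans c d = chart_map d \<circ> chart_inv c"

lemma trans_smooth: "c \<in> A \<Longrightarrow> d \<in> A \<Longrightarrow> smooth_on (chart_map c ` (chart_dom d \<inter> chart_dom c)) (trans c d)"
  using atlas unfolding smooth_atlas_def smooth_transition_def trans_def by (metis Int_commute)

lemma trans_chart: "c \<in> A \<Longrightarrow> x \<in> chart_dom c \<Longrightarrow> trans c d (chart_map c x) = chart_map d x"
  by (simp add: trans_def chart_inv_map)

definition Dtrans :: "('m, 'e) chart \<Rightarrow> ('m, 'e) chart \<Rightarrow> 'm \<Rightarrow> 'e \<Rightarrow> 'e" where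
  "Dtrans c d x = frechet_derivative (trans c d) (at (chart_map c x))"

lemma trans_has_derivative:
  assumes "c \<in> A" "d \<in> A" "x \<in> chart_dom c" "x \<in> chart_dom d"
  shows "(trans c d has_derivative Dtrans c d x) (at (chart_map c x))"
  unfolding Dtrans_def by (rule smooth_on_has_derivative[OF trans_smooth]) (use assms in auto)

lemma Dtrans_linear:
  assumes "c \<in> A" "d \<in> A" "x \<in> chart_dom c" "x \<in> chart_dom d" shows "linear (Dtrans c d x)"
  using trans_has_derivative[OF assms] has_derivative_linear by blast

lemma change_chart_has_derivative:
  assumes c: "c \<in> A" "d \<in> A" "x \<in> chart_dom c" "x \<in> chart_dom d"
    and f: "((f \<circ> chart_inv d) has_derivative D) (at (chart_map d x))"
  shows "((f \<circ> chart_inv c) has_derivative (\<lambda>v. D (Dtrans c d x v))) (at (chart_map c x))"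
proof -
  have "((f \<circ> chart_inv d) \<circ> trans c d has_derivative D \<circ> Dtrans c d x) (at (chart_map c x))"
    using trans_has_derivative[OF c] f trans_chart[OF c(1,3)] by (intro diff_chain_at) auto
  then have "((\<lambda>p. (f \<circ> chart_inv d) (trans c d p)) has_derivative (\<lambda>v. D (Dtrans c d x v))) (at (chart_map c x))"
    by (simp add: o_def)
  then show ?thesis
  proof (rule has_derivative_transform_within_open[OF _ open_chart_image[OF c(1) chart_open(1)[OF c(2)]]])
    show "chart_map c x \<in> chart_map c ` (chart_dom d \<inter> chart_dom c)" using c by auto
    fix p assume "p \<in> chart_map c ` (chart_dom d \<inter> chart_dom c)"
    then show "(f \<circ> chart_inv d) (trans c d p) = (f \<circ> chart_inv c) p"
      using c by (auto simp: trans_def chart_inv_map)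
  qed
qed

lemma Dtrans_comp:
  assumes c: "c \<in> A" "d \<in> A" "e \<in> A" "x \<in> chart_dom c" "x \<in> chart_dom d" "x \<in> chart_dom e"
  shows "Dtrans d e x (Dtrans c d x v) = Dtrans c e x v"
proof -
  have "((chart_map e \<circ> chart_inv c) has_derivative (\<lambda>v. Dtrans d e x (Dtrans c d x v))) (at (chart_map c x))"
    by (rule change_chart_has_derivative[OF c(1,2,4,5) trans_has_derivative[OF c(2,3,5,6), unfolded trans_def]])
  then show ?thesis
    using trans_has_derivative[OF c(1,3,4,6)] has_derivative_unique unfolding trans_def by metis
qed

lemma Dtrans_id: "c \<in> A \<Longrightarrow> x \<in> chart_dom c \<Longrightarrow> Dtrans c c x v = v"
proof -
  assume c: "c \<in> A" "x \<in> chart_dom c"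
  have "((\<lambda>p. p) has_derivative (\<lambda>v. v)) (at (chart_map c x))" by simp
  then have "(trans c c has_derivative (\<lambda>v. v)) (at (chart_map c x))"
    by (rule has_derivative_transform_within_open[OF _ chart_open(2)[OF c(1)]])
      (use c chart_map_inv[OF c(1)] in \<open>auto simp: trans_def\<close>)
  then show ?thesis using trans_has_derivative[OF c(1,1,2,2)] has_derivative_unique by metis
qed

lemma tangent_coord_eq: "tangent_coord A c x v = Dtrans (chart_at A x) c x v"
  by (simp add: tangent_coord_def Dtrans_def trans_def)

lemma tangent_coord_linear: "c \<in> A \<Longrightarrow> x \<in> chart_dom c \<Longrightarrow> linear (tangent_coord A c x)"
  unfolding tangent_coord_eq[abs_def] using Dtrans_linear[OF chart_at(1) _ chart_at(2)] by blast

lemma tangent_coord_inverse: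
  assumes "c \<in> A" "x \<in> chart_dom c"
  shows "Dtrans c (chart_at A x) x (tangent_coord A c x v) = v"
    and "tangent_coord A c x (Dtrans c (chart_at A x) x w) = w"
  using assms chart_at by (simp_all add: tangent_coord_eq Dtrans_comp Dtrans_id)

lemma tangent_coord_inj: "c \<in> A \<Longrightarrow> x \<in> chart_dom c \<Longrightarrow> tangent_coord A c x v = tangent_coord A c x w \<Longrightarrow> v = w"
  by (metis tangent_coord_inverse(1))

lemma path_change_chart:
  assumes c: "c \<in> A" "d \<in> A" "\<gamma> t \<in> chart_dom c" "\<gamma> t \<in> chart_dom d"
    and T: "open T" "t \<in> T" "continuous_on T \<gamma>"
    and v: "((chart_map c \<circ> \<gamma>) has_vector_derivative v) (at t)"
  shows "((chart_map d \<circ> \<gamma>) has_vector_derivative Dtrans c d (\<gamma> t) v) (at t)"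
proof -
  have l: "linear (Dtrans c d (\<gamma> t))" by (rule Dtrans_linear[OF c])
  have "((chart_map c \<circ> \<gamma>) has_derivative (\<lambda>h. h *\<^sub>R v)) (at t)" using v by (simp add: has_vector_derivative_def)
  then have "(trans c d \<circ> (chart_map c \<circ> \<gamma>) has_derivative Dtrans c d (\<gamma> t) \<circ> (\<lambda>h. h *\<^sub>R v)) (at t)"
    using trans_has_derivative[OF c] by (intro diff_chain_at) auto
  then have "((\<lambda>s. trans c d (chart_map c (\<gamma> s))) has_derivative (\<lambda>h. h *\<^sub>R Dtrans c d (\<gamma> t) v)) (at t)"
    using l by (simp add: o_def linear_cmul)
  moreover have "open (T \<inter> \<gamma> -` chart_dom c)" by (rule continuous_open_preimage[OF T(3,1) chart_open(1)[OF c(1)]])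
  ultimately have "((chart_map d \<circ> \<gamma>) has_derivative (\<lambda>h. h *\<^sub>R Dtrans c d (\<gamma> t) v)) (at t)"
    by (rule has_derivative_transform_within_open) (use T c trans_chart in auto)
  then show ?thesis by (simp add: has_vector_derivative_def)
qed

text \<open>Velocities are coordinates in the preferred chart of the current point, which may jump
  along the path; here they are moved to one fixed chart. Continuity on an open set of times keeps
  nearby points in both chart domains.\<close>

lemma has_velocity_chart:
  assumes c: "c \<in> A" "\<gamma> t \<in> chart_dom c" and T: "open T" "t \<in> T" "continuous_on T \<gamma>"
  shows "has_velocity A \<gamma> t v \<longleftrightarrow> ((chart_map c \<circ> \<gamma>) has_vector_derivative tangent_coord A c (\<gamma> t) v) (at t)"
proof
  assume "has_velocity A \<gamma> t v"
  then show "((chart_map c \<circ> \<gamma>) has_vector_derivative tangent_coord A c (\<gamma> t) v) (at t)"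
    unfolding has_velocity_def tangent_coord_eq
    by (intro path_change_chart[OF chart_at(1) c(1) chart_at(2) c(2) T])
next
  assume "((chart_map c \<circ> \<gamma>) has_vector_derivative tangent_coord A c (\<gamma> t) v) (at t)"
  from path_change_chart[OF c(1) chart_at(1) c(2) chart_at(2) T this]
  show "has_velocity A \<gamma> t v" unfolding has_velocity_def tangent_coord_inverse(1)[OF c] .
qed

lemma velocity_eq: "has_velocity A \<gamma> t v \<Longrightarrow> velocity A \<gamma> t = v"
  unfolding has_velocity_def velocity_def by (rule vector_derivative_at)

lemma has_velocity_cong:
  assumes "open T" "t \<in> T" "\<And>s. s \<in> T \<Longrightarrow> \<gamma> s = \<sigma> s" "has_velocity A \<gamma> t v"
  shows "has_velocity A \<sigma> t v"
proof -
  have "\<gamma> t = \<sigma> t" using assms by blast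
  then show ?thesis using assms(4) unfolding has_velocity_def
    by (auto intro: has_vector_derivative_transform_within_open[OF _ assms(1,2)] simp: assms(3))
qed

lemma has_velocity_affine:
  assumes "has_velocity A \<gamma> (a + b * t) v"
  shows "has_velocity A (\<lambda>s. \<gamma> (a + b * s)) t (b *\<^sub>R v)"
proof -
  define f where "f = chart_map (chart_at A (\<gamma> (a + b * t))) \<circ> \<gamma>"
  have f: "(f has_vector_derivative v) (at (a + b * t))" using assms by (simp add: has_velocity_def f_def)
  have "((\<lambda>s. a + b * s) has_vector_derivative b) (at t)"
    unfolding has_real_derivative_iff_has_vector_derivative[symmetric] by (auto intro!: derivative_eq_intros)
  from vector_diff_chain_at[OF this f] show ?thesis
    by (simp add: has_velocity_def f_def o_def)
qed

text \<open>\<open>loc_mod\<close> is a chart-independent modulus of continuity along a path: \<open>m t = t\<close> expresses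
  local Lipschitz continuity, and an absolutely continuous \<open>m\<close> gives absolute continuity.\<close>

definition loc_mod :: "(real \<Rightarrow> real) \<Rightarrow> (real \<Rightarrow> 'm) \<Rightarrow> bool" where
  "loc_mod m \<gamma> \<longleftrightarrow> (\<forall>t\<in>{0..1}. \<exists>c\<in>A. \<exists>\<delta>>0. \<exists>L\<ge>0. \<forall>s\<in>{0..1}. \<forall>s'\<in>{0..1}. \<bar>s - t\<bar> < \<delta> \<and> \<bar>s' - t\<bar> < \<delta> \<longrightarrow>
     \<gamma> s \<in> chart_dom c \<and> norm (chart_map c (\<gamma> s) - chart_map c (\<gamma> s')) \<le> L * \<bar>m s - m s'\<bar>)"

lemma loc_mod_continuous:
  assumes l: "loc_mod m \<gamma>" and m: "continuous_on {0..1} m"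
  shows "continuous_on {0..1} \<gamma>"
  unfolding continuous_on_eq_continuous_within
proof
  fix t :: real assume t: "t \<in> {0..1}"
  then obtain c \<delta> L where c: "c \<in> A" "\<delta> > 0" "L \<ge> 0" and L: "\<And>s s'. \<lbrakk>s \<in> {0..1}; s' \<in> {0..1}; \<bar>s - t\<bar> < \<delta>; \<bar>s' - t\<bar> < \<delta>\<rbrakk> \<Longrightarrow>
     \<gamma> s \<in> chart_dom c \<and> norm (chart_map c (\<gamma> s) - chart_map c (\<gamma> s')) \<le> L * \<bar>m s - m s'\<bar>"
    using l unfolding loc_mod_def by meson
  have gt: "\<gamma> t \<in> chart_dom c" using L[of t t] t c by auto
  have ev: "\<forall>\<^sub>F s in at t within {0..1}. s \<in> {0..1} \<and> \<bar>s - t\<bar> < \<delta>"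
    unfolding eventually_at using c(2) by (auto simp: dist_real_def)
  have mt: "(m \<longlongrightarrow> m t) (at t within {0..1})" using m t by (simp add: continuous_on_def)
  have "((\<lambda>s. chart_map c (\<gamma> s) - chart_map c (\<gamma> t)) \<longlongrightarrow> 0) (at t within {0..1})"
  proof (rule Lim_null_comparison)
    show "\<forall>\<^sub>F s in at t within {0..1}. norm (chart_map c (\<gamma> s) - chart_map c (\<gamma> t)) \<le> L * \<bar>m s - m t\<bar>"
      using ev by eventually_elim (use L[of _ t] t c in auto)
    have "((\<lambda>s. L * \<bar>m s - m t\<bar>) \<longlongrightarrow> L * \<bar>m t - m t\<bar>) (at t within {0..1})" by (intro tendsto_intros mt)
    then show "((\<lambda>s. L * \<bar>m s - m t\<bar>) \<longlongrightarrow> 0) (at t within {0..1})" by simp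
  qed
  then have lim: "((\<lambda>s. chart_map c (\<gamma> s)) \<longlongrightarrow> chart_map c (\<gamma> t)) (at t within {0..1})" by (simp add: LIM_zero_iff)
  have "((\<lambda>s. chart_inv c (chart_map c (\<gamma> s))) \<longlongrightarrow> chart_inv c (chart_map c (\<gamma> t))) (at t within {0..1})"
  proof (rule continuous_on_tendsto_compose[OF chart_inv_cont[OF c(1)] lim])
    show "\<forall>\<^sub>F s in at t within {0..1}. chart_map c (\<gamma> s) \<in> cimg c"
      using ev by eventually_elim (use L[of _ t] t c in auto)
  qed (use gt in auto)
  moreover have "\<forall>\<^sub>F s in at t within {0..1}. chart_inv c (chart_map c (\<gamma> s)) = \<gamma> s"
    using ev by eventually_elim (use L[of _ t] t c chart_inv_map[OF c(1)] in auto)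
  ultimately have "(\<gamma> \<longlongrightarrow> \<gamma> t) (at t within {0..1})"
    using chart_inv_map[OF c(1) gt] Lim_transform_eventually by fastforce
  then show "continuous (at t within {0..1}) \<gamma>" by (simp add: continuous_within)
qed

text \<open>The transition map is Lipschitz on a small closed ball around the point, and the path
  stays in that ball for nearby times by continuity; the constants multiply.\<close>

lemma loc_mod_chart:
  assumes l: "loc_mod m \<gamma>" and m: "continuous_on {0..1} m" and d: "d \<in> A" and t: "t \<in> {0..1}" "\<gamma> t \<in> chart_dom d"
  obtains \<delta> L where "\<delta> > 0" "L \<ge> 0" "\<And>s s'. \<lbrakk>s \<in> {0..1}; s' \<in> {0..1}; \<bar>s - t\<bar> < \<delta>; \<bar>s' - t\<bar> < \<delta>\<rbrakk> \<Longrightarrow>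
     \<gamma> s \<in> chart_dom d \<and> norm (chart_map d (\<gamma> s) - chart_map d (\<gamma> s')) \<le> L * \<bar>m s - m s'\<bar>"
proof -
  obtain c \<delta> L where c: "c \<in> A" "\<delta> > 0" "L \<ge> 0" and L: "\<And>s s'. \<lbrakk>s \<in> {0..1}; s' \<in> {0..1}; \<bar>s - t\<bar> < \<delta>; \<bar>s' - t\<bar> < \<delta>\<rbrakk> \<Longrightarrow>
     \<gamma> s \<in> chart_dom c \<and> norm (chart_map c (\<gamma> s) - chart_map c (\<gamma> s')) \<le> L * \<bar>m s - m s'\<bar>"
    using l t(1) unfolding loc_mod_def by meson
  have gt: "\<gamma> t \<in> chart_dom c" using L[of t t] t c by auto
  define S where "S = chart_map c ` (chart_dom d \<inter> chart_dom c)"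
  have S: "open S" "chart_map c (\<gamma> t) \<in> S"
    unfolding S_def using open_chart_image[OF c(1) chart_open(1)[OF d]] gt t by auto
  obtain e where e: "e > 0" "cball (chart_map c (\<gamma> t)) e \<subseteq> S" using S open_contains_cball by blast
  obtain K where K: "K \<ge> 0" "\<And>x y. \<lbrakk>x \<in> cball (chart_map c (\<gamma> t)) e; y \<in> cball (chart_map c (\<gamma> t)) e\<rbrakk> \<Longrightarrow>
      norm (trans c d x - trans c d y) \<le> K * norm (x - y)"
    by (rule bounded_derivative_cball[OF trans_smooth[OF c(1) d] e(2)[unfolded S_def]], rule that)
  have cont: "continuous_on {0..1} \<gamma>" by (rule loc_mod_continuous[OF l m])
  define V where "V = chart_dom c \<inter> chart_map c -` ball (chart_map c (\<gamma> t)) e"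
  have V: "open V" "\<gamma> t \<in> V" unfolding V_def using open_chart_preimage[OF c(1)] gt e by auto
  have "(\<gamma> \<longlongrightarrow> \<gamma> t) (at t within {0..1})" using cont t(1) by (simp add: continuous_on_def)
  then have "\<forall>\<^sub>F s in at t within {0..1}. \<gamma> s \<in> V" by (rule topological_tendstoD[OF _ V])
  then obtain \<delta>' where \<delta>'0: "\<delta>' > 0" "\<forall>s\<in>{0..1}. s \<noteq> t \<and> dist s t < \<delta>' \<longrightarrow> \<gamma> s \<in> V"
    unfolding eventually_at by blast
  have \<delta>': "\<gamma> s \<in> V" if "s \<in> {0..1}" "\<bar>s - t\<bar> < \<delta>'" for s
    using \<delta>'0(2) that V(2) by (cases "s = t") (auto simp: dist_real_def)
  show ?thesis
  proof (rule that[of "min \<delta> \<delta>'" "K * L"])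
    fix s s' assume s: "s \<in> {0..1}" "s' \<in> {0..1}" "\<bar>s - t\<bar> < min \<delta> \<delta>'" "\<bar>s' - t\<bar> < min \<delta> \<delta>'"
    have V': "\<gamma> s \<in> V" "\<gamma> s' \<in> V" using \<delta>' s by auto
    then have b: "chart_map c (\<gamma> s) \<in> cball (chart_map c (\<gamma> t)) e" "chart_map c (\<gamma> s') \<in> cball (chart_map c (\<gamma> t)) e"
      "\<gamma> s \<in> chart_dom c" "\<gamma> s' \<in> chart_dom c" by (auto simp: V_def)
    have "chart_map c (\<gamma> s) \<in> S" using b e by blast
    then have dom: "\<gamma> s \<in> chart_dom d" unfolding S_def using b(3) chart_inv_map[OF c(1)] by (auto simp: image_iff) (metis)
    have "norm (chart_map d (\<gamma> s) - chart_map d (\<gamma> s')) \<le> K * norm (chart_map c (\<gamma> s) - chart_map c (\<gamma> s'))"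
      using K(2)[OF b(1,2)] b trans_chart[OF c(1)] by simp
    also have "\<dots> \<le> K * (L * \<bar>m s - m s'\<bar>)" using L[of s s'] s K by (intro mult_left_mono) auto
    finally show "\<gamma> s \<in> chart_dom d \<and> norm (chart_map d (\<gamma> s) - chart_map d (\<gamma> s')) \<le> K * L * \<bar>m s - m s'\<bar>"
      using dom by (simp add: mult.assoc)
  qed (use \<delta>'0 c K in auto)
qed

text \<open>Local constants are glued by bisection. On adjacent intervals they are added, which is
  harmless because \<open>m\<close> is monotone.\<close>

lemma loc_mod_chart_ivl:
  assumes l: "loc_mod m \<gamma>" and m: "continuous_on {0..1} m" "mono_on {0..1} m" and d: "d \<in> A"
    and ab: "0 \<le> a" "a \<le> b" "b \<le> 1" "\<gamma> ` {a..b} \<subseteq> chart_dom d"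
  obtains L where "L \<ge> 0" "\<And>s t. \<lbrakk>a \<le> s; s \<le> t; t \<le> b\<rbrakk> \<Longrightarrow> norm (chart_map d (\<gamma> t) - chart_map d (\<gamma> s)) \<le> L * (m t - m s)"
proof -
  have mm: "m s \<le> m t" if "0 \<le> s" "s \<le> t" "t \<le> 1" for s t using m(2) that by (auto simp: mono_on_def)
  define P where "P u v \<longleftrightarrow> (a \<le> u \<longrightarrow> v \<le> b \<longrightarrow> (\<exists>L\<ge>0. \<forall>s t. u \<le> s \<and> s \<le> t \<and> t \<le> v \<longrightarrow>
     norm (chart_map d (\<gamma> t) - chart_map d (\<gamma> s)) \<le> L * (m t - m s)))" for u v
  have "P a b"
  proof (rule Bolzano[OF ab(2)])
    fix u v w assume uv: "P u v" "P v w" "u \<le> v" "v \<le> w"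
    show "P u w" unfolding P_def
    proof (intro impI)
      assume uw: "a \<le> u" "w \<le> b"
      obtain L1 where L1: "L1 \<ge> 0" "\<And>s t. u \<le> s \<and> s \<le> t \<and> t \<le> v \<Longrightarrow> norm (chart_map d (\<gamma> t) - chart_map d (\<gamma> s)) \<le> L1 * (m t - m s)"
        using uv uw unfolding P_def by force
      obtain L2 where L2: "L2 \<ge> 0" "\<And>s t. v \<le> s \<and> s \<le> t \<and> t \<le> w \<Longrightarrow> norm (chart_map d (\<gamma> t) - chart_map d (\<gamma> s)) \<le> L2 * (m t - m s)"
        using uv uw unfolding P_def by force
      show "\<exists>L\<ge>0. \<forall>s t. u \<le> s \<and> s \<le> t \<and> t \<le> w \<longrightarrow> norm (chart_map d (\<gamma> t) - chart_map d (\<gamma> s)) \<le> L * (m t - m s)"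
      proof (intro exI[of _ "L1 + L2"] conjI allI impI)
        fix s t assume st: "u \<le> s \<and> s \<le> t \<and> t \<le> w"
        have le: "m p \<le> m q" if "s \<le> p" "p \<le> q" "q \<le> t" for p q using that st uw ab by (intro mm) auto
        consider "t \<le> v" | "v \<le> s" | "s \<le> v" "v \<le> t" by linarith
        then show "norm (chart_map d (\<gamma> t) - chart_map d (\<gamma> s)) \<le> (L1 + L2) * (m t - m s)"
        proof cases
          case 1
          then have "norm (chart_map d (\<gamma> t) - chart_map d (\<gamma> s)) \<le> L1 * (m t - m s)" using L1 st by auto
          moreover have "0 \<le> L2 * (m t - m s)" using L2(1) le[of s t] st by (intro mult_nonneg_nonneg) auto
          ultimately show ?thesis by (simp add: distrib_right)
        next
          case 2
          then have "norm (chart_map d (\<gamma> t) - chart_map d (\<gamma> s)) \<le> L2 * (m t - m s)" using L2 st by auto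
          moreover have "0 \<le> L1 * (m t - m s)" using L1(1) le[of s t] st by (intro mult_nonneg_nonneg) auto
          ultimately show ?thesis by (simp add: distrib_right)
        next
          case 3
          have "norm (chart_map d (\<gamma> t) - chart_map d (\<gamma> s)) \<le> norm (chart_map d (\<gamma> v) - chart_map d (\<gamma> s)) + norm (chart_map d (\<gamma> t) - chart_map d (\<gamma> v))"
            by (metis add.commute norm_triangle_ineq diff_add_cancel add_diff_eq)
          also have "\<dots> \<le> L1 * (m v - m s) + L2 * (m t - m v)" using L1(2)[of s v] L2(2)[of v t] 3 st by (intro add_mono) auto
          also have "\<dots> \<le> L1 * (m t - m s) + L2 * (m t - m s)"
            using L1(1) L2(1) le[of s v] le[of v t] 3 st by (intro add_mono mult_left_mono) auto
          finally show ?thesis by (simp add: distrib_right)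
        qed
      qed (use L1 L2 in auto)
    qed
  next
    fix x assume x: "a \<le> x" "x \<le> b"
    then have "x \<in> {0..1}" "\<gamma> x \<in> chart_dom d" using ab by auto
    then obtain \<delta> L where \<delta>: "\<delta> > 0" "L \<ge> 0" "\<And>s s'. \<lbrakk>s \<in> {0..1}; s' \<in> {0..1}; \<bar>s - x\<bar> < \<delta>; \<bar>s' - x\<bar> < \<delta>\<rbrakk> \<Longrightarrow>
       \<gamma> s \<in> chart_dom d \<and> norm (chart_map d (\<gamma> s) - chart_map d (\<gamma> s')) \<le> L * \<bar>m s - m s'\<bar>"
      using loc_mod_chart[OF l m(1) d] by blast
    show "\<exists>\<delta>>0. \<forall>u v. u \<le> x \<and> x \<le> v \<and> v - u < \<delta> \<longrightarrow> P u v"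
    proof (intro exI[of _ \<delta>] conjI allI impI \<delta>(1))
      fix u v assume uv: "u \<le> x \<and> x \<le> v \<and> v - u < \<delta>"
      show "P u v" unfolding P_def
      proof (intro impI exI[of _ L] conjI allI)
        fix s t assume *: "a \<le> u" "v \<le> b" "u \<le> s \<and> s \<le> t \<and> t \<le> v"
        have "norm (chart_map d (\<gamma> t) - chart_map d (\<gamma> s)) \<le> L * \<bar>m t - m s\<bar>" using \<delta>(3)[of t s] * uv ab by auto
        moreover have "m s \<le> m t" by (rule mm) (use * ab in auto)
        ultimately show "norm (chart_map d (\<gamma> t) - chart_map d (\<gamma> s)) \<le> L * (m t - m s)" by simp
      qed (rule \<delta>(2))
    qed
  qed
  then show ?thesis using that unfolding P_def by force
qed

lemma loc_mod_ac_path: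
  assumes l: "loc_mod (\<lambda>t. integral {0..t} k) \<gamma>"
    and k: "k absolutely_integrable_on {0..1}" "\<And>t. t \<in> {0..1} \<Longrightarrow> 0 \<le> k t"
  shows "ac_path A \<gamma>"
  unfolding ac_path_def
proof (intro conjI ballI allI impI)
  define m where "m t = integral {0..t} k" for t
  have m: "primitive m k" unfolding primitive_def m_def using k by simp
  have mc: "continuous_on {0..1} m" by (rule primitive_continuous[OF m])
  have inc: "m t - m s = integral {s..t} k" if "0 \<le> s" "s \<le> t" "t \<le> 1" for s t by (rule primitive_diff[OF m that])
  have mm: "mono_on {0..1} m"
  proof (rule mono_onI)
    fix s t :: real assume st: "s \<in> {0..1}" "t \<in> {0..1}" "s \<le> t"
    have "0 \<le> integral {s..t} k"
      by (rule Henstock_Kurzweil_Integration.integral_nonneg)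
        (use primitive_has_integral[OF m, of s t] st k in auto)
    then show "m s \<le> m t" using inc[of s t] st by auto
  qed
  have l': "loc_mod m \<gamma>" using l unfolding m_def .
  show "continuous_on {0..1} \<gamma>" by (rule loc_mod_continuous[OF l' mc])
  fix d a b assume d: "d \<in> A" and ab: "0 \<le> a \<and> a \<le> b \<and> b \<le> 1 \<and> \<gamma> ` {a..b} \<subseteq> chart_dom d"
  then obtain L where L: "L \<ge> 0" "\<And>s t. \<lbrakk>a \<le> s; s \<le> t; t \<le> b\<rbrakk> \<Longrightarrow> norm (chart_map d (\<gamma> t) - chart_map d (\<gamma> s)) \<le> L * (m t - m s)"
    using loc_mod_chart_ivl[OF l' mc mm d] by blast
  show "absolutely_continuous_on_ivl a b (chart_map d \<circ> \<gamma>)"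
  proof (rule absolutely_continuous_modulus[where k = k and C = "L + 1"])
    show "k absolutely_integrable_on {a..b}" by (rule abs_integrable_ivl[OF k(1)]) (use ab in auto)
    show "0 \<le> k t" if "t \<in> {a..b}" for t using k(2) that ab by auto
    fix s t assume st: "a \<le> s" "s \<le> t" "t \<le> b"
    have "0 \<le> m t - m s" using mm st ab by (auto simp: mono_on_def)
    then show "norm ((chart_map d \<circ> \<gamma>) t - (chart_map d \<circ> \<gamma>) s) \<le> (L + 1) * integral {s..t} k"
      using L(2)[OF st] inc[of s t] st ab by (simp add: distrib_right)
  qed (use L in simp)
qed

end

lemma AE_lebesgue_on_ivl_iff:
  "(AE t in lebesgue_on {0..1::real}. P t) \<longleftrightarrow> (\<exists>N. negligible N \<and> (\<forall>t\<in>{0<..<1} - N. P t))"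
proof
  assume "AE t in lebesgue_on {0..1}. P t"
  then have "AE t in lebesgue. t \<in> {0..1} \<longrightarrow> P t" by (subst (asm) AE_restrict_space_iff) auto
  then obtain N where "{t. \<not> (t \<in> {0..1} \<longrightarrow> P t)} \<subseteq> N" "N \<in> null_sets lebesgue"
    by (auto simp: eventually_ae_filter)
  moreover have "P t" if "t \<in> {0<..<1} - N" for t
  proof (rule ccontr)
    assume "\<not> P t"
    then have "t \<in> {t. \<not> (t \<in> {0..1} \<longrightarrow> P t)}" using that by auto
    then show False using that calculation(1) by blast
  qed
  ultimately show "\<exists>N. negligible N \<and> (\<forall>t\<in>{0<..<1} - N. P t)"
    by (auto simp: negligible_iff_null_sets)
next
  assume "\<exists>N. negligible N \<and> (\<forall>t\<in>{0<..<1} - N. P t)"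
  then show "AE t in lebesgue_on {0..1}. P t" by (metis AE_lebesgue_on_ivl)
qed

lemma negligible_affine_vimage:
  fixes a b :: real
  assumes "negligible N" "b \<noteq> 0" shows "negligible {t. a + b * t \<in> N}"
proof -
  have "negligible ((\<lambda>s. (s - a) / b) ` N)"
    by (rule negligible_differentiable_image_negligible) (use assms in \<open>auto intro!: derivative_intros simp: differentiable_on_def\<close>)
  moreover have "{t. a + b * t \<in> N} \<subseteq> (\<lambda>s. (s - a) / b) ` N"
    using assms(2) by (auto simp: image_iff intro!: bexI[of _ "a + b * _"])
  ultimately show ?thesis by (rule negligible_subset)
qed

lemma emeasure_lebesgue_on_01: "emeasure (lebesgue_on {0..1::real}) (space (lebesgue_on {0..1})) = 1"
  by (simp add: emeasure_restrict_space)

context manifold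
begin

lemma loc_mod_affine:
  assumes l: "loc_mod (\<lambda>t. t) \<gamma>" and a: "a \<in> {0..1}" "b \<in> {0..1}"
  shows "loc_mod (\<lambda>t. t) (\<lambda>t. \<gamma> (a + (b - a) * t))"
  unfolding loc_mod_def
proof
  define \<phi> where "\<phi> t = a + (b - a) * t" for t
  have \<phi>01: "\<phi> t \<in> {0..1}" if "t \<in> {0..1}" for t
  proof -
    have "\<phi> t = (1 - t) * a + t * b" by (simp add: \<phi>_def algebra_simps)
    moreover have "(1 - t) * a + t * b \<le> (1 - t) * 1 + t * 1" using that a by (intro add_mono mult_left_mono) auto
    moreover have "0 \<le> (1 - t) * a + t * b" using that a by auto
    ultimately show ?thesis by auto
  qed
  have \<phi>d: "\<bar>\<phi> s - \<phi> t\<bar> \<le> \<bar>s - t\<bar>" for s t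
  proof -
    have "\<phi> s - \<phi> t = (b - a) * (s - t)" by (simp add: \<phi>_def algebra_simps)
    moreover have "\<bar>b - a\<bar> \<le> 1" using a by auto
    ultimately show ?thesis using mult_right_mono[of "\<bar>b - a\<bar>" 1 "\<bar>s - t\<bar>"] by (simp add: abs_mult)
  qed
  fix t :: real assume t: "t \<in> {0..1}"
  obtain c \<delta> L where c: "c \<in> A" "\<delta> > 0" "L \<ge> 0" and L: "\<And>s s'. \<lbrakk>s \<in> {0..1}; s' \<in> {0..1}; \<bar>s - \<phi> t\<bar> < \<delta>; \<bar>s' - \<phi> t\<bar> < \<delta>\<rbrakk> \<Longrightarrow>
     \<gamma> s \<in> chart_dom c \<and> norm (chart_map c (\<gamma> s) - chart_map c (\<gamma> s')) \<le> L * \<bar>s - s'\<bar>"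
    using l \<phi>01[OF t] unfolding loc_mod_def by meson
  have "\<gamma> (\<phi> s) \<in> chart_dom c \<and> norm (chart_map c (\<gamma> (\<phi> s)) - chart_map c (\<gamma> (\<phi> s'))) \<le> L * \<bar>s - s'\<bar>"
    if s: "s \<in> {0..1}" "s' \<in> {0..1}" "\<bar>s - t\<bar> < \<delta> \<and> \<bar>s' - t\<bar> < \<delta>" for s s'
  proof -
    have "\<bar>\<phi> s - \<phi> t\<bar> < \<delta>" "\<bar>\<phi> s' - \<phi> t\<bar> < \<delta>" using \<phi>d[of s t] \<phi>d[of s' t] s by auto
    from L[OF \<phi>01[OF s(1)] \<phi>01[OF s(2)] this] mult_left_mono[OF \<phi>d[of s s'] c(3)] show ?thesis by auto
  qed
  then show "\<exists>c\<in>A. \<exists>\<delta>>0. \<exists>L\<ge>0. \<forall>s\<in>{0..1}. \<forall>s'\<in>{0..1}. \<bar>s - t\<bar> < \<delta> \<and> \<bar>s' - t\<bar> < \<delta> \<longrightarrow>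
     \<gamma> (a + (b - a) * s) \<in> chart_dom c \<and> norm (chart_map c (\<gamma> (a + (b - a) * s)) - chart_map c (\<gamma> (a + (b - a) * s'))) \<le> L * \<bar>s - s'\<bar>"
    using c unfolding \<phi>_def by blast
qed

text \<open>Off the junction one of the two halves applies after rescaling. At the junction both
  apply in the same chart, and an increment across it is split there, so the larger constant L1 + L2
  works.\<close>

lemma loc_mod_concat:
  assumes l: "0 < l" "l < 1"
    and l1: "loc_mod (\<lambda>t. t) (\<lambda>t. \<sigma> (l * t))" and l2: "loc_mod (\<lambda>t. t) (\<lambda>t. \<sigma> (l + (1 - l) * t))"
  shows "loc_mod (\<lambda>t. t) \<sigma>"
proof -
  have id: "continuous_on {0..1} (\<lambda>t::real. t)" by (rule continuous_on_id)
  have left: "\<exists>\<delta>>0. \<exists>L\<ge>0. \<forall>s\<in>{0..l}. \<forall>s'\<in>{0..l}. \<bar>s - t\<bar> < \<delta> \<and> \<bar>s' - t\<bar> < \<delta> \<longrightarrow>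
     \<sigma> s \<in> chart_dom d \<and> norm (chart_map d (\<sigma> s) - chart_map d (\<sigma> s')) \<le> L * \<bar>s - s'\<bar>"
    if t: "t \<in> {0..l}" and d: "d \<in> A" "\<sigma> t \<in> chart_dom d" for t d
  proof -
    have "t / l \<in> {0..1}" "\<sigma> (l * (t / l)) \<in> chart_dom d" using t l d by auto
    from loc_mod_chart[OF l1 id d(1) this] obtain \<delta> L where \<delta>: "\<delta> > 0" "L \<ge> 0"
      and L: "\<And>s s'. \<lbrakk>s \<in> {0..1}; s' \<in> {0..1}; \<bar>s - t / l\<bar> < \<delta>; \<bar>s' - t / l\<bar> < \<delta>\<rbrakk> \<Longrightarrow>
        \<sigma> (l * s) \<in> chart_dom d \<and> norm (chart_map d (\<sigma> (l * s)) - chart_map d (\<sigma> (l * s'))) \<le> L * \<bar>s - s'\<bar>"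
      by metis
    show ?thesis
    proof (rule exI[of _ "\<delta> * l"], rule conjI[rotated], rule exI[of _ "L / l"], intro conjI ballI impI)
      show "0 < \<delta> * l" "0 \<le> L / l" using \<delta> l by auto
      fix s s' assume s: "s \<in> {0..l}" "s' \<in> {0..l}" "\<bar>s - t\<bar> < \<delta> * l \<and> \<bar>s' - t\<bar> < \<delta> * l"
      have eq: "\<bar>a / l - b / l\<bar> = \<bar>a - b\<bar> / l" for a b using l by (simp flip: diff_divide_distrib)
      have "\<sigma> (l * (s / l)) \<in> chart_dom d \<and> norm (chart_map d (\<sigma> (l * (s / l))) - chart_map d (\<sigma> (l * (s' / l)))) \<le> L * \<bar>s / l - s' / l\<bar>"
        by (rule L) (use s l in \<open>auto simp: eq field_simps\<close>)
      then show "\<sigma> s \<in> chart_dom d" "norm (chart_map d (\<sigma> s) - chart_map d (\<sigma> s')) \<le> L / l * \<bar>s - s'\<bar>"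
        using l by (auto simp: eq)
    qed
  qed
  have right: "\<exists>\<delta>>0. \<exists>L\<ge>0. \<forall>s\<in>{l..1}. \<forall>s'\<in>{l..1}. \<bar>s - t\<bar> < \<delta> \<and> \<bar>s' - t\<bar> < \<delta> \<longrightarrow>
     \<sigma> s \<in> chart_dom d \<and> norm (chart_map d (\<sigma> s) - chart_map d (\<sigma> s')) \<le> L * \<bar>s - s'\<bar>"
    if t: "t \<in> {l..1}" and d: "d \<in> A" "\<sigma> t \<in> chart_dom d" for t d
  proof -
    define k where "k = 1 - l"
    have k: "k > 0" using l by (simp add: k_def)
    have inv: "l + k * ((a - l) / k) = a" for a using k by simp
    have "(t - l) / k \<in> {0..1}" using t l by (simp add: k_def field_simps)
    moreover have "\<sigma> (l + (1 - l) * ((t - l) / k)) \<in> chart_dom d"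
      unfolding k_def[symmetric] inv by (rule d(2))
    ultimately have "(t - l) / k \<in> {0..1}" "\<sigma> (l + (1 - l) * ((t - l) / k)) \<in> chart_dom d" .
    from loc_mod_chart[OF l2 id d(1) this] obtain \<delta> L where \<delta>: "\<delta> > 0" "L \<ge> 0"
      and L: "\<And>s s'. \<lbrakk>s \<in> {0..1}; s' \<in> {0..1}; \<bar>s - (t - l) / k\<bar> < \<delta>; \<bar>s' - (t - l) / k\<bar> < \<delta>\<rbrakk> \<Longrightarrow>
        \<sigma> (l + (1 - l) * s) \<in> chart_dom d \<and> norm (chart_map d (\<sigma> (l + (1 - l) * s)) - chart_map d (\<sigma> (l + (1 - l) * s'))) \<le> L * \<bar>s - s'\<bar>"
      by metis
    show ?thesis
    proof (rule exI[of _ "\<delta> * k"], rule conjI[rotated], rule exI[of _ "L / k"], intro conjI ballI impI)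
      show "0 < \<delta> * k" "0 \<le> L / k" using \<delta> k by auto
      fix s s' assume s: "s \<in> {l..1}" "s' \<in> {l..1}" "\<bar>s - t\<bar> < \<delta> * k \<and> \<bar>s' - t\<bar> < \<delta> * k"
      have eq: "\<bar>(a - l) / k - (b - l) / k\<bar> = \<bar>a - b\<bar> / k" for a b using k by (simp flip: diff_divide_distrib)
      have "\<sigma> (l + (1 - l) * ((s - l) / k)) \<in> chart_dom d \<and> norm (chart_map d (\<sigma> (l + (1 - l) * ((s - l) / k))) - chart_map d (\<sigma> (l + (1 - l) * ((s' - l) / k)))) \<le> L * \<bar>(s - l) / k - (s' - l) / k\<bar>"
      proof (rule L)
        show "(s - l) / k \<in> {0..1}" "(s' - l) / k \<in> {0..1}" using s l by (auto simp: k_def)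
        show "\<bar>(s - l) / k - (t - l) / k\<bar> < \<delta>" "\<bar>(s' - l) / k - (t - l) / k\<bar> < \<delta>"
          unfolding eq using s k by (simp_all add: pos_divide_less_eq)
      qed
      then show "\<sigma> s \<in> chart_dom d" "norm (chart_map d (\<sigma> s) - chart_map d (\<sigma> s')) \<le> L / k * \<bar>s - s'\<bar>"
        using inv[of s] inv[of s'] unfolding k_def[symmetric] by (auto simp: eq)
    qed
  qed
  show ?thesis
    unfolding loc_mod_def
  proof
    fix t :: real assume t: "t \<in> {0..1}"
    define d where "d = chart_at A (\<sigma> t)"
    have d: "d \<in> A" "\<sigma> t \<in> chart_dom d" using chart_at by (auto simp: d_def)
    consider "t < l" | "t > l" | "t = l" by linarith
    then have "\<exists>\<delta>>0. \<exists>L\<ge>0. \<forall>s\<in>{0..1}. \<forall>s'\<in>{0..1}. \<bar>s - t\<bar> < \<delta> \<and> \<bar>s' - t\<bar> < \<delta> \<longrightarrow>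
       \<sigma> s \<in> chart_dom d \<and> norm (chart_map d (\<sigma> s) - chart_map d (\<sigma> s')) \<le> L * \<bar>s - s'\<bar>"
    proof cases
      case 1
      then have "t \<in> {0..l}" using t by auto
      from left[OF this d] obtain \<delta> L where \<delta>: "\<delta> > 0" "L \<ge> 0" and L: "\<forall>s\<in>{0..l}. \<forall>s'\<in>{0..l}. \<bar>s - t\<bar> < \<delta> \<and> \<bar>s' - t\<bar> < \<delta> \<longrightarrow>
       \<sigma> s \<in> chart_dom d \<and> norm (chart_map d (\<sigma> s) - chart_map d (\<sigma> s')) \<le> L * \<bar>s - s'\<bar>" by blast
      show ?thesis
      proof (rule exI[of _ "min \<delta> (l - t)"], rule conjI[rotated], rule exI[of _ L], intro conjI ballI impI)
        fix s s' :: real assume s: "s \<in> {0..1}" "s' \<in> {0..1}" "\<bar>s - t\<bar> < min \<delta> (l - t) \<and> \<bar>s' - t\<bar> < min \<delta> (l - t)"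
        then have "s \<in> {0..l}" "s' \<in> {0..l}" by auto
        with L s show "\<sigma> s \<in> chart_dom d" "norm (chart_map d (\<sigma> s) - chart_map d (\<sigma> s')) \<le> L * \<bar>s - s'\<bar>" by auto
      qed (use \<delta> 1 in auto)
    next
      case 2
      then have "t \<in> {l..1}" using t by auto
      from right[OF this d] obtain \<delta> L where \<delta>: "\<delta> > 0" "L \<ge> 0" and L: "\<forall>s\<in>{l..1}. \<forall>s'\<in>{l..1}. \<bar>s - t\<bar> < \<delta> \<and> \<bar>s' - t\<bar> < \<delta> \<longrightarrow>
       \<sigma> s \<in> chart_dom d \<and> norm (chart_map d (\<sigma> s) - chart_map d (\<sigma> s')) \<le> L * \<bar>s - s'\<bar>" by blast
      show ?thesis
      proof (rule exI[of _ "min \<delta> (t - l)"], rule conjI[rotated], rule exI[of _ L], intro conjI ballI impI)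
        fix s s' :: real assume s: "s \<in> {0..1}" "s' \<in> {0..1}" "\<bar>s - t\<bar> < min \<delta> (t - l) \<and> \<bar>s' - t\<bar> < min \<delta> (t - l)"
        then have "s \<in> {l..1}" "s' \<in> {l..1}" by auto
        with L s show "\<sigma> s \<in> chart_dom d" "norm (chart_map d (\<sigma> s) - chart_map d (\<sigma> s')) \<le> L * \<bar>s - s'\<bar>" by auto
      qed (use \<delta> 2 in auto)
    next
      case 3
      then have "t \<in> {0..l}" "t \<in> {l..1}" using t by auto
      from left[OF this(1) d] right[OF this(2) d]
      obtain \<delta>1 L1 \<delta>2 L2 where \<delta>: "\<delta>1 > 0" "L1 \<ge> 0" "\<delta>2 > 0" "L2 \<ge> 0"
        and L1: "\<And>s s'. s \<in> {0..l} \<Longrightarrow> s' \<in> {0..l} \<Longrightarrow> \<bar>s - t\<bar> < \<delta>1 \<Longrightarrow> \<bar>s' - t\<bar> < \<delta>1 \<Longrightarrow>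
         \<sigma> s \<in> chart_dom d \<and> norm (chart_map d (\<sigma> s) - chart_map d (\<sigma> s')) \<le> L1 * \<bar>s - s'\<bar>"
        and L2: "\<And>s s'. s \<in> {l..1} \<Longrightarrow> s' \<in> {l..1} \<Longrightarrow> \<bar>s - t\<bar> < \<delta>2 \<Longrightarrow> \<bar>s' - t\<bar> < \<delta>2 \<Longrightarrow>
         \<sigma> s \<in> chart_dom d \<and> norm (chart_map d (\<sigma> s) - chart_map d (\<sigma> s')) \<le> L2 * \<bar>s - s'\<bar>"
        by metis
      define L where "L = L1 + L2"
      have LL: "L1 * \<bar>x\<bar> \<le> L * \<bar>x\<bar>" "L2 * \<bar>x\<bar> \<le> L * \<bar>x\<bar>" for x using \<delta> by (auto simp: L_def intro!: mult_right_mono)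
      have key: "\<sigma> s \<in> chart_dom d \<and> norm (chart_map d (\<sigma> s) - chart_map d (\<sigma> s')) \<le> L * \<bar>s - s'\<bar>"
        if s: "s \<in> {0..1}" "s' \<in> {0..1}" "\<bar>s - t\<bar> < min \<delta>1 \<delta>2" "\<bar>s' - t\<bar> < min \<delta>1 \<delta>2" "s \<le> s'" for s s'
      proof -
        consider "s' \<le> l" | "l \<le> s" | "s \<le> l" "l \<le> s'" by linarith
        then show ?thesis
        proof cases
          case 1 then show ?thesis using L1[of s s'] LL(1)[of "s - s'"] s by auto
        next
          case 2 then show ?thesis using L2[of s s'] LL(2)[of "s - s'"] s by auto
        next
          case 3
          have a: "\<sigma> s \<in> chart_dom d" "norm (chart_map d (\<sigma> s) - chart_map d (\<sigma> l)) \<le> L1 * \<bar>s - l\<bar>"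
            using L1[of s l] 3 s \<open>t = l\<close> \<delta> l by auto
          have b: "norm (chart_map d (\<sigma> l) - chart_map d (\<sigma> s')) \<le> L2 * \<bar>l - s'\<bar>"
            using L2[of l s'] 3 s \<open>t = l\<close> \<delta> l by auto
          have "norm (chart_map d (\<sigma> s) - chart_map d (\<sigma> s')) \<le> norm (chart_map d (\<sigma> s) - chart_map d (\<sigma> l)) + norm (chart_map d (\<sigma> l) - chart_map d (\<sigma> s'))"
            using norm_triangle_ineq[of "chart_map d (\<sigma> s) - chart_map d (\<sigma> l)" "chart_map d (\<sigma> l) - chart_map d (\<sigma> s')"] by simp
          also have "\<dots> \<le> L * \<bar>s - l\<bar> + L * \<bar>l - s'\<bar>" using a b LL(1)[of "s - l"] LL(2)[of "l - s'"] by linarith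
          also have "\<dots> = L * \<bar>s - s'\<bar>" using 3 by (simp add: algebra_simps)
          finally show ?thesis using a by simp
        qed
      qed
      show ?thesis
      proof (rule exI[of _ "min \<delta>1 \<delta>2"], rule conjI[rotated], rule exI[of _ L], intro conjI ballI impI)
        fix s s' :: real assume s: "s \<in> {0..1}" "s' \<in> {0..1}" "\<bar>s - t\<bar> < min \<delta>1 \<delta>2 \<and> \<bar>s' - t\<bar> < min \<delta>1 \<delta>2"
        show "\<sigma> s \<in> chart_dom d" using key[of s s] s by auto
        show "norm (chart_map d (\<sigma> s) - chart_map d (\<sigma> s')) \<le> L * \<bar>s - s'\<bar>"
          using key[of s s'] key[of s' s] s by (cases "s \<le> s'") (auto simp: norm_minus_commute abs_minus_commute)
      qed (use \<delta> in \<open>auto simp: L_def\<close>)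
    qed
    then show "\<exists>c\<in>A. \<exists>\<delta>>0. \<exists>L\<ge>0. \<forall>s\<in>{0..1}. \<forall>s'\<in>{0..1}. \<bar>s - t\<bar> < \<delta> \<and> \<bar>s' - t\<bar> < \<delta> \<longrightarrow>
       \<sigma> s \<in> chart_dom c \<and> norm (chart_map c (\<sigma> s) - chart_map c (\<sigma> s')) \<le> L * \<bar>s - s'\<bar>"
      using d(1) by blast
  qed
qed

lemma loc_mod_const: "loc_mod m (\<lambda>t. x)"
  unfolding loc_mod_def
  by (intro ballI bexI[of _ "chart_at A x"] exI[of _ 1] exI[of _ 0] conjI) (use chart_at in auto)

lemma has_velocity_const: "has_velocity A (\<lambda>t. x) t 0"
  by (simp add: has_velocity_def o_def)

end

section \<open>Horizontal paths of bounded speed\<close>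

locale sr_manifold = manifold A for A :: "('m::{t2_space, second_countable_topology}, 'e::euclidean_space) chart set" +
  fixes \<Delta> :: "'m \<Rightarrow> 'e set" and g :: "'m \<Rightarrow> 'e \<Rightarrow> 'e \<Rightarrow> real" and K :: "'k::finite itself"
  assumes dist: "smooth_distribution K A \<Delta>" and metric: "smooth_metric A \<Delta> g"
begin

lemma \<Delta>_subspace: "subspace (\<Delta> x)"
proof -
  obtain U and X :: "'k \<Rightarrow> 'm \<Rightarrow> 'e" where "x \<in> U" "local_frame A \<Delta> U X" using dist unfolding smooth_distribution_def by metis
  then have "\<Delta> x = span (range (\<lambda>i. X i x))" unfolding local_frame_def frame_at_def by auto
  then show ?thesis by simp
qed

lemma g_inner: "inner_product_on (\<Delta> x) (g x)" using metric by (simp add: smooth_metric_def)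

lemma g_sym: "v \<in> \<Delta> x \<Longrightarrow> w \<in> \<Delta> x \<Longrightarrow> g x v w = g x w v"
  and g_add: "u \<in> \<Delta> x \<Longrightarrow> v \<in> \<Delta> x \<Longrightarrow> w \<in> \<Delta> x \<Longrightarrow> g x (u + v) w = g x u w + g x v w"
  and g_scale: "v \<in> \<Delta> x \<Longrightarrow> w \<in> \<Delta> x \<Longrightarrow> g x (r *\<^sub>R v) w = r * g x v w"
  and g_pos: "v \<in> \<Delta> x \<Longrightarrow> v \<noteq> 0 \<Longrightarrow> g x v v > 0"
  using g_inner[of x] by (auto simp: inner_product_on_def)

lemma g_zero: "w \<in> \<Delta> x \<Longrightarrow> g x 0 w = 0"
  using g_scale[of 0 x w 0] subspace_0[OF \<Delta>_subspace] by simp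

lemma g_scale2: "v \<in> \<Delta> x \<Longrightarrow> g x (r *\<^sub>R v) (r *\<^sub>R v) = r\<^sup>2 * g x v v"
  using g_scale[of v x "r *\<^sub>R v" r] g_scale[of v x v r] g_sym[of v x "r *\<^sub>R v"] subspace_scale[OF \<Delta>_subspace]
  by (simp add: power2_eq_square)

lemma g_nonneg: "v \<in> \<Delta> x \<Longrightarrow> g x v v \<ge> 0"
  using g_pos[of v x] g_zero[of 0 x] subspace_0[OF \<Delta>_subspace] by (cases "v = 0") auto

text \<open>Speed at most \<open>T\<close> on unit time. In a chart these paths are the trajectories
  of controls bounded by \<open>T\<close>, so compactness applies to them, and the single number
  bounds the length by \<open>T\<close> and the energy by its square.\<close>

definition hp :: "real \<Rightarrow> (real \<Rightarrow> 'm) \<Rightarrow> bool" where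
  "hp T \<gamma> \<longleftrightarrow> loc_mod (\<lambda>t. t) \<gamma> \<and> (\<exists>N. negligible N \<and> (\<forall>t\<in>{0<..<1} - N.
     \<exists>v\<in>\<Delta> (\<gamma> t). has_velocity A \<gamma> t v \<and> g (\<gamma> t) v v \<le> T\<^sup>2))"

definition reach :: "real \<Rightarrow> 'm \<Rightarrow> 'm \<Rightarrow> bool" where
  "reach T x y \<longleftrightarrow> 0 < T \<and> (\<exists>\<gamma>. hp T \<gamma> \<and> \<gamma> 0 = x \<and> \<gamma> 1 = y)"

lemma hp_continuous: "hp T \<gamma> \<Longrightarrow> continuous_on {0..1} \<gamma>"
  unfolding hp_def using loc_mod_continuous[OF _ continuous_on_id] by blast

lemma hp_horizontal: "hp T \<gamma> \<Longrightarrow> horizontal A \<Delta> \<gamma>"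
proof -
  assume h: "hp T \<gamma>"
  have "loc_mod (\<lambda>t. integral {0..t} (\<lambda>_. 1)) \<gamma>"
  proof -
    have "loc_mod m \<gamma>" if "\<And>t. t \<in> {0..1} \<Longrightarrow> m t = t" for m
    proof -
      have "loc_mod (\<lambda>t. t) \<gamma>" using h by (simp add: hp_def)
      then show ?thesis unfolding loc_mod_def using that by simp
    qed
    then show ?thesis by simp
  qed
  then have "ac_path A \<gamma>" by (rule loc_mod_ac_path) auto
  then show ?thesis unfolding horizontal_def AE_lebesgue_on_ivl_iff using h unfolding hp_def by meson
qed

lemma hp_ae:
  assumes "hp T \<gamma>" shows "AE t in lebesgue_on {0..1}. g (\<gamma> t) (velocity A \<gamma> t) (velocity A \<gamma> t) \<le> T\<^sup>2"
  unfolding AE_lebesgue_on_ivl_iff using assms unfolding hp_def by (metis velocity_eq)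

lemma hp_length: "hp T \<gamma> \<Longrightarrow> 0 \<le> T \<Longrightarrow> sr_length A g \<gamma> \<le> ennreal T"
proof -
  assume h: "hp T \<gamma>" and T: "0 \<le> T"
  have "sr_length A g \<gamma> \<le> (\<integral>\<^sup>+t. ennreal T \<partial>lebesgue_on {0..1::real})"
    unfolding sr_length_def
  proof (rule nn_integral_mono_AE)
    show "AE t in lebesgue_on {0..1}. ennreal (sqrt (g (\<gamma> t) (velocity A \<gamma> t) (velocity A \<gamma> t))) \<le> ennreal T"
      using hp_ae[OF h] by eventually_elim (intro ennreal_leI real_le_lsqrt T)
  qed
  then show ?thesis using emeasure_lebesgue_on_01 by simp
qed

lemma hp_energy: "hp T \<gamma> \<Longrightarrow> 0 \<le> T \<Longrightarrow> sr_energy A g \<gamma> \<le> ennreal (T\<^sup>2)"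
proof -
  assume h: "hp T \<gamma>" and T: "0 \<le> T"
  have "sr_energy A g \<gamma> \<le> (\<integral>\<^sup>+t. ennreal (T\<^sup>2) \<partial>lebesgue_on {0..1::real})"
    unfolding sr_energy_def
  proof (rule nn_integral_mono_AE)
    show "AE t in lebesgue_on {0..1}. ennreal (g (\<gamma> t) (velocity A \<gamma> t) (velocity A \<gamma> t)) \<le> ennreal (T\<^sup>2)"
      using hp_ae[OF h] by eventually_elim (rule ennreal_leI)
  qed
  then show ?thesis using emeasure_lebesgue_on_01 by simp
qed

lemma reach_value: "reach T x y \<Longrightarrow> value_fun A \<Delta> g x y \<le> ennreal (T\<^sup>2)"
proof -
  assume "reach T x y"
  then obtain \<gamma> where \<gamma>: "hp T \<gamma>" "\<gamma> 0 = x" "\<gamma> 1 = y" "0 < T" by (auto simp: reach_def)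
  then have "\<gamma> \<in> horizontal_paths A \<Delta> x y" using hp_horizontal by (auto simp: horizontal_paths_def)
  then have "value_fun A \<Delta> g x y \<le> sr_energy A g \<gamma>" unfolding value_fun_def by (rule INF_lower)
  also have "\<dots> \<le> ennreal (T\<^sup>2)" using hp_energy \<gamma> by simp
  finally show ?thesis .
qed

lemma hp_mono: "hp S \<gamma> \<Longrightarrow> 0 \<le> S \<Longrightarrow> S \<le> T \<Longrightarrow> hp T \<gamma>"
proof -
  assume h: "hp S \<gamma>" "0 \<le> S" "S \<le> T"
  then have "S\<^sup>2 \<le> T\<^sup>2" by (intro power_mono)
  then show ?thesis using h(1) unfolding hp_def by (meson order_trans)
qed

lemma reach_mono: "reach S x y \<Longrightarrow> S \<le> T \<Longrightarrow> reach T x y"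
proof -
  assume "reach S x y" "S \<le> T"
  then obtain \<gamma> where \<gamma>: "hp S \<gamma>" "\<gamma> 0 = x" "\<gamma> 1 = y" "0 < S" by (auto simp: reach_def)
  then have "hp T \<gamma>" using hp_mono[of S \<gamma> T] \<open>S \<le> T\<close> by simp
  then show ?thesis unfolding reach_def using \<gamma> \<open>S \<le> T\<close> by auto
qed

lemma hp_const: "hp T (\<lambda>t. x)"
  unfolding hp_def using loc_mod_const has_velocity_const subspace_0[OF \<Delta>_subspace] g_zero[of 0 x]
  by (intro conjI exI[of _ "{}"] ballI bexI[of _ 0]) auto

lemma reach_refl: "0 < T \<Longrightarrow> reach T x x"
  unfolding reach_def using hp_const[of T x] by auto

lemma affine_ivl:
  fixes a b t :: real
  assumes "a \<in> {0..1}" "b \<in> {0..1}" "a \<noteq> b" "t \<in> {0<..<1}"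
  shows "a + (b - a) * t \<in> {0<..<1}"
proof (cases "a < b")
  case True
  then have "0 < (b - a) * t" "(b - a) * t < (b - a) * 1" using assms by (auto intro: mult_strict_left_mono)
  moreover define X where "X = (b - a) * t"
  ultimately show ?thesis using assms unfolding X_def[symmetric] by simp
next
  case False
  then have "(b - a) * t < 0" "(b - a) * t > (b - a) * 1" using assms by (auto simp: mult_less_0_iff mult_less_cancel_left)
  moreover define X where "X = (b - a) * t"
  ultimately show ?thesis using assms unfolding X_def[symmetric] by simp
qed

lemma hp_affine:
  assumes h: "hp T \<gamma>" and ab: "a \<in> {0..1}" "b \<in> {0..1}"
  shows "hp (\<bar>b - a\<bar> * T) (\<lambda>t. \<gamma> (a + (b - a) * t))"
proof (cases "a = b")
  case True then show ?thesis using hp_const by simp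
next
  case False
  obtain N where N: "negligible N" "\<And>t. t \<in> {0<..<1} - N \<Longrightarrow> \<exists>v\<in>\<Delta> (\<gamma> t). has_velocity A \<gamma> t v \<and> g (\<gamma> t) v v \<le> T\<^sup>2"
    using h unfolding hp_def by blast
  have N': "negligible {t. a + (b - a) * t \<in> N}" by (rule negligible_affine_vimage[OF N(1)]) (use False in auto)
  have "\<exists>v\<in>\<Delta> (\<gamma> (a + (b - a) * t)). has_velocity A (\<lambda>t. \<gamma> (a + (b - a) * t)) t v \<and> g (\<gamma> (a + (b - a) * t)) v v \<le> (\<bar>b - a\<bar> * T)\<^sup>2"
    if t: "t \<in> {0<..<1} - {t. a + (b - a) * t \<in> N}" for t
  proof -
    have "a + (b - a) * t \<in> {0<..<1} - N" using affine_ivl[OF ab False, of t] t by auto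
    then obtain v where v: "v \<in> \<Delta> (\<gamma> (a + (b - a) * t))" "has_velocity A \<gamma> (a + (b - a) * t) v" "g (\<gamma> (a + (b - a) * t)) v v \<le> T\<^sup>2"
      using N(2) by blast
    show ?thesis
    proof (intro bexI[of _ "(b - a) *\<^sub>R v"] conjI)
      show "has_velocity A (\<lambda>t. \<gamma> (a + (b - a) * t)) t ((b - a) *\<^sub>R v)" by (rule has_velocity_affine[OF v(2)])
      show "g (\<gamma> (a + (b - a) * t)) ((b - a) *\<^sub>R v) ((b - a) *\<^sub>R v) \<le> (\<bar>b - a\<bar> * T)\<^sup>2"
        using g_scale2[OF v(1)] v(3) by (simp add: power_mult_distrib mult_left_mono)
      show "(b - a) *\<^sub>R v \<in> \<Delta> (\<gamma> (a + (b - a) * t))" by (rule subspace_scale[OF \<Delta>_subspace v(1)])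
    qed
  qed
  then show ?thesis unfolding hp_def using N' loc_mod_affine[OF _ ab, of \<gamma>] h unfolding hp_def by blast
qed

text \<open>The orientation is free: for b < a the piece is run backwards, which is how symmetry of
  \<open>reach\<close> arises.\<close>

lemma hp_subpath_reach:
  assumes "hp T \<gamma>" "0 < T" "a \<in> {0..1}" "b \<in> {0..1}" "\<bar>b - a\<bar> * T \<le> S" "0 < S"
  shows "reach S (\<gamma> a) (\<gamma> b)"
proof -
  have "hp S (\<lambda>t. \<gamma> (a + (b - a) * t))" by (rule hp_mono[OF hp_affine[OF assms(1,3,4)]]) (use assms in auto)
  then show ?thesis unfolding reach_def using \<open>0 < S\<close> by (intro conjI exI[of _ "\<lambda>t. \<gamma> (a + (b - a) * t)"]) auto
qed

lemma reach_sym: "reach T x y \<Longrightarrow> reach T y x"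
  unfolding reach_def using hp_subpath_reach[of T _ 1 0 T] unfolding reach_def by auto

text \<open>Unit time is allotted in proportion to the two bounds: a path of speed \<open>S\<close>
  compressed to the fraction S/(S+T) of the time has speed S + T, and likewise for the other one.
  Thus \<open>reach\<close> is additive, as length is.\<close>

lemma reach_trans:
  assumes "reach S x y" "reach T y z" shows "reach (S + T) x z"
proof -
  obtain \<gamma> where \<gamma>: "hp S \<gamma>" "\<gamma> 0 = x" "\<gamma> 1 = y" "0 < S" using assms by (auto simp: reach_def)
  obtain \<eta> where \<eta>: "hp T \<eta>" "\<eta> 0 = y" "\<eta> 1 = z" "0 < T" using assms by (auto simp: reach_def)
  define l where "l = S / (S + T)"
  have l: "0 < l" "l < 1" using \<gamma> \<eta> by (auto simp: l_def)
  have l': "1 - l = T / (S + T)" using \<gamma> \<eta> by (simp add: l_def field_simps)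
  define \<sigma> where "\<sigma> t = (if t \<le> l then \<gamma> (t / l) else \<eta> ((t - l) / (1 - l)))" for t
  have s1: "\<sigma> (l * t) = \<gamma> t" if "t \<in> {0..1}" for t using that l by (simp add: \<sigma>_def mult_left_le)
  have s2: "\<sigma> (l + (1 - l) * t) = \<eta> t" if "t \<in> {0..1}" for t
  proof (cases "t = 0")
    case True then show ?thesis using \<gamma> \<eta> l by (simp add: \<sigma>_def)
  next
    case False
    then have "(1 - l) * t > 0" using that l by auto
    then show ?thesis using l by (simp add: \<sigma>_def)
  qed
  have cong: "loc_mod (\<lambda>t. t) \<alpha>" if "loc_mod (\<lambda>t. t) \<beta>" "\<And>t. t \<in> {0..1} \<Longrightarrow> \<alpha> t = \<beta> t" for \<alpha> \<beta>
    using that unfolding loc_mod_def by simp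
  have lm: "loc_mod (\<lambda>t. t) \<sigma>"
    by (rule loc_mod_concat[OF l cong[OF _ s1] cong[OF _ s2]]) (use \<gamma> \<eta> in \<open>auto simp: hp_def\<close>)
  obtain N1 where N1: "negligible N1" "\<And>t. t \<in> {0<..<1} - N1 \<Longrightarrow> \<exists>v\<in>\<Delta> (\<gamma> t). has_velocity A \<gamma> t v \<and> g (\<gamma> t) v v \<le> S\<^sup>2"
    using \<gamma> unfolding hp_def by blast
  obtain N2 where N2: "negligible N2" "\<And>t. t \<in> {0<..<1} - N2 \<Longrightarrow> \<exists>v\<in>\<Delta> (\<eta> t). has_velocity A \<eta> t v \<and> g (\<eta> t) v v \<le> T\<^sup>2"
    using \<eta> unfolding hp_def by blast
  define a1 b1 a2 b2 where "a1 = (0::real)" and "b1 = 1 / l" and "a2 = - l / (1 - l)" and "b2 = 1 / (1 - l)"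
  define N where "N = {t. a1 + b1 * t \<in> N1} \<union> {t. a2 + b2 * t \<in> N2} \<union> {l}"
  have Nn: "negligible N" unfolding N_def using l N1(1) N2(1)
    by (intro negligible_Un negligible_affine_vimage) (auto simp: b1_def b2_def)
  have e1: "a1 + b1 * t = t / l" and e2: "a2 + b2 * t = (t - l) / (1 - l)" for t
    by (auto simp: a1_def b1_def a2_def b2_def diff_divide_distrib)
  have part: "\<exists>v\<in>\<Delta> (\<sigma> t). has_velocity A \<sigma> t v \<and> g (\<sigma> t) v v \<le> (S + T)\<^sup>2"
    if v: "v \<in> \<Delta> (\<alpha> (a + b * t))" "has_velocity A \<alpha> (a + b * t) v" "g (\<alpha> (a + b * t)) v v \<le> R\<^sup>2"
      and b: "b * R = S + T" "0 < R" and V: "open V" "t \<in> V" "\<And>s. s \<in> V \<Longrightarrow> \<alpha> (a + b * s) = \<sigma> s" for v a b \<alpha> R V t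
  proof (intro bexI[of _ "b *\<^sub>R v"] conjI)
    have eq: "\<alpha> (a + b * t) = \<sigma> t" by (rule V(3)[OF V(2)])
    show "has_velocity A \<sigma> t (b *\<^sub>R v)" by (rule has_velocity_cong[OF V has_velocity_affine[OF v(2)]])
    have "g (\<sigma> t) (b *\<^sub>R v) (b *\<^sub>R v) = b\<^sup>2 * g (\<sigma> t) v v" using v(1) eq by (intro g_scale2) simp
    also have "\<dots> \<le> b\<^sup>2 * R\<^sup>2" using v(3) eq by (intro mult_left_mono) auto
    also have "\<dots> = (S + T)\<^sup>2" using b(1) by (simp flip: power_mult_distrib)
    finally show "g (\<sigma> t) (b *\<^sub>R v) (b *\<^sub>R v) \<le> (S + T)\<^sup>2" .
    show "b *\<^sub>R v \<in> \<Delta> (\<sigma> t)" using v(1) eq by (intro subspace_scale[OF \<Delta>_subspace]) simp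
  qed
  have "\<exists>v\<in>\<Delta> (\<sigma> t). has_velocity A \<sigma> t v \<and> g (\<sigma> t) v v \<le> (S + T)\<^sup>2" if t: "t \<in> {0<..<1} - N" for t
  proof (cases "t < l")
    case True
    have "a1 + b1 * t \<in> {0<..<1} - N1" using t True l unfolding N_def e1 by (auto simp: e1[symmetric]) (auto simp: e1)
    then obtain v where v: "v \<in> \<Delta> (\<gamma> (a1 + b1 * t))" "has_velocity A \<gamma> (a1 + b1 * t) v" "g (\<gamma> (a1 + b1 * t)) v v \<le> S\<^sup>2" using N1(2) by blast
    have "b1 * S = S + T" using \<gamma> \<eta> by (simp add: b1_def l_def)
    moreover have "\<gamma> (a1 + b1 * s) = \<sigma> s" if "s \<in> {..<l}" for s using that by (simp add: e1 \<sigma>_def)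
    ultimately show ?thesis using part[OF v _ \<gamma>(4) open_lessThan[of l]] True by simp
  next
    case False
    then have "t > l" using t by (auto simp: N_def)
    have "a2 + b2 * t \<in> {0<..<1} - N2" using t \<open>t > l\<close> l unfolding N_def e2 by (auto simp: e2)
    then obtain v where v: "v \<in> \<Delta> (\<eta> (a2 + b2 * t))" "has_velocity A \<eta> (a2 + b2 * t) v" "g (\<eta> (a2 + b2 * t)) v v \<le> T\<^sup>2" using N2(2) by blast
    have "b2 * T = S + T" unfolding b2_def l' using \<gamma> \<eta> by simp
    then show ?thesis
      by (rule part[OF v _ _ open_greaterThan[of l]]) (use \<open>t > l\<close> \<eta> in \<open>auto simp: e2 \<sigma>_def\<close>)
  qed
  then have "hp (S + T) \<sigma>" unfolding hp_def using lm Nn by blast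
  moreover have "\<sigma> 0 = x" using s1[of 0] \<gamma> by simp
  moreover have "\<sigma> 1 = z" using s2[of 1] \<eta> by simp
  ultimately show ?thesis unfolding reach_def using \<gamma> \<eta> by auto
qed

end

section \<open>Orthonormal frames and the control system of a chart\<close>

text \<open>The right-hand side of the system in coordinates; \<open>ctl\<close> and
  \<open>Dctl\<close> are the \<open>F\<close> and \<open>DF\<close> with which
  \<open>control_system\<close> is instantiated.\<close>

definition ctl :: "('m, 'e::euclidean_space) chart set \<Rightarrow> ('m, 'e) chart \<Rightarrow> ('k::finite \<Rightarrow> 'm \<Rightarrow> 'e) \<Rightarrow> 'e \<Rightarrow> real ^ 'k \<Rightarrow> 'e" where
  "ctl A c Y p u = (\<Sum>i\<in>UNIV. (u $ i) *\<^sub>R field_coord A c (Y i) p)"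

definition Dctl :: "('m, 'e::euclidean_space) chart set \<Rightarrow> ('m, 'e) chart \<Rightarrow> ('k::finite \<Rightarrow> 'm \<Rightarrow> 'e) \<Rightarrow> 'e \<Rightarrow> real ^ 'k \<Rightarrow> 'e \<Rightarrow> 'e" where
  "Dctl A c Y p u v = (\<Sum>i\<in>UNIV. (u $ i) *\<^sub>R frechet_derivative (field_coord A c (Y i)) (at p) v)"

context sr_manifold
begin

lemma smooth_field_scale:
  assumes U: "open U" and f: "smooth_fun_on A U f" and X: "smooth_field_on A U X"
  shows "smooth_field_on A U (\<lambda>y. f y *\<^sub>R X y)"
  unfolding smooth_field_on_def
proof
  fix c assume c: "c \<in> A"
  have o: "open (chart_map c ` (U \<inter> chart_dom c))" by (rule open_chart_image[OF c U])
  have "smooth_on (chart_map c ` (U \<inter> chart_dom c)) (\<lambda>p. (f \<circ> chart_inv c) p *\<^sub>R field_coord A c X p)"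
    by (rule smooth_on_bilinear[OF bounded_bilinear_scaleR o f[unfolded smooth_fun_on_def, rule_format, OF c]
        X[unfolded smooth_field_on_def, rule_format, OF c]])
  then show "smooth_on (chart_map c ` (U \<inter> chart_dom c)) (field_coord A c (\<lambda>y. f y *\<^sub>R X y))"
  proof (rule smooth_on_cong[OF _ o])
    fix p assume "p \<in> chart_map c ` (U \<inter> chart_dom c)"
    then have "chart_inv c p \<in> chart_dom c" using chart_inv_map[OF c] by auto
    then show "(f \<circ> chart_inv c) p *\<^sub>R field_coord A c X p = field_coord A c (\<lambda>y. f y *\<^sub>R X y) p"
      unfolding field_coord_def by (simp add: linear_cmul[OF tangent_coord_linear[OF c]])
  qed
qed

lemma smooth_field_add:
  assumes U: "open U" and X: "smooth_field_on A U X" and Z: "smooth_field_on A U Z"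
  shows "smooth_field_on A U (\<lambda>y. X y + Z y)"
  unfolding smooth_field_on_def
proof
  fix c assume c: "c \<in> A"
  have o: "open (chart_map c ` (U \<inter> chart_dom c))" by (rule open_chart_image[OF c U])
  have "smooth_on (chart_map c ` (U \<inter> chart_dom c)) (\<lambda>p. field_coord A c X p + field_coord A c Z p)"
    using X Z c by (intro smooth_on_add[OF o]) (auto simp: smooth_field_on_def)
  then show "smooth_on (chart_map c ` (U \<inter> chart_dom c)) (field_coord A c (\<lambda>y. X y + Z y))"
  proof (rule smooth_on_cong[OF _ o])
    fix p assume "p \<in> chart_map c ` (U \<inter> chart_dom c)"
    then have "chart_inv c p \<in> chart_dom c" using chart_inv_map[OF c] by auto
    then show "field_coord A c X p + field_coord A c Z p = field_coord A c (\<lambda>y. X y + Z y) p"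
      unfolding field_coord_def by (simp add: linear_add[OF tangent_coord_linear[OF c]])
  qed
qed

lemma smooth_fun_const: "open U \<Longrightarrow> smooth_fun_on A U (\<lambda>y. r)"
  unfolding smooth_fun_on_def smooth_on_def o_def by (intro ballI allI Ck_on_const open_chart_image)

lemma smooth_field_sum:
  assumes U: "open U" "finite I" "I \<noteq> {}" "\<And>i. i \<in> I \<Longrightarrow> smooth_field_on A U (X i)"
  shows "smooth_field_on A U (\<lambda>y. \<Sum>i\<in>I. X i y)"
  using assms(2-4) by (induction I rule: finite_ne_induct) (auto intro: smooth_field_add[OF U(1)])

lemma smooth_fun_powr:
  assumes U: "open U" and f: "smooth_fun_on A U f" and pos: "\<And>y. y \<in> U \<Longrightarrow> f y > 0"
  shows "smooth_fun_on A U (\<lambda>y. f y powr a)"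
  unfolding smooth_fun_on_def
proof
  fix c assume c: "c \<in> A"
  have "smooth_on (chart_map c ` (U \<inter> chart_dom c)) (\<lambda>p. (f \<circ> chart_inv c) p powr a)"
  proof (rule smooth_on_powr[OF open_chart_image[OF c U]])
    show "smooth_on (chart_map c ` (U \<inter> chart_dom c)) (f \<circ> chart_inv c)" using f c by (simp add: smooth_fun_on_def)
    show "(f \<circ> chart_inv c) p > 0" if "p \<in> chart_map c ` (U \<inter> chart_dom c)" for p
      using that pos chart_inv_map[OF c] by auto
  qed
  then show "smooth_on (chart_map c ` (U \<inter> chart_dom c)) ((\<lambda>y. f y powr a) \<circ> chart_inv c)" by (simp add: o_def)
qed

lemma smooth_g:
  assumes "open U" "smooth_field_on A U X" "smooth_field_on A U Z" "\<And>y. y \<in> U \<Longrightarrow> X y \<in> \<Delta> y \<and> Z y \<in> \<Delta> y"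
  shows "smooth_fun_on A U (\<lambda>y. g y (X y) (Z y))"
  using metric assms unfolding smooth_metric_def by blast

lemma g_diff: "u \<in> \<Delta> x \<Longrightarrow> v \<in> \<Delta> x \<Longrightarrow> w \<in> \<Delta> x \<Longrightarrow> g x (u - v) w = g x u w - g x v w"
  using g_add[of "u - v" x v w] subspace_diff[OF \<Delta>_subspace] by auto

lemma g_sum: "finite I \<Longrightarrow> (\<And>i. i \<in> I \<Longrightarrow> v i \<in> \<Delta> x) \<Longrightarrow> w \<in> \<Delta> x \<Longrightarrow> g x (\<Sum>i\<in>I. v i) w = (\<Sum>i\<in>I. g x (v i) w)"
  by (induction I rule: finite_induct) (auto simp: g_zero g_add subspace_sum[OF \<Delta>_subspace])

lemma g_sum_right: "finite I \<Longrightarrow> (\<And>i. i \<in> I \<Longrightarrow> v i \<in> \<Delta> x) \<Longrightarrow> w \<in> \<Delta> x \<Longrightarrow> g x w (\<Sum>i\<in>I. v i) = (\<Sum>i\<in>I. g x w (v i))"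
  using g_sum[of I v x w] g_sym[of w x] subspace_sum[OF \<Delta>_subspace, of I v x] by simp

text \<open>Gram-Schmidt for smooth fields, by induction on the set of treated indices. Keeping the
  new fields in the span of the treated old ones is what makes the next residual nonzero at every
  point, so that normalization is smooth.\<close>

lemma gram_schmidt_partial:
  fixes X :: "'k \<Rightarrow> 'm \<Rightarrow> 'e"
  assumes U: "open U" and X: "local_frame A \<Delta> U X" and "finite I"
  shows "\<exists>Y :: 'k \<Rightarrow> 'm \<Rightarrow> 'e. (\<forall>i\<in>I. smooth_field_on A U (Y i)) \<and> (\<forall>y\<in>U. \<forall>i\<in>I. Y i y \<in> span ((\<lambda>i. X i y) ` I) \<and>
     (\<forall>j\<in>I. g y (Y i y) (Y j y) = (if i = j then 1 else 0)))"
  using assms(3)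
proof (induction I rule: finite_induct)
  case (insert k I)
  then obtain Y :: "'k \<Rightarrow> 'm \<Rightarrow> 'e" where Y: "\<And>i. i \<in> I \<Longrightarrow> smooth_field_on A U (Y i)"
    "\<And>y i. y \<in> U \<Longrightarrow> i \<in> I \<Longrightarrow> Y i y \<in> span ((\<lambda>i. X i y) ` I)"
    "\<And>y i j. y \<in> U \<Longrightarrow> i \<in> I \<Longrightarrow> j \<in> I \<Longrightarrow> g y (Y i y) (Y j y) = (if i = j then 1 else 0)" by blast
  have frame: "inj (\<lambda>i. X i y)" "independent (range (\<lambda>i. X i y))" "span (range (\<lambda>i. X i y)) = \<Delta> y" if "y \<in> U" for y
    using X that unfolding local_frame_def frame_at_def by auto
  have X\<Delta>: "X i y \<in> \<Delta> y" if "y \<in> U" for y i using frame(3)[OF that] span_base[of "X i y" "range (\<lambda>i. X i y)"] by auto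
  have Y\<Delta>: "Y i y \<in> \<Delta> y" if "y \<in> U" "i \<in> I" for y i
    using Y(2)[OF that] span_mono[of "(\<lambda>i. X i y) ` I" "range (\<lambda>i. X i y)"] frame(3)[OF that(1)] by auto
  have Xs: "smooth_field_on A U (X i)" for i using X by (simp add: local_frame_def)
  define S where "S y = (\<Sum>i\<in>I. g y (X k y) (Y i y) *\<^sub>R Y i y)" for y
  define Z where "Z y = X k y - S y" for y
  have tm: "smooth_field_on A U (\<lambda>y. g y (X k y) (Y i y) *\<^sub>R Y i y)" if "i \<in> I" for i
    by (intro smooth_field_scale[OF U] smooth_g[OF U] Xs Y(1) that) (use X\<Delta> Y\<Delta> that in auto)
  have Zs: "smooth_field_on A U Z"
  proof (cases "I = {}")
    case True then show ?thesis using Xs by (simp add: Z_def[abs_def] S_def)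
  next
    case False
    have "smooth_field_on A U S" unfolding S_def[abs_def] by (intro smooth_field_sum U False insert tm)
    then have "smooth_field_on A U (\<lambda>y. (-1) *\<^sub>R S y)" by (intro smooth_field_scale[OF U] smooth_fun_const U)
    from smooth_field_add[OF U Xs this, of k] show ?thesis by (simp add: Z_def[abs_def])
  qed
  have S_span: "S y \<in> span ((\<lambda>i. X i y) ` I)" if "y \<in> U" for y
    unfolding S_def by (intro span_sum span_scale Y(2) that)
  have S\<Delta>: "S y \<in> \<Delta> y" if "y \<in> U" for y unfolding S_def by (intro subspace_sum subspace_scale \<Delta>_subspace Y\<Delta> that)
  have Z\<Delta>: "Z y \<in> \<Delta> y" if "y \<in> U" for y unfolding Z_def by (intro subspace_diff \<Delta>_subspace X\<Delta> S\<Delta> that)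
  have Z0: "Z y \<noteq> 0" if y: "y \<in> U" for y
  proof
    assume "Z y = 0"
    then have "X k y \<in> span ((\<lambda>i. X i y) ` I)" using S_span[OF y] by (simp add: Z_def)
    moreover have "(\<lambda>i. X i y) ` I \<subseteq> range (\<lambda>i. X i y) - {X k y}"
      using insert(2) frame(1)[OF y] by (auto dest: injD)
    ultimately have "X k y \<in> span (range (\<lambda>i. X i y) - {X k y})" using span_mono by blast
    then show False using frame(2)[OF y] unfolding dependent_def by blast
  qed
  define n where "n y = g y (Z y) (Z y)" for y
  have n: "n y > 0" if "y \<in> U" for y unfolding n_def by (intro g_pos Z\<Delta> Z0 that)
  have ns: "smooth_fun_on A U n" unfolding n_def[abs_def] by (intro smooth_g[OF U] Zs) (use Z\<Delta> in auto)
  define W where "W y = (n y powr (- (1/2))) *\<^sub>R Z y" for y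
  have Ws: "smooth_field_on A U W" unfolding W_def[abs_def] by (intro smooth_field_scale[OF U] smooth_fun_powr U ns n Zs)
  have W\<Delta>: "W y \<in> \<Delta> y" if "y \<in> U" for y unfolding W_def by (intro subspace_scale \<Delta>_subspace Z\<Delta> that)
  have ZY: "g y (Z y) (Y j y) = 0" if y: "y \<in> U" and j: "j \<in> I" for y j
  proof -
    have "g y (S y) (Y j y) = (\<Sum>i\<in>I. g y (g y (X k y) (Y i y) *\<^sub>R Y i y) (Y j y))"
      unfolding S_def by (intro g_sum insert subspace_scale \<Delta>_subspace Y\<Delta> y j)
    also have "\<dots> = (\<Sum>i\<in>I. if i = j then g y (X k y) (Y i y) else 0)"
      by (rule sum.cong) (use g_scale[OF Y\<Delta>[OF y] Y\<Delta>[OF y j]] Y(3)[OF y _ j] in auto)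
    also have "\<dots> = g y (X k y) (Y j y)" using insert(1) j by (simp add: sum.delta)
    finally show ?thesis unfolding Z_def using g_diff[OF X\<Delta>[OF y] S\<Delta>[OF y] Y\<Delta>[OF y j], of k] by simp
  qed
  have WY: "g y (W y) (Y j y) = 0" "g y (Y j y) (W y) = 0" if y: "y \<in> U" and j: "j \<in> I" for y j
  proof -
    show "g y (W y) (Y j y) = 0" unfolding W_def using g_scale[OF Z\<Delta>[OF y] Y\<Delta>[OF y j]] ZY[OF y j] by simp
    then show "g y (Y j y) (W y) = 0" using g_sym[OF W\<Delta>[OF y] Y\<Delta>[OF y j]] by simp
  qed
  have WW: "g y (W y) (W y) = 1" if y: "y \<in> U" for y
  proof -
    have "g y (W y) (W y) = (n y powr (- (1/2)))\<^sup>2 * n y" unfolding W_def n_def by (rule g_scale2[OF Z\<Delta>[OF y]])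
    also have "(n y powr (- (1/2)))\<^sup>2 = n y powr (-1)" by (simp add: power2_eq_square flip: powr_add)
    also have "n y powr (-1) * n y = 1" using n[OF y] by (simp add: powr_minus)
    finally show ?thesis .
  qed
  have W_span: "W y \<in> span ((\<lambda>i. X i y) ` insert k I)" if y: "y \<in> U" for y
  proof -
    have "X k y \<in> span ((\<lambda>i. X i y) ` insert k I)" by (intro span_base) auto
    moreover have "S y \<in> span ((\<lambda>i. X i y) ` insert k I)" using S_span[OF y] span_mono[of "(\<lambda>i. X i y) ` I" "(\<lambda>i. X i y) ` insert k I"] by auto
    ultimately show ?thesis unfolding W_def Z_def by (intro span_scale span_diff)
  qed
  have Y_span: "Y i y \<in> span ((\<lambda>i. X i y) ` insert k I)" if "y \<in> U" "i \<in> I" for y i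
    using Y(2)[OF that] span_mono[of "(\<lambda>i. X i y) ` I" "(\<lambda>i. X i y) ` insert k I"] by auto
  show ?case
  proof (intro exI[of _ "Y(k := W)"] conjI ballI)
    show "smooth_field_on A U ((Y(k := W)) i)" if "i \<in> insert k I" for i using that Ws Y(1) by auto
    fix y i assume y: "y \<in> U" and i: "i \<in> insert k I"
    show "(Y(k := W)) i y \<in> span ((\<lambda>i. X i y) ` insert k I)" using i W_span[OF y] Y_span[OF y] by auto
    show "g y ((Y(k := W)) i y) ((Y(k := W)) j y) = (if i = j then 1 else 0)" if j: "j \<in> insert k I" for j
      using i j insert(2) WW[OF y] WY[OF y] Y(3)[OF y] by auto
  qed
qed auto

definition orthonormal_on :: "'m set \<Rightarrow> ('k \<Rightarrow> 'm \<Rightarrow> 'e) \<Rightarrow> bool" where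
  "orthonormal_on U Y \<longleftrightarrow> (\<forall>y\<in>U. \<forall>i j. g y (Y i y) (Y j y) = (if i = j then 1 else 0))"

text \<open>Orthonormality yields independence, and a dimension count yields the span, so the new
  fields frame the same distribution.\<close>

lemma orthonormal_frame:
  fixes X :: "'k \<Rightarrow> 'm \<Rightarrow> 'e"
  assumes U: "open U" and X: "local_frame A \<Delta> U X"
  obtains Y :: "'k \<Rightarrow> 'm \<Rightarrow> 'e" where "local_frame A \<Delta> U Y" "orthonormal_on U Y"
proof -
  obtain Y :: "'k \<Rightarrow> 'm \<Rightarrow> 'e" where Y: "\<And>i. smooth_field_on A U (Y i)"
    "\<And>y i. y \<in> U \<Longrightarrow> Y i y \<in> span (range (\<lambda>i. X i y))"
    "\<And>y i j. y \<in> U \<Longrightarrow> g y (Y i y) (Y j y) = (if i = j then 1 else 0)"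
    using gram_schmidt_partial[OF U X finite[of UNIV]] by simp blast
  have "frame_at \<Delta> y (\<lambda>i. Y i y)" if y: "y \<in> U" for y
  proof -
    have frame: "inj (\<lambda>i. X i y)" "independent (range (\<lambda>i. X i y))" "span (range (\<lambda>i. X i y)) = \<Delta> y"
      using X y unfolding local_frame_def frame_at_def by auto
    have Y\<Delta>: "Y i y \<in> \<Delta> y" for i using Y(2)[OF y] frame(3) by auto
    have inj: "inj (\<lambda>i. Y i y)"
    proof (rule injI, rule ccontr)
      fix i j assume "Y i y = Y j y" "i \<noteq> j"
      then show False using Y(3)[OF y, of i j] Y(3)[OF y, of i i] by simp
    qed
    have ind: "independent (range (\<lambda>i. Y i y))"
    proof (rule independent_if_scalars_zero)
      fix f x assume f: "(\<Sum>x\<in>range (\<lambda>i. Y i y). f x *\<^sub>R x) = 0" and x: "x \<in> range (\<lambda>i. Y i y)"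
      then obtain j where j: "x = Y j y" by auto
      have "(\<Sum>i\<in>UNIV. f (Y i y) *\<^sub>R Y i y) = 0" using f by (subst (asm) sum.reindex[OF inj]) (simp add: o_def)
      then have "0 = g y (\<Sum>i\<in>UNIV. f (Y i y) *\<^sub>R Y i y) (Y j y)" using g_zero[OF Y\<Delta>] by simp
      also have "\<dots> = (\<Sum>i\<in>UNIV. g y (f (Y i y) *\<^sub>R Y i y) (Y j y))"
        by (intro g_sum finite subspace_scale \<Delta>_subspace Y\<Delta>)
      also have "\<dots> = (\<Sum>i\<in>UNIV. if i = j then f (Y i y) else 0)"
        by (rule sum.cong) (use g_scale[OF Y\<Delta> Y\<Delta>] Y(3)[OF y] in auto)
      also have "\<dots> = f x" using j by (simp add: sum.delta)
      finally show "f x = 0" by simp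
    qed simp
    have "card (range (\<lambda>i. Y i y)) = dim (\<Delta> y)"
    proof -
      have "dim (\<Delta> y) = card (range (\<lambda>i. X i y))" using frame by (metis dim_span dim_eq_card_independent)
      then show ?thesis using card_image[OF frame(1)] card_image[OF inj] by simp
    qed
    then have "\<Delta> y \<subseteq> span (range (\<lambda>i. Y i y))"
      using card_eq_dim[of "range (\<lambda>i. Y i y)" "\<Delta> y"] ind Y\<Delta> by auto
    moreover have "span (range (\<lambda>i. Y i y)) \<subseteq> \<Delta> y"
      by (rule span_minimal) (use Y\<Delta> \<Delta>_subspace in auto)
    ultimately show ?thesis using inj ind by (simp add: frame_at_def)
  qed
  then show ?thesis using that[of Y] Y by (simp add: local_frame_def orthonormal_on_def)
qed

lemma frame_coord:
  fixes Y :: "'k \<Rightarrow> 'm \<Rightarrow> 'e"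
  assumes Y: "local_frame A \<Delta> U Y" and y: "y \<in> U"
  shows "(\<Sum>i\<in>UNIV. (u $ i) *\<^sub>R Y i y) \<in> \<Delta> y"
    and "v \<in> \<Delta> y \<Longrightarrow> \<exists>u :: real ^ 'k. v = (\<Sum>i\<in>UNIV. (u $ i) *\<^sub>R Y i y)"
    and "(\<Sum>i\<in>UNIV. (u $ i) *\<^sub>R Y i y) = 0 \<Longrightarrow> u = 0"
    and "c \<in> A \<Longrightarrow> y \<in> chart_dom c \<Longrightarrow> tangent_coord A c y (\<Sum>i\<in>UNIV. (u $ i) *\<^sub>R Y i y) = ctl A c Y (chart_map c y) u"
proof -
  have frame: "inj (\<lambda>i. Y i y)" "independent (range (\<lambda>i. Y i y))" "span (range (\<lambda>i. Y i y)) = \<Delta> y"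
    using Y y unfolding local_frame_def frame_at_def by auto
  have Y\<Delta>: "Y i y \<in> \<Delta> y" for i using frame(3) span_base[of "Y i y" "range (\<lambda>i. Y i y)"] by auto
  show "(\<Sum>i\<in>UNIV. (u $ i) *\<^sub>R Y i y) \<in> \<Delta> y" by (intro subspace_sum subspace_scale \<Delta>_subspace Y\<Delta>)
  show "\<exists>u :: real ^ 'k. v = (\<Sum>i\<in>UNIV. (u $ i) *\<^sub>R Y i y)" if "v \<in> \<Delta> y"
  proof -
    have "v \<in> range (\<lambda>f. \<Sum>x\<in>range (\<lambda>i. Y i y). f x *\<^sub>R x)"
      using that unfolding frame(3)[symmetric] by (subst (asm) span_finite) auto
    then obtain f where "v = (\<Sum>x\<in>range (\<lambda>i. Y i y). f x *\<^sub>R x)" by (rule imageE)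
    then have "v = (\<Sum>i\<in>UNIV. f (Y i y) *\<^sub>R Y i y)" by (simp add: sum.reindex[OF frame(1)])
    then show ?thesis by (intro exI[of _ "\<chi> i. f (Y i y)"]) simp
  qed
  show "u = 0" if "(\<Sum>i\<in>UNIV. (u $ i) *\<^sub>R Y i y) = 0"
  proof -
    define f where "f x = u $ (inv (\<lambda>i. Y i y) x)" for x
    have "(\<Sum>x\<in>range (\<lambda>i. Y i y). f x *\<^sub>R x) = 0"
      using that by (simp add: sum.reindex[OF frame(1)] f_def inv_f_f[OF frame(1)])
    then have "f (Y i y) = 0" for i
      using independentD[OF frame(2), of "range (\<lambda>i. Y i y)" f "Y i y"] by auto
    then show ?thesis by (simp add: f_def inv_f_f[OF frame(1)] vec_eq_iff)
  qed
  show "tangent_coord A c y (\<Sum>i\<in>UNIV. (u $ i) *\<^sub>R Y i y) = ctl A c Y (chart_map c y) u" if c: "c \<in> A" "y \<in> chart_dom c"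
  proof -
    note l = tangent_coord_linear[OF c]
    show ?thesis
      by (simp add: ctl_def field_coord_def chart_inv_map[OF c] linear_sum[OF l] linear_cmul[OF l])
  qed
qed

lemma orthonormal_norm:
  fixes Y :: "'k \<Rightarrow> 'm \<Rightarrow> 'e"
  assumes Y: "local_frame A \<Delta> U Y" "orthonormal_on U Y" and y: "y \<in> U"
  shows "g y (\<Sum>i\<in>UNIV. (u $ i) *\<^sub>R Y i y) (\<Sum>i\<in>UNIV. (u $ i) *\<^sub>R Y i y) = (norm u)\<^sup>2"
proof -
  have Y\<Delta>: "Y i y \<in> \<Delta> y" for i
    using frame_coord(1)[OF Y(1) y, of "axis i 1"] by (simp add: axis_def if_distrib[of "\<lambda>r. r *\<^sub>R _"] sum.delta cong: if_cong)
  let ?v = "\<Sum>i\<in>UNIV. (u $ i) *\<^sub>R Y i y"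
  have v: "?v \<in> \<Delta> y" by (rule frame_coord(1)[OF Y(1) y])
  have vj: "g y ?v (Y j y) = u $ j" for j
  proof -
    have "g y ?v (Y j y) = (\<Sum>i\<in>UNIV. g y ((u $ i) *\<^sub>R Y i y) (Y j y))"
      by (intro g_sum finite subspace_scale \<Delta>_subspace Y\<Delta>)
    also have "\<dots> = (\<Sum>i\<in>UNIV. if i = j then u $ i else 0)"
      by (rule sum.cong) (use g_scale[OF Y\<Delta> Y\<Delta>] Y(2) y in \<open>auto simp: orthonormal_on_def\<close>)
    finally show ?thesis by (simp add: sum.delta)
  qed
  have "g y ?v ?v = (\<Sum>j\<in>UNIV. g y ?v ((u $ j) *\<^sub>R Y j y))"
    by (intro g_sum_right finite subspace_scale \<Delta>_subspace Y\<Delta> v)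
  also have "\<dots> = (\<Sum>j\<in>UNIV. (u $ j) * (u $ j))"
    by (rule sum.cong) (use vj g_sym[OF v] Y\<Delta> g_scale[OF Y\<Delta> v] subspace_scale[OF \<Delta>_subspace Y\<Delta>] in auto)
  also have "\<dots> = (norm u)\<^sup>2" by (simp add: power2_norm_eq_inner inner_vec_def)
  finally show ?thesis .
qed

text \<open>All constants come from compactness of the ball. The Lipschitz bound of the derivative
  is obtained direction by direction, from the smooth derivatives along basis vectors; the added 1
  makes \<open>M\<close> and \<open>L\<close> positive.\<close>

lemma chart_control_system:
  fixes Y :: "'k \<Rightarrow> 'm \<Rightarrow> 'e"
  assumes c: "c \<in> A" and U: "open U" "U \<subseteq> chart_dom c" and Y: "local_frame A \<Delta> U Y"
    and R: "0 < R" "cball p0 R \<subseteq> chart_map c ` U"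
  obtains M L where "control_system (ctl A c Y) (Dctl A c Y) p0 R M L"
proof -
  define W where "W = chart_map c ` U"
  have Wi: "U \<inter> chart_dom c = U" using U by auto
  have W: "open W" unfolding W_def using open_chart_image[OF c U(1)] Wi by simp
  have Ys: "smooth_on W (field_coord A c (Y i))" for i
    using Y c unfolding local_frame_def smooth_field_on_def W_def by (metis Wi)
  have BW: "cball p0 R \<subseteq> W" using R by (simp add: W_def)
  have "\<exists>L\<ge>0. \<forall>x\<in>cball p0 R. \<forall>v. norm (frechet_derivative (field_coord A c (Y i)) (at x) v) \<le> L * norm v" for i
    by (rule bounded_derivative_cball[OF Ys[of i] BW]) blast
  then obtain L1 where L1: "\<And>i. L1 i \<ge> 0" "\<And>i x v. x \<in> cball p0 R \<Longrightarrow> norm (frechet_derivative (field_coord A c (Y i)) (at x) v) \<le> L1 i * norm v"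
    by metis
  have "\<exists>L\<ge>0. \<forall>x\<in>cball p0 R. \<forall>y\<in>cball p0 R. norm (frechet_derivative (field_coord A c (Y i)) (at x) b - frechet_derivative (field_coord A c (Y i)) (at y) b) \<le> L * norm (x - y)" for i b
    by (rule bounded_derivative_cball[OF smooth_on_deriv[OF Ys[of i], of b] BW]) blast
  then obtain L2 where L2: "\<And>i b. L2 i b \<ge> 0" "\<And>i b x y. x \<in> cball p0 R \<Longrightarrow> y \<in> cball p0 R \<Longrightarrow>
     norm (frechet_derivative (field_coord A c (Y i)) (at x) b - frechet_derivative (field_coord A c (Y i)) (at y) b) \<le> L2 i b * norm (x - y)"
    by metis
  have "\<exists>M\<ge>0. \<forall>x\<in>cball p0 R. norm (field_coord A c (Y i) x) \<le> M" for i
  proof -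
    have "bounded (field_coord A c (Y i) ` cball p0 R)"
      by (intro compact_imp_bounded compact_continuous_image continuous_on_subset[OF smooth_on_continuous[OF Ys] BW]) auto
    then show ?thesis unfolding bounded_pos by (meson imageI less_imp_le)
  qed
  then obtain M0 where M0: "\<And>i. M0 i \<ge> 0" "\<And>i x. x \<in> cball p0 R \<Longrightarrow> norm (field_coord A c (Y i) x) \<le> M0 i" by metis
  define M where "M = (\<Sum>i\<in>UNIV. M0 i) + 1"
  define L where "L = (\<Sum>i\<in>UNIV. L1 i) + (\<Sum>i\<in>UNIV. \<Sum>b\<in>Basis. L2 i b) + 1"
  have nn: "(\<Sum>i\<in>UNIV. M0 i) \<ge> 0" "(\<Sum>i\<in>UNIV. L1 i) \<ge> 0" "(\<Sum>i\<in>UNIV. \<Sum>b\<in>(Basis::'e set). L2 i b) \<ge> 0"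
    using M0 L1 L2 by (auto intro!: sum_nonneg)
  have sum_bd: "norm (\<Sum>i\<in>UNIV. (u $ i) *\<^sub>R a i) \<le> (\<Sum>i\<in>UNIV. K i) * norm u"
    if "\<And>i. norm (a i :: 'e) \<le> K i" for a K and u :: "real ^ 'k"
  proof -
    have "norm (\<Sum>i\<in>UNIV. (u $ i) *\<^sub>R a i) \<le> (\<Sum>i\<in>UNIV. norm u * K i)"
      by (rule sum_norm_le) (use that component_le_norm_cart[of u] in \<open>auto intro!: mult_mono\<close>)
    then show ?thesis by (simp add: sum_distrib_left mult.commute)
  qed
  have lin: "linear (frechet_derivative (field_coord A c (Y i)) (at x))" if "x \<in> cball p0 R" for i x
    using smooth_on_has_derivative[OF Ys] BW that has_derivative_linear by blast
  have "control_system (ctl A c Y) (Dctl A c Y) p0 R M L"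
  proof (rule control_system.intro)
    show "0 < R" "0 < M" "0 < L" using R nn by (auto simp: M_def L_def add_nonneg_pos)
    show "linear (ctl A c Y x)" for x
      by (rule linearI) (simp_all add: ctl_def scaleR_add_left sum.distrib scaleR_sum_right)
    show "linear (\<lambda>u. Dctl A c Y x u v)" for x v
      by (rule linearI) (simp_all add: Dctl_def scaleR_add_left sum.distrib scaleR_sum_right)
    fix x u assume x: "x \<in> cball p0 R"
    show "((\<lambda>x. ctl A c Y x u) has_derivative Dctl A c Y x u) (at x)"
      unfolding ctl_def Dctl_def[abs_def]
      by (intro has_derivative_sum has_derivative_scaleR_right smooth_on_has_derivative[OF Ys]) (use x BW in auto)
    show "norm (ctl A c Y x u) \<le> M * norm u"
    proof -
      have "norm (ctl A c Y x u) \<le> (\<Sum>i\<in>UNIV. M0 i) * norm u" unfolding ctl_def by (rule sum_bd) (rule M0(2)[OF x])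
      then show ?thesis using norm_ge_zero[of u] unfolding M_def distrib_right mult_1 by linarith
    qed
    show "norm (Dctl A c Y x u v) \<le> L * norm u * norm v" for v
    proof -
      have "norm (Dctl A c Y x u v) \<le> (\<Sum>i\<in>UNIV. L1 i * norm v) * norm u"
        unfolding Dctl_def by (rule sum_bd[OF L1(2)[OF x]])
      also have "\<dots> = (\<Sum>i\<in>UNIV. L1 i) * (norm u * norm v)" unfolding sum_distrib_right[symmetric] by (simp only: mult_ac)
      also have "\<dots> \<le> L * (norm u * norm v)" using nn by (intro mult_right_mono) (auto simp: L_def)
      finally show ?thesis by (simp add: mult_ac)
    qed
    show "norm (Dctl A c Y x u v - Dctl A c Y y u v) \<le> L * norm u * norm (x - y) * norm v" if y: "y \<in> cball p0 R" for y v
    proof -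
      have i: "norm (frechet_derivative (field_coord A c (Y i)) (at x) v - frechet_derivative (field_coord A c (Y i)) (at y) v)
          \<le> (\<Sum>b\<in>Basis. L2 i b) * norm (x - y) * norm v" for i
      proof -
        have "frechet_derivative (field_coord A c (Y i)) (at x) v - frechet_derivative (field_coord A c (Y i)) (at y) v =
            (\<Sum>b\<in>Basis. (v \<bullet> b) *\<^sub>R (frechet_derivative (field_coord A c (Y i)) (at x) b - frechet_derivative (field_coord A c (Y i)) (at y) b))"
          unfolding linear_basis_sum[OF lin[OF x], of i v] linear_basis_sum[OF lin[OF y], of i v]
          by (simp add: sum_subtractf scaleR_diff_right)
        also have "norm \<dots> \<le> (\<Sum>b\<in>Basis. norm v * (L2 i b * norm (x - y)))"
          by (rule sum_norm_le) (use L2(2)[OF x y] Basis_le_norm in \<open>auto intro!: mult_mono\<close>)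
        also have "\<dots> = (\<Sum>b\<in>Basis. L2 i b) * norm (x - y) * norm v" by (simp add: sum_distrib_right sum_distrib_left mult_ac)
        finally show ?thesis .
      qed
      have "Dctl A c Y x u v - Dctl A c Y y u v = (\<Sum>i\<in>UNIV. (u $ i) *\<^sub>R (frechet_derivative (field_coord A c (Y i)) (at x) v - frechet_derivative (field_coord A c (Y i)) (at y) v))"
        by (simp add: Dctl_def sum_subtractf scaleR_diff_right)
      then have "norm (Dctl A c Y x u v - Dctl A c Y y u v) \<le> (\<Sum>i\<in>UNIV. (\<Sum>b\<in>Basis. L2 i b) * norm (x - y) * norm v) * norm u"
        using sum_bd[OF i, of u] by simp
      also have "\<dots> = (\<Sum>i\<in>UNIV. \<Sum>b\<in>Basis. L2 i b) * (norm u * norm (x - y) * norm v)" unfolding sum_distrib_right[symmetric] by (simp only: mult_ac)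
      also have "\<dots> \<le> L * (norm u * norm (x - y) * norm v)" using nn by (intro mult_right_mono) (auto simp: L_def)
      finally show ?thesis by (simp add: mult_ac)
    qed
    show "u = 0" if "ctl A c Y x u = 0"
    proof -
      obtain y where y: "y \<in> U" "x = chart_map c y" using x R(2) by auto
      then have yc: "y \<in> chart_dom c" using U by auto
      have "tangent_coord A c y (\<Sum>i\<in>UNIV. (u $ i) *\<^sub>R Y i y) = tangent_coord A c y 0"
        using frame_coord(4)[OF Y y(1) c yc, of u] that y(2) linear_0[OF tangent_coord_linear[OF c yc]] by simp
      then have "(\<Sum>i\<in>UNIV. (u $ i) *\<^sub>R Y i y) = 0" by (rule tangent_coord_inj[OF c yc])
      then show ?thesis by (rule frame_coord(3)[OF Y y(1)])
    qed
  qed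
  then show ?thesis by (rule that)
qed

end

section \<open>Passage from integrable to bounded controls\<close>

context control_system
begin

lemma trajectory_of_inclusion:
  assumes "primitive x h" "\<And>t. t \<in> {0..1} \<Longrightarrow> x t \<in> B" "negligible N" "0 \<le> r"
    "\<And>t. t \<in> {0<..<1} - N \<Longrightarrow> \<exists>u. h t = F (x t) u \<and> norm u \<le> r"
  obtains u where "is_traj F B u x" "\<And>t. norm (u t) \<le> r"
  by (rule traj_of_inclusion[where F = F and B = B and r = r and x = x and h = h and N = N, OF F_lin F_cont])
    (use F_inj assms that in auto)

text \<open>The new time is normalized arc length plus a small multiple of the old time. Only
  increments are compared, in the form of \<open>ctraj\<close>, so neither a change of variables nor
  a derivative of the inverse time change occurs; \<open>ctraj_is_traj\<close> then supplies the
  bounded control.\<close>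

lemma reparametrization:
  assumes ab: "a < b" and w: "w absolutely_integrable_on {a..b::real}" and x: "\<And>t. t \<in> {a..b} \<Longrightarrow> x t \<in> B"
    and xw: "\<And>s t. \<lbrakk>a \<le> s; s \<le> t; t \<le> b\<rbrakk> \<Longrightarrow> ((\<lambda>\<tau>. F (x \<tau>) (w \<tau>)) has_integral x t - x s) {s..t}"
    and T: "integral {a..b} (\<lambda>t. norm (w t)) < T"
  obtains y v where "is_traj F B v y" "y 0 = x a" "y 1 = x b" "\<And>t. norm (v t) \<le> T"
proof -
  define W where "W t = integral {a..t} (\<lambda>t. norm (w t))" for t
  have nwi: "(\<lambda>t. norm (w t)) integrable_on {a..b}" by (intro abs_integrable_imp_integrable abs_integrable_norm w)
  have wi: "w integrable_on {s..t}" "(\<lambda>t. norm (w t)) integrable_on {s..t}" if "a \<le> s" "t \<le> b" for s t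
    using abs_integrable_ivl[OF w that] abs_integrable_norm abs_integrable_imp_integrable by blast+
  have Wd: "W t - W s = integral {s..t} (\<lambda>t. norm (w t))" if "a \<le> s" "s \<le> t" "t \<le> b" for s t
    unfolding W_def by (rule integral_diff_ivl[OF nwi that])
  have Wmono: "W s \<le> W t" if "a \<le> s" "s \<le> t" "t \<le> b" for s t
    using Wd[OF that] Henstock_Kurzweil_Integration.integral_nonneg[OF wi(2)[of s t]] that by simp
  have W0: "W a = 0" by (simp add: W_def)
  have Tp: "T > 0" using T Wmono[of a b] ab W0 by (simp add: W_def)
  \<comment> \<open>The linear term makes \<open>s\<close> strictly increasing even where
    \<open>w\<close> vanishes. Its coefficient is fixed by \<open>s b = 1\<close>, and it is
    positive because \<open>T\<close> strictly exceeds the integral of |w|.\<close>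
  define e where "e = (T - W b) / (b - a)"
  have e: "e > 0" using T ab by (simp add: e_def W_def)
  define s where "s t = (W t + e * (t - a)) / T" for t
  have s0: "s a = 0" and s1: "s b = 1" using W0 ab Tp by (simp_all add: s_def e_def)
  have s_less: "s t < s t'" if "a \<le> t" "t < t'" "t' \<le> b" for t t'
    unfolding s_def using Wmono[of t t'] that e Tp by (intro divide_strict_right_mono add_le_less_mono mult_strict_left_mono) auto
  have sW: "W t' - W t \<le> T * (s t' - s t)" if "a \<le> t" "t \<le> t'" "t' \<le> b" for t t'
  proof -
    have "T * (s t' - s t) = W t' - W t + e * (t' - t)" using Tp by (simp add: s_def field_simps)
    then show ?thesis using e that by simp
  qed
  have s_cont: "continuous_on {a..b} s"
    unfolding s_def W_def by (intro continuous_intros indefinite_integral_continuous_1 nwi) (use Tp in auto)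
  have "\<exists>t. t \<in> {a..b} \<and> s t = \<tau>" if "\<tau> \<in> {0..1}" for \<tau>
    using IVT'[of s a \<tau> b] s0 s1 s_cont ab that by auto
  then obtain r where r: "\<And>\<tau>. \<tau> \<in> {0..1} \<Longrightarrow> r \<tau> \<in> {a..b}" "\<And>\<tau>. \<tau> \<in> {0..1} \<Longrightarrow> s (r \<tau>) = \<tau>" by metis
  have r_mono: "r \<tau> \<le> r \<tau>'" if "\<tau> \<in> {0..1}" "\<tau>' \<in> {0..1}" "\<tau> \<le> \<tau>'" for \<tau> \<tau>'
    using s_less[of "r \<tau>'" "r \<tau>"] r[OF that(1)] r[OF that(2)] that(3) by (auto simp: not_le[symmetric])
  have r0: "r 0 = a" using s_less[of a "r 0"] r[of 0] s0 by (cases "r 0 = a") auto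
  have r1: "r 1 = b" using s_less[of "r 1" b] r[of 1] s1 by (cases "r 1 = b") auto
  have "ctraj F T (L * M * T\<^sup>2) (\<lambda>\<tau>. x (r \<tau>))"
    unfolding ctraj_def
  proof (intro allI impI)
    fix \<tau> \<tau>' :: real assume \<tau>: "0 \<le> \<tau> \<and> \<tau> \<le> \<tau>' \<and> \<tau>' \<le> 1"
    define \<sigma> \<sigma>' d where "\<sigma> = r \<tau>" and "\<sigma>' = r \<tau>'" and "d = \<tau>' - \<tau>"
    have \<sigma>: "a \<le> \<sigma>" "\<sigma> \<le> \<sigma>'" "\<sigma>' \<le> b" using r_mono[of \<tau> \<tau>'] r(1)[of \<tau>] r(1)[of \<tau>'] \<tau> by (auto simp: \<sigma>_def \<sigma>'_def)
    have Wle: "integral {\<sigma>..\<sigma>'} (\<lambda>t. norm (w t)) \<le> T * d"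
      using sW[OF \<sigma>] Wd[OF \<sigma>] r(2)[of \<tau>] r(2)[of \<tau>'] \<tau> by (simp add: \<sigma>_def \<sigma>'_def d_def)
    show "\<exists>u. norm u \<le> T \<and> norm (x (r \<tau>') - x (r \<tau>) - (\<tau>' - \<tau>) *\<^sub>R F (x (r \<tau>)) u) \<le> L * M * T\<^sup>2 * (\<tau>' - \<tau>)\<^sup>2"
    proof (cases "d = 0")
      case True then show ?thesis using Tp by (intro exI[of _ 0]) (auto simp: d_def)
    next
      case False
      then have d: "d > 0" using \<tau> by (simp add: d_def)
      \<comment> \<open>The witness over a piece of new duration \<open>d\<close> is the integral of
        the old control over that piece, divided by \<open>d\<close>; the time change enters only
        through the bound \<open>Wle\<close>.\<close>
      define I where "I = integral {\<sigma>..\<sigma>'} w"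
      have nI: "norm I \<le> T * d"
        unfolding I_def using integral_norm_bound_integral[OF wi[OF \<sigma>(1,3)]] Wle by fastforce
      have xs: "x \<sigma> \<in> B" using x \<sigma> by simp
      have lin: "bounded_linear (F (x \<sigma>))" using F_lin linear_conv_bounded_linear by blast
      have "((\<lambda>t. F (x \<sigma>) (w t)) has_integral F (x \<sigma>) I) {\<sigma>..\<sigma>'}"
        using has_integral_linear[OF integrable_integral[OF wi(1)[OF \<sigma>(1,3)]] lin] by (simp add: o_def I_def)
      from has_integral_diff[OF xw[OF \<sigma>] this]
      have hi: "((\<lambda>t. F (x t) (w t) - F (x \<sigma>) (w t)) has_integral x \<sigma>' - x \<sigma> - F (x \<sigma>) I) {\<sigma>..\<sigma>'}" .
      have bd: "norm (F (x t) (w t) - F (x \<sigma>) (w t)) \<le> L * M * T * d * norm (w t)" if t: "t \<in> {\<sigma>..\<sigma>'}" for t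
      proof -
        have t': "a \<le> \<sigma>" "\<sigma> \<le> t" "t \<le> b" using t \<sigma> by auto
        have "norm (x t - x \<sigma>) \<le> integral {\<sigma>..t} (\<lambda>t. M * norm (w t))"
          unfolding integral_unique[OF xw[OF t'], symmetric]
          by (rule integral_norm_bound_integral[OF has_integral_integrable[OF xw[OF t']]])
            (use wi(2)[OF t'(1,3)] F_bnd x t' in \<open>auto intro!: integrable_on_mult_right\<close>)
        also have "\<dots> = M * (W t - W \<sigma>)" using Wd[OF t'] by simp
        also have "\<dots> \<le> M * (W \<sigma>' - W \<sigma>)" using Wmono[of t \<sigma>'] t \<sigma> M by (intro mult_left_mono) auto
        also have "\<dots> \<le> M * (T * d)" using Wle Wd[OF \<sigma>] M by (intro mult_left_mono) auto
        finally have "L * norm (w t) * norm (x t - x \<sigma>) \<le> L * norm (w t) * (M * (T * d))" using L by (intro mult_left_mono) auto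
        moreover have "norm (F (x t) (w t) - F (x \<sigma>) (w t)) \<le> L * norm (w t) * norm (x t - x \<sigma>)"
          by (rule F_lip[OF x xs]) (use t \<sigma> in auto)
        ultimately show ?thesis by (simp add: mult_ac)
      qed
      have "norm (x \<sigma>' - x \<sigma> - F (x \<sigma>) I) \<le> integral {\<sigma>..\<sigma>'} (\<lambda>t. L * M * T * d * norm (w t))"
        unfolding integral_unique[OF hi, symmetric]
        by (rule integral_norm_bound_integral[OF has_integral_integrable[OF hi] _ bd])
          (intro integrable_on_mult_right wi \<sigma>)
      also have "\<dots> = L * M * T * d * integral {\<sigma>..\<sigma>'} (\<lambda>t. norm (w t))" by simp
      also have "\<dots> \<le> L * M * T * d * (T * d)" by (rule mult_left_mono[OF Wle]) (use L M Tp d in auto)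
      finally have main: "norm (x \<sigma>' - x \<sigma> - F (x \<sigma>) I) \<le> L * M * T\<^sup>2 * d\<^sup>2" by (simp add: power2_eq_square mult_ac)
      show ?thesis
      proof (intro exI[of _ "I /\<^sub>R d"] conjI)
        show "norm (I /\<^sub>R d) \<le> T" using nI d by (simp add: field_simps)
        have "(\<tau>' - \<tau>) *\<^sub>R F (x (r \<tau>)) (I /\<^sub>R d) = F (x \<sigma>) I"
          using d linear_cmul[OF F_lin, of "x \<sigma>" "inverse d" I] by (simp add: d_def[symmetric] \<sigma>_def)
        then show "norm (x (r \<tau>') - x (r \<tau>) - (\<tau>' - \<tau>) *\<^sub>R F (x (r \<tau>)) (I /\<^sub>R d)) \<le> L * M * T\<^sup>2 * (\<tau>' - \<tau>)\<^sup>2"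
          using main by (simp add: \<sigma>_def \<sigma>'_def d_def)
      qed
    qed
  qed
  moreover have "x (r t) \<in> B" if "t \<in> {0..1}" for t using x[OF r(1)[OF that]] .
  ultimately obtain v where "is_traj F B v (\<lambda>\<tau>. x (r \<tau>))" "\<And>t. norm (v t) \<le> T"
    by (rule ctraj_is_traj[where F = F and B = B and r = T and M = M, OF F_lin F_cont compact_cball, rotated 2])
      (use F_inj F_bnd M L Tp in auto)
  then show ?thesis using that r0 r1 by metis
qed

end

section \<open>Trajectories in a chart\<close>

text \<open>In an orthonormal frame the norm of the control is the speed of the path.\<close>

locale sr_chart = sr_manifold A \<Delta> g K + control_system "ctl A c Y" "Dctl A c Y" p0 R M L
  for A :: "('m::{t2_space, second_countable_topology}, 'e::euclidean_space) chart set"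
    and \<Delta> :: "'m \<Rightarrow> 'e set" and g :: "'m \<Rightarrow> 'e \<Rightarrow> 'e \<Rightarrow> real" and K :: "'k::finite itself"
    and c and Y :: "'k \<Rightarrow> 'm \<Rightarrow> 'e" and p0 R M L +
  fixes U :: "'m set"
  assumes c: "c \<in> A" and U: "open U" "U \<subseteq> chart_dom c" and frame: "local_frame A \<Delta> U Y" and on: "orthonormal_on U Y"
    and BU: "cball p0 R \<subseteq> chart_map c ` U"
begin

abbreviation F where "F \<equiv> ctl A c Y"
abbreviation \<phi> where "\<phi> \<equiv> chart_map c"
abbreviation \<psi> where "\<psi> \<equiv> chart_inv c"

lemma \<psi>_U: "p \<in> B \<Longrightarrow> \<psi> p \<in> U" and \<phi>_\<psi>: "p \<in> B \<Longrightarrow> \<phi> (\<psi> p) = p"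
  using BU U chart_inv_map[OF c] by (auto simp: subset_iff image_iff)

lemma \<psi>_\<phi>: "y \<in> U \<Longrightarrow> \<psi> (\<phi> y) = y"
  using U chart_inv_map[OF c] by auto

lemma B_cimg: "B \<subseteq> cimg c" using BU U by auto

lemma open_chart_ball: "open (chart_dom c \<inter> \<phi> -` ball p0 R)" and compact_\<psi>B: "compact (\<psi> ` B)"
  and \<psi>_ball: "\<psi> ` ball p0 R = chart_dom c \<inter> \<phi> -` ball p0 R"
proof -
  show "open (chart_dom c \<inter> \<phi> -` ball p0 R)" by (rule open_chart_preimage[OF c]) simp
  show "compact (\<psi> ` B)"
    by (intro compact_continuous_image continuous_on_subset[OF chart_inv_cont[OF c] B_cimg]) simp
  show "\<psi> ` ball p0 R = chart_dom c \<inter> \<phi> -` ball p0 R"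
    using \<psi>_U \<phi>_\<psi> U chart_inv_map[OF c] by (auto simp: image_iff subset_iff) (metis mem_ball)
qed

lemma tangent_coord_F: "y \<in> U \<Longrightarrow> tangent_coord A c y (\<Sum>i\<in>UNIV. (u $ i) *\<^sub>R Y i y) = F (\<phi> y) u"
  by (rule frame_coord(4)[OF frame _ c]) (use U in auto)

lemma loc_mod_chart_path:
  assumes "\<And>t. t \<in> {0..1} \<Longrightarrow> x t \<in> B" "0 \<le> C"
    "\<And>s t. \<lbrakk>s \<in> {0..1}; t \<in> {0..1}; s \<le> t\<rbrakk> \<Longrightarrow> norm (x t - x s) \<le> C * \<bar>m t - m s\<bar>"
  shows "loc_mod m (\<lambda>t. \<psi> (x t))"
proof -
  have "norm (x s - x t) \<le> C * \<bar>m s - m t\<bar>" if "s \<in> {0..1}" "t \<in> {0..1}" for s t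
    using assms(3)[OF that] assms(3)[OF that(2,1)] by (cases "s \<le> t") (auto simp: norm_minus_commute abs_minus_commute)
  moreover have "\<psi> (x t) \<in> chart_dom c \<and> \<phi> (\<psi> (x t)) = x t" if "t \<in> {0..1}" for t
    using \<psi>_U[OF assms(1)[OF that]] \<phi>_\<psi>[OF assms(1)[OF that]] U by auto
  ultimately show ?thesis
    unfolding loc_mod_def by (intro ballI bexI[OF _ c] exI[of _ 1] conjI exI[of _ C]) (use assms(2) in auto)
qed

lemma traj_velocity:
  assumes x: "is_traj F B u x"
  shows "ac_path A (\<lambda>t. \<psi> (x t))"
    and "\<exists>N. negligible N \<and> (\<forall>t\<in>{0<..<1} - N. has_velocity A (\<lambda>t. \<psi> (x t)) t (\<Sum>i\<in>UNIV. (u t $ i) *\<^sub>R Y i (\<psi> (x t))))"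
proof -
  note xp = traj_parts[OF x]
  have cont: "continuous_on {0..1} (\<lambda>t. \<psi> (x t))"
    by (rule continuous_on_compose2[OF continuous_on_subset[OF chart_inv_cont[OF c] B_cimg] primitive_continuous[OF xp(1)]])
      (use xp(3) in auto)
  show "ac_path A (\<lambda>t. \<psi> (x t))"
  proof (rule loc_mod_ac_path)
    show "(\<lambda>t. norm (u t)) absolutely_integrable_on {0..1}" by (rule abs_integrable_norm[OF xp(2)])
    then have ni: "(\<lambda>t. norm (u t)) integrable_on {0..1}" by (rule abs_integrable_imp_integrable)
    show "loc_mod (\<lambda>t. integral {0..t} (\<lambda>t. norm (u t))) (\<lambda>t. \<psi> (x t))"
    proof (rule loc_mod_chart_path[OF xp(3)])
      fix s t :: real assume st: "s \<in> {0..1}" "t \<in> {0..1}" "s \<le> t"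
      have i: "(\<lambda>\<tau>. norm (u \<tau>)) integrable_on {s..t}" using integrable_on_subinterval[OF ni, of s t] st by auto
      have "norm (x t - x s) \<le> integral {s..t} (\<lambda>\<tau>. M * norm (u \<tau>))"
        by (rule primitive_norm_le[OF xp(1)]) (use st i xp(3) F_bnd in \<open>auto intro!: integrable_on_mult_right\<close>)
      also have "\<dots> = M * (integral {0..t} (\<lambda>\<tau>. norm (u \<tau>)) - integral {0..s} (\<lambda>\<tau>. norm (u \<tau>)))"
        using integral_diff_ivl[OF ni, of s t] st by simp
      also have "\<dots> \<le> M * \<bar>integral {0..t} (\<lambda>\<tau>. norm (u \<tau>)) - integral {0..s} (\<lambda>\<tau>. norm (u \<tau>))\<bar>"
        using M by (intro mult_left_mono) auto
      finally show "norm (x t - x s) \<le> M * \<bar>integral {0..t} (\<lambda>\<tau>. norm (u \<tau>)) - integral {0..s} (\<lambda>\<tau>. norm (u \<tau>))\<bar>" .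
    qed (use M in auto)
  qed auto
  obtain N where N: "negligible N" "\<And>t. t \<in> {0<..<1} - N \<Longrightarrow> (x has_vector_derivative F (x t) (u t)) (at t)"
    using primitive_deriv[OF xp(1)] by blast
  show "\<exists>N. negligible N \<and> (\<forall>t\<in>{0<..<1} - N. has_velocity A (\<lambda>t. \<psi> (x t)) t (\<Sum>i\<in>UNIV. (u t $ i) *\<^sub>R Y i (\<psi> (x t))))"
  proof (intro exI[of _ N] conjI N(1) ballI)
    fix t assume t: "t \<in> {0<..<1} - N"
    then have xB: "x t \<in> B" using xp(3) by auto
    have dom: "\<psi> (x t) \<in> chart_dom c" using \<psi>_U[OF xB] U by auto
    have "((\<phi> \<circ> (\<lambda>t. \<psi> (x t))) has_vector_derivative F (x t) (u t)) (at t)"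
      by (rule has_vector_derivative_transform_within_open[OF N(2)[OF t], of "{0<..<1}"]) (use t \<phi>_\<psi> xp(3) in auto)
    moreover have "tangent_coord A c (\<psi> (x t)) (\<Sum>i\<in>UNIV. (u t $ i) *\<^sub>R Y i (\<psi> (x t))) = F (x t) (u t)"
      using tangent_coord_F[OF \<psi>_U[OF xB]] \<phi>_\<psi>[OF xB] by simp
    ultimately show "has_velocity A (\<lambda>t. \<psi> (x t)) t (\<Sum>i\<in>UNIV. (u t $ i) *\<^sub>R Y i (\<psi> (x t)))"
      using has_velocity_chart[of c "\<lambda>t. \<psi> (x t)" t "{0<..<1}"] c dom t continuous_on_subset[OF cont greaterThanLessThan_subseteq_atLeastAtMost_iff[THEN iffD2]] by auto
  qed
qed

lemma traj_lipschitz: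
  assumes x: "is_traj F B u x" and u: "\<And>t. norm (u t) \<le> T" and st: "0 \<le> s" "s \<le> t" "t \<le> 1"
  shows "norm (x t - x s) \<le> M * T * (t - s)"
proof -
  note xp = traj_parts[OF x]
  have "norm (x t - x s) \<le> integral {s..t} (\<lambda>\<tau>. M * T)"
  proof (rule primitive_norm_le[OF xp(1) st])
    fix \<tau> assume "\<tau> \<in> {s..t}"
    then have "norm (F (x \<tau>) (u \<tau>)) \<le> M * norm (u \<tau>)" using xp(3) st F_bnd by auto
    then show "norm (F (x \<tau>) (u \<tau>)) \<le> M * T" using u[of \<tau>] M mult_left_mono[of "norm (u \<tau>)" T M] by linarith
  qed auto
  then show ?thesis using st by (simp add: mult_ac)
qed

lemma traj_hp:
  assumes x: "is_traj F B u x" and u: "\<And>t. norm (u t) \<le> T"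
  shows "hp T (\<lambda>t. \<psi> (x t))"
  unfolding hp_def
proof
  note xp = traj_parts[OF x]
  have T: "T \<ge> 0" using u[of 0] norm_ge_zero order_trans by blast
  show "loc_mod (\<lambda>t. t) (\<lambda>t. \<psi> (x t))"
    by (rule loc_mod_chart_path[OF xp(3), where C = "M * T"]) (use traj_lipschitz[OF x u] M T in auto)
  obtain N where N: "negligible N" "\<And>t. t \<in> {0<..<1} - N \<Longrightarrow> has_velocity A (\<lambda>t. \<psi> (x t)) t (\<Sum>i\<in>UNIV. (u t $ i) *\<^sub>R Y i (\<psi> (x t)))"
    using traj_velocity(2)[OF x] by blast
  show "\<exists>N. negligible N \<and> (\<forall>t\<in>{0<..<1} - N. \<exists>v\<in>\<Delta> (\<psi> (x t)). has_velocity A (\<lambda>t. \<psi> (x t)) t v \<and> g (\<psi> (x t)) v v \<le> T\<^sup>2)"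
  proof (intro exI[of _ N] conjI N(1) ballI)
    fix t assume t: "t \<in> {0<..<1} - N"
    then have y: "\<psi> (x t) \<in> U" using xp(3) \<psi>_U by auto
    show "\<exists>v\<in>\<Delta> (\<psi> (x t)). has_velocity A (\<lambda>t. \<psi> (x t)) t v \<and> g (\<psi> (x t)) v v \<le> T\<^sup>2"
      using N(2)[OF t] frame_coord(1)[OF frame y] orthonormal_norm[OF frame on y] power_mono[OF u norm_ge_zero] by (metis)
  qed
qed

text \<open>Converse of \<open>traj_hp\<close>: the path in coordinates is Lipschitz, hence a
  primitive, and orthonormality of the frame turns the speed bound into a bound for the coefficients
  of the velocity.\<close>

lemma hp_traj:
  assumes \<gamma>: "hp T \<gamma>" "0 \<le> T" and B: "\<And>t. t \<in> {0..1} \<Longrightarrow> \<gamma> t \<in> \<psi> ` B"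
  obtains u where "is_traj F B u (\<lambda>t. \<phi> (\<gamma> t))" "\<And>t. norm (u t) \<le> T"
proof -
  have \<gamma>U: "\<gamma> t \<in> U" "\<phi> (\<gamma> t) \<in> B" if "t \<in> {0..1}" for t using B[OF that] \<psi>_U \<phi>_\<psi> by auto
  have l: "loc_mod (\<lambda>t. t) \<gamma>" using \<gamma> by (simp add: hp_def)
  have "mono_on {0..1} (\<lambda>t::real. t)" by (simp add: mono_on_def)
  then obtain L' where L': "L' \<ge> 0" "\<And>s t. \<lbrakk>0 \<le> s; s \<le> t; t \<le> 1\<rbrakk> \<Longrightarrow> norm (\<phi> (\<gamma> t) - \<phi> (\<gamma> s)) \<le> L' * (t - s)"
    by (rule loc_mod_chart_ivl[OF l continuous_on_id _ c, of 0 1]) (use \<gamma>U(1) U(2) in auto)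
  have "norm (\<phi> (\<gamma> t) - \<phi> (\<gamma> s)) \<le> L' * \<bar>t - s\<bar>" if "s \<in> {0..1}" "t \<in> {0..1}" for s t
    using L'(2)[of s t] L'(2)[of t s] that by (cases "s \<le> t") (auto simp: norm_minus_commute)
  then obtain h where h: "primitive (\<lambda>t. \<phi> (\<gamma> t)) h" by (rule lipschitz_primitive)
  obtain N1 where N1: "negligible N1" "\<And>t. t \<in> {0<..<1} - N1 \<Longrightarrow> ((\<lambda>t. \<phi> (\<gamma> t)) has_vector_derivative h t) (at t)"
    using primitive_deriv[OF h] by blast
  obtain N2 where N2: "negligible N2" "\<And>t. t \<in> {0<..<1} - N2 \<Longrightarrow> \<exists>v\<in>\<Delta> (\<gamma> t). has_velocity A \<gamma> t v \<and> g (\<gamma> t) v v \<le> T\<^sup>2"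
    using \<gamma> unfolding hp_def by blast
  have cont: "continuous_on {0<..<1} \<gamma>" by (rule continuous_on_subset[OF hp_continuous[OF \<gamma>(1)]]) auto
  show ?thesis
  proof (rule trajectory_of_inclusion[OF h \<gamma>U(2) negligible_Un[OF N1(1) N2(1)] \<gamma>(2) _ that])
    fix t assume t: "t \<in> {0<..<1} - (N1 \<union> N2)"
    then obtain v where v: "v \<in> \<Delta> (\<gamma> t)" "has_velocity A \<gamma> t v" "g (\<gamma> t) v v \<le> T\<^sup>2" using N2(2) by auto
    have tU: "\<gamma> t \<in> U" using \<gamma>U(1) t by auto
    obtain u :: "real ^ 'k" where u: "v = (\<Sum>i\<in>UNIV. (u $ i) *\<^sub>R Y i (\<gamma> t))" using frame_coord(2)[OF frame tU v(1)] by blast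
    have "((\<phi> \<circ> \<gamma>) has_vector_derivative tangent_coord A c (\<gamma> t) v) (at t)"
      using v(2) has_velocity_chart[OF c, of \<gamma> t "{0<..<1}" v] cont t tU U by auto
    then have "h t = F (\<phi> (\<gamma> t)) u"
      using N1(2)[of t] t tangent_coord_F[OF tU, of u] u vector_derivative_unique_at by (fastforce simp: o_def)
    moreover have "norm u \<le> T" using v(3) orthonormal_norm[OF frame on tU, of u] u \<gamma>(2) by (auto intro: power2_le_imp_le)
    ultimately show "\<exists>u. h t = F (\<phi> (\<gamma> t)) u \<and> norm u \<le> T" by blast
  qed
qed

text \<open>While it is in the chart ball, such a path moves by at most \<open>M * T\<close> in
  coordinates, which is too little to reach the boundary. A first exit time would lead to a
  contradiction.\<close>

lemma hp_confined:
  assumes \<gamma>: "hp T \<gamma>" "0 \<le> T" "\<gamma> 0 = \<psi> p" and p: "norm (p - p0) + M * T < R" and t: "t \<in> {0..1}"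
  shows "\<gamma> t \<in> \<psi> ` ball p0 R" and "norm (\<phi> (\<gamma> t) - p) \<le> M * T"
proof -
  have MT: "M * T \<ge> 0" using M \<gamma> by simp
  have pB: "p \<in> B" "p \<in> ball p0 R" using p MT by (auto simp: dist_norm norm_minus_commute)
  have sub: "norm (\<phi> (\<gamma> b) - p) \<le> M * T" if b: "b \<in> {0..1}" and B: "\<And>t. t \<in> {0..b} \<Longrightarrow> \<gamma> t \<in> \<psi> ` B" for b
  proof -
    define \<sigma> where "\<sigma> t = \<gamma> (0 + (b - 0) * t)" for t
    have \<sigma>: "hp (\<bar>b - 0\<bar> * T) \<sigma>" unfolding \<sigma>_def by (rule hp_affine[OF \<gamma>(1)]) (use b in auto)
    have "\<sigma> t \<in> \<psi> ` B" if "t \<in> {0..1}" for t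
      unfolding \<sigma>_def using B[of "b * t"] that b mult_left_mono[of t 1 b] by auto
    then obtain u where u: "is_traj F B u (\<lambda>t. \<phi> (\<sigma> t))" "\<And>t. norm (u t) \<le> \<bar>b - 0\<bar> * T"
      using hp_traj[OF \<sigma>] \<gamma>(2) b by (metis abs_ge_zero mult_nonneg_nonneg)
    have "norm (\<phi> (\<sigma> 1) - \<phi> (\<sigma> 0)) \<le> M * (\<bar>b - 0\<bar> * T) * (1 - 0)" by (rule traj_lipschitz[OF u]) auto
    also have "\<dots> = b * (M * T)" using b by simp
    also have "\<dots> \<le> 1 * (M * T)" using b MT by (intro mult_right_mono) auto
    finally show ?thesis using \<gamma>(3) \<phi>_\<psi>[OF pB(1)] by (simp add: \<sigma>_def)
  qed
  have ball: "\<gamma> t \<in> \<psi> ` ball p0 R" if t: "t \<in> {0..1}" for t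
  proof (rule ccontr)
    define E where "E = {t \<in> {0..1}. \<gamma> t \<notin> \<psi> ` ball p0 R}"
    assume "\<gamma> t \<notin> \<psi> ` ball p0 R"
    then have "E \<noteq> {}" using t by (auto simp: E_def)
    moreover have "compact E"
    proof -
      have "E = {0..1} \<inter> \<gamma> -` (- (\<psi> ` ball p0 R))" by (auto simp: E_def)
      moreover have "closed ({0..1} \<inter> \<gamma> -` (- (\<psi> ` ball p0 R)))"
        by (rule continuous_closed_preimage[OF hp_continuous[OF \<gamma>(1)]]) (simp, simp only: \<psi>_ball closed_Compl[OF open_chart_ball])
      ultimately show ?thesis using compact_Int_closed[OF compact_Icc, of E 0 1] by (simp add: E_def Int_absorb1)
    qed
    ultimately obtain b where b: "b \<in> E" "\<And>t. t \<in> E \<Longrightarrow> b \<le> t" using compact_attains_inf by metis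
    have before: "\<gamma> t \<in> \<psi> ` ball p0 R" if "0 \<le> t" "t < b" for t using b that by (force simp: E_def)
    have b0: "b > 0" using b(1) \<gamma>(3) pB by (cases "b = 0") (auto simp: E_def)
    have cl: "closed (\<psi> ` B)" by (rule compact_imp_closed[OF compact_\<psi>B])
    \<comment> \<open>The manifold image of \<open>B\<close> is compact, hence closed, so it still
      contains the point at the first exit time. Only then is \<open>sub\<close> available up to
      \<open>b\<close>, and it puts this point into the open ball.\<close>
    have "\<gamma> b \<in> \<psi> ` B"
    proof (rule closed_sequentially[OF cl])
      define s where "s n = b - b / real (Suc (Suc n))" for n
      have s: "0 \<le> s n" "s n < b" for n using b0 by (auto simp: s_def field_simps)
      have b1: "b \<le> 1" using b(1) by (simp add: E_def)
      show "\<gamma> (s n) \<in> \<psi> ` B" for n by (rule subsetD[OF image_mono[OF ball_subset_cball] before[OF s]])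
      have "s \<longlonglongrightarrow> b - 0"
        unfolding s_def by (intro tendsto_intros LIMSEQ_Suc[OF LIMSEQ_Suc[OF lim_const_over_n]])
      then show "(\<lambda>n. \<gamma> (s n)) \<longlonglongrightarrow> \<gamma> b"
        by (intro continuous_on_tendsto_compose[OF hp_continuous[OF \<gamma>(1)]])
          (use b0 b1 order_trans[OF less_imp_le[OF s(2)] b1] s(1) in auto)
    qed
    moreover have "\<gamma> t \<in> \<psi> ` B" if "0 \<le> t" "t < b" for t using before[OF that] by auto
    ultimately have "\<gamma> t \<in> \<psi> ` B" if "t \<in> {0..b}" for t using that by (cases "t = b") auto
    then have "norm (\<phi> (\<gamma> b) - p) \<le> M * T" by (rule sub[rotated]) (use b in \<open>auto simp: E_def\<close>)
    then have "norm (\<phi> (\<gamma> b) - p0) < R" using p norm_triangle_ineq[of "\<phi> (\<gamma> b) - p" "p - p0"] by simp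
    moreover have "\<gamma> b \<in> chart_dom c" using \<open>\<gamma> b \<in> \<psi> ` B\<close> \<psi>_U U by auto
    ultimately have "\<gamma> b \<in> \<psi> ` ball p0 R" unfolding \<psi>_ball by (simp add: dist_norm norm_minus_commute)
    then show False using b(1) by (simp add: E_def)
  qed
  show "\<gamma> t \<in> \<psi> ` ball p0 R" by (rule ball[OF t])
  show "norm (\<phi> (\<gamma> t) - p) \<le> M * T"
    by (rule sub[OF t]) (use ball t in \<open>force\<close>)
qed

lemma hp_confined_traj:
  assumes \<gamma>: "hp T \<gamma>" "0 \<le> T" "\<gamma> 0 = \<psi> p" and p: "norm (p - p0) + M * T < R"
  obtains u where "is_traj F B u (\<lambda>t. \<phi> (\<gamma> t))" "\<And>t. norm (u t) \<le> T"
proof -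
  have "\<gamma> t \<in> \<psi> ` B" if "t \<in> {0..1}" for t
    using hp_confined(1)[OF \<gamma> p that] image_mono[OF ball_subset_cball, of \<psi> p0 R] by blast
  then show ?thesis using hp_traj[OF \<gamma>(1,2)] that by metis
qed

lemma reach_confined:
  assumes "reach T (\<psi> p) y" "norm (p - p0) + M * T < R"
  shows "y \<in> \<psi> ` ball p0 R" "norm (\<phi> y - p) \<le> M * T"
  using assms hp_confined[of T _ p 1] unfolding reach_def by auto

text \<open>Turns the L1 norm of a control into a speed bound by \<open>reparametrization\<close>,
  whence the strict inequality.\<close>

lemma traj_reach:
  assumes x: "is_traj F B w x" and T: "integral {0..1} (\<lambda>t. norm (w t)) < T"
  shows "reach T (\<psi> (x 0)) (\<psi> (x 1))"
proof -
  note xp = traj_parts[OF x]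
  obtain y v where y: "is_traj F B v y" "y 0 = x 0" "y 1 = x 1" "\<And>t. norm (v t) \<le> T"
    by (rule reparametrization[OF zero_less_one xp(2) xp(3) primitive_has_integral[OF xp(1)] T]) blast+
  have "0 \<le> integral {0..1} (\<lambda>t. norm (w t))"
    by (rule Henstock_Kurzweil_Integration.integral_nonneg) (use abs_integrable_norm[OF xp(2)] abs_integrable_imp_integrable in auto)
  then show ?thesis unfolding reach_def using traj_hp[OF y(1,4)] T y(2,3) by (auto intro!: exI[of _ "\<lambda>t. \<psi> (y t)"])
qed

text \<open>The bounds \<open>T n\<close> may exceed \<open>T0\<close>. Cutting at time T0 / S n
  leaves a piece of bound exactly \<open>T0\<close>, to which compactness applies, and the lost end
  has coordinate length at most M (S n - T0), which tends to 0.\<close>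

lemma reach_limit:
  assumes re: "\<And>n::nat. reach (T n) (\<psi> (p n)) (\<psi> (q n))" and T: "T \<longlonglongrightarrow> T0" "T0 > 0"
    and p: "p \<longlonglongrightarrow> p'" and q: "q \<longlonglongrightarrow> q'" "\<And>n. q n \<in> B" and R': "norm (p' - p0) + M * T0 < R"
  obtains \<gamma> where "hp T0 \<gamma>" "\<gamma> 0 = \<psi> p'" "\<gamma> 1 = \<psi> q'"
proof -
  \<comment> \<open>Raising \<open>T n\<close> to at least \<open>T0\<close> keeps the cutting time
    \<open>l n\<close> in [0,1].\<close>
  define S where "S n = max T0 (T n)" for n
  have S: "S \<longlonglongrightarrow> T0" unfolding S_def using tendsto_max[OF tendsto_const[of T0] T(1)] by simp
  have ST: "S n \<ge> T0" "S n > 0" for n using T(2) by (auto simp: S_def)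
  have "(\<lambda>n. norm (p n - p0) + M * S n) \<longlonglongrightarrow> norm (p' - p0) + M * T0" by (intro tendsto_intros p S)
  then have "\<forall>\<^sub>F n in sequentially. norm (p n - p0) + M * S n < R" using R' by (rule order_tendstoD)
  then obtain n0 where n0: "\<And>n. n \<ge> n0 \<Longrightarrow> norm (p n - p0) + M * S n < R" unfolding eventually_sequentially by blast
  define l where "l n = T0 / S n" for n
  have l: "l n \<in> {0..1}" for n using ST[of n] T(2) by (simp add: l_def)
  have "\<exists>x u. is_traj F B u x \<and> (\<forall>t. norm (u t) \<le> T0) \<and> x 0 = p n \<and> norm (q n - x 1) \<le> M * (S n - T0)" if n: "n \<ge> n0" for n
  proof -
    have pB: "p n \<in> B" using n0[OF n] mult_pos_pos[OF M ST(2)[of n]] by (simp add: dist_norm norm_minus_commute)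
    have "reach (S n) (\<psi> (p n)) (\<psi> (q n))" using re[of n] by (rule reach_mono) (simp add: S_def)
    then obtain \<gamma> where \<gamma>: "hp (S n) \<gamma>" "\<gamma> 0 = \<psi> (p n)" "\<gamma> 1 = \<psi> (q n)" unfolding reach_def by blast
    obtain u where u: "is_traj F B u (\<lambda>t. \<phi> (\<gamma> t))" "\<And>t. norm (u t) \<le> S n"
      by (rule hp_confined_traj[OF \<gamma>(1) less_imp_le[OF ST(2)] \<gamma>(2) n0[OF n]]) blast
    have "hp (\<bar>l n - 0\<bar> * S n) (\<lambda>t. \<gamma> (0 + (l n - 0) * t))" by (rule hp_affine[OF \<gamma>(1)]) (use l in auto)
    moreover have "\<bar>l n - 0\<bar> * S n = T0" using ST[of n] T(2) by (simp add: l_def)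
    ultimately have \<sigma>: "hp T0 (\<lambda>t. \<gamma> (l n * t))" by simp
    have "norm (p n - p0) + M * T0 < R" using n0[OF n] ST(1)[of n] M mult_left_mono[of T0 "S n" M] by linarith
    then obtain v where v: "is_traj F B v (\<lambda>t. \<phi> (\<gamma> (l n * t)))" "\<And>t. norm (v t) \<le> T0"
      using hp_confined_traj[OF \<sigma>, of "p n"] T(2) \<gamma>(2) by (metis less_imp_le mult_zero_right)
    have "norm (\<phi> (\<gamma> 1) - \<phi> (\<gamma> (l n))) \<le> M * S n * (1 - l n)" by (rule traj_lipschitz[OF u]) (use l[of n] in auto)
    also have "\<dots> = M * (S n - T0)" using ST[of n] T(2) by (simp add: l_def field_simps)
    finally have "norm (q n - \<phi> (\<gamma> (l n))) \<le> M * (S n - T0)" using \<gamma>(3) \<phi>_\<psi>[OF q(2)] by simp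
    then show ?thesis using v \<gamma>(2) \<phi>_\<psi>[OF pB] by (intro exI[of _ "\<lambda>t. \<phi> (\<gamma> (l n * t))"] exI[of _ v]) auto
  qed
  then obtain X u where X: "\<And>n. n \<ge> n0 \<Longrightarrow> is_traj F B (u n) (X n)" "\<And>n t. n \<ge> n0 \<Longrightarrow> norm (u n t) \<le> T0" "\<And>n. n \<ge> n0 \<Longrightarrow> X n 0 = p n"
    "\<And>n. n \<ge> n0 \<Longrightarrow> norm (q n - X n 1) \<le> M * (S n - T0)" by metis
  obtain k y w where k: "strict_mono (k :: nat \<Rightarrow> nat)" "is_traj F B w y" "\<And>t. norm (w t) \<le> T0"
    "\<And>t. t \<in> {0..1} \<Longrightarrow> (\<lambda>n. X (k n + n0) t) \<longlonglongrightarrow> y t"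
    by (rule traj_compactness[of "\<lambda>n. u (n + n0)" "\<lambda>n. X (n + n0)" T0]) (use X T(2) in auto)
  have sub: "(\<lambda>n. f (k n + n0)) \<longlonglongrightarrow> a" if "f \<longlonglongrightarrow> a" for f :: "nat \<Rightarrow> 'z::topological_space" and a
    using LIMSEQ_subseq_LIMSEQ[OF LIMSEQ_ignore_initial_segment[OF that, of n0] k(1)] by (simp add: o_def)
  have y01: "(\<lambda>n. X (k n + n0) 0) \<longlonglongrightarrow> y 0" "(\<lambda>n. X (k n + n0) 1) \<longlonglongrightarrow> y 1" by (intro k(4), simp)+
  have "y 0 = p'" using LIMSEQ_unique[OF y01(1)] sub[OF p] X(3) by simp
  have "(\<lambda>n. q (k n + n0) - X (k n + n0) 1) \<longlonglongrightarrow> 0"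
  proof (rule Lim_null_comparison)
    show "\<forall>\<^sub>F n in sequentially. norm (q (k n + n0) - X (k n + n0) 1) \<le> M * (S (k n + n0) - T0)" using X(4) by simp
    have "(\<lambda>n. M * (S (k n + n0) - T0)) \<longlonglongrightarrow> M * (T0 - T0)" by (intro tendsto_intros sub[OF S])
    then show "(\<lambda>n. M * (S (k n + n0) - T0)) \<longlonglongrightarrow> 0" by simp
  qed
  from tendsto_diff[OF sub[OF q(1)] this] have "y 1 = q'" using LIMSEQ_unique[OF y01(2)] by simp
  show ?thesis
    by (rule that[OF traj_hp[OF k(2,3)]]) (simp_all add: \<open>y 0 = p'\<close> \<open>y 1 = q'\<close>)
qed

end

text \<open>The open set \<open>V\<close> permits a chart that avoids a prescribed point, as will be
  required for \<open>xbar\<close>.\<close>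

lemma (in sr_manifold) sr_chart_exists:
  fixes x :: 'm
  assumes V: "open V" "x \<in> V"
  obtains c and Y :: "'k \<Rightarrow> 'm \<Rightarrow> 'e" and R M L U where "sr_chart A \<Delta> g K c Y (chart_map c x) R M L U" "x \<in> U" "U \<subseteq> V"
proof -
  obtain W and X :: "'k \<Rightarrow> 'm \<Rightarrow> 'e" where W: "open W" "x \<in> W" "local_frame A \<Delta> W X"
    using dist unfolding smooth_distribution_def by metis
  define c where "c = chart_at A x"
  have c: "c \<in> A" "x \<in> chart_dom c" using chart_at by (auto simp: c_def)
  define U where "U = W \<inter> V \<inter> chart_dom c"
  have U: "open U" unfolding U_def by (intro open_Int W V chart_open(1) c)
  have U: "open U" "x \<in> U" "U \<subseteq> chart_dom c" "U \<subseteq> V" using U W V c by (auto simp: U_def)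
  have "smooth_field_on A U (X i)" for i
    unfolding smooth_field_on_def
  proof
    fix d assume d: "d \<in> A"
    have "smooth_on (chart_map d ` (W \<inter> chart_dom d)) (field_coord A d (X i))"
      using W(3) d unfolding local_frame_def smooth_field_on_def by blast
    then show "smooth_on (chart_map d ` (U \<inter> chart_dom d)) (field_coord A d (X i))"
      by (rule smooth_on_subset) (auto simp: U_def)
  qed
  then have "local_frame A \<Delta> U X" using W(3) unfolding local_frame_def by (auto simp: U_def)
  then obtain Y :: "'k \<Rightarrow> 'm \<Rightarrow> 'e" where Y: "local_frame A \<Delta> U Y" "orthonormal_on U Y" by (rule orthonormal_frame[OF U(1)])
  have "open (chart_map c ` U)" using open_chart_image[OF c(1) U(1)] U(3) by (simp add: Int_absorb2)
  then obtain R where R: "R > 0" "cball (chart_map c x) R \<subseteq> chart_map c ` U" using U(2) open_contains_cball by (metis imageI)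
  obtain M L where cs: "control_system (ctl A c Y) (Dctl A c Y) (chart_map c x) R M L"
    by (rule chart_control_system[OF c(1) U(1,3) Y(1) R])
  have "sr_chart A \<Delta> g K c Y (chart_map c x) R M L U"
    using cs sr_manifold_axioms c(1) U(1,3) Y R(2) by (intro sr_chart.intro sr_chart_axioms.intro)
  then show ?thesis using that U(2,4) by blast
qed

section \<open>From horizontal paths to paths of bounded speed\<close>

context sr_manifold
begin

text \<open>The absolute value makes it nonnegative everywhere: at exceptional times the velocity
  need not be horizontal, \<open>g\<close> may be negative, and \<open>sqrt\<close> of a negative
  number is negative.\<close>

definition speed :: "(real \<Rightarrow> 'm) \<Rightarrow> real \<Rightarrow> real" where
  "speed \<gamma> t = \<bar>sqrt (g (\<gamma> t) (velocity A \<gamma> t) (velocity A \<gamma> t))\<bar>"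

text \<open>The conditions on \<open>a\<close> and \<open>b\<close> are premises inside the property
  because the bisection principle considers all small intervals around a time, including those that
  stick out of [0,1].\<close>

definition reach_speed :: "(real \<Rightarrow> 'm) \<Rightarrow> real \<Rightarrow> real \<Rightarrow> bool" where
  "reach_speed \<gamma> a b \<longleftrightarrow> (0 \<le> a \<longrightarrow> b \<le> 1 \<longrightarrow> speed \<gamma> absolutely_integrable_on {a..b} \<and>
     (\<forall>T>integral {a..b} (speed \<gamma>). reach T (\<gamma> a) (\<gamma> b)))"

end

text \<open>Near \<open>t0\<close> absolute continuity makes the coordinate velocity integrable, its
  control has norm equal to the speed, and \<open>reparametrization\<close> converts any number
  above the integral of the speed into a bound for \<open>reach\<close>.\<close>

lemma (in sr_chart) reach_speed_local:
  assumes ac: "ac_path A \<gamma>" and N: "negligible N" "\<And>t. t \<in> {0<..<1} - N \<Longrightarrow> \<exists>v\<in>\<Delta> (\<gamma> t). has_velocity A \<gamma> t v"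
    and t0: "t0 \<in> {0..1}" "\<gamma> t0 \<in> \<psi> ` ball p0 R"
  shows "\<exists>\<delta>>0. \<forall>a b. a \<le> t0 \<and> t0 \<le> b \<and> b - a < \<delta> \<longrightarrow> reach_speed \<gamma> a b"
proof -
  have cont: "continuous_on {0..1} \<gamma>" using ac by (simp add: ac_path_def)
  have "(\<gamma> \<longlongrightarrow> \<gamma> t0) (at t0 within {0..1})" using cont t0(1) by (simp add: continuous_on_def)
  then have "\<forall>\<^sub>F t in at t0 within {0..1}. \<gamma> t \<in> \<psi> ` ball p0 R"
    using open_chart_ball t0(2) unfolding \<psi>_ball by (intro topological_tendstoD)
  then obtain d where d: "d > 0" "\<And>t. t \<in> {0..1} \<Longrightarrow> \<bar>t - t0\<bar> < d \<Longrightarrow> \<gamma> t \<in> \<psi> ` ball p0 R"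
    unfolding eventually_at using t0(2) by (metis dist_real_def)
  define a0 b0 where "a0 = max 0 (t0 - d/2)" and "b0 = min 1 (t0 + d/2)"
  have ab0: "0 \<le> a0" "b0 \<le> 1" "\<And>t. t \<in> {a0..b0} \<Longrightarrow> t \<in> {0..1} \<and> \<bar>t - t0\<bar> < d" "a0 \<le> b0"
    using d(1) t0(1) by (auto simp: a0_def b0_def)
  have inB: "\<gamma> t \<in> U" "\<phi> (\<gamma> t) \<in> B" "\<gamma> t \<in> chart_dom c" if "t \<in> {a0..b0}" for t
  proof -
    have "\<gamma> t \<in> \<psi> ` B" using d(2) ab0(3)[OF that] image_mono[OF ball_subset_cball, of \<psi> p0 R] by blast
    then show "\<gamma> t \<in> U" "\<phi> (\<gamma> t) \<in> B" using \<psi>_U \<phi>_\<psi> by auto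
    then show "\<gamma> t \<in> chart_dom c" using U by auto
  qed
  define z where "z = \<phi> \<circ> \<gamma>"
  define h where "h t = tangent_coord A c (\<gamma> t) (velocity A \<gamma> t)" for t
  have acz: "absolutely_continuous_on_ivl a0 b0 z"
    using ac c ab0 inB(3) unfolding ac_path_def z_def by blast
  have zc: "continuous_on {a0..b0} z" unfolding z_def
    by (rule continuous_on_compose[OF continuous_on_subset[OF cont] continuous_on_subset[OF chart_cont[OF c]]])
      (use ab0 inB in auto)
  have N': "negligible (N \<union> {0,1})" using N(1) by auto
  have vel: "velocity A \<gamma> t \<in> \<Delta> (\<gamma> t)" "(z has_vector_derivative h t) (at t)" if t: "t \<in> {a0..b0} - (N \<union> {0,1})" for t
  proof -
    have t': "t \<in> {0<..<1} - N" using t ab0(3)[of t] by auto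
    then obtain v where v: "v \<in> \<Delta> (\<gamma> t)" "has_velocity A \<gamma> t v" using N(2) by blast
    then have ve: "velocity A \<gamma> t = v" by (simp add: velocity_eq)
    then show "velocity A \<gamma> t \<in> \<Delta> (\<gamma> t)" using v by simp
    show "(z has_vector_derivative h t) (at t)"
      unfolding z_def h_def ve
      using v(2) has_velocity_chart[of c \<gamma> t "{0<..<1}" v] c inB(3)[of t] t t' continuous_on_subset[OF cont, of "{0<..<1}"]
      by (auto simp: subset_iff)
  qed
  have velw: "(z has_vector_derivative h t) (at t within S)" if t: "t \<in> {a0..b0} - (N \<union> {0,1})" for t S
    by (rule has_vector_derivative_at_within[OF vel(2)[OF t]])
  obtain d2 where d2: "d2 > 0" "\<And>a b. \<lbrakk>a0 \<le> a; a \<le> b; b \<le> b0; b - a < d2\<rbrakk> \<Longrightarrow> h absolutely_integrable_on {a..b}"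
    using absolutely_continuous_abs_integrable[OF acz N' velw] by blast
  have main: "reach_speed \<gamma> a b" if ab: "a \<le> t0" "t0 \<le> b" "b - a < min (d/2) d2" for a b
    unfolding reach_speed_def
  proof (intro impI)
    assume "0 \<le> a" "b \<le> 1"
    then have ab': "a0 \<le> a" "a \<le> b" "b \<le> b0" "b - a < d2" using ab by (auto simp: a0_def b0_def)
    have hi: "h absolutely_integrable_on {a..b}" by (rule d2(2)[OF ab'])
    have "\<exists>u. h t = F (z t) u \<and> norm u = speed \<gamma> t" if t: "t \<in> {a<..<b} - (N \<union> {0,1})" for t
    proof -
      have t': "t \<in> {a0..b0}" "t \<in> {a0..b0} - (N \<union> {0,1})" using t ab' by auto
      obtain u :: "real ^ 'k" where u: "velocity A \<gamma> t = (\<Sum>i\<in>UNIV. (u $ i) *\<^sub>R Y i (\<gamma> t))"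
        using frame_coord(2)[OF frame inB(1)[OF t'(1)] vel(1)[OF t'(2)]] by blast
      have "h t = F (z t) u" using tangent_coord_F[OF inB(1)[OF t'(1)], of u] u by (simp add: h_def z_def)
      moreover have "norm u = speed \<gamma> t"
        using orthonormal_norm[OF frame on inB(1)[OF t'(1)], of u] u by (simp add: speed_def)
      ultimately show ?thesis by blast
    qed
    note inc = this
    have zB: "z t \<in> B" if "t \<in> {a..b}" for t using inB(2)[of t] that ab' by (auto simp: z_def)
    obtain w where w: "w absolutely_integrable_on {a..b}"
      "\<And>t. t \<in> {a<..<b} - (N \<union> {0,1}) \<Longrightarrow> h t = F (z t) (w t) \<and> norm (w t) = speed \<gamma> t"
    proof (rule velocity_control[where F = F and B = B and Q = "\<lambda>t u. norm u = speed \<gamma> t" and a = a and b = b and x = z and h = h, OF F_lin F_cont compact_cball])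
      show "u = 0" if "x \<in> B" "F x u = 0" for x u by (rule F_inj[OF that])
      show "continuous_on {a..b} z" by (rule continuous_on_subset[OF zc]) (use ab' in auto)
      show "z t \<in> B" if "t \<in> {a..b}" for t by (rule zB[OF that])
      show "\<exists>u. h t = F (z t) u \<and> norm u = speed \<gamma> t" if "t \<in> {a<..<b} - (N \<union> {0,1})" for t by (rule inc[OF that])
    qed (use hi N' in auto)
    have N2: "negligible (N \<union> {0,1} \<union> {a,b})" using N' by auto
    have sp: "speed \<gamma> t = norm (w t)" "F (z t) (w t) = h t" if "t \<in> {a..b} - (N \<union> {0,1} \<union> {a,b})" for t
      using w(2)[of t] that by auto
    have "speed \<gamma> absolutely_integrable_on {a..b}"
      by (rule absolutely_integrable_spike[OF abs_integrable_norm[OF w(1)] N2 sp(1)])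
    moreover have "reach T (\<gamma> a) (\<gamma> b)" if T: "integral {a..b} (speed \<gamma>) < T" for T
    proof (cases "a = b")
      case True then show ?thesis using T reach_refl by simp
    next
      case False
      have "integral {a..b} (\<lambda>t. norm (w t)) = integral {a..b} (speed \<gamma>)"
        by (rule integral_spike[OF N2]) (use sp in auto)
      then have T': "integral {a..b} (\<lambda>t. norm (w t)) < T" using T by simp
      have zw: "((\<lambda>\<tau>. F (z \<tau>) (w \<tau>)) has_integral z t - z s) {s..t}" if st: "a \<le> s" "s \<le> t" "t \<le> b" for s t
      proof (rule has_integral_spike[OF N2])
        show "(h has_integral z t - z s) {s..t}"
        proof (rule absolutely_continuous_FTC[OF _ N' st(2)])
          show "absolutely_continuous_on_ivl s t z" by (rule absolutely_continuous_on_ivl_subset[OF acz]) (use st ab' in auto)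
        qed (use velw st ab' in auto)
      qed (use sp st in auto)
      obtain y v where y: "is_traj F B v y" "y 0 = z a" "y 1 = z b" "\<And>t. norm (v t) \<le> T"
        by (rule reparametrization[of a b w z T]) (use False ab' w(1) zB zw T' in auto)
      have "T > 0" using Henstock_Kurzweil_Integration.integral_nonneg[of "\<lambda>t. norm (w t)" "{a..b}"] T'
        abs_integrable_imp_integrable[OF abs_integrable_norm[OF w(1)]] by auto
      moreover have "\<psi> (z a) = \<gamma> a" "\<psi> (z b) = \<gamma> b" using \<psi>_\<phi>[OF inB(1)] ab' by (auto simp: z_def)
      ultimately show ?thesis
        unfolding reach_def using traj_hp[OF y(1,4)] y(2,3) by (intro conjI exI[of _ "\<lambda>t. \<psi> (y t)"]) auto
    qed
    ultimately show "speed \<gamma> absolutely_integrable_on {a..b} \<and> (\<forall>T>integral {a..b} (speed \<gamma>). reach T (\<gamma> a) (\<gamma> b))" by blast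
  qed
  then show ?thesis using d(1) d2(1) by (intro exI[of _ "min (d/2) d2"]) auto
qed

context sr_manifold
begin

text \<open>Bisection of [0,1] with a chart around each point of the path: integrability and the
  reach property both pass to the union of adjacent intervals.\<close>

lemma horizontal_reach_speed:
  assumes h: "horizontal A \<Delta> \<gamma>"
  shows "speed \<gamma> absolutely_integrable_on {0..1}" "integral {0..1} (speed \<gamma>) < T \<Longrightarrow> reach T (\<gamma> 0) (\<gamma> 1)"
proof -
  have ac: "ac_path A \<gamma>" using h by (simp add: horizontal_def)
  obtain N where N: "negligible N" "\<And>t. t \<in> {0<..<1} - N \<Longrightarrow> \<exists>v\<in>\<Delta> (\<gamma> t). has_velocity A \<gamma> t v"
    using h unfolding horizontal_def AE_lebesgue_on_ivl_iff by blast
  have "reach_speed \<gamma> 0 1"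
  proof (rule Bolzano[of 0 1])
    fix a b d :: real assume P: "reach_speed \<gamma> a b" "reach_speed \<gamma> b d" and ab: "a \<le> b" "b \<le> d"
    show "reach_speed \<gamma> a d"
      unfolding reach_speed_def
    proof (intro impI conjI allI)
      assume "0 \<le> a" "d \<le> 1"
      then have 1: "speed \<gamma> absolutely_integrable_on {a..b}" "\<And>T. T > integral {a..b} (speed \<gamma>) \<Longrightarrow> reach T (\<gamma> a) (\<gamma> b)"
        and 2: "speed \<gamma> absolutely_integrable_on {b..d}" "\<And>T. T > integral {b..d} (speed \<gamma>) \<Longrightarrow> reach T (\<gamma> b) (\<gamma> d)"
        using P ab unfolding reach_speed_def by auto
      have "{a..b} \<union> {b..d} = {a..d}" using ab by auto
      then show i: "speed \<gamma> absolutely_integrable_on {a..d}" using absolutely_integrable_Un[OF 1(1) 2(1)] by simp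
      fix T assume T: "T > integral {a..d} (speed \<gamma>)"
      \<comment> \<open>The excess of \<open>T\<close> over the total integral is shared equally by
        the two pieces, each of which needs a strict inequality.\<close>
      define e where "e = (T - integral {a..d} (speed \<gamma>)) / 2"
      have "integral {a..b} (speed \<gamma>) + integral {b..d} (speed \<gamma>) = integral {a..d} (speed \<gamma>)"
        by (rule Henstock_Kurzweil_Integration.integral_combine[OF ab abs_integrable_imp_integrable[OF i]])
      then have "T = (integral {a..b} (speed \<gamma>) + e) + (integral {b..d} (speed \<gamma>) + e)" by (simp add: e_def)
      moreover have "e > 0" using T by (simp add: e_def)
      ultimately show "reach T (\<gamma> a) (\<gamma> d)" using reach_trans[OF 1(2) 2(2)] by (metis less_add_same_cancel1)
    qed
  next
    fix t :: real assume t: "0 \<le> t" "t \<le> 1"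
    obtain c and Y :: "'k \<Rightarrow> 'm \<Rightarrow> 'e" and R M L U where *: "sr_chart A \<Delta> g K c Y (chart_map c (\<gamma> t)) R M L U" "\<gamma> t \<in> U"
      by (rule sr_chart_exists[OF open_UNIV UNIV_I]) blast
    interpret sr_chart A \<Delta> g K c Y "chart_map c (\<gamma> t)" R M L U by (rule *)
    have "\<gamma> t \<in> \<psi> ` ball (\<phi> (\<gamma> t)) R" using \<psi>_\<phi>[OF *(2)] R by (metis centre_in_ball imageI)
    then show "\<exists>d>0. \<forall>a b. a \<le> t \<and> t \<le> b \<and> b - a < d \<longrightarrow> reach_speed \<gamma> a b"
      using reach_speed_local[OF ac N] t by auto
  qed simp
  then show "speed \<gamma> absolutely_integrable_on {0..1}" "integral {0..1} (speed \<gamma>) < T \<Longrightarrow> reach T (\<gamma> 0) (\<gamma> 1)"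
    unfolding reach_speed_def by auto
qed

lemma horizontal_speed_ae:
  assumes h: "horizontal A \<Delta> \<gamma>"
  shows "AE t in lebesgue_on {0..1}. (speed \<gamma> t)\<^sup>2 = g (\<gamma> t) (velocity A \<gamma> t) (velocity A \<gamma> t)"
proof -
  have "AE t in lebesgue_on {0..1}. \<exists>v\<in>\<Delta> (\<gamma> t). has_velocity A \<gamma> t v" using h by (simp add: horizontal_def)
  then show ?thesis
  proof eventually_elim
    case (elim t)
    then have "velocity A \<gamma> t \<in> \<Delta> (\<gamma> t)" using velocity_eq by auto
    then show ?case unfolding speed_def power2_abs using g_nonneg by simp
  qed
qed

lemma horizontal_speed_integral:
  assumes h: "horizontal A \<Delta> \<gamma>"
  shows "(\<integral>\<^sup>+t. ennreal (speed \<gamma> t) \<partial>lebesgue_on {0..1}) = ennreal (integral {0..1} (speed \<gamma>))"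
proof -
  have "integrable (lebesgue_on {0..1}) (speed \<gamma>)" using horizontal_reach_speed(1)[OF h] by (simp add: absolutely_integrable_imp_integrable)
  moreover from this have "integral\<^sup>L (lebesgue_on {0..1}) (speed \<gamma>) = integral {0..1} (speed \<gamma>)"
    by (intro lebesgue_integral_eq_integral) auto
  ultimately show ?thesis using nn_integral_eq_integral[of "lebesgue_on {0..1}" "speed \<gamma>"] by (simp add: speed_def)
qed

lemma horizontal_length_reach:
  assumes h: "horizontal A \<Delta> \<gamma>" and T: "sr_length A g \<gamma> < ennreal T"
  shows "reach T (\<gamma> 0) (\<gamma> 1)"
proof (rule horizontal_reach_speed(2)[OF h])
  have "sr_length A g \<gamma> = (\<integral>\<^sup>+t. ennreal (speed \<gamma> t) \<partial>lebesgue_on {0..1})"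
    unfolding sr_length_def
  proof (rule nn_integral_cong_AE)
    show "AE t in lebesgue_on {0..1}. ennreal (sqrt (g (\<gamma> t) (velocity A \<gamma> t) (velocity A \<gamma> t))) = ennreal (speed \<gamma> t)"
      using horizontal_speed_ae[OF h]
    proof eventually_elim
      case (elim t)
      then have "0 \<le> g (\<gamma> t) (velocity A \<gamma> t) (velocity A \<gamma> t)" by (metis zero_le_power2)
      then show ?case by (simp add: speed_def)
    qed
  qed
  then have "ennreal (integral {0..1} (speed \<gamma>)) < ennreal T" using T horizontal_speed_integral[OF h] by simp
  moreover have "0 \<le> integral {0..1} (speed \<gamma>)"
    by (rule Henstock_Kurzweil_Integration.integral_nonneg[OF abs_integrable_imp_integrable[OF horizontal_reach_speed(1)[OF h]]])
      (simp add: speed_def)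
  ultimately show "integral {0..1} (speed \<gamma>) < T" by (simp add: ennreal_less_iff)
qed

text \<open>The inequality 2Tv <= v^2 + T^2, integrated over unit time, plays the role of
  Cauchy-Schwarz: energy below T^2 forces length below T.\<close>

lemma horizontal_energy_reach:
  assumes h: "horizontal A \<Delta> \<gamma>" and T: "sr_energy A g \<gamma> < ennreal (T\<^sup>2)" "0 < T"
  shows "reach T (\<gamma> 0) (\<gamma> 1)"
proof (rule horizontal_reach_speed(2)[OF h])
  let ?M = "lebesgue_on {0..1::real}"
  have i: "integrable ?M (speed \<gamma>)" using horizontal_reach_speed(1)[OF h] by (simp add: absolutely_integrable_imp_integrable)
  have m[measurable]: "speed \<gamma> \<in> borel_measurable ?M" using i by simp
  have E: "sr_energy A g \<gamma> = (\<integral>\<^sup>+t. ennreal ((speed \<gamma> t)\<^sup>2) \<partial>?M)"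
    unfolding sr_energy_def by (rule nn_integral_cong_AE) (use horizontal_speed_ae[OF h] in eventually_elim, simp)
  have fin: "(\<integral>\<^sup>+t. ennreal ((speed \<gamma> t)\<^sup>2) \<partial>?M) < \<infinity>" using T(1) E by (metis ennreal_less_top infinity_ennreal_def order_less_trans)
  have i2: "integrable ?M (\<lambda>t. (speed \<gamma> t)\<^sup>2)" by (rule integrableI_bounded) (use fin in auto)
  have "(\<integral>t. (speed \<gamma> t)\<^sup>2 \<partial>?M) < T\<^sup>2"
    using T(1) unfolding E by (subst (asm) nn_integral_eq_integral[OF i2]) (auto simp: ennreal_less_iff integral_nonneg_AE)
  moreover have "(\<integral>t. 2 * T * speed \<gamma> t \<partial>?M) \<le> (\<integral>t. (speed \<gamma> t)\<^sup>2 + T\<^sup>2 \<partial>?M)"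
  proof (rule integral_mono)
    show "integrable ?M (\<lambda>t. (speed \<gamma> t)\<^sup>2 + T\<^sup>2)" using i2 emeasure_lebesgue_on_01 by (intro Bochner_Integration.integrable_add) (auto intro!: finite_measure.integrable_const finite_measureI)
    show "2 * T * speed \<gamma> t \<le> (speed \<gamma> t)\<^sup>2 + T\<^sup>2" for t using zero_le_power2[of "speed \<gamma> t - T"] by (simp add: power2_diff mult.assoc mult.commute[of _ T])
  qed (use i in auto)
  moreover have "(\<integral>t. (speed \<gamma> t)\<^sup>2 + T\<^sup>2 \<partial>?M) = (\<integral>t. (speed \<gamma> t)\<^sup>2 \<partial>?M) + T\<^sup>2"
    using i2 emeasure_lebesgue_on_01 by (subst Bochner_Integration.integral_add) (auto intro!: finite_measure.integrable_const finite_measureI simp: measure_def)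
  ultimately have "2 * T * (\<integral>t. speed \<gamma> t \<partial>?M) < 2 * T * T" by (simp add: power2_eq_square)
  then have "(\<integral>t. speed \<gamma> t \<partial>?M) < T" using T(2) by (simp add: mult_less_cancel_left)
  then show "integral {0..1} (speed \<gamma>) < T" using lebesgue_integral_eq_integral[of "{0..1}" "speed \<gamma>"] i by simp
qed

lemma sr_dist_reach: "sr_dist A \<Delta> g x y < ennreal T \<Longrightarrow> reach T x y"
  unfolding sr_dist_def INF_less_iff horizontal_paths_def using horizontal_length_reach by auto

lemma value_fun_reach: "value_fun A \<Delta> g x y < ennreal (T\<^sup>2) \<Longrightarrow> 0 < T \<Longrightarrow> reach T x y"
  unfolding value_fun_def INF_less_iff horizontal_paths_def using horizontal_energy_reach by auto

end

section \<open>Minimizing paths are nonsingular\<close>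

text \<open>Representatives in the quotient respect the vector space operations only almost
  everywhere; this is how integrals are freed from the choice made by \<open>rep_L1\<close>.\<close>

lemma L1_rel_integral:
  assumes "L1_rel f h" "\<And>t. f t = h t \<Longrightarrow> F t = H t"
  shows "integral {0..1} F = integral {0..1} H"
proof -
  obtain N where N: "negligible N" "\<And>t. t \<in> {0<..<1} - N \<Longrightarrow> f t = h t"
    using assms(1) unfolding L1_rel_def AE_lebesgue_on_ivl_iff by blast
  show ?thesis
  proof (rule integral_spike[of "N \<union> {0,1}"])
    show "negligible (N \<union> {0,1})" using N by auto
    fix t :: real assume "t \<in> {0..1} - (N \<union> {0,1})"
    then show "H t = F t" using N(2)[of t] assms(2)[of t] by (cases "t = 0 \<or> t = 1") auto
  qed
qed

lemma rep_L1: "L1_rel (rep_L1 w) (rep_L1 w)"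
  by (rule Quotient_rep_reflp[OF Quotient_L1])

lemma rep_abs_L1: "f absolutely_integrable_on {0..1} \<Longrightarrow> L1_rel (rep_L1 (abs_L1 f)) f"
  by (rule Quotient_rep_abs[OF Quotient_L1]) (simp add: L1_rel_def absolutely_integrable_imp_integrable)

lemma integrable_lebesgue_on_iff:
  fixes f :: "real \<Rightarrow> 'a::euclidean_space"
  shows "integrable (lebesgue_on {0..1}) f \<longleftrightarrow> f absolutely_integrable_on {0..1}"
  by (simp add: integrable_restrict_space set_integrable_def)

lemma rep_L1_abs_integrable: "rep_L1 w absolutely_integrable_on {0..1}"
  using rep_L1[of w] by (simp add: L1_rel_def integrable_lebesgue_on_iff)

lemma norm_L1_eq: "norm w = integral {0..1} (\<lambda>t. norm (rep_L1 w t))"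
proof -
  have "norm w = (\<integral>t. norm (rep_L1 w t) \<partial>lebesgue_on {0..1})" by (simp add: norm_L1_def)
  also have "\<dots> = integral {0..1} (\<lambda>t. norm (rep_L1 w t))"
    by (rule lebesgue_integral_eq_integral) (use rep_L1[of w] in \<open>auto simp: L1_rel_def\<close>)
  finally show ?thesis .
qed

lemma rep_L1_add: "L1_rel (rep_L1 (v + w :: 'a::euclidean_space L1)) (\<lambda>t. rep_L1 v t + rep_L1 w t)"
  and rep_L1_diff: "L1_rel (rep_L1 (v - w)) (\<lambda>t. rep_L1 v t - rep_L1 w t)"
  and rep_L1_scale: "L1_rel (rep_L1 (r *\<^sub>R v)) (\<lambda>t. r *\<^sub>R rep_L1 v t)"
proof -
  have i: "integrable (lebesgue_on {0..1}) (rep_L1 w)" for w :: "'a L1" using rep_L1[of w] by (simp add: L1_rel_def)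
  show "L1_rel (rep_L1 (v + w)) (\<lambda>t. rep_L1 v t + rep_L1 w t)"
    and "L1_rel (rep_L1 (v - w)) (\<lambda>t. rep_L1 v t - rep_L1 w t)"
    and "L1_rel (rep_L1 (r *\<^sub>R v)) (\<lambda>t. r *\<^sub>R rep_L1 v t)"
    unfolding plus_L1_def minus_L1_def scaleR_L1_def map_fun_def o_def id_def
    by (rule Quotient_rep_abs[OF Quotient_L1], simp add: L1_rel_def i)+
qed

lemma norm_L1_diff: "norm (v - w) = integral {0..1} (\<lambda>t. norm (rep_L1 v t - rep_L1 w t))"
  unfolding norm_L1_eq by (rule L1_rel_integral[OF rep_L1_diff[of v w]]) simp

lemma L1_pairing_integrable:
  assumes "continuous_on {0..1} k"
  shows "(\<lambda>t. k t \<bullet> rep_L1 w t) integrable_on {0..1}"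
  by (rule abs_integrable_imp_integrable[OF abs_integrable_continuous_mult[OF bounded_bilinear_inner assms rep_L1_abs_integrable]])

lemma L1_pairing_bounded_linear:
  fixes k :: "real \<Rightarrow> 'a::euclidean_space"
  assumes k: "continuous_on {0..1} k"
  shows "bounded_linear (\<lambda>w. integral {0..1} (\<lambda>t. k t \<bullet> rep_L1 w t))"
proof -
  obtain C where "\<forall>t\<in>{0..1}. norm (k t) \<le> C"
    using compact_imp_bounded[OF compact_continuous_image[OF k compact_Icc]] by (auto simp: bounded_iff)
  then have C: "norm (k t) \<le> C" if "t \<in> {0..1}" for t using that by blast
  show ?thesis
  proof (rule bounded_linear_intro)
    show "integral {0..1} (\<lambda>t. k t \<bullet> rep_L1 (v + w) t) = integral {0..1} (\<lambda>t. k t \<bullet> rep_L1 v t) + integral {0..1} (\<lambda>t. k t \<bullet> rep_L1 w t)" for v w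
      unfolding Henstock_Kurzweil_Integration.integral_add[OF L1_pairing_integrable[OF k] L1_pairing_integrable[OF k], symmetric]
      by (rule L1_rel_integral[OF rep_L1_add[of v w]]) (simp add: inner_add_right)
    show "integral {0..1} (\<lambda>t. k t \<bullet> rep_L1 (r *\<^sub>R v) t) = r *\<^sub>R integral {0..1} (\<lambda>t. k t \<bullet> rep_L1 v t)" for r v
      unfolding Henstock_Kurzweil_Integration.integral_cmul[symmetric]
      by (rule L1_rel_integral[OF rep_L1_scale[of r v]]) simp
    show "norm (integral {0..1} (\<lambda>t. k t \<bullet> rep_L1 v t)) \<le> norm v * C" for v
    proof -
      have n: "(\<lambda>t. norm (rep_L1 v t)) integrable_on {0..1}"
        by (rule abs_integrable_imp_integrable[OF abs_integrable_norm[OF rep_L1_abs_integrable]])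
      have "norm (integral {0..1} (\<lambda>t. k t \<bullet> rep_L1 v t)) \<le> integral {0..1} (\<lambda>t. C * norm (rep_L1 v t))"
      proof (rule integral_norm_bound_integral[OF L1_pairing_integrable[OF k] integrable_on_mult_right[OF n]])
        fix t :: real assume t: "t \<in> {0..1}"
        have "norm (k t \<bullet> rep_L1 v t) \<le> norm (k t) * norm (rep_L1 v t)" by (simp add: Cauchy_Schwarz_ineq2)
        also have "\<dots> \<le> C * norm (rep_L1 v t)" by (rule mult_right_mono[OF C[OF t]]) simp
        finally show "norm (k t \<bullet> rep_L1 v t) \<le> C * norm (rep_L1 v t)" .
      qed
      then show ?thesis by (simp add: norm_L1_eq mult.commute)
    qed
  qed
qed

lemma has_derivative_quadratic:
  fixes f :: "'a::real_normed_vector \<Rightarrow> 'b::real_normed_vector"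
  assumes L: "bounded_linear L" and e: "e > 0"
    and bd: "\<And>w. norm (w - u) < e \<Longrightarrow> norm (f w - f u - L (w - u)) \<le> C * (norm (w - u))\<^sup>2"
  shows "(f has_derivative L) (at u)"
  unfolding has_derivative_at_within
proof (intro conjI L)
  show "((\<lambda>w. (f w - f u - L (w - u)) /\<^sub>R norm (w - u)) \<longlongrightarrow> 0) (at u)"
  proof (rule Lim_null_comparison)
    show "\<forall>\<^sub>F w in at u. norm ((f w - f u - L (w - u)) /\<^sub>R norm (w - u)) \<le> C * norm (w - u)"
      unfolding eventually_at
    proof (intro exI[of _ e] conjI e ballI impI)
      fix w assume w: "w \<noteq> u \<and> dist w u < e"
      then have n: "norm (w - u) > 0" "norm (w - u) < e" by (auto simp: dist_norm)
      have "norm (f w - f u - L (w - u)) / norm (w - u) \<le> C * norm (w - u)"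
        unfolding pos_divide_le_eq[OF n(1)] using bd[OF n(2)] by (simp add: power2_eq_square mult.assoc)
      then show "norm ((f w - f u - L (w - u)) /\<^sub>R norm (w - u)) \<le> C * norm (w - u)"
        by (simp add: divide_inverse mult.commute)
    qed
    have "((\<lambda>w. C * norm (w - u)) \<longlongrightarrow> C * norm (u - u)) (at u)" by (intro tendsto_intros)
    then show "((\<lambda>w. C * norm (w - u)) \<longlongrightarrow> 0) (at u)" by simp
  qed
qed

lemma (in control_system) traj_cong_ae:
  assumes x: "is_traj F B u x" and w: "L1_rel w u"
  shows "is_traj F B w x"
proof -
  obtain N where N: "negligible N" "\<And>t. t \<in> {0<..<1} - N \<Longrightarrow> w t = u t"
    using w unfolding L1_rel_def AE_lebesgue_on_ivl_iff by blast
  have "primitive x (\<lambda>t. F (x t) (w t))" by (rule primitive_cong_ae[OF traj_parts(1)[OF x] N(1)]) (simp add: N(2))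
  then show ?thesis using w traj_parts(3)[OF x] unfolding is_traj_def L1_rel_def integrable_lebesgue_on_iff by blast
qed

lemma (in control_system) adj_cong_ae:
  assumes q: "adj_sol u x q" and w: "L1_rel w u"
  shows "adj_sol w x q"
proof -
  obtain N where N: "negligible N" "\<And>t. t \<in> {0<..<1} - N \<Longrightarrow> w t = u t"
    using w unfolding L1_rel_def AE_lebesgue_on_ivl_iff by blast
  show ?thesis using q unfolding adj_sol_def by (rule primitive_cong_ae[OF _ N(1)]) (simp add: N(2))
qed

section \<open>The differential of the end-point mapping in a chart\<close>

context sr_chart
begin

abbreviation "\<Y> \<equiv> \<lambda>i (p :: real \<times> 'm). Y i (snd p)"
abbreviation "\<W> \<equiv> (UNIV :: real set) \<times> \<psi> ` ball p0 R"

lemma control_path_traj: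
  assumes cp: "control_path A \<W> \<Y> x0 w \<sigma>"
  shows "is_traj F B (rep_L1 w) (\<lambda>t. \<phi> (\<sigma> t))"
proof -
  have ac: "ac_path A \<sigma>" and W: "\<And>t. t \<in> {0..1} \<Longrightarrow> \<sigma> t \<in> \<psi> ` ball p0 R"
    and ae: "AE t in lebesgue_on {0..1}. has_velocity A \<sigma> t (\<Sum>i\<in>UNIV. (rep_L1 w t $ i) *\<^sub>R Y i (\<sigma> t))"
    using cp by (auto simp: control_path_def)
  have \<sigma>B: "\<sigma> t \<in> U" "\<phi> (\<sigma> t) \<in> B" "\<sigma> t \<in> chart_dom c" if "t \<in> {0..1}" for t
    using W[OF that] \<psi>_U \<phi>_\<psi> U by (auto simp: subset_iff)
  have cont: "continuous_on {0..1} \<sigma>" using ac by (simp add: ac_path_def)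
  have zc: "continuous_on {0..1} (\<lambda>t. \<phi> (\<sigma> t))"
    by (rule continuous_on_compose2[OF chart_cont[OF c] cont]) (use \<sigma>B(3) in auto)
  obtain N where N: "negligible N" "\<And>t. t \<in> {0<..<1} - N \<Longrightarrow> has_velocity A \<sigma> t (\<Sum>i\<in>UNIV. (rep_L1 w t $ i) *\<^sub>R Y i (\<sigma> t))"
    using ae unfolding AE_lebesgue_on_ivl_iff by blast
  have "absolutely_continuous_on_ivl 0 1 (\<phi> \<circ> \<sigma>)"
    using ac c \<sigma>B(3) unfolding ac_path_def by (metis image_subsetI order_refl zero_le_one)
  then have ac': "absolutely_continuous_on_ivl 0 1 (\<lambda>t. \<phi> (\<sigma> t))" by (simp add: o_def)
  have "primitive (\<lambda>t. \<phi> (\<sigma> t)) (\<lambda>t. F (\<phi> (\<sigma> t)) (rep_L1 w t))"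
  proof (rule primitive_intro[OF ac' N(1)])
    show "(\<lambda>t. F (\<phi> (\<sigma> t)) (rep_L1 w t)) absolutely_integrable_on {0..1}"
      by (rule F_traj_integrable[OF zc \<sigma>B(2) rep_L1_abs_integrable])
    fix t assume t: "t \<in> {0<..<1} - N"
    then have t': "t \<in> {0..1}" by auto
    have "((\<phi> \<circ> \<sigma>) has_vector_derivative tangent_coord A c (\<sigma> t) (\<Sum>i\<in>UNIV. (rep_L1 w t $ i) *\<^sub>R Y i (\<sigma> t))) (at t)"
      using N(2)[OF t] has_velocity_chart[of c \<sigma> t "{0<..<1}"] c \<sigma>B(3)[OF t'] t continuous_on_subset[OF cont, of "{0<..<1}"]
      by (auto simp: subset_iff)
    then show "((\<lambda>t. \<phi> (\<sigma> t)) has_vector_derivative F (\<phi> (\<sigma> t)) (rep_L1 w t)) (at t)"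
      using tangent_coord_F[OF \<sigma>B(1)[OF t']] by (simp add: o_def)
  qed
  then show ?thesis using rep_L1_abs_integrable \<sigma>B(2) by (auto simp: is_traj_def)
qed

lemma traj_control_path:
  assumes y: "is_traj F B (rep_L1 w) y" and V: "\<And>t. t \<in> {0..1} \<Longrightarrow> y t \<in> ball p0 R"
  shows "control_path A \<W> \<Y> (\<psi> (y 0)) w (\<lambda>t. \<psi> (y t))"
  using traj_velocity[OF y] V unfolding control_path_def AE_lebesgue_on_ivl_iff by auto

text \<open>Two paths with the same control agree by the Gronwall estimate at control distance 0,
  which justifies the definite description. Every competitor lies over the chart ball, because that
  ball is the domain of the frame.\<close>

lemma control_endpoint_traj:
  assumes y: "is_traj F B (rep_L1 w) y" and V: "\<And>t. t \<in> {0..1} \<Longrightarrow> y t \<in> ball p0 R"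
  shows "control_endpoint A \<W> \<Y> (\<psi> (y 0)) w = \<psi> (y 1)"
  unfolding control_endpoint_def
proof (rule the_equality)
  show "\<exists>\<gamma>. control_path A \<W> \<Y> (\<psi> (y 0)) w \<gamma> \<and> \<gamma> 1 = \<psi> (y 1)" using traj_control_path[OF y V] by blast
  fix z assume "\<exists>\<gamma>. control_path A \<W> \<Y> (\<psi> (y 0)) w \<gamma> \<and> \<gamma> 1 = z"
  then obtain \<sigma> where \<sigma>: "control_path A \<W> \<Y> (\<psi> (y 0)) w \<sigma>" "\<sigma> 1 = z" by blast
  have "y 0 = \<phi> (\<sigma> 0)" using \<sigma>(1) \<phi>_\<psi>[OF traj_parts(3)[OF y], of 0] by (simp add: control_path_def)
  from traj_gronwall[OF y control_path_traj[OF \<sigma>(1)] this order_refl, of 1] have "\<phi> (\<sigma> 1) = y 1" by simp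
  moreover have "\<sigma> 1 \<in> \<psi> ` ball p0 R" using \<sigma>(1) by (simp add: control_path_def)
  then have "\<sigma> 1 \<in> U" using \<psi>_U by auto
  ultimately show "z = \<psi> (y 1)" using \<psi>_\<phi> \<sigma>(2) by metis
qed

lemma traj_in_ball:
  assumes y: "is_traj F B w y" and r: "integral {0..1} (\<lambda>t. norm (w t)) \<le> r" "norm (y 0 - p0) + M * r < R" and t: "t \<in> {0..1}"
  shows "y t \<in> ball p0 R"
proof -
  note yp = traj_parts[OF y]
  have n: "(\<lambda>t. norm (w t)) integrable_on {0..1}" by (rule abs_integrable_imp_integrable[OF abs_integrable_norm[OF yp(2)]])
  have nt: "(\<lambda>t. norm (w t)) integrable_on {0..t}" by (rule integrable_on_subinterval[OF n]) (use t in auto)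
  have "norm (y t - y 0) \<le> integral {0..t} (\<lambda>t. M * norm (w t))"
    by (rule primitive_norm_le[OF yp(1)]) (use t yp(3) F_bnd nt in \<open>auto intro!: integrable_on_mult_right\<close>)
  also have "\<dots> = M * integral {0..t} (\<lambda>t. norm (w t))" by simp
  also have "\<dots> \<le> M * integral {0..1} (\<lambda>t. norm (w t))"
    using M t by (intro mult_left_mono integral_subset_le nt n) auto
  also have "\<dots> \<le> M * r" using r(1) M by simp
  finally have "norm (y t - p0) < R" using r(2) norm_triangle_ineq[of "y t - y 0" "y 0 - p0"] by simp
  then show ?thesis by (simp add: dist_norm norm_minus_commute)
qed

text \<open>The frame of the chart, constant in time, is an admissible parametrization for every
  path that stays over the ball.\<close>

lemma frame_along_chart:
  assumes "\<And>t. t \<in> {0..1} \<Longrightarrow> \<gamma> t \<in> \<psi> ` ball p0 R"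
  shows "frame_along A \<Delta> \<gamma> \<W> \<Y>"
  unfolding frame_along_def
proof (intro conjI ballI allI)
  have o: "open (\<psi> ` ball p0 R)" using open_chart_ball \<psi>_ball by simp
  then show "open \<W>" by (intro open_Times) auto
  show "(t, \<gamma> t) \<in> \<W>" if "t \<in> {0..1}" for t using assms[OF that] by simp
  have VU: "\<psi> ` ball p0 R \<subseteq> U" using \<psi>_U by auto
  show "case z of (t, y) \<Rightarrow> frame_at \<Delta> y (\<lambda>i. Y i (snd (t, y)))" if "z \<in> \<W>" for z
    using that VU frame unfolding local_frame_def by (cases z) auto
  show "smooth_time_field_on A \<W> (\<Y> i)" for i
    unfolding smooth_time_field_on_def
  proof
    fix d assume d: "d \<in> A"
    define S where "S = chart_map d ` (\<psi> ` ball p0 R \<inter> chart_dom d)"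
    have S: "open S" unfolding S_def by (rule open_chart_image[OF d o])
    have "smooth_on (chart_map d ` (U \<inter> chart_dom d)) (field_coord A d (Y i))"
      using frame d unfolding local_frame_def smooth_field_on_def by blast
    then have "smooth_on S (field_coord A d (Y i))" by (rule smooth_on_subset) (use VU in \<open>auto simp: S_def\<close>)
    then have "smooth_on (UNIV \<times> S) (\<lambda>p :: real \<times> 'e. field_coord A d (Y i) (snd p))"
      unfolding smooth_on_def using Ck_on_snd[OF S] by blast
    moreover have "{(t, p). p \<in> chart_map d ` chart_dom d \<and> (t, chart_inv d p) \<in> \<W>} = UNIV \<times> S"
      unfolding S_def using chart_inv_map[OF d] by force
    ultimately show "smooth_on {(t, p). p \<in> chart_map d ` chart_dom d \<and> (t, chart_inv d p) \<in> \<W>}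
        (\<lambda>(t, p). field_coord A d (\<lambda>y. Y i (snd (t, y))) p)" by (simp add: case_prod_unfold)
  qed
qed

text \<open>A nonzero \<open>q 1\<close> is orthogonal to the image of the differential of the end
  point, since the derivative of its inner product with the end point is the pairing of the control
  with tr (F x) q, which vanishes. So the path is singular. It has speed at most \<open>r\<close>
  and joins points that no smaller bound can join, hence it is minimizing and not constant, contrary
  to \<open>nosing\<close>.\<close>

lemma minimizer_nonsingular:
  assumes nosing: "\<not> (\<exists>\<gamma>. nontrivial_path \<gamma> \<and> singular_path K A \<Delta> \<gamma> \<and> minimizing A \<Delta> g \<gamma>)"
    and x: "is_traj F B u0 x" "\<And>t. norm (u0 t) \<le> r" and r: "0 < r" "norm (x 0 - p0) + M * r < R"
    and min: "\<And>T. reach T (\<psi> (x 0)) (\<psi> (x 1)) \<Longrightarrow> r \<le> T"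
    and q: "adj_sol u0 x q" "\<And>t. t \<in> {0..1} \<Longrightarrow> tr (F (x t)) (q t) = 0"
  shows "q 1 = 0"
proof (rule ccontr)
  assume q1: "q 1 \<noteq> 0"
  define \<gamma> where "\<gamma> t = \<psi> (x t)" for t
  have hp: "hp r \<gamma>" unfolding \<gamma>_def by (rule traj_hp[OF x])
  define u where "u = abs_L1 u0"
  have rel: "L1_rel (rep_L1 u) u0" unfolding u_def by (rule rep_abs_L1[OF traj_parts(2)[OF x(1)]])
  have xu: "is_traj F B (rep_L1 u) x" by (rule traj_cong_ae[OF x(1) rel])
  have qu: "adj_sol (rep_L1 u) x q" by (rule adj_cong_ae[OF q(1) rel])
  have "integral {0..1} (\<lambda>t. norm (rep_L1 u t)) = integral {0..1} (\<lambda>t. norm (u0 t))"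
    by (rule L1_rel_integral[OF rel]) simp
  also have "\<dots> \<le> r"
    by (rule integral_le_const[OF abs_integrable_imp_integrable[OF abs_integrable_norm[OF traj_parts(2)[OF x(1)]]] x(2)])
  finally have ur: "integral {0..1} (\<lambda>t. norm (rep_L1 u t)) \<le> r" .
  have xball: "x t \<in> ball p0 R" if "t \<in> {0..1}" for t by (rule traj_in_ball[OF xu ur r(2) that])
  have xB: "x t \<in> B" if "t \<in> {0..1}" for t by (rule traj_parts(3)[OF xu that])
  define E where "E = control_endpoint A \<W> \<Y> (\<psi> (x 0))"
  \<comment> \<open>Controls closer than \<open>s\<close> to \<open>u\<close> have L1 norm below
    \<open>r + s\<close>, too little to leave the ball; for them the end point is that of an actual
    trajectory.\<close>
  define s where "s = (R - norm (x 0 - p0) - M * r) / M"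
  have s: "s > 0" using r(2) M by (simp add: s_def)
  have near: "\<exists>y. is_traj F B (rep_L1 w) y \<and> y 0 = x 0 \<and> E w = \<psi> (y 1) \<and> y 1 \<in> B" if w: "norm (w - u) < s" for w
  proof -
    have "norm w \<le> norm u + norm (w - u)" using norm_triangle_sub[of w u] by simp
    then have nw: "norm w < r + s" using ur w by (simp add: norm_L1_eq[of u])
    have "M * (r + s) = R - norm (x 0 - p0)" using M by (simp add: s_def field_simps)
    then have bd: "norm (x 0 - p0) + M * norm w < R" using mult_strict_left_mono[OF nw M] by simp
    then obtain y where y: "is_traj F B (rep_L1 w) y" "y 0 = x 0"
      using traj_exists[OF rep_L1_abs_integrable, of "x 0" w] by (auto simp: norm_L1_eq)
    have "y t \<in> ball p0 R" if "t \<in> {0..1}" for t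
      by (rule traj_in_ball[OF y(1) _ _ that, of "norm w"]) (use bd y(2) in \<open>auto simp: norm_L1_eq\<close>)
    from control_endpoint_traj[OF y(1) this] have "E w = \<psi> (y 1)" by (simp add: E_def y(2))
    then show ?thesis using y traj_parts(3)[OF y(1), of 1] by auto
  qed
  have Eu: "E u = \<psi> (x 1)" unfolding E_def by (rule control_endpoint_traj[OF xu xball])
  have x1: "\<psi> (x 1) \<in> U" "\<psi> (x 1) \<in> chart_dom c" "\<phi> (\<psi> (x 1)) = x 1" using \<psi>_U[OF xB] \<phi>_\<psi>[OF xB] U by auto
  have deriv: "((\<lambda>w. p 1 \<bullet> \<phi> (E w)) has_derivative (\<lambda>v. integral {0..1} (\<lambda>t. tr (F (x t)) (p t) \<bullet> rep_L1 v t))) (at u)"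
    if p: "adj_sol (rep_L1 u) x p" for p
  proof (rule has_derivative_quadratic[OF _ s])
    have pc: "continuous_on {0..1} p" using p primitive_continuous unfolding adj_sol_def by blast
    have kc: "continuous_on {0..1} (\<lambda>t. tr (F (x t)) (p t))" by (rule tr_F_cont[OF xu pc])
    show "bounded_linear (\<lambda>v. integral {0..1} (\<lambda>t. tr (F (x t)) (p t) \<bullet> rep_L1 v t))" by (rule L1_pairing_bounded_linear[OF kc])
    define Q where "Q = 2 * exp (2 * L * r) * norm (p 1)"
    fix w assume w: "norm (w - u) < s"
    obtain y where y: "is_traj F B (rep_L1 w) y" "y 0 = x 0" "E w = \<psi> (y 1)" "y 1 \<in> B" using near[OF w] by blast
    have "\<bar>p 1 \<bullet> (y 1 - x 1) - integral {0..1} (\<lambda>t. tr (F (x t)) (p t) \<bullet> (rep_L1 w t - rep_L1 u t))\<bar>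
       \<le> Q * expansion_const r * (integral {0..1} (\<lambda>t. norm (rep_L1 w t - rep_L1 u t)))\<^sup>2"
      by (rule endpoint_expansion[OF xu y(1) y(2)[symmetric] p ur]) (unfold Q_def, rule adj_bound[OF xu p ur])
    moreover have "integral {0..1} (\<lambda>t. tr (F (x t)) (p t) \<bullet> rep_L1 (w - u) t) = integral {0..1} (\<lambda>t. tr (F (x t)) (p t) \<bullet> (rep_L1 w t - rep_L1 u t))"
      by (rule L1_rel_integral[OF rep_L1_diff[of w u]]) simp
    ultimately show "norm (p 1 \<bullet> \<phi> (E w) - p 1 \<bullet> \<phi> (E u) - integral {0..1} (\<lambda>t. tr (F (x t)) (p t) \<bullet> rep_L1 (w - u) t)) \<le> Q * expansion_const r * (norm (w - u))\<^sup>2"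
      using \<phi>_\<psi>[OF y(4)] x1(3) by (simp add: y(3) Eu norm_L1_diff inner_diff_right)
  qed
  have "\<exists>p. adj_sol (rep_L1 u) x p \<and> p 1 = b" for b using adj_exists[OF xu] by blast
  then obtain qb where qb: "\<And>b. adj_sol (rep_L1 u) x (qb b)" "\<And>b. qb b 1 = b" by metis
  \<comment> \<open>The components of the differential come from the adjoint solutions that end in
    the basis vectors.\<close>
  define L0 where "L0 v = (\<Sum>b\<in>Basis. integral {0..1} (\<lambda>t. tr (F (x t)) (qb b t) \<bullet> rep_L1 v t) *\<^sub>R b)" for v
  have L0b: "L0 v \<bullet> b = integral {0..1} (\<lambda>t. tr (F (x t)) (qb b t) \<bullet> rep_L1 v t)" if "b \<in> Basis" for v b
    using that by (simp add: L0_def inner_sum_left inner_Basis if_distrib sum.delta cong: if_cong)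
  have De: "((\<lambda>w. \<phi> (E w)) has_derivative L0) (at u)"
  proof (rule has_derivative_componentwise_within[THEN iffD2, rule_format])
    fix b :: 'e assume b: "b \<in> Basis"
    show "((\<lambda>w. \<phi> (E w) \<bullet> b) has_derivative (\<lambda>v. L0 v \<bullet> b)) (at u)"
      using deriv[OF qb(1)[of b]] unfolding qb(2) L0b[OF b] inner_commute[of b] .
  qed
  \<comment> \<open>The derivative of the end point in direction \<open>q 1\<close> is computed
    twice: by the adjoint solution \<open>q\<close>, which gives 0, and by composing with
    \<open>L0\<close>.\<close>
  have orth: "q 1 \<bullet> L0 v = 0" for v
  proof -
    have "((\<lambda>w. q 1 \<bullet> \<phi> (E w)) has_derivative (\<lambda>v. 0)) (at u)"
    proof -
      have "integral {0..1} (\<lambda>t. tr (F (x t)) (q t) \<bullet> rep_L1 v t) = 0" for v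
        using q(2) by (subst Henstock_Kurzweil_Integration.integral_cong[of _ _ "\<lambda>t. 0"]) auto
      then show ?thesis using deriv[OF qu] by simp
    qed
    moreover have "((\<lambda>w. q 1 \<bullet> \<phi> (E w)) has_derivative (\<lambda>v. q 1 \<bullet> L0 v)) (at u)"
      by (rule has_derivative_inner_right[OF De])
    ultimately show ?thesis using has_derivative_unique by metis
  qed
  \<comment> \<open>The definition of a singular path reads the end point in the preferred chart
    \<open>d\<close>. The differential of the transition map is invertible and does not affect
    surjectivity.\<close>
  define d where "d = chart_at A (\<gamma> 1)"
  have \<gamma>1: "\<gamma> 1 = \<psi> (x 1)" by (simp add: \<gamma>_def)
  have d: "d \<in> A" "\<psi> (x 1) \<in> chart_dom d" using chart_at[of "\<gamma> 1"] by (simp_all add: d_def \<gamma>1)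
  have "(trans c d has_derivative Dtrans c d (\<psi> (x 1))) (at (\<phi> (E u)))"
    unfolding Eu by (rule trans_has_derivative[OF c d(1) x1(2) d(2)])
  from has_derivative_compose[OF De this]
  have "((\<lambda>w. trans c d (\<phi> (E w))) has_derivative (\<lambda>v. Dtrans c d (\<psi> (x 1)) (L0 v))) (at u)" .
  then have DE: "((\<lambda>w. chart_map d (E w)) has_derivative (\<lambda>v. Dtrans c d (\<psi> (x 1)) (L0 v))) (at u)"
  proof (rule has_derivative_transform_within[OF _ s UNIV_I])
    fix w assume "dist w u < s"
    then obtain y where "E w = \<psi> (y 1)" "y 1 \<in> B" using near[of w] by (auto simp: dist_norm)
    then have "E w \<in> chart_dom c" using \<psi>_U U by auto
    then show "trans c d (\<phi> (E w)) = chart_map d (E w)" by (rule trans_chart[OF c])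
  qed
  have "\<not> surj (\<lambda>v. Dtrans c d (\<psi> (x 1)) (L0 v))"
  proof
    assume "surj (\<lambda>v. Dtrans c d (\<psi> (x 1)) (L0 v))"
    then obtain v where "Dtrans c d (\<psi> (x 1)) (L0 v) = Dtrans c d (\<psi> (x 1)) (q 1)" by (metis surjD)
    then have "Dtrans d c (\<psi> (x 1)) (Dtrans c d (\<psi> (x 1)) (L0 v)) = Dtrans d c (\<psi> (x 1)) (Dtrans c d (\<psi> (x 1)) (q 1))" by simp
    then have "L0 v = q 1" using Dtrans_comp[OF c d(1) c] Dtrans_id[OF c] x1(2) d(2) by simp
    then show False using orth[of v] q1 by simp
  qed
  moreover have "frame_along A \<Delta> \<gamma> \<W> \<Y>" by (rule frame_along_chart) (use xball in \<open>simp add: \<gamma>_def\<close>)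
  moreover have "control_path A \<W> \<Y> (\<gamma> 0) u \<gamma>"
    unfolding \<gamma>_def by (rule traj_control_path[OF xu xball])
  moreover have "((\<lambda>w. chart_map (chart_at A (\<gamma> 1)) (control_endpoint A \<W> \<Y> (\<gamma> 0) w)) has_derivative (\<lambda>v. Dtrans c d (\<psi> (x 1)) (L0 v))) (at u)"
    using DE by (simp add: E_def \<gamma>_def d_def)
  ultimately have "singular_path K A \<Delta> \<gamma>"
    unfolding singular_path_def using hp_horizontal[OF hp] by blast
  moreover have "minimizing A \<Delta> g \<gamma>"
  proof -
    have "sr_dist A \<Delta> g (\<gamma> 0) (\<gamma> 1) \<ge> ennreal r"
    proof (rule ccontr)
      assume "\<not> ennreal r \<le> sr_dist A \<Delta> g (\<gamma> 0) (\<gamma> 1)"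
      then obtain T where T: "sr_dist A \<Delta> g (\<gamma> 0) (\<gamma> 1) < T" "T < ennreal r" using dense not_le by metis
      then have "reach (enn2real T) (\<gamma> 0) (\<gamma> 1)"
        by (intro sr_dist_reach) (metis ennreal_enn2real ennreal_less_top order_less_trans)
      then have "r \<le> enn2real T" using min by (simp add: \<gamma>_def)
      then show False using T(2) by (metis ennreal_enn2real ennreal_leI ennreal_less_top leD order_less_trans)
    qed
    moreover have "sr_length A g \<gamma> \<le> ennreal r" by (rule hp_length[OF hp]) (use r in simp)
    moreover have "sr_dist A \<Delta> g (\<gamma> 0) (\<gamma> 1) \<le> sr_length A g \<gamma>"
      unfolding sr_dist_def by (rule INF_lower) (simp add: horizontal_paths_def hp_horizontal[OF hp])
    ultimately show ?thesis unfolding minimizing_def using hp_horizontal[OF hp] by (metis order_antisym order_trans)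
  qed
  moreover have "nontrivial_path \<gamma>"
    unfolding nontrivial_path_def
  proof
    assume "\<gamma> constant_on {0..1}"
    then have "\<gamma> 0 = \<gamma> 1" by (auto simp: constant_on_def)
    then have "r \<le> r / 2" using min[of "r/2"] reach_refl[of "r/2"] r(1) by (simp add: \<gamma>_def)
    then show False using r(1) by simp
  qed
  ultimately show False using nosing by blast
qed

end

lemma (in sr_chart) minimizer_endpoint_perturbation:
  assumes nosing: "\<not> (\<exists>\<gamma>. nontrivial_path \<gamma> \<and> singular_path K A \<Delta> \<gamma> \<and> minimizing A \<Delta> g \<gamma>)"
    and r: "0 < r" "\<rho> + M * r < R" and cl: "closed S"
    and S: "\<And>p q. (p, q) \<in> S \<Longrightarrow> norm (p - p0) \<le> \<rho>" "\<And>p q T. (p, q) \<in> S \<Longrightarrow> reach T (\<psi> p) (\<psi> q) \<Longrightarrow> r \<le> T"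
  obtains C \<delta> where "C > 0" "\<delta> > 0" "\<And>p q. \<lbrakk>(p, q) \<in> S; reach r (\<psi> p) (\<psi> q); q \<in> B\<rbrakk> \<Longrightarrow>
    \<exists>P. norm P \<le> C \<and> (\<forall>z T. norm (z - q) < \<delta> \<longrightarrow> 0 < T \<longrightarrow> r\<^sup>2 + P \<bullet> (z - q) + C * (norm (z - q))\<^sup>2 < T\<^sup>2 \<longrightarrow> reach T (\<psi> p) (\<psi> z))"
proof -
  define \<M> where "\<M> = {x. (\<exists>u. is_traj F B u x \<and> (\<forall>t. norm (u t) \<le> r)) \<and> (x 0, x 1) \<in> S}"
  obtain \<kappa> where \<kappa>: "\<kappa> > 0" "\<And>x u q. \<lbrakk>x \<in> \<M>; is_traj F B u x; \<And>t. t \<in> {0..1} \<Longrightarrow> norm (u t) \<le> r; adj_sol u x q\<rbrakk> \<Longrightarrow>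
      \<kappa> * (norm (q 1))\<^sup>2 \<le> integral {0..1} (\<lambda>t. (norm (tr (F (x t)) (q t)))\<^sup>2)"
  proof (rule uniform_nondegeneracy[OF r(1), of \<M>])
    show "\<exists>u. is_traj F B u x \<and> (\<forall>t. norm (u t) \<le> r)" if "x \<in> \<M>" for x using that by (simp add: \<M>_def)
    show "x \<in> \<M>" if "\<And>n. xn n \<in> \<M>" "\<And>t. t \<in> {0..1} \<Longrightarrow> (\<lambda>n. xn n t) \<longlonglongrightarrow> x t" "is_traj F B u x" "\<And>t. norm (u t) \<le> r" for xn x u
    proof -
      have "(\<lambda>n. (xn n 0, xn n 1)) \<longlonglongrightarrow> (x 0, x 1)" using that(2) by (intro tendsto_Pair) auto
      then have "(x 0, x 1) \<in> S" using closed_sequentially[OF cl, of "\<lambda>n. (xn n 0, xn n 1)"] that(1) by (simp add: \<M>_def)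
      then show ?thesis using that(3,4) by (auto simp: \<M>_def)
    qed
    show "q 1 = 0" if x: "x \<in> \<M>" "is_traj F B u x" "\<And>t. norm (u t) \<le> r" "adj_sol u x q" "\<And>t. t \<in> {0..1} \<Longrightarrow> tr (F (x t)) (q t) = 0" for x u q
    proof (rule minimizer_nonsingular[OF nosing x(2,3) r(1) _ _ x(4,5)])
      have xS: "(x 0, x 1) \<in> S" using x(1) by (simp add: \<M>_def)
      show "norm (x 0 - p0) + M * r < R" using S(1)[OF xS] r(2) by simp
      show "r \<le> T" if "reach T (\<psi> (x 0)) (\<psi> (x 1))" for T by (rule S(2)[OF xS that])
    qed
  qed blast
  \<comment> \<open>The room which the ball leaves beyond paths of length \<open>r\<close> from
    starting points within \<open>\<rho>\<close> of the centre, divided by the speed factor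
    \<open>M\<close>.\<close>
  define s where "s = (R - \<rho> - M * r) / M"
  have s: "s > 0" using r(2) M by (simp add: s_def)
  have Ms: "\<rho> + M * (r + s) = R" using M by (simp add: s_def field_simps)
  obtain C \<delta> where C: "C > 0" "\<delta> > 0"
    "\<And>x u. \<lbrakk>is_traj F B u x; \<And>t. t \<in> {0..1} \<Longrightarrow> norm (u t) \<le> r; norm (x 0 - p0) + M * (r + s) \<le> R;
       \<And>q. adj_sol u x q \<Longrightarrow> \<kappa> * (norm (q 1))\<^sup>2 \<le> integral {0..1} (\<lambda>t. (norm (tr (F (x t)) (q t)))\<^sup>2)\<rbrakk> \<Longrightarrow>
     \<exists>P. norm P \<le> C \<and> (\<forall>z. norm (z - x 1) < \<delta> \<longrightarrow> (\<exists>w y. is_traj F B w y \<and> y 0 = x 0 \<and> y 1 = z \<and>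
        (\<lambda>t. (norm (w t))\<^sup>2) integrable_on {0..1} \<and>
        integral {0..1} (\<lambda>t. (norm (w t))\<^sup>2) \<le> r\<^sup>2 + P \<bullet> (z - x 1) + C * (norm (z - x 1))\<^sup>2))"
    by (rule endpoint_perturbation[OF r(1) s \<kappa>(1)]) blast
  show ?thesis
  proof (rule that[OF C(1,2)])
    fix p q assume pq: "(p, q) \<in> S" and re: "reach r (\<psi> p) (\<psi> q)" and qB: "q \<in> B"
    have p: "norm (p - p0) + M * r < R" using S(1)[OF pq] r(2) by simp
    have pB: "p \<in> B" using p mult_pos_pos[OF M r(1)] by (simp add: dist_norm norm_minus_commute)
    obtain \<gamma> where \<gamma>: "hp r \<gamma>" "\<gamma> 0 = \<psi> p" "\<gamma> 1 = \<psi> q" using re unfolding reach_def by blast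
    obtain u where u: "is_traj F B u (\<lambda>t. \<phi> (\<gamma> t))" "\<And>t. norm (u t) \<le> r"
      by (rule hp_confined_traj[OF \<gamma>(1) less_imp_le[OF r(1)] \<gamma>(2) p]) blast
    define x where "x t = \<phi> (\<gamma> t)" for t
    have x: "x 0 = p" "x 1 = q" using \<gamma> \<phi>_\<psi> pB qB by (auto simp: x_def)
    have xu: "is_traj F B u x" using u(1) by (simp add: x_def[abs_def])
    have "x \<in> \<M>" using xu u(2) x pq by (auto simp: \<M>_def)
    obtain P where P: "norm P \<le> C" "\<And>z. norm (z - q) < \<delta> \<Longrightarrow> \<exists>w y. is_traj F B w y \<and> y 0 = p \<and> y 1 = z \<and>
        (\<lambda>t. (norm (w t))\<^sup>2) integrable_on {0..1} \<and>
        integral {0..1} (\<lambda>t. (norm (w t))\<^sup>2) \<le> r\<^sup>2 + P \<bullet> (z - q) + C * (norm (z - q))\<^sup>2"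
      using C(3)[OF xu u(2) _ \<kappa>(2)[OF \<open>x \<in> \<M>\<close> xu u(2)]] x S(1)[OF pq] Ms by auto
    show "\<exists>P. norm P \<le> C \<and> (\<forall>z T. norm (z - q) < \<delta> \<longrightarrow> 0 < T \<longrightarrow> r\<^sup>2 + P \<bullet> (z - q) + C * (norm (z - q))\<^sup>2 < T\<^sup>2 \<longrightarrow> reach T (\<psi> p) (\<psi> z))"
    proof (intro exI[of _ P] conjI P(1) allI impI)
      fix z T assume z: "norm (z - q) < \<delta>" and T: "0 < T" "r\<^sup>2 + P \<bullet> (z - q) + C * (norm (z - q))\<^sup>2 < T\<^sup>2"
      obtain w y where y: "is_traj F B w y" "y 0 = p" "y 1 = z" "(\<lambda>t. (norm (w t))\<^sup>2) integrable_on {0..1}"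
        "integral {0..1} (\<lambda>t. (norm (w t))\<^sup>2) \<le> r\<^sup>2 + P \<bullet> (z - q) + C * (norm (z - q))\<^sup>2" using P(2)[OF z] by blast
      have n: "(\<lambda>t. norm (w t)) integrable_on {0..1}"
        by (rule abs_integrable_imp_integrable[OF abs_integrable_norm[OF traj_parts(2)[OF y(1)]]])
      have "integral {0..1} (\<lambda>t. 2 * T * norm (w t)) \<le> integral {0..1} (\<lambda>t. (norm (w t))\<^sup>2 + T\<^sup>2)"
      proof (rule Henstock_Kurzweil_Integration.integral_le)
        show "2 * T * norm (w t) \<le> (norm (w t))\<^sup>2 + T\<^sup>2" for t
          using zero_le_power2[of "norm (w t) - T"] by (simp add: power2_diff mult.assoc mult.commute[of _ T])
      qed (intro integrable_on_mult_right n integrable_add y(4) integrable_const_ivl)+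
      also have "\<dots> = integral {0..1} (\<lambda>t. (norm (w t))\<^sup>2) + T\<^sup>2"
        by (subst Henstock_Kurzweil_Integration.integral_add[OF y(4) integrable_const_ivl]) simp
      also have "\<dots> < 2 * T * T" using y(5) T(2) by (simp add: power2_eq_square)
      finally have "integral {0..1} (\<lambda>t. norm (w t)) < T" using T(1) by simp
      from traj_reach[OF y(1) this] show "reach T (\<psi> p) (\<psi> z)" by (simp add: y(2,3))
    qed
  qed
qed

section \<open>The distance function\<close>

locale sr_nonsingular = sr_manifold A \<Delta> g K
  for A :: "('m::{t2_space, second_countable_topology}, 'e::euclidean_space) chart set"
    and \<Delta> :: "'m \<Rightarrow> 'e set" and g :: "'m \<Rightarrow> 'e \<Rightarrow> 'e \<Rightarrow> real" and K :: "'k::finite itself" +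
  assumes nosing: "\<not> (\<exists>\<gamma>. nontrivial_path \<gamma> \<and> singular_path K A \<Delta> \<gamma> \<and> minimizing A \<Delta> g \<gamma>)"
begin

text \<open>Since a minimizing path \<open>y \<rightarrow> x0\<close> is nonsingular, perturbing its control reaches a neighbourhood of \<open>x0\<close>.\<close>

lemma local_reach:
  fixes x0 :: 'm
  assumes \<epsilon>: "0 < \<epsilon>"
  obtains V where "open V" "x0 \<in> V" "\<And>z. z \<in> V \<Longrightarrow> reach \<epsilon> x0 z"
proof -
  obtain c and Y :: "'k \<Rightarrow> 'm \<Rightarrow> 'e" and R M L U where *: "sr_chart A \<Delta> g K c Y (chart_map c x0) R M L U" "x0 \<in> U"
    by (rule sr_chart_exists[OF open_UNIV UNIV_I]) blast
  interpret sr_chart A \<Delta> g K c Y "chart_map c x0" R M L U by (rule *)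
  define p0 where "p0 = \<phi> x0"
  have p0B: "p0 \<in> B" "\<psi> p0 = x0" using R \<psi>_\<phi>[OF *(2)] by (auto simp: p0_def)
  \<comment> \<open>The final path consists of a piece of bound \<sigma> and one of bound 2\<sigma>,
    hence the first condition; the second one keeps the construction inside the chart ball.\<close>
  define \<sigma> where "\<sigma> = min (\<epsilon> / 3) (R / (4 * M))"
  have \<sigma>: "0 < \<sigma>" "3 * \<sigma> \<le> \<epsilon>" "4 * (M * \<sigma>) \<le> R"
    using \<epsilon> R M by (auto simp: \<sigma>_def min_def field_simps)
  \<comment> \<open>A nonzero constant control leads to some nearby point other than
    \<open>x0\<close>. Finite types are inhabited, so \<open>axis undefined\<close> selects some
    field of the frame.\<close>
  define v :: "real ^ 'k" where "v = \<sigma> *\<^sub>R axis undefined 1"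
  have v: "norm v = \<sigma>" "v \<noteq> 0" using \<sigma> by (auto simp: v_def norm_axis_1)
  obtain x where x: "is_traj F B (\<lambda>t. v) x" "x 0 = p0"
    by (rule traj_exists[of "\<lambda>t. v" p0]) (use \<sigma> R v in \<open>auto simp: p0_def\<close>)
  have xv: "norm v \<le> \<sigma>" for t :: real using v by simp
  have "\<exists>t\<in>{0..1}. x t \<noteq> p0"
  proof (rule ccontr)
    assume "\<not> (\<exists>t\<in>{0..1}. x t \<noteq> p0)"
    then have c0: "x t = p0" if "t \<in> {0..1}" for t using that by blast
    have "((\<lambda>t. F (x t) v) has_integral x 1 - x 0) {0..1}" by (rule primitive_has_integral[OF traj_parts(1)[OF x(1)]]) auto
    then have "((\<lambda>t. F p0 v) has_integral 0) {0..1::real}"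
      using has_integral_cong[of "{0..1}" "\<lambda>t. F (x t) v" "\<lambda>t. F p0 v"] c0 by simp
    then have "F p0 v = 0" using has_integral_unique[OF has_integral_const_real[of "F p0 v" 0 1]] by simp
    then show False using F_inj[of p0 v] p0B v(2) by (simp add: p0_def)
  qed
  then obtain t where t: "t \<in> {0..1}" "x t \<noteq> p0" by blast
  define y where "y = x t"
  have "reach \<sigma> (\<psi> (x 0)) (\<psi> (x t))"
    by (rule hp_subpath_reach[OF traj_hp[OF x(1) xv] \<sigma>(1)]) (use t \<sigma> mult_right_mono[of t 1 \<sigma>] in auto)
  then have re: "reach \<sigma> x0 (\<psi> y)" "reach \<sigma> (\<psi> y) (\<psi> p0)" using reach_sym by (auto simp: x(2) p0B y_def)
  have yB: "y \<in> B" using traj_parts(3)[OF x(1) t(1)] by (simp add: y_def)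
  have yn: "norm (y - p0) \<le> M * \<sigma>" "y \<noteq> p0"
    using reach_confined(2)[of \<sigma> p0 "\<psi> y"] re(1) p0B(2) \<phi>_\<psi>[OF yB] \<sigma> R t by (auto simp: y_def p0_def)
  define S where "S = {T. reach T (\<psi> y) (\<psi> p0)}"
  \<comment> \<open>Makes the infimum of \<open>S\<close> positive: a path from \<open>y\<close>
    with bound \<open>T\<close> either has enough length to leave the ball, or is confined and must
    cover the coordinate distance from \<open>y\<close> to \<open>p0\<close>. In both cases
    \<open>T\<close> is at least \<open>m\<close>.\<close>
  define m where "m = min ((R - norm (y - p0)) / M) (norm (y - p0) / M)"
  have "norm (y - p0) < R" using yn(1) \<sigma>(3) mult_pos_pos[OF M \<sigma>(1)] R by linarith
  then have m: "m > 0" using yn(2) M by (simp add: m_def)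
  have Sm: "m \<le> T" if "T \<in> S" for T
  proof (cases "norm (y - p0) + M * T < R")
    case True
    then have "norm (p0 - y) \<le> M * T" using reach_confined(2)[of T y "\<psi> p0"] that \<phi>_\<psi>[OF p0B(1)] by (simp add: S_def p0_def)
    then show ?thesis using M by (simp add: m_def norm_minus_commute field_simps min_le_iff_disj)
  next
    case False then show ?thesis using M by (simp add: m_def field_simps min_le_iff_disj)
  qed
  have \<sigma>S: "\<sigma> \<in> S" using re by (simp add: S_def)
  have bdd: "bdd_below S" using Sm by (rule bdd_belowI)
  define r where "r = Inf S"
  have r: "0 < r" "r \<le> \<sigma>" "\<And>T. T \<in> S \<Longrightarrow> r \<le> T"
    using cInf_greatest[of S m] Sm m \<sigma>S cInf_lower[OF _ bdd] by (auto simp: r_def intro: order_less_le_trans)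
  have "\<exists>T\<in>S. T < r + 1 / real (Suc n)" for n
    using cInf_less_iff[of S "r + 1 / real (Suc n)"] bdd \<sigma>S by (auto simp: r_def)
  then obtain T where T: "\<And>n. T n \<in> S" "\<And>n. T n < r + 1 / real (Suc n)" by metis
  have "T \<longlonglongrightarrow> r"
  proof (rule tendsto_sandwich[of "\<lambda>n. r" _ _ "\<lambda>n. r + 1 / real (Suc n)"])
    have "(\<lambda>n. r + 1 / real (Suc n)) \<longlonglongrightarrow> r + 0" by (intro tendsto_intros LIMSEQ_Suc[OF lim_const_over_n])
    then show "(\<lambda>n. r + 1 / real (Suc n)) \<longlonglongrightarrow> r" by simp
  qed (use r(3) T(1) less_imp_le[OF T(2)] in auto)
  have Mr: "M * r \<le> M * \<sigma>" using r(2) M by simp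
  obtain \<gamma> where "hp r \<gamma>" "\<gamma> 0 = \<psi> y" "\<gamma> 1 = \<psi> p0"
    by (rule reach_limit[of T "\<lambda>n. y" "\<lambda>n. p0" r y p0])
      (use T(1) \<open>T \<longlonglongrightarrow> r\<close> r(1) p0B yn Mr \<sigma> R in \<open>auto simp: S_def p0_def\<close>)
  then have rr: "reach r (\<psi> y) (\<psi> p0)" using r(1) by (auto simp: reach_def)
  have yR: "norm (y - p0) + M * r < R" using yn Mr \<sigma>(3) R by linarith
  obtain C \<delta> where C: "C > 0" "\<delta> > 0" and pert: "\<And>p q. \<lbrakk>(p, q) \<in> {(y, p0)}; reach r (\<psi> p) (\<psi> q); q \<in> B\<rbrakk> \<Longrightarrow>
    \<exists>P. norm P \<le> C \<and> (\<forall>z T. norm (z - q) < \<delta> \<longrightarrow> 0 < T \<longrightarrow> r\<^sup>2 + P \<bullet> (z - q) + C * (norm (z - q))\<^sup>2 < T\<^sup>2 \<longrightarrow> reach T (\<psi> p) (\<psi> z))"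
    by (rule minimizer_endpoint_perturbation[OF nosing r(1) yR[unfolded p0_def], of "{(y, p0)}"])
      (use r(3) in \<open>auto simp: S_def p0_def\<close>)
  obtain P where P: "norm P \<le> C" "\<And>z T. \<lbrakk>norm (z - p0) < \<delta>; 0 < T; r\<^sup>2 + P \<bullet> (z - p0) + C * (norm (z - p0))\<^sup>2 < T\<^sup>2\<rbrakk> \<Longrightarrow> reach T (\<psi> y) (\<psi> z)"
    using pert[OF singletonI rr p0B(1)] by blast
  \<comment> \<open>With n the coordinate distance of the target to \<open>p0\<close>, this radius
    gives r^2 + C n + C n^2 < 3 \<sigma>^2, because r <= \<sigma>, C n < \<sigma>^2 and n <= 1; that
    is below (2\<sigma>)^2.\<close>
  define \<delta>' where "\<delta>' = min (min \<delta> 1) (\<sigma>\<^sup>2 / C)"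
  have \<delta>': "\<delta>' > 0" using C \<sigma> by (simp add: \<delta>'_def)
  show ?thesis
  proof (rule that)
    show "open (chart_dom c \<inter> \<phi> -` ball p0 \<delta>')" by (rule open_chart_preimage[OF c]) simp
    show "x0 \<in> chart_dom c \<inter> \<phi> -` ball p0 \<delta>'" using *(2) U \<delta>' by (auto simp: p0_def)
    fix z assume z: "z \<in> chart_dom c \<inter> \<phi> -` ball p0 \<delta>'"
    define n where "n = norm (\<phi> z - p0)"
    have n: "n < \<delta>" "n \<le> 1" "C * n < \<sigma>\<^sup>2" "0 \<le> n"
      using z C by (auto simp: n_def \<delta>'_def dist_norm norm_minus_commute field_simps)
    have "P \<bullet> (\<phi> z - p0) \<le> C * n"
      using norm_cauchy_schwarz[of P "\<phi> z - p0"] mult_right_mono[OF P(1), of n] n(4) by (simp add: n_def)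
    moreover have "C * n\<^sup>2 \<le> C * n" using n C mult_left_mono[of "n * n" n C] mult_left_le[of n n] by (simp add: power2_eq_square)
    moreover have "r\<^sup>2 \<le> \<sigma>\<^sup>2" using r by (intro power_mono) auto
    moreover have "0 < \<sigma>\<^sup>2" and four_eq: "(2::real)\<^sup>2 = 4" using \<sigma> by simp_all
    ultimately have "r\<^sup>2 + P \<bullet> (\<phi> z - p0) + C * (norm (\<phi> z - p0))\<^sup>2 < (2 * \<sigma>)\<^sup>2"
      using n(3) unfolding n_def[symmetric] power_mult_distrib four_eq by linarith
    then have "reach (2 * \<sigma>) (\<psi> y) (\<psi> (\<phi> z))" using P(2)[of "\<phi> z" "2 * \<sigma>"] n(1) \<sigma>(1) by (simp add: n_def)
    then have "reach (2 * \<sigma>) (\<psi> y) z" using chart_inv_map[OF c] z by simp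
    from reach_trans[OF re(1) this] show "reach \<epsilon> x0 z" by (rule reach_mono) (use \<sigma> in simp)
  qed
qed

text \<open>The sub-Riemannian distance as a real number. The set under the infimum is known to be
  nonempty once \<open>reachable\<close> is proved, and \<open>value_fun_eq\<close> ties its square
  to the value function.\<close>

definition D :: "'m \<Rightarrow> 'm \<Rightarrow> real" where
  "D x y = Inf {T. reach T x y}"

lemma reach_pos: "reach T x y \<Longrightarrow> 0 < T" by (simp add: reach_def)

lemma D_le: "reach T x y \<Longrightarrow> D x y \<le> T"
  unfolding D_def by (rule cInf_lower) (auto intro!: bdd_belowI[of _ 0] dest: reach_pos)

end

locale sr_connected = sr_nonsingular A \<Delta> g K
  for A :: "('m::{t2_space, second_countable_topology}, 'e::euclidean_space) chart set"
    and \<Delta> :: "'m \<Rightarrow> 'e set" and g :: "'m \<Rightarrow> 'e \<Rightarrow> 'e \<Rightarrow> real" and K :: "'k::finite itself" +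
  assumes conn: "connected (UNIV :: 'm set)"
begin

text \<open>By local accessibility and symmetry of \<open>reach\<close>, both the set of points
  reachable from \<open>x\<close> and its complement are open.\<close>

lemma reachable:
  fixes x y :: 'm shows "\<exists>T. reach T x y"
proof -
  define S where "S = {y. \<exists>T. reach T x y}"
  have "open S"
  proof (rule topological_space_class.openI)
    fix y assume "y \<in> S"
    then obtain T where T: "reach T x y" by (auto simp: S_def)
    obtain V where V: "open V" "y \<in> V" "\<And>z. z \<in> V \<Longrightarrow> reach 1 y z" by (rule local_reach[of 1 y]) auto
    then show "\<exists>T. open T \<and> y \<in> T \<and> T \<subseteq> S" using reach_trans[OF T] by (intro exI[of _ V]) (auto simp: S_def)
  qed
  moreover have "open (- S)"
  proof (rule topological_space_class.openI)
    fix y assume y: "y \<in> - S"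
    obtain V where V: "open V" "y \<in> V" "\<And>z. z \<in> V \<Longrightarrow> reach 1 y z" by (rule local_reach[of 1 y]) auto
    have "z \<notin> S" if "z \<in> V" for z
    proof
      assume "z \<in> S"
      then obtain T where "reach T x z" by (auto simp: S_def)
      from reach_trans[OF this reach_sym[OF V(3)[OF that]]] show False using y by (auto simp: S_def)
    qed
    then show "\<exists>T. open T \<and> y \<in> T \<and> T \<subseteq> - S" using V by (intro exI[of _ V]) auto
  qed
  ultimately have "S = {} \<or> S = UNIV" using conn unfolding connected_clopen by (simp add: closed_def)
  moreover have "x \<in> S" using reach_refl[of 1 x] by (auto simp: S_def)
  ultimately show ?thesis by (auto simp: S_def)
qed

lemma D_less: "D x y < T \<Longrightarrow> reach T x y"
proof -
  assume "D x y < T"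
  then obtain S where "reach S x y" "S < T"
    using cInf_lessD[of "{T. reach T x y}" T] reachable[of x y] by (auto simp: D_def)
  then show ?thesis by (intro reach_mono[of S x y T]) auto
qed

lemma D_nonneg: "0 \<le> D x y"
  unfolding D_def by (rule cInf_greatest) (use reachable[of x y] in \<open>auto dest: reach_pos\<close>)

lemma D_triangle: "reach T y z \<Longrightarrow> D x z \<le> D x y + T"
proof (rule field_le_epsilon)
  fix e :: real assume "reach T y z" "0 < e"
  then have "reach (D x y + e + T) x z" by (intro reach_trans[OF D_less]) auto
  then show "D x z \<le> D x y + T + e" using D_le[of "D x y + e + T" x z] by simp
qed

lemma D_continuous: "continuous_on UNIV (D x)"
  unfolding continuous_on_def
proof (intro ballI tendstoI)
  fix y :: 'm and e :: real assume e: "0 < e"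
  obtain V where V: "open V" "y \<in> V" "\<And>z. z \<in> V \<Longrightarrow> reach (e/2) y z" by (rule local_reach[of "e/2" y]) (use e in auto)
  have "dist (D x z) (D x y) < e" if "z \<in> V" for z
    using D_triangle[OF V(3)[OF that], of x] D_triangle[OF reach_sym[OF V(3)[OF that]], of x] e by (simp add: dist_real_def)
  then show "\<forall>\<^sub>F z in at y within UNIV. dist (D x z) (D x y) < e"
    using V(1,2) by (auto simp: eventually_at_topological)
qed

text \<open>Paths of bound slightly above the distance have energy slightly above its square.
  Conversely, an energy below the square would allow a bound \<open>T\<close> whose square lies
  halfway between, and \<open>T\<close> would be less than the distance.\<close>

lemma value_fun_eq: "value_fun A \<Delta> g x y = ennreal ((D x y)\<^sup>2)"
proof (rule antisym)
  have "value_fun A \<Delta> g x y \<le> ennreal ((D x y + e)\<^sup>2)" if "e > 0" for e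
    by (rule reach_value[OF D_less]) (use that in simp)
  moreover have "((\<lambda>e. ennreal ((D x y + e)\<^sup>2)) \<longlongrightarrow> ennreal ((D x y + 0)\<^sup>2)) (at_right 0)"
    by (intro tendsto_intros)
  ultimately show "value_fun A \<Delta> g x y \<le> ennreal ((D x y)\<^sup>2)"
    using tendsto_lowerbound[of "\<lambda>e. ennreal ((D x y + e)\<^sup>2)" "ennreal ((D x y + 0)\<^sup>2)" "at_right 0" "value_fun A \<Delta> g x y"]
    by (simp add: eventually_at_filter)
  show "ennreal ((D x y)\<^sup>2) \<le> value_fun A \<Delta> g x y"
  proof (rule ccontr)
    assume "\<not> ennreal ((D x y)\<^sup>2) \<le> value_fun A \<Delta> g x y"
    then have lt: "value_fun A \<Delta> g x y < ennreal ((D x y)\<^sup>2)" by simp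
    define a where "a = enn2real (value_fun A \<Delta> g x y)"
    have a: "value_fun A \<Delta> g x y = ennreal a" "0 \<le> a"
      using lt by (auto simp: a_def intro!: ennreal_enn2real[symmetric] elim: order_less_trans)
    then have aD: "a < (D x y)\<^sup>2" using lt by (simp add: ennreal_less_iff)
    define T where "T = sqrt ((a + (D x y)\<^sup>2) / 2)"
    have T: "0 < T" "T\<^sup>2 = (a + (D x y)\<^sup>2) / 2" using a aD by (auto simp: T_def)
    then have "reach T x y" by (intro value_fun_reach) (use a aD in \<open>auto simp: ennreal_less_iff\<close>)
    then have "(D x y)\<^sup>2 \<le> T\<^sup>2" using D_le D_nonneg by (intro power_mono) auto
    then show False using T aD by simp
  qed
qed

end

section \<open>Semiconcavity of the squared distance\<close>

text \<open>The quadratic bound based at the convex combination \<open>m\<close> is evaluated at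
  \<open>x\<close> and \<open>y\<close> and averaged. The linear terms cancel, and \<mu>(1-\<mu>)^2
  + (1-\<mu>)\<mu>^2 = \<mu>(1-\<mu>).\<close>

lemma semiconcave_of_quadratic_upper_bound:
  fixes f :: "'e::euclidean_space \<Rightarrow> real"
  assumes K: "K > 0" and up: "\<And>q. q \<in> ball p \<delta> \<Longrightarrow> \<exists>Q. \<forall>z\<in>ball p \<delta>. f z \<le> f q + Q \<bullet> (z - q) + K * (norm (z - q))\<^sup>2"
  shows "semiconcave_euclidean (ball p \<delta>) f"
  unfolding semiconcave_euclidean_def
proof
  fix z assume "z \<in> ball p \<delta>"
  then obtain d where d: "d > 0" "ball z d \<subseteq> ball p \<delta>" using open_ball open_contains_ball by metis
  have "\<mu> * f y + (1 - \<mu>) * f x - f (\<mu> *\<^sub>R y + (1 - \<mu>) *\<^sub>R x) \<le> \<mu> * (1 - \<mu>) * K * (norm (x - y))\<^sup>2"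
    if x: "x \<in> ball z d" and y: "y \<in> ball z d" and \<mu>: "\<mu> \<in> {0..1}" for x y \<mu>
  proof -
    define m where "m = \<mu> *\<^sub>R y + (1 - \<mu>) *\<^sub>R x"
    have "m \<in> ball z d" unfolding m_def using convexD[OF convex_ball y x, of \<mu> "1 - \<mu>"] \<mu> by simp
    then obtain Q where Q: "\<And>w. w \<in> ball p \<delta> \<Longrightarrow> f w \<le> f m + Q \<bullet> (w - m) + K * (norm (w - m))\<^sup>2" using up[of m] d(2) by blast
    have ym: "y - m = (1 - \<mu>) *\<^sub>R (y - x)" and xm: "x - m = (- \<mu>) *\<^sub>R (y - x)" by (simp_all add: m_def algebra_simps)
    define n where "n = (norm (x - y))\<^sup>2"
    have ny: "(norm (y - m))\<^sup>2 = (1 - \<mu>)\<^sup>2 * n" and nx: "(norm (x - m))\<^sup>2 = \<mu>\<^sup>2 * n"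
      unfolding ym xm by (simp_all add: power_mult_distrib n_def norm_minus_commute)
    have "f y \<le> f m + (1 - \<mu>) * (Q \<bullet> (y - x)) + K * ((1 - \<mu>)\<^sup>2 * n)" using Q[of y] y d(2) unfolding ny unfolding ym by auto
    then have "\<mu> * f y \<le> \<mu> * (f m + (1 - \<mu>) * (Q \<bullet> (y - x)) + K * ((1 - \<mu>)\<^sup>2 * n))" using \<mu> by (intro mult_left_mono) auto
    moreover have "f x \<le> f m + (- \<mu>) * (Q \<bullet> (y - x)) + K * (\<mu>\<^sup>2 * n)" using Q[of x] x d(2) unfolding nx unfolding xm by auto
    then have "(1 - \<mu>) * f x \<le> (1 - \<mu>) * (f m + (- \<mu>) * (Q \<bullet> (y - x)) + K * (\<mu>\<^sup>2 * n))" using \<mu> by (intro mult_left_mono) auto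
    moreover have "\<mu> * (f m + (1 - \<mu>) * (Q \<bullet> (y - x)) + K * ((1 - \<mu>)\<^sup>2 * n)) + (1 - \<mu>) * (f m + (- \<mu>) * (Q \<bullet> (y - x)) + K * (\<mu>\<^sup>2 * n))
        = f m + \<mu> * (1 - \<mu>) * K * n" by algebra
    ultimately show ?thesis unfolding m_def[symmetric] n_def[symmetric] by linarith
  qed
  then show "\<exists>C>0. \<exists>d>0. ball z d \<subseteq> ball p \<delta> \<and> (\<forall>x\<in>ball z d. \<forall>y\<in>ball z d. \<forall>\<mu>\<in>{0..1}.
       \<mu> * f y + (1 - \<mu>) * f x - f (\<mu> *\<^sub>R y + (1 - \<mu>) *\<^sub>R x) \<le> \<mu> * (1 - \<mu>) * C * (norm (x - y))\<^sup>2)"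
    using K d by blast
qed

text \<open>Semiconcavity is required on the entire image of a chart, so the chart is cut down to
  the region where the bound holds. The smaller chart belongs to the maximal atlas but need not
  belong to \<open>A\<close>.\<close>

lemma (in manifold) restricted_chart:
  assumes c: "c \<in> A" and V: "open V" "V \<subseteq> chart_dom c"
  shows "smooth_chart A (V, chart_map c)" and "p \<in> chart_map c ` V \<Longrightarrow> chart_inv (V, chart_map c) p = chart_inv c p"
proof -
  let ?d = "(V, chart_map c)"
  have inj: "inj_on (chart_map c) (chart_dom c)" using chart_inv_map[OF c] by (metis inj_onI)
  have inv: "chart_inv ?d (chart_map c y) = y" "chart_inv c (chart_map c y) = y" if "y \<in> V" for y
    using that V chart_inv_map[OF c] inj_on_subset[OF inj V(2)] by (auto simp: chart_inv_def inv_into_f_f)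
  then show eq: "p \<in> chart_map c ` V \<Longrightarrow> chart_inv ?d p = chart_inv c p" for p by auto
  have o: "open (chart_map c ` V)" using open_chart_image[OF c V(1)] V(2) by (simp add: Int_absorb2)
  have "is_chart ?d"
    unfolding is_chart_def fst_conv snd_conv
  proof (intro conjI V(1) o homeomorphismI)
    show "continuous_on V (chart_map c)" by (rule continuous_on_subset[OF chart_cont[OF c] V(2)])
    have "continuous_on (chart_map c ` V) (chart_inv c)" by (rule continuous_on_subset[OF chart_inv_cont[OF c]]) (use V in auto)
    then show "continuous_on (chart_map c ` V) (chart_inv ?d)" by (subst continuous_on_cong[OF refl eq]) auto
  qed (use inv in auto)
  moreover have "smooth_transition ?d e \<and> smooth_transition e ?d" if e: "e \<in> A" for e
  proof
    have st: "smooth_transition c e" "smooth_transition e c" using atlas c e by (auto simp: smooth_atlas_def)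
    have oV: "open (chart_map c ` (V \<inter> chart_dom e))"
      using open_chart_image[OF c open_Int[OF V(1) chart_open(1)[OF e]]] V(2) by (simp add: Int_absorb2 le_infI1)
    have "smooth_on (chart_map c ` (V \<inter> chart_dom e)) (chart_map e \<circ> chart_inv c)"
      by (rule smooth_on_subset[OF st(1)[unfolded smooth_transition_def]]) (use V in auto)
    then show "smooth_transition ?d e"
      unfolding smooth_transition_def fst_conv snd_conv by (rule smooth_on_cong[OF _ oV]) (use eq in auto)
    show "smooth_transition e ?d"
      unfolding smooth_transition_def fst_conv snd_conv
      by (rule smooth_on_subset[OF st(2)[unfolded smooth_transition_def]]) (use V in auto)
  qed
  ultimately show "smooth_chart A ?d" by (auto simp: smooth_chart_def)
qed

locale sr_connected_chart = sr_connected A \<Delta> g K + sr_chart A \<Delta> g K c Y p0 R M L U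
  for A :: "('m::{t2_space, second_countable_topology}, 'e::euclidean_space) chart set"
    and \<Delta> :: "'m \<Rightarrow> 'e set" and g :: "'m \<Rightarrow> 'e \<Rightarrow> 'e \<Rightarrow> real" and K :: "'k::finite itself"
    and c and Y :: "'k \<Rightarrow> 'm \<Rightarrow> 'e" and p0 R M L and U :: "'m set"
begin

lemma \<psi>_continuous: "continuous_on B \<psi>"
  by (rule continuous_on_subset[OF chart_inv_cont[OF c] B_cimg])

text \<open>A path between the limit points is prolonged at both ends, by local accessibility, to a
  nearby pair of the sequence; its bound is then at least r - e for every e > 0. The conjunct
  \<open>\<rho> \<le> R\<close> places \<open>p\<close> in \<open>B\<close>.\<close>

lemma minimizer_pairs_closed:
  "closed {(p, q). p \<in> cball p0 \<rho> \<and> \<rho> \<le> R \<and> q \<in> B \<and> (\<forall>T. reach T (\<psi> p) (\<psi> q) \<longrightarrow> r \<le> T)}" (is "closed ?S")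
  unfolding closed_sequential_limits
proof (intro allI impI, elim conjE)
  fix x l assume x: "\<forall>n. x n \<in> ?S" and l: "x \<longlonglongrightarrow> l"
  obtain p q where pq: "l = (p, q)" by (cases l)
  have xn: "fst (x n) \<in> cball p0 \<rho>" "\<rho> \<le> R" "snd (x n) \<in> B" "\<And>T. reach T (\<psi> (fst (x n))) (\<psi> (snd (x n))) \<Longrightarrow> r \<le> T" for n
    using x by (auto simp: case_prod_unfold)
  have lim: "(\<lambda>n. fst (x n)) \<longlonglongrightarrow> p" "(\<lambda>n. snd (x n)) \<longlonglongrightarrow> q" using tendsto_fst[OF l] tendsto_snd[OF l] by (simp_all add: pq)
  have p: "p \<in> cball p0 \<rho>" by (rule closed_sequentially[OF closed_cball xn(1) lim(1)])
  have q: "q \<in> B" by (rule closed_sequentially[OF closed_cball xn(3) lim(2)])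
  have B: "p \<in> B" "fst (x n) \<in> B" for n using p xn(1)[of n] xn(2) by auto
  have near: "\<forall>\<^sub>F n in sequentially. reach e (\<psi> z) (\<psi> (f n))" if e: "e > 0" and f: "f \<longlonglongrightarrow> z" "z \<in> B" "\<And>n. f n \<in> B" for e f z
  proof -
    obtain V where V: "open V" "\<psi> z \<in> V" "\<And>y. y \<in> V \<Longrightarrow> reach e (\<psi> z) y" by (rule local_reach[OF e, of "\<psi> z"]) blast
    have "(\<lambda>n. \<psi> (f n)) \<longlonglongrightarrow> \<psi> z"
      by (rule continuous_on_tendsto_compose[OF \<psi>_continuous f(1,2)]) (use f(3) in simp)
    then have "\<forall>\<^sub>F n in sequentially. \<psi> (f n) \<in> V" using V by (intro topological_tendstoD)
    then show ?thesis by eventually_elim (rule V(3))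
  qed
  have "r \<le> T" if T: "reach T (\<psi> p) (\<psi> q)" for T
  proof (rule field_le_epsilon)
    fix e :: real assume "e > 0"
    then have "\<forall>\<^sub>F n in sequentially. reach (e/2) (\<psi> p) (\<psi> (fst (x n))) \<and> reach (e/2) (\<psi> q) (\<psi> (snd (x n)))"
      by (intro eventually_conj near lim B q xn(3)) auto
    then obtain n where n: "reach (e/2) (\<psi> p) (\<psi> (fst (x n)))" "reach (e/2) (\<psi> q) (\<psi> (snd (x n)))"
      unfolding eventually_sequentially by blast
    have "reach (e/2 + (T + e/2)) (\<psi> (fst (x n))) (\<psi> (snd (x n)))" by (rule reach_trans[OF reach_sym[OF n(1)] reach_trans[OF T n(2)]])
    from xn(4)[OF this] show "r \<le> T + e" by simp
  qed
  then show "l \<in> ?S" using p q xn(2) by (simp add: pq)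
qed

text \<open>A point at distance \<open>r\<close> from the end of a shortest path; it exists although the shortest path itself
  need not lie in the chart.\<close>

lemma predecessor:
  assumes r: "0 < r" "r < D xbar (\<psi> q)" and q: "norm (q - p0) + 2 * (M * r) < R"
  obtains p where "norm (p - q) \<le> M * r" "reach r (\<psi> p) (\<psi> q)" "\<And>T. reach T (\<psi> p) (\<psi> q) \<Longrightarrow> r \<le> T"
    "D xbar (\<psi> p) + r \<le> D xbar (\<psi> q)"
proof -
  define d where "d = D xbar (\<psi> q)"
  have Mr: "M * r > 0" using M r by simp
  define T where "T n = d + 1 / real (Suc n)" for n
  have Td: "d < T n" for n by (simp add: T_def)
  have "\<exists>z. reach (T n - r) xbar z \<and> reach r z (\<psi> q)" for n
  proof -
    have "reach (T n) xbar (\<psi> q)" by (rule D_less) (use Td[of n] in \<open>simp add: d_def\<close>)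
    then obtain \<gamma> where \<gamma>: "hp (T n) \<gamma>" "\<gamma> 0 = xbar" "\<gamma> 1 = \<psi> q" "0 < T n" by (auto simp: reach_def)
    \<comment> \<open>The path of bound \<open>T n\<close> is cut where its remaining part has bound
      exactly \<open>r\<close>; what precedes has bound \<open>T n - r\<close>.\<close>
    define a where "a = 1 - r / T n"
    have rT: "r < T n" using r Td[of n] by (simp add: d_def)
    have a: "a \<in> {0..1}" "a * T n = T n - r" "(1 - a) * T n = r" using \<gamma>(4) rT r by (auto simp: a_def field_simps)
    have "reach (T n - r) (\<gamma> 0) (\<gamma> a)" by (rule hp_subpath_reach[OF \<gamma>(1,4)]) (use a rT in auto)
    moreover have "reach r (\<gamma> a) (\<gamma> 1)" by (rule hp_subpath_reach[OF \<gamma>(1,4)]) (use a r in auto)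
    ultimately show ?thesis using \<gamma>(2,3) by auto
  qed
  then obtain z where z: "\<And>n. reach (T n - r) xbar (z n)" "\<And>n. reach r (z n) (\<psi> q)" by metis
  have qR: "norm (q - p0) + M * r < R" using q Mr by simp
  have qB: "q \<in> B" using qR Mr by (simp add: dist_norm norm_minus_commute)
  note conf = reach_confined[OF reach_sym[OF z(2)] qR]
  have z\<psi>: "\<psi> (\<phi> (z n)) = z n" for n using conf(1)[of n] \<psi>_U by (intro \<psi>_\<phi>) auto
  have zB: "\<phi> (z n) \<in> B" for n
  proof -
    obtain w where "w \<in> ball p0 R" "z n = \<psi> w" using conf(1)[of n] by auto
    then show ?thesis using \<phi>_\<psi>[of w] by auto
  qed
  have "\<phi> (z n) \<in> cball q (M * r)" for n using conf(2)[of n] by (simp add: dist_norm norm_minus_commute)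
  then obtain p and k :: "nat \<Rightarrow> nat" where p: "p \<in> cball q (M * r)" "strict_mono k" "((\<lambda>n. \<phi> (z n)) \<circ> k) \<longlonglongrightarrow> p"
    using compact_cball[of q "M * r"] unfolding compact_def by metis
  have plim: "(\<lambda>n. \<phi> (z (k n))) \<longlonglongrightarrow> p" using p(3) by (simp add: o_def)
  have pB: "p \<in> B" by (rule closed_sequentially[OF closed_cball _ plim]) (rule zB)
  obtain \<gamma> where "hp r \<gamma>" "\<gamma> 0 = \<psi> q" "\<gamma> 1 = \<psi> p"
    by (rule reach_limit[of "\<lambda>n. r" "\<lambda>n. q" "\<lambda>n. \<phi> (z (k n))" r q p])
      (use reach_sym[OF z(2)] z\<psi> r(1) plim zB qR in auto)
  then have "reach r (\<psi> q) (\<psi> p)" using r(1) by (auto simp: reach_def)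
  then have rp: "reach r (\<psi> p) (\<psi> q)" by (rule reach_sym)
  have Dp: "D xbar (\<psi> p) + r \<le> d"
  proof -
    have "(\<lambda>n. \<psi> (\<phi> (z (k n)))) \<longlonglongrightarrow> \<psi> p"
      by (rule continuous_on_tendsto_compose[OF \<psi>_continuous plim pB]) (use zB in simp)
    then have "(\<lambda>n. z (k n)) \<longlonglongrightarrow> \<psi> p" by (simp add: z\<psi>)
    then have "(\<lambda>n. D xbar (z (k n))) \<longlonglongrightarrow> D xbar (\<psi> p)"
      by (rule continuous_on_tendsto_compose[OF D_continuous]) auto
    moreover have "(\<lambda>n. T (k n) - r) \<longlonglongrightarrow> d - r"
    proof -
      have "T \<longlonglongrightarrow> d + 0" unfolding T_def by (intro tendsto_intros LIMSEQ_Suc[OF lim_const_over_n])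
      from tendsto_diff[OF LIMSEQ_subseq_LIMSEQ[OF this p(2)] tendsto_const[of r]] show ?thesis by (simp add: o_def)
    qed
    moreover have "D xbar (z (k n)) \<le> T (k n) - r" for n by (rule D_le[OF z(1)])
    ultimately have "D xbar (\<psi> p) \<le> d - r" by (intro LIMSEQ_le[of "\<lambda>n. D xbar (z (k n))" _ "\<lambda>n. T (k n) - r"]) auto
    then show ?thesis by simp
  qed
  show ?thesis
  proof (rule that[OF _ rp])
    show "norm (p - q) \<le> M * r" using p(1) by (simp add: dist_norm norm_minus_commute)
    show "D xbar (\<psi> p) + r \<le> D xbar (\<psi> q)" using Dp by (simp add: d_def)
    \<comment> \<open>A better connection from \<open>p\<close> to \<open>q\<close> would, by the
      triangle inequality and \<open>Dp\<close>, make the distance from \<open>xbar\<close> to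
      \<open>q\<close> smaller than it is.\<close>
    show "r \<le> T'" if "reach T' (\<psi> p) (\<psi> q)" for T' using D_triangle[OF that, of xbar] Dp by (simp add: d_def)
  qed
qed

text \<open>The way from \<open>xbar\<close> to the predecessor \<open>p\<close> of \<open>q\<close>
  is kept and only the last piece is replaced. If the new piece has energy at most r^2 + a, the
  distance at \<open>z\<close> is at most d + a/(2r); squaring this produces the linear term (d/r)P
  and a quadratic error.\<close>

lemma squared_distance_upper_bound:
  assumes xbar: "xbar \<notin> U"
  obtains \<delta> H where "0 < \<delta>" "\<delta> \<le> R" "0 < H" "\<And>q. q \<in> ball p0 \<delta> \<Longrightarrow>
    \<exists>Q. \<forall>z\<in>ball p0 \<delta>. (D xbar (\<psi> z))\<^sup>2 \<le> (D xbar (\<psi> q))\<^sup>2 + Q \<bullet> (z - q) + H * (norm (z - q))\<^sup>2"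
proof -
  define d0 where "d0 = D xbar (\<psi> p0)"
  have p0B: "p0 \<in> B" using R by simp
  \<comment> \<open>Since \<open>xbar\<close> is outside the chart, a path from the centre to it
    must leave the ball.\<close>
  have "R / M \<le> d0"
  proof (rule ccontr)
    assume "\<not> R / M \<le> d0"
    then obtain T where T: "d0 < T" "T < R / M" using dense[of d0 "R / M"] by (auto simp: not_le)
    have "norm (p0 - p0) + M * T < R" using T(2) by (simp add: pos_less_divide_eq[OF M] mult.commute)
    moreover have "reach T (\<psi> p0) xbar" by (rule reach_sym[OF D_less]) (use T(1) in \<open>simp add: d0_def\<close>)
    ultimately have "xbar \<in> \<psi> ` ball p0 R" by (intro reach_confined(1))
    then show False using xbar \<psi>_U by auto
  qed
  then have d0: "d0 > 0" using R M by (meson divide_pos_pos less_le_trans)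
  \<comment> \<open>Points \<open>q\<close> near the centre have distance at least 3/4 of
    \<open>d0\<close> from \<open>xbar\<close>, so half of \<open>d0\<close> guarantees a
    predecessor; the other bound keeps the last pieces well inside the ball.\<close>
  define r where "r = min (d0 / 2) (R / (8 * M))"
  have r: "0 < r" "r \<le> d0 / 2" "8 * (M * r) \<le> R" using d0 R M by (auto simp: r_def min_def field_simps)
  define S where "S = {(p, q). p \<in> cball p0 (R/2) \<and> R/2 \<le> R \<and> q \<in> B \<and> (\<forall>T. reach T (\<psi> p) (\<psi> q) \<longrightarrow> r \<le> T)}"
  obtain C \<delta>1 where C: "C > 0" "\<delta>1 > 0" and pert: "\<And>p q. \<lbrakk>(p, q) \<in> S; reach r (\<psi> p) (\<psi> q); q \<in> B\<rbrakk> \<Longrightarrow>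
    \<exists>P. norm P \<le> C \<and> (\<forall>z T. norm (z - q) < \<delta>1 \<longrightarrow> 0 < T \<longrightarrow> r\<^sup>2 + P \<bullet> (z - q) + C * (norm (z - q))\<^sup>2 < T\<^sup>2 \<longrightarrow> reach T (\<psi> p) (\<psi> z))"
  proof (rule minimizer_endpoint_perturbation[OF nosing r(1), of "R/2" S])
    show "R / 2 + M * r < R" using r(3) R by simp
    show "closed S" unfolding S_def by (rule minimizer_pairs_closed)
  qed (auto simp: S_def dist_norm norm_minus_commute)
  obtain V where V: "open V" "\<psi> p0 \<in> V" "\<And>y. y \<in> V \<Longrightarrow> reach (d0/4) (\<psi> p0) y" by (rule local_reach[of "d0/4" "\<psi> p0"]) (use d0 in auto)
  have "open (\<phi> ` (V \<inter> chart_dom c))" by (rule open_chart_image[OF c V(1)])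
  moreover have "p0 \<in> \<phi> ` (V \<inter> chart_dom c)"
    using V(2) \<psi>_U[OF p0B] \<phi>_\<psi>[OF p0B] U by (intro image_eqI[of _ _ "\<psi> p0"]) auto
  ultimately obtain \<delta>2 where \<delta>2: "\<delta>2 > 0" "ball p0 \<delta>2 \<subseteq> \<phi> ` (V \<inter> chart_dom c)" using open_contains_ball by metis
  have Dq: "r < D xbar (\<psi> q)" "D xbar (\<psi> q) \<le> 2 * d0" if "q \<in> ball p0 \<delta>2" for q
  proof -
    have "\<psi> q \<in> V" using \<delta>2(2) that chart_inv_map[OF c] by auto
    then have "reach (d0/4) (\<psi> p0) (\<psi> q)" by (rule V(3))
    from D_triangle[OF this, of xbar] D_triangle[OF reach_sym[OF this], of xbar] show "r < D xbar (\<psi> q)" "D xbar (\<psi> q) \<le> 2 * d0"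
      using r(2) d0 by (auto simp: d0_def[symmetric])
  qed
  \<comment> \<open>Two points of the ball are less than 2\<delta> apart. This must be at most
    \<open>\<delta>1\<close> and at most 1, and so small that the energy excess \<open>a\<close>
    does not exceed \<open>r\<^sup>2\<close> in absolute value.\<close>
  define \<delta> where "\<delta> = min (min \<delta>2 (R / 8)) (min (min (\<delta>1 / 2) (1 / 2)) (r\<^sup>2 / (4 * C)))"
  have \<delta>: "0 < \<delta>" "\<delta> \<le> \<delta>2" "\<delta> \<le> R / 8" "2 * \<delta> \<le> \<delta>1" "2 * \<delta> \<le> 1"
    using \<delta>2 R C r by (auto simp: \<delta>_def)
  have \<delta>C: "2 * C * (2 * \<delta>) \<le> r\<^sup>2"
  proof -
    have "\<delta> \<le> r\<^sup>2 / (4 * C)" by (simp add: \<delta>_def)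
    then show ?thesis using C(1) by (simp add: field_simps)
  qed
  \<comment> \<open>The first term dominates (d/r) C, as d <= 2 d0; the second one dominates
    a^2/(4r^2) by |a| <= 2 C n, with n the distance of \<open>z\<close> to \<open>q\<close>.\<close>
  define H where "H = 2 * d0 * C / r + C\<^sup>2 / r\<^sup>2"
  have H: "0 < H" unfolding H_def using d0 C(1) r(1) by (intro add_pos_pos) auto
  show ?thesis
  proof (rule that[OF \<delta>(1) _ H])
    show "\<delta> \<le> R" using \<delta>(3) R by simp
    fix q assume q: "q \<in> ball p0 \<delta>"
    then have q2: "q \<in> ball p0 \<delta>2" using \<delta>(2) by auto
    have qn: "norm (q - p0) \<le> R / 8" using q \<delta>(3) by (simp add: dist_norm norm_minus_commute)
    have qB: "q \<in> B" using qn R by (simp add: dist_norm norm_minus_commute)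
    define d where "d = D xbar (\<psi> q)"
    have d: "r < d" "d \<le> 2 * d0" using Dq[OF q2] by (auto simp: d_def)
    obtain p where p: "norm (p - q) \<le> M * r" "reach r (\<psi> p) (\<psi> q)" "\<And>T. reach T (\<psi> p) (\<psi> q) \<Longrightarrow> r \<le> T" "D xbar (\<psi> p) + r \<le> d"
      unfolding d_def by (rule predecessor[OF r(1) Dq(1)[OF q2]]) (use qn r(3) R in auto)
    have "norm (p - p0) \<le> R / 2" using p(1) qn r(3) R norm_triangle_ineq[of "p - q" "q - p0"] by simp
    then have "(p, q) \<in> S" using p(3) qB R by (simp add: S_def dist_norm norm_minus_commute)
    then obtain P where P: "norm P \<le> C" "\<And>z T. \<lbrakk>norm (z - q) < \<delta>1; 0 < T; r\<^sup>2 + P \<bullet> (z - q) + C * (norm (z - q))\<^sup>2 < T\<^sup>2\<rbrakk> \<Longrightarrow> reach T (\<psi> p) (\<psi> z)"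
      using pert[OF _ p(2) qB] by blast
    have "(D xbar (\<psi> z))\<^sup>2 \<le> d\<^sup>2 + (d / r) *\<^sub>R P \<bullet> (z - q) + H * (norm (z - q))\<^sup>2" if z: "z \<in> ball p0 \<delta>" for z
    proof -
      define n where "n = norm (z - q)"
      define a where "a = P \<bullet> (z - q) + C * n\<^sup>2"
      have n: "0 \<le> n" "n < 2 * \<delta>" using z q norm_triangle_ineq4[of "z - p0" "q - p0"] by (auto simp: n_def dist_norm norm_minus_commute)
      have n1: "n < \<delta>1" "n \<le> 1" using n \<delta> by auto
      have "\<bar>P \<bullet> (z - q)\<bar> \<le> norm P * n" unfolding n_def by (rule Cauchy_Schwarz_ineq2)
      also have "\<dots> \<le> C * n" by (rule mult_right_mono[OF P(1) n(1)])
      finally have Pn: "\<bar>P \<bullet> (z - q)\<bar> \<le> C * n" .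
      have "C * n\<^sup>2 \<le> C * n" "0 \<le> C * n\<^sup>2" using C(1) n(1) n1(2) by (auto simp: power2_eq_square mult_left_le)
      then have an: "\<bar>a\<bar> \<le> 2 * C * n" using Pn unfolding a_def by linarith
      have "2 * C * n \<le> 2 * C * (2 * \<delta>)" using C(1) n(2) by (intro mult_left_mono) auto
      then have ar: "\<bar>a\<bar> \<le> r\<^sup>2" using an \<delta>C by linarith
      have Dz: "D xbar (\<psi> z) \<le> d + a / (2 * r)"
      proof (rule field_le_epsilon)
        fix e :: real assume e: "0 < e"
        define T where "T = r + a / (2 * r) + e"
        have "0 \<le> 2 * r\<^sup>2 + a" using ar zero_le_power2[of r] by linarith
        then have "0 \<le> (2 * r\<^sup>2 + a) / (2 * r)" using r(1) by (intro divide_nonneg_pos) auto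
        also have "\<dots> = r + a / (2 * r)" using r(1) by (simp add: power2_eq_square field_simps)
        finally have ra: "0 \<le> r + a / (2 * r)" .
        \<comment> \<open>Completing the square replaces the square root of r^2 + a by its tangent r
          + a/(2r), which lies above it and is nonnegative because |a| <= r^2.\<close>
        have "(r + a / (2 * r))\<^sup>2 = r\<^sup>2 + a + (a / (2 * r))\<^sup>2" using r(1) by (simp add: power2_eq_square field_simps)
        then have "r\<^sup>2 + a \<le> (r + a / (2 * r))\<^sup>2" using zero_le_power2[of "a / (2 * r)"] by linarith
        also have "\<dots> < T\<^sup>2" unfolding T_def using ra e by (intro power_strict_mono) auto
        finally have "r\<^sup>2 + P \<bullet> (z - q) + C * (norm (z - q))\<^sup>2 < T\<^sup>2" by (simp add: a_def n_def)
        then have "reach T (\<psi> p) (\<psi> z)" using P(2)[of z T] n1(1) ra e by (simp add: n_def T_def)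
        from D_triangle[OF this, of xbar] p(4) show "D xbar (\<psi> z) \<le> d + a / (2 * r) + e" by (simp add: T_def)
      qed
      have "(D xbar (\<psi> z))\<^sup>2 \<le> (d + a / (2 * r))\<^sup>2" by (rule power_mono[OF Dz D_nonneg])
      also have "\<dots> = d\<^sup>2 + d / r * a + a\<^sup>2 / (4 * r\<^sup>2)" using r(1) by (simp add: power2_eq_square field_simps)
      also have "\<dots> = d\<^sup>2 + (d / r) *\<^sub>R P \<bullet> (z - q) + (d / r * C * n\<^sup>2 + a\<^sup>2 / (4 * r\<^sup>2))" by (simp add: a_def algebra_simps)
      also have "\<dots> \<le> d\<^sup>2 + (d / r) *\<^sub>R P \<bullet> (z - q) + H * n\<^sup>2"
      proof -
        have "a\<^sup>2 \<le> (2 * C * n)\<^sup>2" using power_mono[OF an, of 2] by simp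
        then have "a\<^sup>2 / (4 * r\<^sup>2) \<le> (2 * C * n)\<^sup>2 / (4 * r\<^sup>2)" by (rule divide_right_mono) simp
        also have "\<dots> = C\<^sup>2 / r\<^sup>2 * n\<^sup>2" by (simp add: power_mult_distrib)
        finally have 1: "a\<^sup>2 / (4 * r\<^sup>2) \<le> C\<^sup>2 / r\<^sup>2 * n\<^sup>2" .
        have "d / r * C * n\<^sup>2 \<le> 2 * d0 / r * C * n\<^sup>2"
          using d(2) r(1) C(1) by (intro mult_right_mono divide_right_mono) auto
        then show ?thesis using 1 by (simp add: H_def distrib_right)
      qed
      finally show ?thesis by (simp add: n_def)
    qed
    then show "\<exists>Q. \<forall>z\<in>ball p0 \<delta>. (D xbar (\<psi> z))\<^sup>2 \<le> (D xbar (\<psi> q))\<^sup>2 + Q \<bullet> (z - q) + H * (norm (z - q))\<^sup>2"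
      unfolding d_def by blast
  qed
qed

end

context sr_connected
begin

text \<open>The chart is chosen inside the complement of \<open>xbar\<close>. This meets the
  hypothesis of the quadratic bound and also makes the restricted chart admissible for local
  semiconcavity there.\<close>

lemma squared_distance_semiconcave: "locally_semiconcave A (- {xbar}) (\<lambda>x. (D xbar x)\<^sup>2)"
  unfolding locally_semiconcave_def
proof
  fix x0 assume x0: "x0 \<in> - {xbar}"
  obtain c and Y :: "'k \<Rightarrow> 'm \<Rightarrow> 'e" and R M L U where *: "sr_chart A \<Delta> g K c Y (chart_map c x0) R M L U" "x0 \<in> U" "U \<subseteq> - {xbar}"
    by (rule sr_chart_exists[of "- {xbar}" x0]) (use x0 in auto)
  interpret sr_chart A \<Delta> g K c Y "chart_map c x0" R M L U by (rule *)
  interpret sr_connected_chart A \<Delta> g K c Y "chart_map c x0" R M L U by unfold_locales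
  obtain \<delta> K' where \<delta>: "0 < \<delta>" "\<delta> \<le> R" "0 < K'" "\<And>q. q \<in> ball (\<phi> x0) \<delta> \<Longrightarrow>
    \<exists>Q. \<forall>z\<in>ball (\<phi> x0) \<delta>. (D xbar (\<psi> z))\<^sup>2 \<le> (D xbar (\<psi> q))\<^sup>2 + Q \<bullet> (z - q) + K' * (norm (z - q))\<^sup>2"
    by (rule squared_distance_upper_bound[of xbar]) (use *(3) in blast)+
  define V where "V = chart_dom c \<inter> \<phi> -` ball (\<phi> x0) \<delta>"
  have V: "open V" "V \<subseteq> chart_dom c" unfolding V_def by (auto intro: open_chart_preimage[OF c])
  have bB: "ball (\<phi> x0) \<delta> \<subseteq> B" using \<delta>(2) by auto
  have \<phi>V: "\<phi> ` V = ball (\<phi> x0) \<delta>"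
  proof
    show "ball (\<phi> x0) \<delta> \<subseteq> \<phi> ` V"
    proof
      fix p assume p: "p \<in> ball (\<phi> x0) \<delta>"
      then have "p \<in> B" using bB by blast
      then show "p \<in> \<phi> ` V" using p \<psi>_U[of p] \<phi>_\<psi>[of p] U by (intro image_eqI[of _ _ "\<psi> p"]) (auto simp: V_def)
    qed
  qed (auto simp: V_def)
  have "V \<subseteq> U"
  proof
    fix y assume y: "y \<in> V"
    then have "\<phi> y \<in> B" "y \<in> chart_dom c" using bB by (auto simp: V_def)
    then show "y \<in> U" using \<psi>_U[of "\<phi> y"] chart_inv_map[OF c, of y] by simp
  qed
  note rc = restricted_chart[OF c V]
  show "\<exists>d. smooth_chart A d \<and> x0 \<in> chart_dom d \<and> chart_dom d \<subseteq> - {xbar} \<and>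
      semiconcave_euclidean (chart_map d ` chart_dom d) ((\<lambda>x. (D xbar x)\<^sup>2) \<circ> chart_inv d)"
  proof (intro exI[of _ "(V, \<phi>)"] conjI rc(1))
    show "x0 \<in> chart_dom (V, \<phi>)" using \<delta>(1) *(2) U by (auto simp: V_def)
    show "chart_dom (V, \<phi>) \<subseteq> - {xbar}" using \<open>V \<subseteq> U\<close> *(3) by auto
    have "semiconcave_euclidean (ball (\<phi> x0) \<delta>) ((\<lambda>x. (D xbar x)\<^sup>2) \<circ> chart_inv (V, \<phi>))"
    proof (rule semiconcave_of_quadratic_upper_bound[OF \<delta>(3)])
      fix q assume q: "q \<in> ball (\<phi> x0) \<delta>"
      have "chart_inv (V, \<phi>) z = \<psi> z" if "z \<in> ball (\<phi> x0) \<delta>" for z by (rule rc(2)) (use that \<phi>V in simp)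
      then show "\<exists>Q. \<forall>z\<in>ball (\<phi> x0) \<delta>. ((\<lambda>x. (D xbar x)\<^sup>2) \<circ> chart_inv (V, \<phi>)) z \<le> ((\<lambda>x. (D xbar x)\<^sup>2) \<circ> chart_inv (V, \<phi>)) q + Q \<bullet> (z - q) + K' * (norm (z - q))\<^sup>2"
        using \<delta>(4)[OF q] q by simp
    qed
    then show "semiconcave_euclidean (chart_map (V, \<phi>) ` chart_dom (V, \<phi>)) ((\<lambda>x. (D xbar x)\<^sup>2) \<circ> chart_inv (V, \<phi>))" by (simp add: \<phi>V)
  qed
qed

end

theorem proposition9:
  fixes A :: "('m::{t2_space, second_countable_topology}, 'e::euclidean_space) chart set"
    and xbar :: 'm
    and \<Delta> :: "'m \<Rightarrow> 'e set"
    and g :: "'m \<Rightarrow> 'e \<Rightarrow> 'e \<Rightarrow> real"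
  assumes "smooth_atlas A"
    and "connected (UNIV :: 'm set)"
    and "smooth_distribution TYPE('k::finite) A \<Delta>"
    and "smooth_metric A \<Delta> g"
    and "sr_complete A \<Delta> g"
    and "\<not> (\<exists>\<gamma>. nontrivial_path \<gamma> \<and> singular_path TYPE('k) A \<Delta> \<gamma> \<and> minimizing A \<Delta> g \<gamma>)"
    and "nonholonomic TYPE('k) A \<Delta>"
  shows "(\<forall>x. value_fun A \<Delta> g xbar x < \<infinity>) \<and>
         continuous_on UNIV (\<lambda>x. enn2real (value_fun A \<Delta> g xbar x)) \<and>
         locally_semiconcave A (- {xbar}) (\<lambda>x. enn2real (value_fun A \<Delta> g xbar x))"
proof -
  interpret sr_connected A \<Delta> g "TYPE('k)" by unfold_locales (fact assms)+
  have eq: "(\<lambda>x. enn2real (value_fun A \<Delta> g xbar x)) = (\<lambda>x. (D xbar x)\<^sup>2)" by (simp add: value_fun_eq)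
  have "value_fun A \<Delta> g xbar x < \<infinity>" for x by (simp add: value_fun_eq)
  then show ?thesis
    unfolding eq using squared_distance_semiconcave continuous_on_power[OF D_continuous] by blast
qed

end
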